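(* Let $d\in\mathbb N$ and $M>0$. Let $\Omega_M$ be the class of Schrödinger operators $H_q=-\Delta+q$ on $L^2(\mathbb R^d)$ with $q\in\mathcal C^1(\mathbb R^d;\mathbb C)$ and $\operatorname{supp}(q)\Subset Q_M$, where $Q_M$ is the cube of edge length $M$ centered at the origin. Let $\operatorname{Res}(H_q)$ be the set of resonances of $H_q$. Let the evaluation set be $$\Lambda=\{M\}\cup\{q\mapsto q(x)\mid x\in\mathbb R^d\}\cup\{G(x,z)\mid x,z\},$$ where $M$ and the values $G(x,z)$ of the Helmholtz fundamental solution are regarded as constant functions on $\Omega_M$. Let $\mathrm{cl}(\mathbb C)$ be the space of closed sets with Attouch-Wets convergence. (Resonances, the function $G$, the range of $(x,z)$ and the convergence of closed sets are as specified in the context.) Then the Solvability Complexity Index of the computational problem $(\Omega_M,\Lambda,\operatorname{Res}(\cdot),\mathrm{cl}(\mathbb C))$ equals one: $$\operatorname{SCI}(\Omega_M,\Lambda,\operatorname{Res}(\cdot),\mathrm{cl}(\mathbb C))=1.$$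
   Context: **Computational problems.** A computational problem is a quadruple $(\Omega,\Lambda,\Xi,\mathcal M)$, where $\Omega$ is a set (the primary set), $\Lambda$ is a set of complex-valued functions on $\Omega$ (the evaluation set), $\mathcal M$ is a metric space, and $\Xi:\Omega\to\mathcal M$ is a map (the problem function). **Arithmetic algorithm.** An arithmetic algorithm for $(\Omega,\Lambda,\Xi,\mathcal M)$ is a map $\Gamma:\Omega\to\mathcal M$ such that for each $T\in\Omega$ there exists a finite subset $\Lambda_\Gamma(T)\subset\Lambda$ such that: (i) the action of $\Gamma$ on $T$ depends only on $\{f(T)\}_{f\in\Lambda_\Gamma(T)}$; (ii) for every $S\in\Omega$ with $f(T)=f(S)$ for all $f\in\Lambda_\Gamma(T)$ one has $\Lambda_\Gamma(S)=\Lambda_\Gamma(T)$; (iii) the action of $\Gamma$ on $T$ consists of performing only finitely many arithmetic operations on $\{f(T)\}_{f\in\Lambda_\Gamma(T)}$. **Towers and SCI.** A tower of algorithms of height $k$ for $\Xi$ is a family $\Gamma_{n_1,\dots,n_k}:\Omega\to\mathcal M$ of arithmetic algorithms such that for all $T\in\Omega$ $$\Xi(T)=\lim_{n_k\to\infty}\cdots\lim_{n_1\to\infty}\Gamma_{n_1,\dots,n_k}(T)$$ (height $0$ means that $\Xi$ itself is an arithmetic algorithm). The problem has $\operatorname{SCI}(\Omega,\Lambda,\Xi,\mathcal M)=k$ if $k$ is the smallest integer for which there exists a tower of algorithms of height $k$ for $\Xi$. In particular, a tower of height one is a sequence $(\Gamma_n)_{n\in\mathbb N}$ of arithmetic algorithms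 with $\Gamma_n(T)\to\Xi(T)$ for every $T\in\Omega$. **The domain $\mathbb C^{\mathrm{ext}}$.** $\mathbb C^{\mathrm{ext}}:=\mathbb C$ if $d$ is odd, and $\mathbb C^{\mathrm{ext}}:=$ the logarithmic cover of $\mathbb C$ (the Riemann surface of the complex logarithm) if $d$ is even. **Fundamental solution.** $$G(x,z)=\begin{cases}\dfrac{i}{4}\left(\dfrac{z}{2\pi|x|}\right)^{\frac{d-2}{2}}H^{(1)}_{\frac{d-2}{2}}(z|x|), & d\ge2,\\[2mm] \dfrac{i}{2z}e^{iz|x|}, & d=1,\end{cases}$$ where $H^{(1)}_\nu$ is the Hankel function of the first kind. For $\operatorname{Im}(z)>0$ this is the fundamental solution of the Helmholtz operator $-\Delta-z^2$ on $\mathbb R^d$. It continues analytically in $z$ to $\mathbb C^{\mathrm{ext}}\setminus\{0\}$. In $\Lambda$, $(x,z)$ ranges over all $x\in\mathbb R^d$ and $z\in\mathbb C^{\mathrm{ext}}$ for which $G(x,z)$ is defined (including by continuous extension where this exists). **Resonances.** Let $\chi:\mathbb R^d\to\mathbb R$ be a compactly supported function with $\chi\equiv1$ on $\operatorname{supp}(q)$, for instance the indicator function of $Q_M$. For $z\in\mathbb C^{\mathrm{ext}}\setminus\{0\}$ let $K(z)=q(-\Delta-z^2)^{-1}\chi$ be the compact operator on $L^2(\mathbb R^d)$ given by $$(K(z)f)(x)=q(x)\int_{\mathbb R^d}G(x-y,z)\chi(y)f(y)\,dy,$$ which is analytic in $z$ on $\mathbb C^{\mathrm{ext}}\setminus\{0\}$.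 The operator-valued function $z\mapsto(I+K(z))^{-1}$ is meromorphic on $\mathbb C^{\mathrm{ext}}$. A resonance of $H_q$ is a pole of this function; this is independent of the choice of $\chi$. $\operatorname{Res}(H_q)\subset\mathbb C^{\mathrm{ext}}$ denotes the set of all resonances. **Convergence of closed sets.** For closed nonempty $A,B\subset\mathbb C$ the Attouch-Wets distance is $$d_{\mathrm{AW}}(A,B)=\sum_{i=1}^\infty2^{-i}\min\Big\{1,\sup_{|x|<i}|\operatorname{dist}(x,A)-\operatorname{dist}(x,B)|\Big\}.$$ Convergence $A_n\to A$ in this metric is equivalent to the following two conditions: (a) if $n_k\to\infty$ strictly, $\lambda_{n_k}\in A_{n_k}$ and $\lambda_{n_k}\to\lambda$, then $\lambda\in A$; (b) if $\lambda\in A$, then there exist $\lambda_n\in A_n$ (for all large $n$) with $\lambda_n\to\lambda$. When the sets may be empty, and when $d$ is even (so that the sets are closed subsets of $\mathbb C^{\mathrm{ext}}$), convergence of closed sets is understood in the sense of (a) and (b) in $\mathbb C^{\mathrm{ext}}$; this convergence is metrizable. *)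

theory Defs
  imports "HOL-Complex_Analysis.Complex_Analysis" "HOL-Library.Extended_Nat"
begin

(* free $ for the components of vectors *)
no_notation fps_nth (infixl \<open>$\<close> 75)

section \<open>The Solvability Complexity Index\<close>

text \<open>
  Arithmetic operations act on complex numbers regarded as pairs of reals, so complex conjugation
  is available.  The only constants are the Gaussian rationals: every other number an
  algorithm uses has to come from the evaluation set.  Division by 0 yields 0; as the trees below
  can test for 0, this does not make algorithms more powerful.
\<close>

datatype 't aterm =
    Eval "'t \<Rightarrow> complex"
  | Const rat rat
  | Add "'t aterm" "'t aterm"
  | Sub "'t aterm" "'t aterm"
  | Mult "'t aterm" "'t aterm"
  | Div "'t aterm" "'t aterm"
  | Conj "'t aterm"

primrec aval :: "'t \<Rightarrow> 't aterm \<Rightarrow> complex" where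
  "aval T (Eval f) = f T"
| "aval T (Const a b) = Complex (of_rat a) (of_rat b)"
| "aval T (Add s t) = aval T s + aval T t"
| "aval T (Sub s t) = aval T s - aval T t"
| "aval T (Mult s t) = aval T s * aval T t"
| "aval T (Div s t) = aval T s / aval T t"
| "aval T (Conj s) = cnj (aval T s)"

primrec inputs :: "'t aterm \<Rightarrow> ('t \<Rightarrow> complex) set" where
  "inputs (Eval f) = {f}"
| "inputs (Const a b) = {}"
| "inputs (Add s t) = inputs s \<union> inputs t"
| "inputs (Sub s t) = inputs s \<union> inputs t"
| "inputs (Mult s t) = inputs s \<union> inputs t"
| "inputs (Div s t) = inputs s \<union> inputs t"
| "inputs (Conj s) = inputs s"

text \<open>
  Algorithms are algebraic computation trees.  They may be infinite, but a run has to
  reach an output after finitely many steps.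
\<close>

codatatype 't atree =
    Output "'t aterm list"
  | Branch "'t aterm" "'t atree" "'t atree"

text \<open>
  \<open>run T A U out\<close>: on the input \<open>T\<close>, the tree \<open>A\<close> terminates with the finite string
  \<open>out\<close> of numbers, having used exactly the evaluations in \<open>U\<close>.
\<close>

inductive run :: "'t \<Rightarrow> 't atree \<Rightarrow> ('t \<Rightarrow> complex) set \<Rightarrow> complex list \<Rightarrow> bool"
  for T :: 't where
  run_Output: "run T (Output es) (\<Union>e\<in>set es. inputs e) (map (aval T) es)"
| run_Pos: "Re (aval T e) > 0 \<Longrightarrow> run T A U out \<Longrightarrow> run T (Branch e A B) (inputs e \<union> U) out"
| run_Nonpos: "Re (aval T e) \<le> 0 \<Longrightarrow> run T B U out \<Longrightarrow> run T (Branch e A B) (inputs e \<union> U) out"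

text \<open>
  A computational problem consists of the primary set \<open>\<Omega>\<close>, the evaluation set \<open>\<Lambda>\<close>, the problem
  function \<open>\<Xi>\<close> and the metric space \<open>\<M>\<close>.  The additional parameter \<open>rd\<close> says which point
  of \<open>\<M>\<close> is denoted by a finite string of numbers; a computation can only return such a string.
\<close>

definition arithmetic_algorithm ::
  "'t set \<Rightarrow> ('t \<Rightarrow> complex) set \<Rightarrow> 'm metric \<Rightarrow> (complex list \<Rightarrow> 'm) \<Rightarrow> ('t \<Rightarrow> 'm) \<Rightarrow> bool" where
  "arithmetic_algorithm \<Omega> \<Lambda> \<M> rd \<Gamma> \<longleftrightarrow>
     (\<forall>T\<in>\<Omega>. \<Gamma> T \<in> mspace \<M>) \<and>
     (\<exists>\<Lambda>\<^sub>\<Gamma> A. \<forall>T\<in>\<Omega>.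
        finite (\<Lambda>\<^sub>\<Gamma> T) \<and> \<Lambda>\<^sub>\<Gamma> T \<subseteq> \<Lambda> \<and>
        (\<forall>S\<in>\<Omega>. (\<forall>f\<in>\<Lambda>\<^sub>\<Gamma> T. f T = f S) \<longrightarrow> \<Gamma> S = \<Gamma> T \<and> \<Lambda>\<^sub>\<Gamma> S = \<Lambda>\<^sub>\<Gamma> T) \<and>
        (\<exists>U out. run T A U out \<and> U \<subseteq> \<Lambda>\<^sub>\<Gamma> T \<and> \<Gamma> T = rd out))"

text \<open>
  For \<open>a\<close> indexed by lists \<open>[n\<^sub>1, \<dots>, n\<^sub>k]\<close>, the limit in \<open>n\<^sub>1\<close> is the innermost and the
  limit in \<open>n\<^sub>k\<close> the outermost one.
\<close>

primrec iterated_limit :: "'m metric \<Rightarrow> nat \<Rightarrow> (nat list \<Rightarrow> 'm) \<Rightarrow> 'm \<Rightarrow> bool" where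
  "iterated_limit \<M> 0 a l \<longleftrightarrow> a [] = l"
| "iterated_limit \<M> (Suc k) a l \<longleftrightarrow>
     (\<exists>b. (\<forall>n. iterated_limit \<M> k (\<lambda>ns. a (ns @ [n])) (b n)) \<and>
          limitin (mtopology_of \<M>) b l sequentially)"

definition tower_of_algorithms ::
  "'t set \<Rightarrow> ('t \<Rightarrow> complex) set \<Rightarrow> ('t \<Rightarrow> 'm) \<Rightarrow> 'm metric \<Rightarrow> (complex list \<Rightarrow> 'm) \<Rightarrow>
   nat \<Rightarrow> (nat list \<Rightarrow> 't \<Rightarrow> 'm) \<Rightarrow> bool" where
  "tower_of_algorithms \<Omega> \<Lambda> \<Xi> \<M> rd k \<Gamma> \<longleftrightarrow>
     (\<forall>ns. length ns = k \<longrightarrow> arithmetic_algorithm \<Omega> \<Lambda> \<M> rd (\<Gamma> ns)) \<and>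
     (\<forall>T\<in>\<Omega>. iterated_limit \<M> k (\<lambda>ns. \<Gamma> ns T) (\<Xi> T))"

text \<open>The infimum is \<open>\<infinity>\<close> if there is no tower of any height.\<close>

definition SCI ::
  "'t set \<Rightarrow> ('t \<Rightarrow> complex) set \<Rightarrow> ('t \<Rightarrow> 'm) \<Rightarrow> 'm metric \<Rightarrow> (complex list \<Rightarrow> 'm) \<Rightarrow> enat" where
  "SCI \<Omega> \<Lambda> \<Xi> \<M> rd = Inf {enat k | k. \<exists>\<Gamma>. tower_of_algorithms \<Omega> \<Lambda> \<Xi> \<M> rd k \<Gamma>}"


section \<open>The space of closed sets\<close>

text \<open>
  The Attouch-Wets distance is meaningful for nonempty sets only.  To include the empty set, the
  distance functions in its \<open>i\<close>-th term are truncated at \<open>i\<close>, with \<open>dist x {} = \<infinity>\<close>.  The lemmas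
  at the end of this theory show that this is a metric on the closed sets, that its convergence is given by the
  two usual conditions on limits of points, and that on nonempty sets it
  is convergence with respect to the Attouch-Wets distance.
\<close>

definition trunc_dist :: "nat \<Rightarrow> complex set \<Rightarrow> complex \<Rightarrow> real" where
  "trunc_dist i A x = (if A = {} then real i else min (real i) (infdist x A))"

definition closed_set_dist :: "complex set \<Rightarrow> complex set \<Rightarrow> real" where
  "closed_set_dist A B =
     (\<Sum>i. (1/2) ^ Suc i *
        min 1 (SUP x\<in>ball 0 (real (Suc i)). \<bar>trunc_dist (Suc i) A x - trunc_dist (Suc i) B x\<bar>))"

definition closed_sets :: "complex set metric" where
  "closed_sets = metric ({A. closed A}, closed_set_dist)"

definition attouch_wets :: "complex set \<Rightarrow> complex set \<Rightarrow> real" where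
  "attouch_wets A B =
     (\<Sum>i. (1/2) ^ Suc i *
        min 1 (SUP x\<in>ball 0 (real (Suc i)). \<bar>infdist x A - infdist x B\<bar>))"

definition set_convergence :: "(nat \<Rightarrow> complex set) \<Rightarrow> complex set \<Rightarrow> bool" where
  "set_convergence A B \<longleftrightarrow>
     (\<forall>r p l. strict_mono r \<and> (\<forall>k. p k \<in> A (r k)) \<and> p \<longlonglongrightarrow> l \<longrightarrow> l \<in> B) \<and>
     (\<forall>l\<in>B. \<exists>p. (\<forall>\<^sub>F n in sequentially. p n \<in> A n) \<and> p \<longlonglongrightarrow> l)"

section \<open>The space \<open>L\<^sup>2\<close>\<close>

definition square_integrable :: "(real ^ 'n \<Rightarrow> complex) \<Rightarrow> bool" where
  "square_integrable f \<longleftrightarrow>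
     f \<in> borel_measurable lborel \<and> integrable lborel (\<lambda>x. (norm (f x))\<^sup>2)"

lemma square_integrable_zero: "square_integrable (\<lambda>_. 0)"
  by (simp add: square_integrable_def)

lemma square_integrable_inner:
  assumes "square_integrable f" "square_integrable g"
  shows "integrable lborel (\<lambda>x. inner (f x) (g x))"
proof (rule Bochner_Integration.integrable_bound)
  show "integrable lborel (\<lambda>x. (norm (f x))\<^sup>2 + (norm (g x))\<^sup>2)"
    using assms by (auto simp: square_integrable_def)
  show "(\<lambda>x. inner (f x) (g x)) \<in> borel_measurable lborel"
    using assms by (auto simp: square_integrable_def)
  have "\<bar>inner a b\<bar> \<le> (norm a)\<^sup>2 + (norm b)\<^sup>2" for a b :: complex
  proof -
    have "\<bar>inner a b\<bar> \<le> norm a * norm b" by (rule Cauchy_Schwarz_ineq2)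
    also have "\<dots> \<le> (norm a)\<^sup>2 + (norm b)\<^sup>2"
      using sum_squares_bound[of "norm a" "norm b"]
        mult_nonneg_nonneg[OF norm_ge_zero[of a] norm_ge_zero[of b]] by linarith
    finally show ?thesis .
  qed
  thus "AE x in lborel. norm (inner (f x) (g x)) \<le> norm ((norm (f x))\<^sup>2 + (norm (g x))\<^sup>2)"
    by simp
qed

lemma square_integrable_add:
  assumes "square_integrable f" "square_integrable g"
  shows "square_integrable (\<lambda>x. f x + g x)"
proof -
  have "integrable lborel (\<lambda>x. (norm (f x))\<^sup>2 + 2 * inner (f x) (g x) + (norm (g x))\<^sup>2)"
    using assms square_integrable_inner[OF assms] by (auto simp: square_integrable_def)
  moreover have "(norm (f x + g x))\<^sup>2 = (norm (f x))\<^sup>2 + 2 * inner (f x) (g x) + (norm (g x))\<^sup>2" for x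
    by (simp add: power2_norm_eq_inner inner_add_left inner_add_right inner_commute)
  ultimately show ?thesis using assms by (auto simp: square_integrable_def)
qed

lemma square_integrable_scaleR:
  "square_integrable f \<Longrightarrow> square_integrable (\<lambda>x. c *\<^sub>R f x)"
  by (auto simp: square_integrable_def power_mult_distrib)

lemma square_integrable_minus: "square_integrable f \<Longrightarrow> square_integrable (\<lambda>x. - f x)"
  using square_integrable_scaleR[of f "-1"] by simp

lemma square_integrable_diff:
  "square_integrable f \<Longrightarrow> square_integrable g \<Longrightarrow> square_integrable (\<lambda>x. f x - g x)"
  using square_integrable_add[OF _ square_integrable_minus, of f g] by simp

definition L2_eq :: "(real ^ 'n \<Rightarrow> complex) \<Rightarrow> (real ^ 'n \<Rightarrow> complex) \<Rightarrow> bool" where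
  "L2_eq f g \<longleftrightarrow> square_integrable f \<and> square_integrable g \<and> (AE x in lborel. f x = g x)"

quotient_type 'n L2 = "real ^ 'n::finite \<Rightarrow> complex" / partial: L2_eq
proof (rule part_equivpI)
  show "\<exists>f :: real ^ 'n \<Rightarrow> complex. L2_eq f f"
    using square_integrable_zero by (auto simp: L2_eq_def)
  show "symp (L2_eq :: (real ^ 'n \<Rightarrow> complex) \<Rightarrow> _)"
    by (rule sympI) (auto simp: L2_eq_def)
  show "transp (L2_eq :: (real ^ 'n \<Rightarrow> complex) \<Rightarrow> _)"
    by (rule transpI) (auto simp: L2_eq_def)
qed

instantiation L2 :: (finite) real_vector
begin

lift_definition zero_L2 :: "'a L2" is "\<lambda>_. 0"
  by (simp add: L2_eq_def square_integrable_zero)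

lift_definition plus_L2 :: "'a L2 \<Rightarrow> 'a L2 \<Rightarrow> 'a L2" is "\<lambda>f g x. f x + g x"
  by (auto simp: L2_eq_def square_integrable_add)

lift_definition minus_L2 :: "'a L2 \<Rightarrow> 'a L2 \<Rightarrow> 'a L2" is "\<lambda>f g x. f x - g x"
  by (auto simp: L2_eq_def square_integrable_diff)

lift_definition uminus_L2 :: "'a L2 \<Rightarrow> 'a L2" is "\<lambda>f x. - f x"
  by (auto simp: L2_eq_def square_integrable_minus)

lift_definition scaleR_L2 :: "real \<Rightarrow> 'a L2 \<Rightarrow> 'a L2" is "\<lambda>c f x. c *\<^sub>R f x"
  by (auto simp: L2_eq_def square_integrable_scaleR)

instance
proof
  fix f g h :: "'a L2" and a b :: real
  show "f + g + h = f + (g + h)"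
    by transfer (auto simp: L2_eq_def square_integrable_add add.assoc)
  show "f + g = g + f"
    by transfer (auto simp: L2_eq_def square_integrable_add add.commute)
  show "0 + f = f" by transfer (auto simp: L2_eq_def)
  show "- f + f = 0" by transfer (auto simp: L2_eq_def square_integrable_zero)
  show "f - g = f + - g"
    by transfer (auto simp: L2_eq_def square_integrable_diff)
  show "a *\<^sub>R (f + g) = a *\<^sub>R f + a *\<^sub>R g"
    by transfer (auto simp: L2_eq_def scaleR_add_right square_integrable_add square_integrable_scaleR)
  show "(a + b) *\<^sub>R f = a *\<^sub>R f + b *\<^sub>R f"
    by transfer (auto simp: L2_eq_def scaleR_add_left square_integrable_add square_integrable_scaleR)
  show "a *\<^sub>R b *\<^sub>R f = (a * b) *\<^sub>R f"
    by transfer (auto simp: L2_eq_def square_integrable_scaleR)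
  show "1 *\<^sub>R f = f" by transfer (auto simp: L2_eq_def)
qed

end

instantiation L2 :: (finite) real_inner
begin

text \<open>The real part of the usual complex inner product; it induces the usual norm.\<close>

lift_definition inner_L2 :: "'a L2 \<Rightarrow> 'a L2 \<Rightarrow> real" is "\<lambda>f g. LINT x|lborel. inner (f x) (g x)"
  by (rule integral_cong_AE) (auto simp: L2_eq_def square_integrable_def)

definition norm_L2 :: "'a L2 \<Rightarrow> real" where "norm_L2 f = sqrt (inner f f)"

definition sgn_L2 :: "'a L2 \<Rightarrow> 'a L2" where "sgn_L2 f = f /\<^sub>R norm f"

definition dist_L2 :: "'a L2 \<Rightarrow> 'a L2 \<Rightarrow> real" where "dist_L2 f g = norm (f - g)"

definition uniformity_L2 :: "('a L2 \<times> 'a L2) filter" where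
  "uniformity_L2 = (INF e\<in>{0<..}. principal {(f, g). dist f g < e})"

definition open_L2 :: "'a L2 set \<Rightarrow> bool" where
  "open_L2 U \<longleftrightarrow> (\<forall>f\<in>U. eventually (\<lambda>(f', g). f' = f \<longrightarrow> g \<in> U) uniformity)"

instance
proof
  fix f g h :: "'a L2" and a :: real
  show "dist f g = norm (f - g)" by (rule dist_L2_def)
  show "sgn f = f /\<^sub>R norm f" by (rule sgn_L2_def)
  show "uniformity = (INF e\<in>{0<..}. principal {(f, g :: 'a L2). dist f g < e})"
    by (rule uniformity_L2_def)
  show "open U \<longleftrightarrow> (\<forall>f\<in>U. eventually (\<lambda>(f', g). f' = f \<longrightarrow> g \<in> U) uniformity)" for U :: "'a L2 set"
    by (rule open_L2_def)
  show "norm f = sqrt (inner f f)" by (rule norm_L2_def)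
  show "inner f g = inner g f" by transfer (simp add: inner_commute)
  show "inner (f + g) h = inner f h + inner g h"
    by transfer (auto simp: L2_eq_def inner_add_left intro!: Bochner_Integration.integral_add square_integrable_inner)
  show "inner (a *\<^sub>R f) g = a * inner f g" by transfer simp
  show "0 \<le> inner f f" by transfer simp
  show "inner f f = 0 \<longleftrightarrow> f = 0"
  proof transfer
    fix f :: "real ^ 'a \<Rightarrow> complex" assume "L2_eq f f"
    hence f: "square_integrable f" by (simp add: L2_eq_def)
    have "(LINT x|lborel. inner (f x) (f x)) = 0 \<longleftrightarrow> (AE x in lborel. inner (f x) (f x) = 0)"
      by (rule integral_nonneg_eq_0_iff_AE) (use square_integrable_inner[OF f f] in auto)
    also have "\<dots> \<longleftrightarrow> L2_eq f (\<lambda>_. 0)" using f by (simp add: L2_eq_def square_integrable_zero)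
    finally show "(LINT x|lborel. inner (f x) (f x)) = 0 \<longleftrightarrow> L2_eq f (\<lambda>_. 0)" .
  qed
qed

end


section \<open>The fundamental solution of the Helmholtz operator\<close>

text \<open>
  Bessel functions on the logarithmic cover: \<open>w\<close> is the logarithm of the argument, so that
  \<open>bessel_J \<nu> w\<close> is the value of \<open>J\<^sub>\<nu>\<close> at the point of the cover above \<open>exp w\<close>.
\<close>

definition bessel_J :: "complex \<Rightarrow> complex \<Rightarrow> complex" where
  "bessel_J \<nu> w =
     (\<Sum>k. (-1) ^ k / fact k * rGamma (\<nu> + of_nat k + 1) *
          exp ((\<nu> + 2 * of_nat k) * (w - of_real (ln 2))))"

definition bessel_Y :: "complex \<Rightarrow> complex \<Rightarrow> complex" where
  "bessel_Y \<nu> w =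
     (let Y = (\<lambda>\<mu>. (bessel_J \<mu> w * cos (of_real pi * \<mu>) - bessel_J (- \<mu>) w) / sin (of_real pi * \<mu>))
      in if \<nu> \<in> \<int> then Lim (at \<nu>) Y else Y \<nu>)"

definition hankel_H1 :: "complex \<Rightarrow> complex \<Rightarrow> complex" where
  "hankel_H1 \<nu> w = bessel_J \<nu> w + \<i> * bessel_Y \<nu> w"

text \<open>
  In dimension \<open>d\<close>, the value for \<open>\<bar>x\<bar> = r\<close> at the point of the cover with logarithm \<open>w\<close>.
\<close>

definition green_log :: "nat \<Rightarrow> real \<Rightarrow> complex \<Rightarrow> complex" where
  "green_log d r w =
     (if d = 1 then \<i> / (2 * exp w) * exp (\<i> * exp w * of_real r)
      else let \<nu> = (of_nat d - 2) / 2
           in \<i> / 4 * exp (\<nu> * (w - of_real (ln (2 * pi * r)))) * hankel_H1 \<nu> (w + of_real (ln r)))"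

text \<open>
  A point of \<open>\<complex>\<^sup>e\<^sup>x\<^sup>t\<close> is represented by a complex number: by itself if the dimension is odd,
  and by its logarithm if the dimension is even.  The logarithm is a biholomorphic global
  coordinate of the logarithmic cover, so topology, holomorphy and poles are those of the
  complex plane in both cases.
\<close>

type_synonym cext = complex

text \<open>
  In odd dimensions \<open>green_log d r\<close> is periodic with period \<open>2\<pi>\<i>\<close>, so the branch of the logarithm
  is irrelevant; at \<open>z = 0\<close> the function is extended continuously, where possible.
\<close>

definition green :: "real ^ 'n \<Rightarrow> cext \<Rightarrow> complex" where
  "green x z =
     (let d = CARD('n); G = green_log d (norm x)
      in if even d then G z
         else if z = 0 then Lim (at 0) (\<lambda>z. G (Ln z))
         else G (Ln z))"

text \<open>
  The arguments for which the fundamental solution is defined, possibly by continuous extension: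
  in dimension 1 it is singular exactly at \<open>z = 0\<close>, otherwise exactly at \<open>x = 0\<close>.
\<close>

definition green_domain :: "((real ^ 'n) \<times> cext) set" where
  "green_domain = {(x, z). if CARD('n) = 1 then z \<noteq> 0 else x \<noteq> 0}"


section \<open>Resonances\<close>

text \<open>The Schroedinger operators \<open>- \<Delta> + q\<close> are represented by their potentials \<open>q\<close>.\<close>

text \<open>
  The cube is open and bounded, so that the inclusion in \<open>potentials\<close> says that the support
  of \<open>q\<close> is compactly contained in it.
\<close>

definition cube :: "real \<Rightarrow> (real ^ 'n) set" where
  "cube M = {x. \<forall>i. \<bar>x $ i\<bar> < M / 2}"

definition potentials :: "real \<Rightarrow> (real ^ 'n \<Rightarrow> complex) set" where
  "potentials M =
     {q. (\<exists>D :: real ^ 'n \<Rightarrow> ((real ^ 'n) \<Rightarrow>\<^sub>L complex).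
            (\<forall>x. (q has_derivative blinfun_apply (D x)) (at x)) \<and> continuous_on UNIV D) \<and>
         closure {x. q x \<noteq> 0} \<subseteq> cube M}"

text \<open>
  Operators are bounded real-linear maps.  \<open>K(z)\<close> is complex-linear, hence
  so is the inverse of \<open>I + K(z)\<close>.
\<close>

definition K_operator ::
  "(real ^ 'n::finite \<Rightarrow> complex) \<Rightarrow> (real ^ 'n \<Rightarrow> real) \<Rightarrow> cext \<Rightarrow> 'n L2 \<Rightarrow>\<^sub>L 'n L2" where
  "K_operator q \<eta> z =
     Blinfun (\<lambda>f. abs_L2 (\<lambda>x. q x * (LINT y|lborel. green (x - y) z * of_real (\<eta> y) * rep_L2 f y)))"

definition blinfun_inverse ::
  "('a::real_normed_vector \<Rightarrow>\<^sub>L 'b::real_normed_vector) \<Rightarrow> ('b \<Rightarrow>\<^sub>L 'a)" where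
  "blinfun_inverse A = (THE B. B o\<^sub>L A = id_blinfun \<and> A o\<^sub>L B = id_blinfun)"

text \<open>
  The cutoff is the indicator function of the cube.  As \<open>is_pole\<close> only looks at a punctured
  neighbourhood of \<open>z\<close>, the value of \<open>K_operator\<close> at \<open>0\<close> in odd dimensions is irrelevant.
\<close>

definition resonances :: "real \<Rightarrow> (real ^ 'n::finite \<Rightarrow> complex) \<Rightarrow> cext set" where
  "resonances M q =
     {z. is_pole (\<lambda>z. blinfun_inverse (id_blinfun + K_operator q (indicator (cube M)) z)) z}"

definition evaluations :: "real \<Rightarrow> ((real ^ 'n \<Rightarrow> complex) \<Rightarrow> complex) set" where
  "evaluations M =
     {\<lambda>q. of_real M} \<union> {\<lambda>q. q x | x. True} \<union> {\<lambda>q. green x z | (x :: real ^ 'n) z. (x, z) \<in> green_domain}"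

section \<open>Convergence of closed sets\<close>

lemma trunc_dist_bounds: "0 \<le> trunc_dist i A x" "trunc_dist i A x \<le> real i"
  by (auto simp: trunc_dist_def infdist_nonneg)

lemma trunc_dist_diff_le: "\<bar>trunc_dist i A x - trunc_dist i B x\<bar> \<le> real i"
  using trunc_dist_bounds[of i A x] trunc_dist_bounds[of i B x] by linarith

lemma trunc_dist_lipschitz: "\<bar>trunc_dist i A x - trunc_dist i A y\<bar> \<le> dist x y"
  using infdist_triangle_abs[of x A y] by (auto simp: trunc_dist_def min_def)

lemma trunc_dist_le: "a \<in> A \<Longrightarrow> trunc_dist i A x \<le> dist x a"
  using infdist_le[of a A x] by (auto simp: trunc_dist_def)

abbreviation td_sup :: "nat \<Rightarrow> complex set \<Rightarrow> complex set \<Rightarrow> real" where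
  "td_sup i A B \<equiv> SUP x\<in>ball 0 (real i). \<bar>trunc_dist i A x - trunc_dist i B x\<bar>"

lemma td_bdd: "bdd_above ((\<lambda>x. \<bar>trunc_dist i A x - trunc_dist i B x\<bar>) ` X)"
  by (intro bdd_aboveI2[where M = "real i"] trunc_dist_diff_le)

lemma td_sup_upper: "norm x < real i \<Longrightarrow> \<bar>trunc_dist i A x - trunc_dist i B x\<bar> \<le> td_sup i A B"
  by (rule cSUP_upper[OF _ td_bdd]) auto

lemma td_sup_least:
  assumes "i > 0" "\<And>x. norm x < real i \<Longrightarrow> \<bar>trunc_dist i A x - trunc_dist i B x\<bar> \<le> c"
  shows "td_sup i A B \<le> c"
  by (rule cSUP_least) (use assms in auto)

lemma td_sup_nonneg: "i > 0 \<Longrightarrow> 0 \<le> td_sup i A B"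
  by (rule order_trans[OF abs_ge_zero td_sup_upper[of 0]]) auto

lemma td_sup_triangle: "i > 0 \<Longrightarrow> td_sup i A C \<le> td_sup i A B + td_sup i B C"
  by (rule td_sup_least) (use td_sup_upper[of _ i A B] td_sup_upper[of _ i B C] in force)+

lemma summable_geom_half: "summable (\<lambda>i. (1/2::real) ^ Suc i)"
  by (simp add: summable_geometric)

lemma summable_min_series:
  assumes "\<And>i. (0::real) \<le> s i"
  shows "summable (\<lambda>i. (1/2) ^ Suc i * min 1 (s i))"
  by (rule summable_comparison_test'[OF summable_geom_half, of 0])
     (use assms in \<open>auto simp: abs_mult min_def intro!: mult_left_le\<close>)

lemma Metric_space_closed_sets: "Metric_space {A. closed A} closed_set_dist"
proof
  fix A B :: "complex set"
  show "0 \<le> closed_set_dist A B"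
    unfolding closed_set_dist_def
    by (intro suminf_nonneg summable_min_series mult_nonneg_nonneg min.boundedI td_sup_nonneg)
       simp_all
  show "closed_set_dist A B = closed_set_dist B A"
    by (simp add: closed_set_dist_def abs_minus_commute)
next
  have *: "x \<in> B" if "closed B" "x \<in> A" "\<And>i. i > 0 \<Longrightarrow> td_sup i A B = 0" for A B and x :: complex
  proof -
    obtain i :: nat where i: "norm x < real i" using reals_Archimedean2 by blast
    hence "i > 0" using norm_ge_zero[of x] by (metis gr0I not_less of_nat_0)
    have "trunc_dist i A x = 0"
      using trunc_dist_le[OF that(2), of i x] trunc_dist_bounds(1)[of i A x] by simp
    with td_sup_upper[OF i, of A B] that(3)[OF \<open>i > 0\<close>] have "trunc_dist i B x = 0" by simp
    with \<open>i > 0\<close> have "B \<noteq> {}" "infdist x B = 0" by (auto simp: trunc_dist_def min_def split: if_splits)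
    thus ?thesis using that(1) in_closed_iff_infdist_zero by blast
  qed
  fix A B :: "complex set" assume AB: "A \<in> {A. closed A}" "B \<in> {A. closed A}"
  show "closed_set_dist A B = 0 \<longleftrightarrow> A = B"
  proof
    assume "closed_set_dist A B = 0"
    moreover have "0 \<le> (1/2) ^ Suc i * min 1 (td_sup (Suc i) A B)" for i
      using td_sup_nonneg[of "Suc i" A B] by (intro mult_nonneg_nonneg) simp_all
    moreover have "summable (\<lambda>i. (1/2) ^ Suc i * min 1 (td_sup (Suc i) A B))"
      by (intro summable_min_series td_sup_nonneg) simp
    ultimately have "\<forall>i. (1/2) ^ Suc i * min 1 (td_sup (Suc i) A B) = 0"
      unfolding closed_set_dist_def by (subst (asm) suminf_eq_zero_iff) auto
    hence "td_sup (Suc i) A B = 0" for i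
      by (auto simp: min_def split: if_splits)
    hence 0: "td_sup i A B = 0" if "i > 0" for i using that by (metis gr0_implies_Suc)
    hence "td_sup i B A = 0" if "i > 0" for i using that by (simp add: abs_minus_commute)
    with 0 AB * show "A = B" by blast
  qed (simp add: closed_set_dist_def)
next
  fix A B C :: "complex set"
  let ?f = "\<lambda>A B i. (1/2) ^ Suc i * min 1 (td_sup (Suc i) A B)"
  have s: "summable (?f A B)" for A B
    by (intro summable_min_series td_sup_nonneg) auto
  have "min 1 (td_sup (Suc i) A C) \<le> min 1 (td_sup (Suc i) A B) + min 1 (td_sup (Suc i) B C)" for i
    using td_sup_triangle[of "Suc i" A C B] td_sup_nonneg[of "Suc i" A B] td_sup_nonneg[of "Suc i" B C]
    by (simp add: min_def)
  hence "?f A C i \<le> ?f A B i + ?f B C i" for i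
    unfolding distrib_left[symmetric] by (rule mult_left_mono) simp
  hence "suminf (?f A C) \<le> (\<Sum>i. ?f A B i + ?f B C i)"
    by (intro suminf_le s summable_add)
  thus "closed_set_dist A C \<le> closed_set_dist A B + closed_set_dist B C"
    unfolding closed_set_dist_def suminf_add[OF s s] .
qed

lemma mspace_closed_sets: "mspace closed_sets = {A. closed A}"
  unfolding closed_sets_def by (rule Metric_space.mspace_metric[OF Metric_space_closed_sets])

lemma min_series_tendsto_0_iff:
  assumes "\<And>i n. (0::real) \<le> s i n"
  shows "(\<lambda>n. \<Sum>i. (1/2) ^ Suc i * min 1 (s i n)) \<longlonglongrightarrow> 0 \<longleftrightarrow> (\<forall>i. s i \<longlonglongrightarrow> 0)"
proof
  assume L: "(\<lambda>n. \<Sum>i. (1/2) ^ Suc i * min 1 (s i n)) \<longlonglongrightarrow> 0"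
  show "\<forall>i. s i \<longlonglongrightarrow> 0"
  proof
    fix i
    have le: "(1/2) ^ Suc i * min 1 (s i n) \<le> (\<Sum>i. (1/2) ^ Suc i * min 1 (s i n))" for n
      using sum_le_suminf[OF summable_min_series, of "\<lambda>i. s i n" "{i}"] assms by auto
    have "(\<lambda>n. (1/2) ^ Suc i * min 1 (s i n)) \<longlonglongrightarrow> 0"
      by (rule tendsto_sandwich[OF _ _ tendsto_const L]) (use le assms in \<open>auto simp del: power_Suc\<close>)
    from tendsto_mult[OF tendsto_const[of "2 ^ Suc i"] this]
    have m: "(\<lambda>n. min 1 (s i n)) \<longlonglongrightarrow> 0" 
      by (simp add: power_one_over mult.assoc[symmetric] del: power_Suc)
    hence "\<forall>\<^sub>F n in sequentially. min 1 (s i n) < 1" by (rule order_tendstoD) simp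
    hence "\<forall>\<^sub>F n in sequentially. min 1 (s i n) = s i n" by eventually_elim auto
    with m show "s i \<longlonglongrightarrow> 0" by (simp add: filterlim_cong)
  qed
next
  assume R: "\<forall>i. s i \<longlonglongrightarrow> 0"
  have "(\<lambda>n. (1/2) ^ Suc i * min 1 (s i n)) \<longlonglongrightarrow> (1/2) ^ Suc i * min 1 0" for i
    using R by (intro tendsto_intros) auto
  hence "(\<lambda>n. \<Sum>i. (1/2) ^ Suc i * min 1 (s i n)) \<longlonglongrightarrow> (\<Sum>i. (1/2::real) ^ Suc i * min 1 0)"
    by (intro tannerys_theorem[THEN conjunct2, THEN conjunct2, OF _ _ summable_geom_half] always_eventually)
       (use assms in \<open>auto simp: abs_mult min_def intro!: mult_left_le\<close>)
  thus "(\<lambda>n. \<Sum>i. (1/2) ^ Suc i * min 1 (s i n)) \<longlonglongrightarrow> 0" by simp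
qed

lemma limitin_closed_sets_iff_sup:
  assumes "\<And>n. closed (A n)" "closed B"
  shows "limitin (mtopology_of closed_sets) A B sequentially \<longleftrightarrow>
           (\<forall>i. (\<lambda>n. td_sup (Suc i) (A n) B) \<longlonglongrightarrow> 0)"
proof -
  interpret Metric_space "{A. closed A}" closed_set_dist by (rule Metric_space_closed_sets)
  have "limitin (mtopology_of closed_sets) A B sequentially \<longleftrightarrow>
          (\<lambda>n. closed_set_dist (A n) B) \<longlonglongrightarrow> 0"
    using assms by (simp add: closed_sets_def limitin_metric_dist_null)
  also have "\<dots> \<longleftrightarrow> (\<forall>i. (\<lambda>n. td_sup (Suc i) (A n) B) \<longlonglongrightarrow> 0)"
    unfolding closed_set_dist_def by (rule min_series_tendsto_0_iff) (rule td_sup_nonneg, simp)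
  finally show ?thesis .
qed

lemma trunc_dist_tendsto:
  assumes conv: "set_convergence A B" and "closed B"
  shows "(\<lambda>n. trunc_dist i (A n) x) \<longlonglongrightarrow> trunc_dist i B x"
proof (rule LIMSEQ_I)
  fix e :: real assume "e > 0"
  have up: "\<forall>\<^sub>F n in sequentially. trunc_dist i (A n) x < trunc_dist i B x + e"
  proof (cases "B = {}")
    case True
    thus ?thesis using trunc_dist_bounds(2)[of i _ x] \<open>e > 0\<close>
      by (auto simp: trunc_dist_def intro!: always_eventually)
  next
    case False
    then obtain y where y: "y \<in> B" "infdist x B = dist x y"
      using infdist_attains_inf[OF \<open>closed B\<close>] by metis
    obtain p where p: "\<forall>\<^sub>F n in sequentially. p n \<in> A n" "p \<longlonglongrightarrow> y"
      using conv y(1) unfolding set_convergence_def by blast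
    from p(2) have "(\<lambda>n. dist x (p n)) \<longlonglongrightarrow> dist x y" by (intro tendsto_intros)
    hence "\<forall>\<^sub>F n in sequentially. dist x (p n) < dist x y + e"
      by (rule order_tendstoD) (use \<open>e > 0\<close> in auto)
    with p(1) show ?thesis
    proof eventually_elim
      case (elim n)
      have "trunc_dist i (A n) x < dist x y + e" "trunc_dist i (A n) x < real i + e"
        using trunc_dist_le[OF elim(1), of i x] elim(2) trunc_dist_bounds(2)[of i "A n" x] \<open>e > 0\<close>
        by linarith+
      moreover have "trunc_dist i B x = min (real i) (dist x y)"
        using False y(2) by (simp add: trunc_dist_def)
      ultimately show ?case by (simp add: min_def)
    qed
  qed
  have low: "\<forall>\<^sub>F n in sequentially. trunc_dist i (A n) x > trunc_dist i B x - e"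
  proof (rule ccontr)
    assume "\<not> ?thesis"
    hence "\<exists>\<^sub>F n in sequentially. trunc_dist i (A n) x \<le> trunc_dist i B x - e"
      by (simp add: frequently_def not_le)
    hence inf: "infinite {n. trunc_dist i (A n) x \<le> trunc_dist i B x - e}"
      by (simp add: frequently_cofinite cofinite_eq_sequentially[symmetric])
    define r where "r = enumerate {n. trunc_dist i (A n) x \<le> trunc_dist i B x - e}"
    have r: "strict_mono r" using inf unfolding r_def by (rule strict_mono_enumerate)
    have le: "trunc_dist i (A (r k)) x \<le> trunc_dist i B x - e" for k
      using enumerate_in_set[OF inf, of k] by (simp add: r_def)
    have "\<exists>a\<in>A (r k). dist x a < trunc_dist i B x - e / 2" for k
    proof -
      from le[of k] \<open>e > 0\<close> trunc_dist_bounds(2)[of i B x] have "trunc_dist i (A (r k)) x < real i" by linarith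
      hence ne: "A (r k) \<noteq> {}" and "infdist x (A (r k)) = trunc_dist i (A (r k)) x"
        by (auto simp: trunc_dist_def min_def split: if_splits)
      with le[of k] \<open>e > 0\<close> have "infdist x (A (r k)) < trunc_dist i B x - e / 2" by linarith
      with ne show ?thesis using cINF_less_iff[of "A (r k)" "dist x"] by (auto simp: infdist_notempty)
    qed
    then obtain p where p: "\<And>k. p k \<in> A (r k)" "\<And>k. dist x (p k) < trunc_dist i B x - e / 2" by metis
    have "\<forall>k. p k \<in> cball x (trunc_dist i B x - e / 2)" using p(2) by (auto simp: less_imp_le)
    then obtain l s where ls: "l \<in> cball x (trunc_dist i B x - e / 2)" "strict_mono s" "(p \<circ> s) \<longlonglongrightarrow> l"
      using compact_cball[of x] unfolding compact_def by metis
    have "strict_mono (r \<circ> s)" "\<forall>k. (p \<circ> s) k \<in> A ((r \<circ> s) k)"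
      using r ls(2) p(1) by (auto simp: strict_mono_o)
    hence "l \<in> B" using conv ls(3) unfolding set_convergence_def by blast
    from trunc_dist_le[OF this, of i x] ls(1) \<open>e > 0\<close> show False by simp
  qed
  from up low have "\<forall>\<^sub>F n in sequentially. norm (trunc_dist i (A n) x - trunc_dist i B x) < e"
    by eventually_elim auto
  thus "\<exists>N. \<forall>n\<ge>N. norm (trunc_dist i (A n) x - trunc_dist i B x) < e"
    by (simp add: eventually_sequentially)
qed

lemma td_sup_tendsto:
  assumes conv: "set_convergence A B" and "closed B" and "i > 0"
  shows "(\<lambda>n. td_sup i (A n) B) \<longlonglongrightarrow> 0"
proof (rule LIMSEQ_I)
  fix e :: real assume "e > 0"
  define d where "d = e / 8"
  have "d > 0" using \<open>e > 0\<close> by (simp add: d_def)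
  obtain F where F: "finite F" "cball (0::complex) (real i) \<subseteq> (\<Union>y\<in>F. ball y d)"
    using seq_compact_imp_totally_bounded[OF compact_imp_seq_compact[OF compact_cball],
        of "0::complex" "real i", rule_format, OF \<open>d > 0\<close>]
    by blast
  have "\<forall>\<^sub>F n in sequentially. \<forall>y\<in>F. \<bar>trunc_dist i (A n) y - trunc_dist i B y\<bar> < d"
    using trunc_dist_tendsto[OF conv \<open>closed B\<close>, of i] \<open>d > 0\<close>
    by (intro eventually_ball_finite F(1)) (auto simp: tendsto_iff dist_real_def)
  hence "\<forall>\<^sub>F n in sequentially. norm (td_sup i (A n) B - 0) < e"
  proof eventually_elim
    case (elim n)
    have "td_sup i (A n) B \<le> 3 * d"
    proof (rule td_sup_least[OF \<open>i > 0\<close>])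
      fix x :: complex assume "norm x < real i"
      hence "x \<in> cball 0 (real i)" by simp
      with F(2) obtain y where y: "y \<in> F" "dist y x < d" by (auto simp: subset_iff)
      show "\<bar>trunc_dist i (A n) x - trunc_dist i B x\<bar> \<le> 3 * d"
        using elim[rule_format, OF y(1)] y(2) trunc_dist_lipschitz[of i "A n" y x]
          trunc_dist_lipschitz[of i B y x] by linarith
    qed
    thus ?case using td_sup_nonneg[OF \<open>i > 0\<close>, of "A n" B] \<open>e > 0\<close> by (simp add: d_def)
  qed
  thus "\<exists>N. \<forall>n\<ge>N. norm (td_sup i (A n) B - 0) < e" by (simp add: eventually_sequentially)
qed

lemma tendsto_trunc_dist_if_td_sup:
  assumes "\<And>i. (\<lambda>n. td_sup (Suc i) (A n) B) \<longlonglongrightarrow> 0" "norm x < real (Suc i)"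
  shows "(\<lambda>n. trunc_dist (Suc i) (A n) x) \<longlonglongrightarrow> trunc_dist (Suc i) B x"
proof -
  have "(\<lambda>n. \<bar>trunc_dist (Suc i) (A n) x - trunc_dist (Suc i) B x\<bar>) \<longlonglongrightarrow> 0"
    by (rule tendsto_sandwich[OF _ _ tendsto_const assms(1)[of i]])
       (use td_sup_upper[OF assms(2)] in \<open>auto intro!: always_eventually simp del: of_nat_Suc\<close>)
  thus ?thesis by (simp add: tendsto_rabs_zero_iff LIM_zero_iff)
qed

lemma set_convergence_if_td_sup:
  assumes L: "\<And>i. (\<lambda>n. td_sup (Suc i) (A n) B) \<longlonglongrightarrow> 0" and "closed B"
  shows "set_convergence A B"
  unfolding set_convergence_def
proof (intro conjI allI impI ballI)
  fix r :: "nat \<Rightarrow> nat" and p and l :: complex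
  assume *: "strict_mono r \<and> (\<forall>k. p k \<in> A (r k)) \<and> p \<longlonglongrightarrow> l"
  obtain i :: nat where i: "norm l < real (Suc i)"
    by (metis less_SucI of_nat_less_iff order_less_trans reals_Archimedean2 lessI)
  from tendsto_trunc_dist_if_td_sup[OF L i]
  have 1: "(\<lambda>k. trunc_dist (Suc i) (A (r k)) l) \<longlonglongrightarrow> trunc_dist (Suc i) B l"
    using * LIMSEQ_subseq_LIMSEQ[of _ _ r] by (fastforce simp: o_def)
  have "(\<lambda>k. dist l (p k)) \<longlonglongrightarrow> dist l l" using * by (intro tendsto_intros) auto
  hence 2: "(\<lambda>k. dist l (p k)) \<longlonglongrightarrow> 0" by simp
  have "trunc_dist (Suc i) B l \<le> 0"
    by (rule LIMSEQ_le[OF 1 2]) (use * trunc_dist_le in blast)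
  hence "B \<noteq> {}" "infdist l B \<le> 0" by (auto simp: trunc_dist_def min_def split: if_splits)
  thus "l \<in> B" using \<open>closed B\<close> infdist_nonneg[of l B] in_closed_iff_infdist_zero by force
next
  fix l assume "l \<in> B"
  obtain i :: nat where i: "norm l < real (Suc i)"
    by (metis less_SucI of_nat_less_iff order_less_trans reals_Archimedean2 lessI)
  have "trunc_dist (Suc i) B l = 0"
    using trunc_dist_le[OF \<open>l \<in> B\<close>, of "Suc i" l] trunc_dist_bounds(1)[of "Suc i" B l] by simp
  with tendsto_trunc_dist_if_td_sup[OF L i]
  have 0: "(\<lambda>n. trunc_dist (Suc i) (A n) l) \<longlonglongrightarrow> 0" by simp
  hence "\<forall>\<^sub>F n in sequentially. trunc_dist (Suc i) (A n) l < real (Suc i)"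
    by (rule order_tendstoD) simp
  hence ev: "\<forall>\<^sub>F n in sequentially. A n \<noteq> {} \<and> trunc_dist (Suc i) (A n) l = infdist l (A n)"
    by eventually_elim (auto simp: trunc_dist_def min_def split: if_splits)
  hence "\<forall>\<^sub>F n in sequentially. trunc_dist (Suc i) (A n) l = infdist l (A n)"
    by eventually_elim auto
  with 0 have inf0: "(\<lambda>n. infdist l (A n)) \<longlonglongrightarrow> 0" by (simp add: filterlim_cong)
  define p where "p n = (SOME a. a \<in> A n \<and> dist l a < infdist l (A n) + 1 / real (Suc n))" for n
  have p: "p n \<in> A n \<and> dist l (p n) < infdist l (A n) + 1 / real (Suc n)" if "A n \<noteq> {}" for n
  proof -
    have "(INF a\<in>A n. dist l a) < infdist l (A n) + 1 / real (Suc n)"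
      using that by (simp add: infdist_notempty)
    hence "\<exists>a. a \<in> A n \<and> dist l a < infdist l (A n) + 1 / real (Suc n)"
      using that by (subst (asm) cINF_less_iff) auto
    thus ?thesis unfolding p_def by (rule someI_ex)
  qed
  have "(\<lambda>n. infdist l (A n) + 1 / real (Suc n)) \<longlonglongrightarrow> 0 + 0"
    by (intro tendsto_add inf0 LIMSEQ_inverse_real_of_nat[unfolded inverse_eq_divide])
  hence "(\<lambda>n. infdist l (A n) + 1 / real (Suc n)) \<longlonglongrightarrow> 0" by simp
  moreover have "\<forall>\<^sub>F n in sequentially. dist (p n) l \<le> infdist l (A n) + 1 / real (Suc n)"
    using ev by eventually_elim (use p in \<open>auto simp: dist_commute less_imp_le\<close>)
  ultimately have "(\<lambda>n. dist (p n) l) \<longlonglongrightarrow> 0"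
    by (intro Lim_null_comparison[of "\<lambda>n. dist (p n) l"]) simp_all
  hence "p \<longlonglongrightarrow> l" by (rule tendsto_dist_iff[THEN iffD2])
  moreover have "\<forall>\<^sub>F n in sequentially. p n \<in> A n" using ev by eventually_elim (use p in auto)
  ultimately show "\<exists>p. (\<forall>\<^sub>F n in sequentially. p n \<in> A n) \<and> p \<longlonglongrightarrow> l" by blast
qed

theorem limitin_closed_sets_iff:
  assumes "\<And>n. closed (A n)" "closed B"
  shows "limitin (mtopology_of closed_sets) A B sequentially \<longleftrightarrow> set_convergence A B"
  unfolding limitin_closed_sets_iff_sup[OF assms]
  using td_sup_tendsto[OF _ assms(2)] set_convergence_if_td_sup[OF _ assms(2)] by blast

lemma attouch_wets_tendsto_iff:
  assumes A: "\<And>n. closed (A n)" "\<And>n. A n \<noteq> {}" and B: "closed B" "B \<noteq> {}"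
  shows "(\<lambda>n. attouch_wets (A n) B) \<longlonglongrightarrow> 0 \<longleftrightarrow>
           limitin (mtopology_of closed_sets) A B sequentially"
proof -
  define aw where "aw i n = (SUP x\<in>ball 0 (real (Suc i)). \<bar>infdist x (A n) - infdist x B\<bar>)" for i n
  have upper: "\<bar>infdist x (A n) - infdist x B\<bar> \<le> aw i n" if "norm x < real (Suc i)" for x i n
    unfolding aw_def
  proof (rule cSUP_upper)
    show "x \<in> ball 0 (real (Suc i))" using that by simp
    show "bdd_above ((\<lambda>x. \<bar>infdist x (A n) - infdist x B\<bar>) ` ball 0 (real (Suc i)))"
    proof (rule bdd_aboveI2)
      have *: "\<bar>a - b\<bar> \<le> \<bar>c - d\<bar> + 2 * s"
        if "\<bar>a - c\<bar> \<le> t" "\<bar>b - d\<bar> \<le> t" "t < s" for a b c d s t :: real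
        using that by linarith
      fix y :: complex assume "y \<in> ball 0 (real (Suc i))"
      thus "\<bar>infdist y (A n) - infdist y B\<bar> \<le> \<bar>infdist 0 (A n) - infdist 0 B\<bar> + 2 * real (Suc i)"
        unfolding mem_ball
        using *[OF infdist_triangle_abs[of y "A n" 0] infdist_triangle_abs[of y B 0]]
        by (simp only: dist_commute[of y 0])
    qed
  qed
  have nonneg: "0 \<le> aw i n" for i n
    by (rule order_trans[OF abs_ge_zero upper[of 0]]) simp
  have "(\<lambda>n. attouch_wets (A n) B) \<longlonglongrightarrow> 0 \<longleftrightarrow> (\<forall>i. aw i \<longlonglongrightarrow> 0)"
    unfolding attouch_wets_def aw_def[symmetric] by (rule min_series_tendsto_0_iff) (rule nonneg)
  also have "\<dots> \<longleftrightarrow> (\<forall>i. (\<lambda>n. td_sup (Suc i) (A n) B) \<longlonglongrightarrow> 0)"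
  proof (intro iffI allI)
    fix i assume *: "\<forall>i. aw i \<longlonglongrightarrow> 0"
    have "td_sup (Suc i) (A n) B \<le> aw i n" for n
    proof (rule td_sup_least)
      fix x :: complex assume "norm x < real (Suc i)"
      from upper[OF this, of n]
      show "\<bar>trunc_dist (Suc i) (A n) x - trunc_dist (Suc i) B x\<bar> \<le> aw i n"
        unfolding trunc_dist_def using A(2) B(2) by (simp del: of_nat_Suc add: min_def) linarith
    qed simp
    moreover have "0 \<le> td_sup (Suc i) (A n) B" for n by (rule td_sup_nonneg) simp
    ultimately show "(\<lambda>n. td_sup (Suc i) (A n) B) \<longlonglongrightarrow> 0"
      by (intro Lim_null_comparison[OF _ *[rule_format, of i]] always_eventually allI)
         (simp only: real_norm_def abs_of_nonneg)
  next
    fix i assume *: "\<forall>i. (\<lambda>n. td_sup (Suc i) (A n) B) \<longlonglongrightarrow> 0"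
    obtain j :: nat where j: "real j > infdist 0 B + real (Suc i) + 1"
      using reals_Archimedean2 by blast
    hence ji: "real (Suc i) \<le> real (Suc j)" using infdist_nonneg[of 0 B] by simp
    have small: "aw i n \<le> td_sup (Suc j) (A n) B" if lt: "td_sup (Suc j) (A n) B < 1" for n
      unfolding aw_def
    proof (rule cSUP_least)
      fix x :: complex assume "x \<in> ball 0 (real (Suc i))"
      hence x: "norm x < real (Suc i)" by simp
      have b: "infdist x B + 1 < real (Suc j)"
        using infdist_triangle[of x B 0] x j by simp
      have t: "\<bar>trunc_dist (Suc j) (A n) x - trunc_dist (Suc j) B x\<bar> \<le> td_sup (Suc j) (A n) B"
        by (rule td_sup_upper) (use x ji in linarith)
      have "trunc_dist (Suc j) B x = infdist x B"
        using b B(2) by (simp add: trunc_dist_def min_def)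
      moreover from this t lt b have "trunc_dist (Suc j) (A n) x < real (Suc j)" by linarith
      hence "trunc_dist (Suc j) (A n) x = infdist x (A n)"
        using A(2) by (auto simp: trunc_dist_def min_def split: if_splits)
      ultimately show "\<bar>infdist x (A n) - infdist x B\<bar> \<le> td_sup (Suc j) (A n) B" using t by simp
    qed simp
    have "\<forall>\<^sub>F n in sequentially. td_sup (Suc j) (A n) B < 1"
      using *[rule_format, of j] by (rule order_tendstoD) simp
    hence "\<forall>\<^sub>F n in sequentially. norm (aw i n) \<le> td_sup (Suc j) (A n) B"
      by eventually_elim (simp only: real_norm_def abs_of_nonneg[OF nonneg] small)
    thus "aw i \<longlonglongrightarrow> 0" by (rule Lim_null_comparison) (rule *[rule_format])
  qed
  also have "\<dots> \<longleftrightarrow> limitin (mtopology_of closed_sets) A B sequentially"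
    by (rule limitin_closed_sets_iff_sup[symmetric]) (rule A(1), rule B(1))
  finally show ?thesis .
qed

end

theory Submission
  imports Defs "Jordan_Normal_Form.Determinant"
begin

text \<open>
  Upper bound.  Near every point, \<open>K(z)\<close> is a small analytic family plus one of finite rank, so
  \<open>I + K(z)\<close> is either nowhere invertible, or else invertible outside a discrete set, near whose
  points \<open>z\<^sub>0\<close> (apart from those where the inverse stays bounded) the norm of the inverse is at
  least \<open>c / \<bar>z - z\<^sub>0\<bar>\<close>.  An algorithm rounds the values of \<open>q\<close> on a grid; any potential \<open>p\<close> with
  the same rounded values and the least possible Lipschitz constant is uniformly close to \<open>q\<close>.  The
  algorithm returns the points \<open>z\<close> of a grid of mesh \<open>1 / n\<^sup>2\<close> at which the inverse of
  \<open>I + K\<^sub>p(z)\<close> does not exist or has norm larger than \<open>n\<close>.  This output only depends on finitely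
  many comparisons, so a finite tree can compute it, whatever function of the bits it is.

  Lower bound.  An algorithm of height 0 evaluates the potential 0, which has no resonances, at
  finitely many points only, and there is a potential that vanishes at these points and has one.
\<close>

section \<open>Algorithms that read off finitely many bits\<close>

text \<open>The rates have to fit together. At distance about 1 / n^2 from a pole the inverse has
  norm at least of order n^2, well above the threshold n, while away from the poles it is bounded
  and stays below n. In dimension 1 the kernel has a pole at 0, so points with |z| < 1 / n^2 are
  discarded; elsewhere an error of order n^-4 in the potential changes K(z) by at most a constant
  times n^-2, which an inverse of norm n tolerates.

  Whether I + K(z) is invertible anywhere is left open. If it is not, there are no poles; this case
  is recognised by all grid points of a fixed disc testing as bad, and the empty output is then
  right.

  Poles are studied through the scalar functions \<psi>(B(z) f), to which complex analysis applies
  directly. In the lower bound one potential has to serve two points: I + K(z1) must have a kernel,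
  and I + K(z2) must be invertible to exclude the degenerate case. Hence the fundamental solution at
  z1 has to dominate the one at z2 near the diagonal by an arbitrary factor.\<close>

definition gaussian_rationals :: "complex set" where
  "gaussian_rationals = range (\<lambda>(a, b). Complex (of_rat a) (of_rat b))"

text \<open>Every question is asked whatever the earlier answers were; the leaf that is reached
  stores the value of \<open>F\<close> at the list of all answers.\<close>

primrec decision_tree :: "'t aterm list \<Rightarrow> (bool list \<Rightarrow> 't aterm list) \<Rightarrow> 't atree" where
  "decision_tree [] F = Output (F [])"
| "decision_tree (e # es) F =
     Branch e (decision_tree es (\<lambda>bs. F (True # bs))) (decision_tree es (\<lambda>bs. F (False # bs)))"

lemma run_decision_tree:
  assumes "\<And>bs e. e \<in> set (F bs) \<Longrightarrow> inputs e = {}"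
  shows "run T (decision_tree es F) (\<Union>e\<in>set es. inputs e)
           (map (aval T) (F (map (\<lambda>e. 0 < Re (aval T e)) es)))"
  using assms
proof (induction es arbitrary: F)
  case Nil
  hence "(\<Union>e\<in>set (F []). inputs e) = {}" by auto
  thus ?case using run_Output[of T "F []"] by simp
next
  case (Cons e es)
  show ?case
  proof (cases "0 < Re (aval T e)")
    case True
    with run_Pos[OF True Cons.IH[of "\<lambda>bs. F (True # bs)"]] Cons.prems show ?thesis by simp
  next
    case False
    hence "Re (aval T e) \<le> 0" by simp
    from run_Nonpos[OF this Cons.IH[of "\<lambda>bs. F (False # bs)"]] Cons.prems False show ?thesis
      by simp
  qed
qed

lemma gaussian_rational_term:
  assumes "z \<in> gaussian_rationals"
  obtains e :: "'t aterm" where "inputs e = {}" "\<And>T. aval T e = z"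
proof -
  from assms obtain a b where z: "z = Complex (of_rat a) (of_rat b)"
    by (auto simp: gaussian_rationals_def)
  show ?thesis by (rule that[of "Const a b"]) (simp_all add: z)
qed

lemma gaussian_rational_terms:
  assumes "finite A" "A \<subseteq> gaussian_rationals"
  obtains es :: "'t aterm list" where "\<And>e. e \<in> set es \<Longrightarrow> inputs e = {}"
    "\<And>T. aval T ` set es = A"
proof -
  obtain c :: "complex \<Rightarrow> 't aterm" where c: "\<And>z. z \<in> A \<Longrightarrow> inputs (c z) = {}"
    "\<And>z T. z \<in> A \<Longrightarrow> aval T (c z) = z"
    using gaussian_rational_term assms(2) by (metis subsetD)
  obtain zs where "set zs = A" using finite_list[OF assms(1)] by blast
  with c show ?thesis by (intro that[of "map c zs"]) (auto simp: image_image)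
qed

text \<open>All inputs are asked the same questions, so the set of evaluations is constant and the
  consistency condition on it is immediate; inputs with equal evaluations give equal answers and
  hence equal outputs.\<close>

lemma arithmetic_algorithm_decision:
  fixes es :: "'t aterm list"
  assumes "\<And>e. e \<in> set es \<Longrightarrow> inputs e \<subseteq> \<Lambda>"
    and fin: "\<And>bs. finite (F bs)" "\<And>bs. F bs \<subseteq> gaussian_rationals"
  shows "arithmetic_algorithm \<Omega> \<Lambda> closed_sets set (\<lambda>T. F (map (\<lambda>e. 0 < Re (aval T e)) es))"
proof -
  let ?U = "\<Union>e\<in>set es. inputs e"
  have aval_cong: "aval S e = aval T e" if "\<forall>f\<in>inputs e. f T = f S" for S T and e :: "'t aterm"
    using that by (induction e) auto
  have finite_inputs: "finite (inputs e)" for e :: "'t aterm"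
    by (induction e) auto
  \<comment> \<open>The outputs are written as constant terms, so the leaves contribute no
    evaluations.\<close>
  have "\<forall>bs. \<exists>ts. (\<forall>e\<in>set ts. inputs e = {}) \<and> (\<forall>T. aval T ` set ts = F bs)"
    using gaussian_rational_terms[OF fin] by metis
  then obtain G :: "bool list \<Rightarrow> 't aterm list"
    where G: "\<And>bs e. e \<in> set (G bs) \<Longrightarrow> inputs e = {}" "\<And>bs T. aval T ` set (G bs) = F bs"
    by metis
  have "\<exists>\<Lambda>\<^sub>\<Gamma> A. \<forall>T\<in>\<Omega>. finite (\<Lambda>\<^sub>\<Gamma> T) \<and> \<Lambda>\<^sub>\<Gamma> T \<subseteq> \<Lambda> \<and>
        (\<forall>S\<in>\<Omega>. (\<forall>f\<in>\<Lambda>\<^sub>\<Gamma> T. f T = f S) \<longrightarrow>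
            F (map (\<lambda>e. 0 < Re (aval S e)) es) = F (map (\<lambda>e. 0 < Re (aval T e)) es) \<and> \<Lambda>\<^sub>\<Gamma> S = \<Lambda>\<^sub>\<Gamma> T) \<and>
        (\<exists>U out. run T A U out \<and> U \<subseteq> \<Lambda>\<^sub>\<Gamma> T \<and> F (map (\<lambda>e. 0 < Re (aval T e)) es) = set out)"
  proof (rule exI[of _ "\<lambda>_. ?U"], rule exI[of _ "decision_tree es G"], intro ballI conjI impI)
    show "finite ?U" using finite_inputs by auto
    show "?U \<subseteq> \<Lambda>" using assms(1) by auto
  next
    fix T S assume "\<forall>f\<in>?U. f T = f S"
    hence "map (\<lambda>e. 0 < Re (aval S e)) es = map (\<lambda>e. 0 < Re (aval T e)) es"
      using aval_cong[of _ T S] by (intro map_cong) auto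
    thus "F (map (\<lambda>e. 0 < Re (aval S e)) es) = F (map (\<lambda>e. 0 < Re (aval T e)) es)" by (rule arg_cong)
  next
    fix T
    have "run T (decision_tree es G) ?U (map (aval T) (G (map (\<lambda>e. 0 < Re (aval T e)) es)))"
      by (rule run_decision_tree) (rule G(1))
    thus "\<exists>U out. run T (decision_tree es G) U out \<and> U \<subseteq> ?U \<and>
             F (map (\<lambda>e. 0 < Re (aval T e)) es) = set out"
      using G(2) by (intro exI conjI) (assumption, auto)
  qed simp
  thus ?thesis
    using fin(1) by (auto simp: arithmetic_algorithm_def mspace_closed_sets intro: finite_imp_closed)
qed

section \<open>Rounding a potential and choosing another one with the same bits\<close>

definition cube_radius :: "real \<Rightarrow> 'n::finite itself \<Rightarrow> real" where
  "cube_radius M _ = real CARD('n) * (M / 2)"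

text \<open>The Euclidean norm is estimated by the l1 norm, whence the factor d and not its square
  root.\<close>

lemma norm_le_cube_radius:
  assumes "x \<in> (cube M :: (real ^ 'n::finite) set)"
  shows "norm x \<le> cube_radius M TYPE('n)"
proof -
  have "norm x \<le> (\<Sum>i\<in>UNIV. \<bar>x $ i\<bar>)" by (rule norm_le_l1_cart)
  also have "\<dots> \<le> (\<Sum>i\<in>(UNIV :: 'n set). M / 2)"
    using assms by (intro sum_mono) (auto simp: cube_def intro: less_imp_le)
  finally show ?thesis by (simp add: cube_radius_def)
qed

lemma potential_eq_0: "q \<in> potentials M \<Longrightarrow> x \<notin> cube M \<Longrightarrow> q x = 0"
  using closure_subset[of "{x. q x \<noteq> 0}"] by (auto simp: potentials_def)

text \<open>One number bounds both the values and the Lipschitz constant; it is a natural number so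
  that a least one exists among the potentials with given bits.\<close>

definition lipschitz_bound :: "real \<Rightarrow> (real ^ 'n::finite \<Rightarrow> complex) \<Rightarrow> nat \<Rightarrow> bool" where
  "lipschitz_bound r q L \<longleftrightarrow> (\<forall>x\<in>cball 0 r. norm (q x) \<le> real L) \<and> (real L)-lipschitz_on (cball 0 r) q"

lemma potential_lipschitz_bound:
  fixes q :: "real ^ 'n::finite \<Rightarrow> complex"
  assumes "q \<in> potentials M"
  shows "\<exists>L. lipschitz_bound r q L"
proof -
  from assms obtain D :: "real ^ 'n \<Rightarrow> ((real ^ 'n) \<Rightarrow>\<^sub>L complex)"
    where D: "\<And>x. (q has_derivative blinfun_apply (D x)) (at x)" "continuous_on UNIV D"
    by (auto simp: potentials_def)
  have "bounded (D ` cball 0 r)"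
    by (intro compact_imp_bounded compact_continuous_image continuous_on_subset[OF D(2)]) auto
  then obtain B1 where B1: "\<And>x. x \<in> cball 0 r \<Longrightarrow> norm (D x) \<le> B1"
    unfolding bounded_iff by blast
  have "continuous_on (cball 0 r) q"
    using D(1) by (intro continuous_at_imp_continuous_on ballI) (rule has_derivative_continuous)
  hence "bounded (q ` cball 0 r)" by (intro compact_imp_bounded compact_continuous_image) auto
  then obtain B2 where B2: "\<And>x. x \<in> cball 0 r \<Longrightarrow> norm (q x) \<le> B2"
    unfolding bounded_iff by blast
  obtain L :: nat where L: "real L \<ge> max B1 B2" using real_arch_simple by blast
  have "norm (q x - q y) \<le> real L * norm (x - y)" if "x \<in> cball 0 r" "y \<in> cball 0 r" for x y
  proof (rule differentiable_bound[OF convex_cball])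
    show "(q has_derivative blinfun_apply (D z)) (at z within cball 0 r)" for z
      using D(1) by (rule has_derivative_at_withinI)
    show "onorm (blinfun_apply (D z)) \<le> real L" if "z \<in> cball 0 r" for z
      using B1[OF that] L by (simp add: norm_blinfun.rep_eq)
  qed (use that in auto)
  moreover have "norm (q x) \<le> real L" if "x \<in> cball 0 r" for x
    using B2[OF that] L by simp
  ultimately have "lipschitz_bound r q L"
    by (auto simp: lipschitz_bound_def lipschitz_on_def dist_norm)
  thus ?thesis ..
qed

lemma finite_net:
  assumes "e > 0"
  obtains F :: "(real ^ 'n::finite) set" where "finite F" "F \<subseteq> cball 0 r" "cball 0 r \<subseteq> (\<Union>y\<in>F. ball y e)"
  using seq_compact_imp_totally_bounded[OF compact_imp_seq_compact[OF compact_cball],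
      of "0 :: real ^ 'n" r, rule_format, OF assms] by blast

lemma close_if_same_thresholds:
  fixes a b :: real and m n :: nat
  assumes "m > 0" "\<bar>a\<bar> \<le> real n" "\<bar>b\<bar> \<le> real n"
    and same: "\<And>k. k \<in> {- int (n * m) - 1..int (n * m)} \<Longrightarrow> real_of_int k / real m < a \<longleftrightarrow> real_of_int k / real m < b"
  shows "\<bar>a - b\<bar> \<le> 1 / real m"
proof -
  have *: "a - b \<le> 1 / real m" if "\<bar>a\<bar> \<le> real n" "\<bar>b\<bar> \<le> real n"
    and same: "\<And>k. k \<in> {- int (n * m) - 1..int (n * m)} \<Longrightarrow> real_of_int k / real m < a \<Longrightarrow> real_of_int k / real m < b"
    for a b
  proof -
    \<comment> \<open>The largest integer with k / m < a. As the comparison is strict, a = - n gives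
      k = - n m - 1, the lower end of the range of thresholds.\<close>
    define k where "k = \<lceil>a * real m\<rceil> - 1"
    have k: "real_of_int k < a * real m" "a * real m \<le> real_of_int k + 1"
      unfolding k_def by linarith+
    have "\<bar>a * real m\<bar> \<le> real n * real m" using that(1) by (simp add: abs_mult mult_right_mono)
    hence "a * real m \<ge> - real (n * m)" "a * real m \<le> real (n * m)" by (simp_all add: abs_le_iff)
    with k have "real_of_int k \<ge> of_int (- int (n * m) - 1)" "real_of_int k \<le> of_int (int (n * m))"
      by (simp_all only: of_int_diff of_int_minus of_int_of_nat_eq of_int_1; linarith)+
    hence "k \<in> {- int (n * m) - 1..int (n * m)}" by (simp only: of_int_le_iff atLeastAtMost_iff)
    moreover have "real_of_int k / real m < a" using k(1) \<open>m > 0\<close> by (simp add: field_simps)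
    ultimately have "real_of_int k / real m < b" by (rule same)
    moreover have "a \<le> real_of_int k / real m + 1 / real m" using k(2) \<open>m > 0\<close> by (simp add: field_simps)
    ultimately show ?thesis by linarith
  qed
  from *[of a b] *[of b a] assms show ?thesis by (simp add: abs_le_iff)
qed

text \<open>The bits that an algorithm extracts from a potential are its values on a net,
  cut off at \<open>n\<close>, up to an error of \<open>1/m\<close>.\<close>

definition threshold_terms ::
  "(real ^ 'n) list \<Rightarrow> nat \<Rightarrow> nat \<Rightarrow> (real ^ 'n \<Rightarrow> complex) aterm list" where
  "threshold_terms xs m n =
     concat (map (\<lambda>x. concat (map (\<lambda>k.
        [Sub (Eval (\<lambda>q. q x)) (Const (of_int k / of_nat m) 0),
         Sub (Mult (Const 0 (- 1)) (Eval (\<lambda>q. q x))) (Const (of_int k / of_nat m) 0)])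
        [- int (n * m) - 1..int (n * m)])) xs)"

definition threshold_bits :: "(real ^ 'n) list \<Rightarrow> nat \<Rightarrow> nat \<Rightarrow> (real ^ 'n \<Rightarrow> complex) \<Rightarrow> bool list" where
  "threshold_bits xs m n q = map (\<lambda>e. 0 < Re (aval q e)) (threshold_terms xs m n)"

lemma close_if_same_bits:
  assumes same: "threshold_bits xs m n p = threshold_bits xs m n q" and "m > 0" "x \<in> set xs"
    and "norm (p x) \<le> real n" "norm (q x) \<le> real n"
  shows "norm (p x - q x) \<le> 2 / real m"
proof -
  have bit: "0 < Re (aval p e) \<longleftrightarrow> 0 < Re (aval q e)" if "e \<in> set (threshold_terms xs m n)" for e
    using same that unfolding threshold_bits_def by (auto simp: map_eq_conv)
  have mem: "Sub (Eval (\<lambda>q. q x)) (Const (of_int k / of_nat m) 0) \<in> set (threshold_terms xs m n)"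
    "Sub (Mult (Const 0 (- 1)) (Eval (\<lambda>q. q x))) (Const (of_int k / of_nat m) 0) \<in> set (threshold_terms xs m n)"
    if "k \<in> {- int (n * m) - 1..int (n * m)}" for k
    unfolding threshold_terms_def using that \<open>x \<in> set xs\<close> by (force simp del: of_nat_mult)+
  have 1: "\<bar>Re (p x) - Re (q x)\<bar> \<le> 1 / real m"
  proof (rule close_if_same_thresholds[of m _ n])
    show "\<bar>Re (p x)\<bar> \<le> real n" "\<bar>Re (q x)\<bar> \<le> real n"
      using assms abs_Re_le_cmod order_trans by blast+
    show "real_of_int k / real m < Re (p x) \<longleftrightarrow> real_of_int k / real m < Re (q x)"
      if "k \<in> {- int (n * m) - 1..int (n * m)}" for k
      using bit[OF mem(1)[OF that]] by (simp add: of_rat_divide)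
  qed fact
  \<comment> \<open>Multiplication by - \<i> turns the imaginary part into a real part, the only
    part that a \<open>Branch\<close> tests.\<close>
  have 2: "\<bar>Im (p x) - Im (q x)\<bar> \<le> 1 / real m"
  proof (rule close_if_same_thresholds[of m _ n])
    show "\<bar>Im (p x)\<bar> \<le> real n" "\<bar>Im (q x)\<bar> \<le> real n"
      using assms abs_Im_le_cmod order_trans by blast+
    show "real_of_int k / real m < Im (p x) \<longleftrightarrow> real_of_int k / real m < Im (q x)"
      if "k \<in> {- int (n * m) - 1..int (n * m)}" for k
      using bit[OF mem(2)[OF that]] by (simp add: of_rat_divide of_rat_minus)
  qed fact
  have "norm (p x - q x) \<le> \<bar>Re (p x - q x)\<bar> + \<bar>Im (p x - q x)\<bar>" by (rule cmod_le)
  also have "\<dots> \<le> 2 / real m" using 1 2 by simp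
  finally show ?thesis .
qed

lemma inputs_threshold_terms: "e \<in> set (threshold_terms xs m n) \<Longrightarrow> inputs e \<subseteq> evaluations M"
  by (auto simp: threshold_terms_def evaluations_def)

text \<open>
  An algorithm may apply an arbitrary function to the bits read off from a potential.  It uses a
  potential with these bits whose Lipschitz constant is minimal, hence at most the unknown
  Lipschitz constant of the input.
\<close>

theorem tower_of_height_one:
  fixes R :: "nat \<Rightarrow> (real ^ 'n::finite \<Rightarrow> complex) \<Rightarrow> complex set"
  assumes R: "\<And>n p. p \<in> potentials M \<Longrightarrow> finite (R n p)" "\<And>n p. p \<in> potentials M \<Longrightarrow> R n p \<subseteq> gaussian_rationals"
    and \<Xi>: "\<And>q. q \<in> potentials M \<Longrightarrow> closed (\<Xi> q)"
    and conv: "\<And>q p C. q \<in> potentials M \<Longrightarrow> (\<And>n. p n \<in> potentials M) \<Longrightarrow>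
       \<forall>\<^sub>F n in sequentially. \<forall>x. norm (p n x - q x) \<le> C / real (Suc n) ^ 4 \<Longrightarrow>
       set_convergence (\<lambda>n. R n (p n)) (\<Xi> q)"
  shows "\<exists>\<Gamma>. tower_of_algorithms (potentials M) (evaluations M) \<Xi> closed_sets set 1 \<Gamma>"
proof -
  \<comment> \<open>The width of the net and the rounding step are both (n + 1)^-4, the accuracy
    that the hypothesis \<open>conv\<close> refers to.\<close>
  let ?r = "cube_radius M TYPE('n)" and ?m = "\<lambda>n. Suc n ^ 4"
  define net :: "nat \<Rightarrow> (real ^ 'n) list" where
    "net n = (SOME xs. set xs \<subseteq> cball 0 ?r \<and> cball 0 ?r \<subseteq> (\<Union>y\<in>set xs. ball y (1 / real (?m n))))" for n
  have net: "set (net n) \<subseteq> cball 0 ?r" "cball 0 ?r \<subseteq> (\<Union>y\<in>set (net n). ball y (1 / real (?m n)))" for n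
  proof -
    have "1 / real (?m n) > 0" by simp
    then obtain F :: "(real ^ 'n) set" where "finite F" "F \<subseteq> cball 0 ?r"
      "cball 0 ?r \<subseteq> (\<Union>y\<in>F. ball y (1 / real (?m n)))" by (rule finite_net)
    moreover from this obtain xs where "set xs = F" using finite_list by blast
    ultimately have "\<exists>xs :: (real ^ 'n) list. set xs \<subseteq> cball 0 ?r \<and> cball 0 ?r \<subseteq> (\<Union>y\<in>set xs. ball y (1 / real (?m n)))"
      by (intro exI[of _ xs]) simp
    from someI_ex[OF this] show "set (net n) \<subseteq> cball 0 ?r"
      "cball 0 ?r \<subseteq> (\<Union>y\<in>set (net n). ball y (1 / real (?m n)))"
      unfolding net_def by blast+
  qed
  define bits where "bits n = threshold_bits (net n) (?m n) n" for n
  define ok where "ok n bs p L \<longleftrightarrow> p \<in> potentials M \<and> bits n p = bs \<and> lipschitz_bound ?r p L" for n bs p L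
  define least where "least n bs = (LEAST L. \<exists>p. ok n bs p L)" for n bs
  define approx where "approx n bs = (SOME p. ok n bs p (least n bs))" for n bs
  have approx: "ok n bs (approx n bs) (least n bs)" "least n bs \<le> L" if "ok n bs p L" for n bs p L
  proof -
    have "\<exists>p. ok n bs p (least n bs)"
      unfolding least_def by (rule LeastI_ex) (use that in blast)
    thus "ok n bs (approx n bs) (least n bs)" unfolding approx_def by (rule someI_ex)
    show "least n bs \<le> L" unfolding least_def by (rule Least_le) (use that in blast)
  qed
  \<comment> \<open>Bit lists that come from no potential get the empty set as a default.\<close>
  define F where "F n bs = (if \<exists>p L. ok n bs p L then R n (approx n bs) else {})" for n bs
  have "approx n bs \<in> potentials M" if "\<exists>p L. ok n bs p L" for n bs
    using that approx(1) by (auto simp: ok_def)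
  hence F: "finite (F n bs)" "F n bs \<subseteq> gaussian_rationals" for n bs
    using R by (simp_all add: F_def)
  define p where "p q n = approx n (bits n q)" for q n
  have ok_q: "\<exists>L. ok n (bits n q) q L" if "q \<in> potentials M" for q n
    using that potential_lipschitz_bound[OF that, of ?r] by (auto simp: ok_def)
  have p: "p q n \<in> potentials M" "F n (bits n q) = R n (p q n)" if "q \<in> potentials M" for q n
    using ok_q[OF that, of n] approx(1) by (auto simp: F_def p_def ok_def)
  have "set_convergence (\<lambda>n. R n (p q n)) (\<Xi> q)" if q: "q \<in> potentials M" for q
  proof -
    from potential_lipschitz_bound[OF q] obtain L where L: "lipschitz_bound ?r q L" by blast
    \<comment> \<open>From n \<ge> L on, the cut-off of the rounding at n affects neither
      \<open>q\<close> nor \<open>p q n\<close>, because the minimal constant of the latter is at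
      most L.\<close>
    have "norm (p q n x - q x) \<le> (2 + 2 * real L) / real (Suc n) ^ 4" if "n \<ge> L" for n x
    proof (cases "x \<in> cube M")
      case False
      thus ?thesis using potential_eq_0[OF p(1)[OF q]] potential_eq_0[OF q] by simp
    next
      case True
      have okq: "ok n (bits n q) q L" using q L by (simp add: ok_def)
      define L' where "L' = least n (bits n q)"
      have L': "lipschitz_bound ?r (p q n) L'" "bits n (p q n) = bits n q" "L' \<le> L"
        using approx[OF okq] by (auto simp: ok_def p_def L'_def)
      from True have x: "x \<in> cball 0 ?r" using norm_le_cube_radius by auto
      then obtain y where y: "y \<in> set (net n)" "dist y x < 1 / real (?m n)" using net(2)[of n] by auto
      hence y': "y \<in> cball 0 ?r" using net(1) by blast
      have "norm (q y) \<le> real L" "norm (p q n y) \<le> real L'"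
        using L L'(1) y' unfolding lipschitz_bound_def by blast+
      hence "norm (q y) \<le> real n" "norm (p q n y) \<le> real n"
        using L'(3) \<open>n \<ge> L\<close> by linarith+
      hence 1: "norm (p q n y - q y) \<le> 2 / real (?m n)"
        using close_if_same_bits[of "net n" "?m n" n "p q n" q y] L'(2) y(1) by (simp add: bits_def)
      have "norm (q y - q x) \<le> real L * dist y x" "norm (p q n x - p q n y) \<le> real L' * dist y x"
        using L L'(1) x y' by (auto simp: lipschitz_bound_def dist_norm norm_minus_commute dest: lipschitz_onD)
      moreover have "real L' * dist y x \<le> real L * dist y x" using L'(3) by (intro mult_right_mono) auto
      moreover have "real L * dist y x \<le> real L * (1 / real (?m n))" using y(2) by (intro mult_left_mono) auto
      ultimately have 2: "norm (q y - q x) \<le> real L / real (?m n)"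
        "norm (p q n x - p q n y) \<le> real L / real (?m n)" by simp_all
      have "norm (p q n x - q x) \<le> norm (p q n x - p q n y) + norm (p q n y - q y) + norm (q y - q x)"
        using norm_triangle_ineq[of "p q n x - p q n y" "p q n y - q y"]
          norm_triangle_ineq[of "p q n x - q y" "q y - q x"] by simp
      also have "\<dots> \<le> real L / real (?m n) + 2 / real (?m n) + real L / real (?m n)" using 1 2 by simp
      also have "\<dots> = (2 + 2 * real L) / real (Suc n) ^ 4" by (simp add: add_divide_distrib)
      finally show ?thesis .
    qed
    hence "\<forall>\<^sub>F n in sequentially. \<forall>x. norm (p q n x - q x) \<le> (2 + 2 * real L) / real (Suc n) ^ 4"
      unfolding eventually_sequentially by blast
    thus ?thesis by (intro conv q p(1))
  qed
  hence lim: "limitin (mtopology_of closed_sets) (\<lambda>n. F n (bits n q)) (\<Xi> q) sequentially"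
    if "q \<in> potentials M" for q
    using that p(2)[OF that] \<Xi> R(1)[OF p(1)[OF that]]
    by (subst limitin_closed_sets_iff) (auto intro: finite_imp_closed)
  have "tower_of_algorithms (potentials M) (evaluations M) \<Xi> closed_sets set 1
          (\<lambda>ns q. F (hd ns) (bits (hd ns) q))"
    unfolding tower_of_algorithms_def One_nat_def iterated_limit.simps
  proof (intro conjI allI impI ballI)
    fix ns :: "nat list"
    show "arithmetic_algorithm (potentials M) (evaluations M) closed_sets set (\<lambda>q. F (hd ns) (bits (hd ns) q))"
      unfolding bits_def threshold_bits_def
      by (rule arithmetic_algorithm_decision) (use inputs_threshold_terms F in blast)+
  next
    fix q :: "real ^ 'n \<Rightarrow> complex" assume "q \<in> potentials M"
    thus "\<exists>b. (\<forall>n. F (hd ([] @ [n])) (bits (hd ([] @ [n])) q) = b n) \<and>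
           limitin (mtopology_of closed_sets) b (\<Xi> q) sequentially"
      using lim by (intro exI[of _ "\<lambda>n. F n (bits n q)"]) simp
  qed
  thus ?thesis by blast
qed

section \<open>Finite rank perturbations of analytic families\<close>

text \<open>Matrices are functions of two indices, read off on the block of indices below k; entries
  that depend on z are then plain holomorphic functions.\<close>

definition cdet :: "nat \<Rightarrow> (nat \<Rightarrow> nat \<Rightarrow> complex) \<Rightarrow> complex" where
  "cdet k M = Determinant.det (Matrix.mat k k (\<lambda>(i, j). M i j))"

definition cadj :: "nat \<Rightarrow> (nat \<Rightarrow> nat \<Rightarrow> complex) \<Rightarrow> nat \<Rightarrow> nat \<Rightarrow> complex" where
  "cadj k M i j = adj_mat (Matrix.mat k k (\<lambda>(i, j). M i j)) $$ (i, j)"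

text \<open>By the Leibniz formula the determinant is a polynomial in the entries.\<close>

lemma holomorphic_det:
  assumes "\<And>z. z \<in> S \<Longrightarrow> A z \<in> carrier_mat k k"
    and hol: "\<And>i j. i < k \<Longrightarrow> j < k \<Longrightarrow> (\<lambda>z. A z $$ (i, j)) holomorphic_on S"
  shows "(\<lambda>z. Determinant.det (A z) :: complex) holomorphic_on S"
proof (subst holomorphic_cong[OF refl])
  show "Determinant.det (A z) = (\<Sum>p\<in>{p. p permutes {0..<k}}. signof p * (\<Prod>i = 0..<k. A z $$ (i, p i)))"
    if "z \<in> S" for z using det_def'[OF assms(1)[OF that]] .
  show "(\<lambda>z. \<Sum>p\<in>{p. p permutes {0..<k}}. signof p * (\<Prod>i = 0..<k. A z $$ (i, p i))) holomorphic_on S"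
    by (intro holomorphic_intros hol) (auto dest: permutes_in_image)
qed

lemma holomorphic_cdet:
  assumes "\<And>i j. i < k \<Longrightarrow> j < k \<Longrightarrow> (\<lambda>z. M z i j) holomorphic_on S"
  shows "(\<lambda>z. cdet k (M z)) holomorphic_on S"
  unfolding cdet_def by (rule holomorphic_det) (use assms in auto)

lemma holomorphic_cadj:
  assumes M: "\<And>i j. i < k \<Longrightarrow> j < k \<Longrightarrow> (\<lambda>z. M z i j) holomorphic_on S" and ij: "i < k" "j < k"
  shows "(\<lambda>z. cadj k (M z) i j) holomorphic_on S"
proof -
  have "(\<lambda>z. Determinant.det (mat_delete (Matrix.mat k k (\<lambda>(i, j). M z i j)) j i)) holomorphic_on S"
    by (rule holomorphic_det[where k = "k - 1"]) (use ij M in \<open>auto simp: mat_delete_def\<close>)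
  thus ?thesis using ij
    by (auto simp: cadj_def adj_mat_def cofactor_def intro!: holomorphic_intros)
qed

lemma
  assumes "i < k" "j < k"
  shows cadj_right: "(\<Sum>l<k. M i l * cadj k M l j) = (if i = j then cdet k M else 0)"
    and cadj_left: "(\<Sum>l<k. cadj k M i l * M l j) = (if i = j then cdet k M else 0)"
proof -
  let ?A = "Matrix.mat k k (\<lambda>(i, j). M i j)"
  have A: "?A \<in> carrier_mat k k" by simp
  have "(?A * adj_mat ?A) $$ (i, j) = (\<Sum>l<k. M i l * cadj k M l j)"
    using assms adj_mat(1)[OF A]
    by (auto simp: times_mat_def scalar_prod_def cadj_def lessThan_atLeast0 intro!: sum.cong)
  thus "(\<Sum>l<k. M i l * cadj k M l j) = (if i = j then cdet k M else 0)"
    using assms unfolding adj_mat(2)[OF A] by (cases "i = j") (simp_all add: cdet_def)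
  have "(adj_mat ?A * ?A) $$ (i, j) = (\<Sum>l<k. cadj k M i l * M l j)"
    using assms adj_mat(1)[OF A]
    by (auto simp: times_mat_def scalar_prod_def cadj_def lessThan_atLeast0 intro!: sum.cong)
  thus "(\<Sum>l<k. cadj k M i l * M l j) = (if i = j then cdet k M else 0)"
    using assms unfolding adj_mat(3)[OF A] by (cases "i = j") (simp_all add: cdet_def)
qed

lemma cdet_0_kernel:
  assumes "cdet k M = 0"
  obtains c :: "nat \<Rightarrow> complex" and l where "l < k" "c l \<noteq> 0" "\<And>i. i < k \<Longrightarrow> (\<Sum>j<k. M i j * c j) = 0"
proof -
  let ?A = "Matrix.mat k k (\<lambda>(i, j). M i j)"
  have A: "?A \<in> carrier_mat k k" by simp
  from assms obtain v where v: "v \<in> carrier_vec k" "v \<noteq> 0\<^sub>v k" "?A *\<^sub>v v = 0\<^sub>v k"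
    unfolding cdet_def det_0_iff_vec_prod_zero[OF A] by blast
  from v(1,2) obtain l where l: "l < k" "vec_index v l \<noteq> 0"
    by (metis carrier_vecD eq_vecI index_zero_vec)
  have "(\<Sum>j<k. M i j * vec_index v j) = 0" if "i < k" for i
  proof -
    have "vec_index (?A *\<^sub>v v) i = (\<Sum>j<k. M i j * vec_index v j)"
      using that v(1) by (auto simp: mult_mat_vec_def scalar_prod_def lessThan_atLeast0 intro!: sum.cong)
    thus ?thesis using v(3) that by simp
  qed
  thus ?thesis using l by (intro that[of l "vec_index v"]) auto
qed

section \<open>Inverses of bounded operators and their perturbation\<close>

definition is_inverse :: "('a::real_normed_vector \<Rightarrow>\<^sub>L 'a) \<Rightarrow> ('a \<Rightarrow>\<^sub>L 'a) \<Rightarrow> bool" where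
  "is_inverse A B \<longleftrightarrow> B o\<^sub>L A = id_blinfun \<and> A o\<^sub>L B = id_blinfun"

lemma is_inverse_apply:
  assumes "is_inverse A B"
  shows "B (A x) = x" "A (B x) = x"
  using assms by (metis is_inverse_def blinfun_apply_blinfun_compose blinfun_apply_id_blinfun id_apply)+

lemma is_inverse_iff: "is_inverse A B \<longleftrightarrow> (\<forall>x. B (A x) = x) \<and> (\<forall>x. A (B x) = x)"
  by (auto simp: is_inverse_apply) (auto simp: is_inverse_def intro!: blinfun_eqI)

lemma is_inverse_unique: "is_inverse A B \<Longrightarrow> is_inverse A C \<Longrightarrow> B = C"
  by (rule blinfun_eqI) (metis is_inverse_apply)

lemma blinfun_inverse_eq: "is_inverse A B \<Longrightarrow> blinfun_inverse A = B"
  unfolding blinfun_inverse_def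
  by (rule the_equality) (auto simp: is_inverse_def[symmetric] dest: is_inverse_unique)

text \<open>What matters is that the junk value is the same for all non-invertible operators: a
  family without inverses is therefore constant under \<open>blinfun_inverse\<close> and cannot have
  a pole.\<close>

lemma blinfun_inverse_undefined:
  "\<nexists>B. is_inverse A B \<Longrightarrow> blinfun_inverse A = (THE B. False)"
  unfolding blinfun_inverse_def is_inverse_def by (intro arg_cong[of _ _ The] ext) blast

text \<open>A' x = y is equivalent to the fixed point equation x = B y - B ((A' - A) x), whose
  right-hand side contracts by 1/2. The same equation gives |x| \<le> |B| |y| + |x| / 2, hence the
  factor 2 in the bound.\<close>

lemma inverse_perturbation:
  fixes A A' B :: "'a::banach \<Rightarrow>\<^sub>L 'a"
  assumes B: "is_inverse A B" and small: "norm (A' - A) * norm B \<le> 1/2"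
  obtains B' where "is_inverse A' B'" "norm B' \<le> 2 * norm B"
proof -
  note BA = is_inverse_apply[OF B]
  have le: "norm (B ((A' - A) x)) \<le> 1/2 * norm x" for x
  proof -
    have "norm (B ((A' - A) x)) \<le> norm B * (norm (A' - A) * norm x)"
      by (rule order_trans[OF norm_blinfun mult_left_mono[OF norm_blinfun]]) simp
    also have "\<dots> = norm (A' - A) * norm B * norm x" by simp
    also have "\<dots> \<le> 1/2 * norm x" by (rule mult_right_mono[OF small]) simp
    finally show ?thesis .
  qed
  have fix_iff: "B y - B ((A' - A) x) = x \<longleftrightarrow> A' x = y" for x y
  proof -
    have "B y - B ((A' - A) x) = x \<longleftrightarrow> B (y - A' x) = 0"
      by (simp add: blinfun.diff_left blinfun.diff_right BA)
    also have "\<dots> \<longleftrightarrow> y - A' x = 0" by (metis BA(2) blinfun.zero_right)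
    finally show ?thesis by auto
  qed
  have ex1: "\<exists>!x. A' x = y" for y
    unfolding fix_iff[symmetric]
  proof (rule banach_fix_type[of "1/2"])
    show "\<forall>x x'. dist (B y - B ((A' - A) x)) (B y - B ((A' - A) x')) \<le> 1/2 * dist x x'"
    proof (intro allI)
      fix x x'
      have "dist (B y - B ((A' - A) x)) (B y - B ((A' - A) x')) = norm (B ((A' - A) (x' - x)))"
        by (simp add: dist_norm blinfun.diff_right)
      also have "\<dots> \<le> 1/2 * dist x x'" using le[of "x' - x"] by (simp add: dist_norm norm_minus_commute)
      finally show "dist (B y - B ((A' - A) x)) (B y - B ((A' - A) x')) \<le> 1/2 * dist x x'" .
    qed
  qed simp_all
  define g where "g y = (THE x. A' x = y)" for y
  have g: "A' (g y) = y" for y unfolding g_def by (rule theI') (rule ex1)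
  have g': "g (A' x) = x" for x using ex1[of "A' x"] g[of "A' x"] by blast
  have bound: "norm (g y) \<le> norm y * (2 * norm B)" for y
  proof -
    have "g y = B y - B ((A' - A) (g y))" using fix_iff[of y "g y"] g by simp
    hence "norm (g y) \<le> norm (B y) + norm (B ((A' - A) (g y)))" by (metis norm_triangle_ineq4)
    also have "\<dots> \<le> norm B * norm y + 1/2 * norm (g y)" by (intro add_mono norm_blinfun le)
    finally show ?thesis by (simp add: mult.commute)
  qed
  have "bounded_linear g"
  proof (rule bounded_linear_intro[OF _ _ bound])
    show "g (x + y) = g x + g y" for x y
      using g'[of "g x + g y"] by (simp add: blinfun.add_right g)
    show "g (r *\<^sub>R x) = r *\<^sub>R g x" for r x
      using g'[of "r *\<^sub>R g x"] by (simp add: blinfun.scaleR_right g)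
  qed
  hence app: "blinfun_apply (Blinfun g) = g" by (rule bounded_linear_Blinfun_apply)
  show ?thesis
  proof (rule that)
    show "is_inverse A' (Blinfun g)" by (simp add: is_inverse_iff app g g')
    show "norm (Blinfun g) \<le> 2 * norm B"
      by (rule norm_blinfun_bound) (use bound in \<open>auto simp: app mult.commute\<close>)
  qed
qed

lemma inverse_id_plus_small:
  fixes A :: "'a::banach \<Rightarrow>\<^sub>L 'a"
  assumes "norm A \<le> 1/2"
  obtains B where "is_inverse (id_blinfun + A) B" "norm B \<le> 2"
proof -
  have 1: "norm (id_blinfun :: 'a \<Rightarrow>\<^sub>L 'a) \<le> 1" by (rule norm_blinfun_id_le)
  have "norm (id_blinfun + A - id_blinfun) * norm (id_blinfun :: 'a \<Rightarrow>\<^sub>L 'a) \<le> 1/2"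
    using mult_mono[OF assms 1] by simp
  from inverse_perturbation[OF _ this] obtain B where "is_inverse (id_blinfun + A) B"
    "norm B \<le> 2 * norm (id_blinfun :: 'a \<Rightarrow>\<^sub>L 'a)"
    by (auto simp: is_inverse_iff)
  with 1 show ?thesis by (intro that[of B]) auto
qed

section \<open>Analytic operator families on a real Hilbert space with a complex structure\<close>

lemma has_field_derivative_quadratic:
  fixes f :: "complex \<Rightarrow> complex"
  assumes "r > 0" and "\<And>z. z \<in> ball w r \<Longrightarrow> norm (f z - f w - d * (z - w)) \<le> C * (norm (z - w))\<^sup>2"
  shows "(f has_field_derivative d) (at w)"
proof -
  have "((\<lambda>z. (f z - f w) / (z - w) - d) \<longlongrightarrow> 0) (at w)"
  proof (rule Lim_null_comparison)
    show "((\<lambda>z. C * norm (z - w)) \<longlongrightarrow> 0) (at w)" by (auto intro!: tendsto_eq_intros)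
    have "\<forall>\<^sub>F z in at w. z \<in> ball w r"
      using assms(1) by (intro eventually_at_in_open') auto
    moreover have "\<forall>\<^sub>F z in at w. z \<noteq> w" by (simp add: eventually_neq_at_within)
    ultimately show "\<forall>\<^sub>F z in at w. norm ((f z - f w) / (z - w) - d) \<le> C * norm (z - w)"
    proof eventually_elim
      case (elim z)
      have "(f z - f w) / (z - w) - d = (f z - f w - d * (z - w)) / (z - w)"
        using elim(2) by (simp add: field_simps)
      thus ?case using assms(2)[OF elim(1)] elim(2)
        by (simp add: norm_divide divide_le_eq power2_eq_square mult.assoc)
    qed
  qed
  thus ?thesis by (simp add: has_field_derivative_iff LIM_zero_iff)
qed

text \<open>\<open>'n L2\<close> is a real Hilbert space. Multiplication by \<i> enters as an
  isometry \<open>J\<close> with square - 1, and complex linearity becomes commutation with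
  \<open>J\<close>.\<close>

locale complex_structure =
  fixes J :: "'a::{real_inner, banach} \<Rightarrow>\<^sub>L 'a"
  assumes J_J: "J (J x) = - x"
    and inner_J_J: "inner (J x) (J y) = inner x y"
begin

definition cscale :: "complex \<Rightarrow> 'a \<Rightarrow>\<^sub>L 'a" where
  "cscale c = Re c *\<^sub>R id_blinfun + Im c *\<^sub>R J"

lemma cscale_apply: "cscale c x = Re c *\<^sub>R x + Im c *\<^sub>R J x"
  by (simp add: cscale_def blinfun.add_left blinfun.scaleR_left)

lemma inner_J_self: "inner x (J x) = 0"
proof -
  have "inner x (J x) = inner (J x) (J (J x))" by (simp add: inner_J_J)
  also have "\<dots> = - inner x (J x)" by (simp add: J_J inner_commute)
  finally show ?thesis by simp
qed

lemma norm_J: "norm (J x) = norm x"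
  by (simp add: norm_eq_sqrt_inner inner_J_J)

lemma cscale_1: "cscale 1 x = x" and cscale_0: "cscale 0 x = 0"
  by (simp_all add: cscale_apply)

lemma cscale_add: "cscale (c + d) x = cscale c x + cscale d x"
  by (simp add: cscale_apply algebra_simps)

lemma cscale_diff: "cscale (c - d) x = cscale c x - cscale d x"
  by (simp add: cscale_apply algebra_simps)

lemma cscale_minus: "cscale (- c) x = - cscale c x"
  by (simp add: cscale_apply algebra_simps)

lemma cscale_mult: "cscale (c * d) x = cscale c (cscale d x)"
  by (simp add: cscale_apply blinfun.add_right blinfun.scaleR_right J_J algebra_simps)

lemma cscale_sum: "cscale (sum f I) x = (\<Sum>i\<in>I. cscale (f i) x)"
  by (induction I rule: infinite_finite_induct) (auto simp: cscale_add cscale_0)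

lemma norm_cscale: "norm (cscale c x) = norm c * norm x"
proof -
  have "(norm (cscale c x))\<^sup>2 = (Re c)\<^sup>2 * (norm x)\<^sup>2 + (Im c)\<^sup>2 * (norm x)\<^sup>2"
    unfolding cscale_apply power2_norm_eq_inner
    by (simp add: inner_add_left inner_add_right inner_J_self inner_J_J power2_eq_square inner_commute[of "J x" x])
  also have "\<dots> = (norm c * norm x)\<^sup>2" by (simp add: cmod_def power_mult_distrib algebra_simps)
  finally show ?thesis by (simp add: power2_eq_iff_nonneg)
qed

definition clinear_op :: "('a \<Rightarrow>\<^sub>L 'a) \<Rightarrow> bool" where
  "clinear_op A \<longleftrightarrow> (\<forall>x. A (J x) = J (A x))"

definition cfunctional :: "('a \<Rightarrow>\<^sub>L complex) \<Rightarrow> bool" where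
  "cfunctional \<phi> \<longleftrightarrow> (\<forall>x. \<phi> (J x) = \<i> * \<phi> x)"

lemma clinear_op_cscale: "clinear_op A \<Longrightarrow> A (cscale c x) = cscale c (A x)"
  by (simp add: cscale_apply clinear_op_def blinfun.add_right blinfun.scaleR_right)

lemma cfunctional_cscale: "cfunctional \<phi> \<Longrightarrow> \<phi> (cscale c x) = c * \<phi> x"
  by (simp add: cscale_apply cfunctional_def blinfun.add_right blinfun.scaleR_right complex_eq_iff)

lemma clinear_op_id_plus: "clinear_op A \<Longrightarrow> clinear_op (id_blinfun + A)"
  by (simp add: clinear_op_def blinfun.add_left blinfun.add_right)

lemma clinear_op_inverse:
  assumes "clinear_op A" "is_inverse A B"
  shows "clinear_op B"
  unfolding clinear_op_def
proof
  fix x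
  have "B (J x) = B (J (A (B x)))" by (simp only: is_inverse_apply(2)[OF assms(2)])
  also have "\<dots> = B (A (J (B x)))" using assms(1) by (simp only: clinear_op_def)
  also have "\<dots> = J (B x)" by (rule is_inverse_apply(1)[OF assms(2)])
  finally show "B (J x) = J (B x)" .
qed

lift_definition rank1 :: "'a \<Rightarrow> ('a \<Rightarrow>\<^sub>L complex) \<Rightarrow> 'a \<Rightarrow>\<^sub>L 'a" is "\<lambda>v \<phi> x. cscale (\<phi> x) v"
proof (rule bounded_linear_intro)
  fix v :: 'a and \<phi> :: "'a \<Rightarrow> complex" and x y :: 'a and r :: real
  assume "bounded_linear \<phi>"
  then interpret \<phi>: bounded_linear \<phi> .
  show "cscale (\<phi> (x + y)) v = cscale (\<phi> x) v + cscale (\<phi> y) v" by (simp add: \<phi>.add cscale_add)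
  show "cscale (\<phi> (r *\<^sub>R x)) v = r *\<^sub>R cscale (\<phi> x) v"
    by (simp add: \<phi>.scaleR cscale_apply algebra_simps)
  show "norm (cscale (\<phi> x) v) \<le> norm x * (onorm \<phi> * norm v)"
    using mult_right_mono[OF onorm[OF \<open>bounded_linear \<phi>\<close>, of x], of "norm v"]
    by (simp add: norm_cscale mult_ac)
qed

lemma rank1_apply: "rank1 v \<phi> x = cscale (\<phi> x) v" by (simp add: rank1.rep_eq)

text \<open>Complex differentiability in operator norm, with a quadratic remainder in place of a
  little-o, since that is what the Taylor estimate of the kernels yields. The factor
  \<open>cscale (z - w)\<close> is multiplication by a complex number.\<close>

definition op_differentiable :: "(complex \<Rightarrow> 'a \<Rightarrow>\<^sub>L 'a) \<Rightarrow> complex \<Rightarrow> bool" where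
  "op_differentiable A w \<longleftrightarrow> (\<exists>D C r. r > 0 \<and> (\<forall>z\<in>ball w r.
     norm (A z - A w - (cscale (z - w) o\<^sub>L D)) \<le> C * (norm (z - w))\<^sup>2))"

text \<open>The resolvent identity R z - R w = - R z (A z - A w) R w, used twice, shows that the
  derivative is - R w D (R w f), with an error that is quadratic in z - w. Only scalar functions
  \<phi> (R z f) are claimed holomorphic, which is enough for everything that follows.\<close>

lemma holomorphic_inverse_family:
  assumes A: "\<And>z. z \<in> S \<Longrightarrow> op_differentiable A z" "\<And>z. z \<in> S \<Longrightarrow> clinear_op (A z)"
    and R: "\<And>z. z \<in> S \<Longrightarrow> is_inverse (id_blinfun + A z) (R z)" "\<And>z. z \<in> S \<Longrightarrow> norm (R z) \<le> 2"
    and "open S" "cfunctional \<phi>"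
  shows "(\<lambda>z. \<phi> (R z f)) holomorphic_on S"
  unfolding holomorphic_on_open[OF \<open>open S\<close>]
proof
  fix w assume w: "w \<in> S"
  from A(1)[OF w] obtain D C r where r: "r > 0"
    and D: "\<And>z. z \<in> ball w r \<Longrightarrow> norm (A z - A w - (cscale (z - w) o\<^sub>L D)) \<le> C * (norm (z - w))\<^sup>2"
    unfolding op_differentiable_def by blast
  from \<open>open S\<close> w obtain r' where r': "r' > 0" "ball w r' \<subseteq> S" using open_contains_ball by blast
  \<comment> \<open>A radius of at most 1 makes the quadratic remainder bounded by a linear one in
    \<open>lip\<close>.\<close>
  define s where "s = min (min r r') 1"
  have s: "s > 0" "ball w s \<subseteq> S" "ball w s \<subseteq> ball w r" "s \<le> 1"
    using r r' by (auto simp: s_def)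
  have C: "C \<ge> 0"
  proof -
    have "w + of_real (s/2) \<in> ball w s" using s(1) by (simp add: dist_norm)
    hence "w + of_real (s/2) \<in> ball w r" using s(3) by blast
    from order_trans[OF norm_ge_zero D[OF this]] s(1) show ?thesis
      by (simp add: zero_le_mult_iff norm_mult)
  qed
  define C1 where "C1 = C + norm D"
  have lip: "norm (A z - A w) \<le> C1 * norm (z - w)" if z: "z \<in> ball w s" for z
  proof -
    have "norm (cscale (z - w) o\<^sub>L D) \<le> norm D * norm (z - w)"
    proof (rule norm_blinfun_bound)
      show "norm ((cscale (z - w) o\<^sub>L D) x) \<le> norm D * norm (z - w) * norm x" for x
        using mult_left_mono[OF norm_blinfun[of D x], of "norm (z - w)"]
        by (simp add: norm_cscale mult_ac)
    qed simp
    moreover have "C * (norm (z - w))\<^sup>2 \<le> C * norm (z - w)"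
      using z s(4) C by (intro mult_left_mono) (auto simp: power2_eq_square dist_norm norm_minus_commute mult_left_le_one_le)
    moreover have "norm (A z - A w) \<le> norm (cscale (z - w) o\<^sub>L D) + norm (A z - A w - (cscale (z - w) o\<^sub>L D))"
      by (rule norm_triangle_sub)
    moreover have "norm (A z - A w - (cscale (z - w) o\<^sub>L D)) \<le> C * (norm (z - w))\<^sup>2"
      using z s(3) by (intro D) blast
    ultimately have "norm (A z - A w) \<le> C * norm (z - w) + norm D * norm (z - w)" by linarith
    thus ?thesis by (simp add: C1_def distrib_right)
  qed
  have cR: "clinear_op (R z)" if "z \<in> S" for z
    using that A(2) R(1) clinear_op_inverse clinear_op_id_plus by blast
  have R_diff: "R z x - R w x = - R z ((A z - A w) (R w x))" if "z \<in> S" for z x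
  proof -
    note iz = is_inverse_apply[OF R(1)[OF that]] and iw = is_inverse_apply[OF R(1)[OF w]]
    have "R z x = R z ((id_blinfun + A w) (R w x))" by (simp add: iw)
    moreover have "R w x = R z ((id_blinfun + A z) (R w x))" by (simp add: iz)
    moreover have "(id_blinfun + A w) (R w x) - (id_blinfun + A z) (R w x) = - (A z - A w) (R w x)"
      by (simp add: blinfun.add_left blinfun.diff_left)
    ultimately have "R z x - R w x = R z (- (A z - A w) (R w x))"
      by (metis blinfun.diff_right)
    thus ?thesis by (simp only: blinfun.minus_right)
  qed
  define d where "d = - \<phi> (R w (D (R w f)))"
  have bnd: "norm (R z x) \<le> 2 * norm x" if "z \<in> S" for z x
    using order_trans[OF norm_blinfun mult_right_mono[OF R(2)[OF that]]] by auto
  have "norm (\<phi> (R z f) - \<phi> (R w f) - d * (z - w)) \<le> norm \<phi> * (8 * C1^2 + 4 * C) * norm f * (norm (z - w))\<^sup>2"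
    if z: "z \<in> ball w s" for z
  proof -
    have zS: "z \<in> S" using z s by auto
    let ?y = "R w f"
    let ?u = "(A z - A w) ?y" and ?k = "C1 * norm (z - w)"
    have e0: "(A z - A w - (cscale (z - w) o\<^sub>L D)) ?y = ?u - cscale (z - w) (D ?y)"
      by (simp add: blinfun.diff_left)
    \<comment> \<open>The error splits into a second application of the resolvent identity, which is
      quadratic by \<open>lip\<close>, and the Taylor remainder of A.\<close>
    have e1: "R z f - R w f + cscale (z - w) (R w (D ?y)) =
      - (R z ?u - R w ?u) - R w ((A z - A w - (cscale (z - w) o\<^sub>L D)) ?y)"
      unfolding R_diff[OF zS, of f] e0 blinfun.diff_right[of "R w"] clinear_op_cscale[OF cR[OF w]] by simp
    have e2: "R z ?u - R w ?u = - R z ((A z - A w) (R w ?u))"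
      by (rule R_diff[OF zS])
    have n: "norm ((A z - A w) x) \<le> ?k * norm x" for x
      by (rule order_trans[OF norm_blinfun mult_right_mono[OF lip[OF z]]]) simp
    have kn: "0 \<le> ?k" using C by (simp add: C1_def)
    have "norm ?y \<le> 2 * norm f" by (rule bnd[OF w])
    from mult_left_mono[OF this kn] n[of ?y] have "norm ?u \<le> ?k * (2 * norm f)" by linarith
    with bnd[OF w, of ?u] have "norm (R w ?u) \<le> 2 * (?k * (2 * norm f))" by linarith
    from mult_left_mono[OF this kn] n[of "R w ?u"]
    have "norm ((A z - A w) (R w ?u)) \<le> ?k * (2 * (?k * (2 * norm f)))" by linarith
    with bnd[OF zS, of "(A z - A w) (R w ?u)"]
    have "norm (R z ((A z - A w) (R w ?u))) \<le> 2 * (?k * (2 * (?k * (2 * norm f))))" by linarith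
    also have "\<dots> = 8 * C1^2 * norm f * (norm (z - w))\<^sup>2" by (simp add: power2_eq_square)
    finally have b1: "norm (R z ((A z - A w) (R w ?u))) \<le> 8 * C1^2 * norm f * (norm (z - w))\<^sup>2" .
    have "norm ((A z - A w - (cscale (z - w) o\<^sub>L D)) ?y) \<le> C * (norm (z - w))\<^sup>2 * (2 * norm f)"
      by (rule order_trans[OF norm_blinfun mult_mono[OF D bnd[OF w]]]) (use z s(3) C in auto)
    with bnd[OF w, of "(A z - A w - (cscale (z - w) o\<^sub>L D)) ?y"]
    have "norm (R w ((A z - A w - (cscale (z - w) o\<^sub>L D)) ?y)) \<le> 2 * (C * (norm (z - w))\<^sup>2 * (2 * norm f))"
      by linarith
    hence b2: "norm (R w ((A z - A w - (cscale (z - w) o\<^sub>L D)) ?y)) \<le> 4 * C * norm f * (norm (z - w))\<^sup>2"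
      by (simp only: mult_ac)
    have "norm (R z f - R w f + cscale (z - w) (R w (D ?y))) \<le>
        8 * C1^2 * norm f * (norm (z - w))\<^sup>2 + 4 * C * norm f * (norm (z - w))\<^sup>2"
    proof -
      let ?Y = "R w ((A z - A w - (cscale (z - w) o\<^sub>L D)) ?y)"
      have "norm (- (R z ?u - R w ?u) - ?Y) \<le> norm (- (R z ?u - R w ?u)) + norm ?Y"
        by (rule norm_triangle_ineq4)
      also have "norm (- (R z ?u - R w ?u)) = norm (R z ((A z - A w) (R w ?u)))"
        by (simp only: e2 norm_minus_cancel)
      finally show ?thesis unfolding e1 using b1 b2 by linarith
    qed
    also have "\<dots> = (8 * C1^2 + 4 * C) * norm f * (norm (z - w))\<^sup>2" by (simp only: distrib_right)
    finally have b3: "norm (R z f - R w f + cscale (z - w) (R w (D ?y))) \<le>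
        (8 * C1^2 + 4 * C) * norm f * (norm (z - w))\<^sup>2" .
    have "\<phi> (R z f) - \<phi> (R w f) - d * (z - w) = \<phi> (R z f - R w f + cscale (z - w) (R w (D ?y)))"
      unfolding blinfun.add_right blinfun.diff_right cfunctional_cscale[OF \<open>cfunctional \<phi>\<close>] d_def
      by simp
    also have "norm \<dots> \<le> norm \<phi> * ((8 * C1^2 + 4 * C) * norm f * (norm (z - w))\<^sup>2)"
      by (rule order_trans[OF norm_blinfun mult_left_mono[OF b3 norm_ge_zero]])
    finally show ?thesis by (simp only: mult.assoc)
  qed
  hence "((\<lambda>z. \<phi> (R z f)) has_field_derivative d) (at w)"
    by (rule has_field_derivative_quadratic[OF s(1)])
  thus "\<exists>f'. ((\<lambda>z. \<phi> (R z f)) has_field_derivative f') (at w)" ..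
qed

end

context complex_structure
begin

text \<open>The Sherman-Morrison-Woodbury formula, with R the inverse of I + A, for the finite rank
  perturbation with coefficients \<beta> j / \<zeta>. Multiplying the usual matrix by \<zeta> gives
  an \<open>M\<close> that has no pole at \<zeta> = 0.\<close>

definition finite_rank_inverse ::
  "('a \<Rightarrow>\<^sub>L 'a) \<Rightarrow> nat \<Rightarrow> (nat \<Rightarrow> complex) \<Rightarrow> (nat \<Rightarrow> nat \<Rightarrow> complex) \<Rightarrow>
   (nat \<Rightarrow> 'a) \<Rightarrow> (nat \<Rightarrow> 'a \<Rightarrow>\<^sub>L complex) \<Rightarrow> 'a \<Rightarrow>\<^sub>L 'a" where
  "finite_rank_inverse R k \<beta> M v \<phi> =
     R - (\<Sum>j<k. \<Sum>i<k. cscale (\<beta> j * cadj k M j i / cdet k M) o\<^sub>L (rank1 (R (v j)) (\<phi> i) o\<^sub>L R))"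

lemma finite_rank_inverse_apply:
  "finite_rank_inverse R k \<beta> M v \<phi> y =
     R y - (\<Sum>j<k. cscale (\<beta> j * (\<Sum>i<k. cadj k M j i / cdet k M * \<phi> i (R y))) (R (v j)))"
  by (simp add: finite_rank_inverse_def blinfun.diff_left blinfun.sum_left rank1_apply cscale_mult[symmetric]
      cscale_sum[symmetric] sum_distrib_left mult.assoc)

context
  fixes A R :: "'a \<Rightarrow>\<^sub>L 'a" and k :: nat and \<beta> :: "nat \<Rightarrow> complex" and \<zeta> :: complex
    and v :: "nat \<Rightarrow> 'a" and \<phi> :: "nat \<Rightarrow> 'a \<Rightarrow>\<^sub>L complex" and M L
  assumes A: "clinear_op A" and R: "is_inverse (id_blinfun + A) R" and \<zeta>: "\<zeta> \<noteq> 0"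
    and \<phi>: "\<And>j. j < k \<Longrightarrow> cfunctional (\<phi> j)"
    and M_def: "M = (\<lambda>i j. (if i = j then \<zeta> else 0) + \<beta> j * \<phi> i (R (v j)))"
    and L_def: "L = id_blinfun + A + (\<Sum>j<k. cscale (\<beta> j / \<zeta>) o\<^sub>L rank1 (v j) (\<phi> j))"
begin

lemma L_apply: "L x = (id_blinfun + A) x + (\<Sum>j<k. cscale (\<beta> j / \<zeta> * \<phi> j x) (v j))"
  by (simp add: L_def blinfun.add_left blinfun.sum_left rank1_apply cscale_mult[symmetric])

lemma M_sum:
  assumes "i < k"
  shows "(\<Sum>j<k. M i j * c j) = \<zeta> * c i + (\<Sum>j<k. \<beta> j * \<phi> i (R (v j)) * c j)"
proof -
  have "(\<Sum>j<k. M i j * c j) = (\<Sum>j<k. (if j = i then \<zeta> * c j else 0)) + (\<Sum>j<k. \<beta> j * \<phi> i (R (v j)) * c j)"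
    unfolding sum.distrib[symmetric] by (intro sum.cong) (auto simp: M_def algebra_simps)
  also have "(\<Sum>j<k. (if j = i then \<zeta> * c j else 0)) = \<zeta> * c i" using assms by simp
  finally show ?thesis .
qed

lemma clinear_R: "clinear_op R"
  using clinear_op_inverse[OF clinear_op_id_plus[OF A] R] .

text \<open>A solution of L x = y is R y minus a combination of the R (v j). Applying the
  functionals \<phi> i turns the equation into a linear system with matrix \<open>M\<close>, which
  the adjugate solves; the left adjugate identity gives the other composition.\<close>

lemma finite_rank_inverse:
  assumes D: "cdet k M \<noteq> 0"
  shows "is_inverse L (finite_rank_inverse R k \<beta> M v \<phi>)"
  unfolding is_inverse_iff
proof (intro conjI allI)
  note Ri = is_inverse_apply[OF R]
  fix y
  \<comment> \<open>The solution of M c = (\<phi> i (R y)); it turns out that \<phi> j of the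
    candidate is \<zeta> * c j.\<close>
  define c where "c j = (\<Sum>i<k. cadj k M j i / cdet k M * \<phi> i (R y))" for j
  have B: "finite_rank_inverse R k \<beta> M v \<phi> y = R y - (\<Sum>j<k. cscale (\<beta> j * c j) (R (v j)))"
    by (simp add: finite_rank_inverse_apply c_def)
  have Mc: "(\<Sum>j<k. M i j * c j) = \<phi> i (R y)" if "i < k" for i
  proof -
    have "(\<Sum>j<k. M i j * c j) = (\<Sum>l<k. (\<Sum>j<k. M i j * cadj k M j l) / cdet k M * \<phi> l (R y))"
      unfolding c_def sum_distrib_left sum_distrib_right sum_divide_distrib
      by (subst sum.swap) (simp add: mult_ac)
    also have "\<dots> = (\<Sum>l<k. if l = i then \<phi> l (R y) else 0)"
      using that D by (intro sum.cong) (auto simp: cadj_right)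
    finally show ?thesis using that by simp
  qed
  have "\<phi> j (finite_rank_inverse R k \<beta> M v \<phi> y) = \<zeta> * c j" if "j < k" for j
  proof -
    have "\<phi> j (finite_rank_inverse R k \<beta> M v \<phi> y) = \<phi> j (R y) - (\<Sum>l<k. \<beta> l * \<phi> j (R (v l)) * c l)"
      unfolding B blinfun.diff_right blinfun.sum_right cfunctional_cscale[OF \<phi>[OF that]]
      by (simp add: mult_ac)
    thus ?thesis using M_sum[OF that, of c] Mc[OF that] by simp
  qed
  hence "(\<Sum>j<k. cscale (\<beta> j / \<zeta> * \<phi> j (finite_rank_inverse R k \<beta> M v \<phi> y)) (v j)) =
      (\<Sum>j<k. cscale (\<beta> j * c j) (v j))"
    using \<zeta> by (intro sum.cong) auto
  moreover have "(id_blinfun + A) (finite_rank_inverse R k \<beta> M v \<phi> y) = y - (\<Sum>j<k. cscale (\<beta> j * c j) (v j))"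
    unfolding B blinfun.diff_right blinfun.sum_right clinear_op_cscale[OF clinear_op_id_plus[OF A]] Ri ..
  ultimately show "L (finite_rank_inverse R k \<beta> M v \<phi> y) = y"
    by (simp only: L_apply) simp
next
  note Ri = is_inverse_apply[OF R]
  fix x
  have RL: "R (L x) = x + (\<Sum>j<k. cscale (\<beta> j / \<zeta> * \<phi> j x) (R (v j)))"
    unfolding L_apply blinfun.add_right[of R] blinfun.sum_right Ri clinear_op_cscale[OF clinear_R] ..
  have \<phi>RL: "\<phi> i (R (L x)) = (\<Sum>l<k. M i l * \<phi> l x) / \<zeta>" if "i < k" for i
  proof -
    have "\<phi> i (R (L x)) = \<phi> i x + (\<Sum>l<k. \<beta> l * \<phi> i (R (v l)) * \<phi> l x) / \<zeta>"
      unfolding RL blinfun.add_right blinfun.sum_right cfunctional_cscale[OF \<phi>[OF that]] sum_divide_distrib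
      by (simp add: mult_ac)
    thus ?thesis using \<zeta> M_sum[OF that, of "\<lambda>l. \<phi> l x"] by (simp add: add_divide_distrib)
  qed
  have "(\<Sum>i<k. cadj k M j i / cdet k M * \<phi> i (R (L x))) = \<phi> j x / \<zeta>" if "j < k" for j
  proof -
    have "(\<Sum>i<k. cadj k M j i / cdet k M * \<phi> i (R (L x))) =
        (\<Sum>i<k. \<Sum>l<k. cadj k M j i * M i l / cdet k M * \<phi> l x / \<zeta>)"
      by (intro sum.cong) (auto simp: \<phi>RL sum_distrib_left sum_divide_distrib mult_ac)
    also have "\<dots> = (\<Sum>l<k. (\<Sum>i<k. cadj k M j i * M i l) / cdet k M * \<phi> l x / \<zeta>)"
      by (subst sum.swap) (simp add: sum_distrib_right sum_divide_distrib)
    also have "\<dots> = (\<Sum>l<k. if l = j then \<phi> l x / \<zeta> else 0)"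
      using that D by (intro sum.cong) (auto simp: cadj_left)
    finally show ?thesis using that by simp
  qed
  hence "(\<Sum>j<k. cscale (\<beta> j * (\<Sum>i<k. cadj k M j i / cdet k M * \<phi> i (R (L x)))) (R (v j))) =
      (\<Sum>j<k. cscale (\<beta> j / \<zeta> * \<phi> j x) (R (v j)))" by (intro sum.cong) auto
  thus "finite_rank_inverse R k \<beta> M v \<phi> (L x) = x"
    unfolding finite_rank_inverse_apply by (simp add: RL)
qed

text \<open>A kernel vector c of \<open>M\<close> yields a vector x in the kernel of L. It is
  nonzero because the functionals recover c from it: \<phi> i x = c i.\<close>

lemma no_inverse_if_cdet_0:
  assumes "cdet k M = 0"
  shows "\<not> is_inverse L B"
proof
  assume inv: "is_inverse L B"
  note Ri = is_inverse_apply[OF R]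
  from cdet_0_kernel[OF assms] obtain c l where l: "l < k" "c l \<noteq> 0"
    and Mc: "\<And>i. i < k \<Longrightarrow> (\<Sum>j<k. M i j * c j) = 0" by metis
  define x where "x = - (\<Sum>j<k. cscale (\<beta> j / \<zeta> * c j) (R (v j)))"
  have \<phi>x: "\<phi> i x = c i" if "i < k" for i
  proof -
    have "\<phi> i x = - (\<Sum>j<k. \<beta> j * \<phi> i (R (v j)) * c j) / \<zeta>"
      unfolding x_def blinfun.minus_right blinfun.sum_right cfunctional_cscale[OF \<phi>[OF that]] sum_divide_distrib
        minus_divide_left
      by (simp add: mult_ac sum_negf sum_divide_distrib)
    moreover have "(\<Sum>j<k. \<beta> j * \<phi> i (R (v j)) * c j) = - \<zeta> * c i"
      using M_sum[OF that, of c] Mc[OF that] by (simp add: eq_neg_iff_add_eq_0 add.commute)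
    ultimately show ?thesis using \<zeta> by simp
  qed
  have "(\<Sum>j<k. cscale (\<beta> j / \<zeta> * \<phi> j x) (v j)) = (\<Sum>j<k. cscale (\<beta> j / \<zeta> * c j) (v j))"
    by (intro sum.cong) (auto simp: \<phi>x)
  moreover have "(id_blinfun + A) x = - (\<Sum>j<k. cscale (\<beta> j / \<zeta> * c j) (v j))"
    unfolding x_def blinfun.minus_right blinfun.sum_right clinear_op_cscale[OF clinear_op_id_plus[OF A]] Ri ..
  ultimately have "L x = 0" by (simp only: L_apply) simp
  hence "x = 0" using is_inverse_apply(1)[OF inv, of x] by simp
  with \<phi>x[OF l(1)] l(2) show False by simp
qed

end

text \<open>The complex inner product with x / |x|. The bound 2 in place of 1 comes from estimating
  real and imaginary part separately.\<close>

lemma norming_functional: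
  obtains \<psi> :: "'a \<Rightarrow>\<^sub>L complex" where "cfunctional \<psi>" "norm \<psi> \<le> 2" "norm x \<le> norm (\<psi> x)"
proof (cases "x = 0")
  case True
  thus ?thesis by (intro that[of 0]) (auto simp: cfunctional_def)
next
  case False
  define f where "f y = Complex (inner y x / norm x) (inner y (J x) / norm x)" for y
  have bound: "norm (f y) \<le> norm y * 2" for y
  proof -
    have "norm (f y) \<le> \<bar>inner y x / norm x\<bar> + \<bar>inner y (J x) / norm x\<bar>"
      using cmod_le[of "f y"] by (simp add: f_def)
    also have "\<dots> \<le> norm y + norm y"
      using False Cauchy_Schwarz_ineq2[of y x] Cauchy_Schwarz_ineq2[of y "J x"]
      by (intro add_mono) (auto simp: norm_J divide_le_eq)
    finally show ?thesis by simp
  qed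
  have "bounded_linear f"
    by (rule bounded_linear_intro[OF _ _ bound])
       (auto simp: f_def inner_add_left add_divide_distrib complex_eq_iff)
  hence app: "blinfun_apply (Blinfun f) = f" by (rule bounded_linear_Blinfun_apply)
  show ?thesis
  proof (rule that[of "Blinfun f"])
    have "inner (J y) x = - inner y (J x)" for y
      using inner_J_J[of y "J x"] by (simp add: J_J)
    thus "cfunctional (Blinfun f)"
      by (simp add: cfunctional_def app f_def complex_eq_iff inner_J_J)
    show "norm (Blinfun f) \<le> 2"
      by (rule norm_blinfun_bound) (use bound in \<open>auto simp: app mult.commute\<close>)
    show "norm x \<le> norm (Blinfun f x)"
      using False complex_Re_le_cmod[of "f x"] by (simp add: app f_def flip: power2_norm_eq_inner add: power2_eq_square)
  qed
qed

end

section \<open>The behaviour of the inverse near a point\<close>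

text \<open>As D does not vanish identically, it has a zero of finite order m at z0; m = 0 covers
  the case that D z0 is nonzero.\<close>

lemma holomorphic_nonzero_factor:
  fixes D :: "complex \<Rightarrow> complex"
  assumes hol: "D holomorphic_on ball z0 \<rho>" and "\<rho> > 0" and nz: "z1 \<in> ball z0 \<rho>" "D z1 \<noteq> 0"
  obtains g r m where "0 < r" "ball z0 r \<subseteq> ball z0 \<rho>" "g holomorphic_on ball z0 r"
    "\<And>z. z \<in> ball z0 r \<Longrightarrow> D z = (z - z0) ^ m * g z" "\<And>z. z \<in> ball z0 r \<Longrightarrow> g z \<noteq> 0"
proof (cases "D z0 = 0")
  case True
  have "\<not> D constant_on ball z0 \<rho>"
    using nz True \<open>\<rho> > 0\<close> unfolding constant_on_def by (metis centre_in_ball)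
  from holomorphic_factor_zero_nonconstant[OF hol _ _ _ True this] \<open>\<rho> > 0\<close> that show ?thesis
    by (metis centre_in_ball connected_ball open_ball)
next
  case False
  have "open (ball z0 \<rho> \<inter> D -` (- {0}))"
    by (rule continuous_open_preimage[OF holomorphic_on_imp_continuous_on[OF hol]]) auto
  moreover have "z0 \<in> ball z0 \<rho> \<inter> D -` (- {0})" using False \<open>\<rho> > 0\<close> by simp
  ultimately obtain r where r: "0 < r" "ball z0 r \<subseteq> ball z0 \<rho> \<inter> D -` (- {0})"
    using open_contains_ball by blast
  show ?thesis
  proof (rule that[of r D 0])
    show "D holomorphic_on ball z0 r" by (rule holomorphic_on_subset[OF hol]) (use r in auto)
  qed (use r in auto)
qed

lemma holomorphic_divide_linear:
  assumes "h holomorphic_on ball z0 r" "r > 0" "h z0 = 0"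
  obtains h' where "h' holomorphic_on ball z0 r" "\<And>z. z \<in> ball z0 r \<Longrightarrow> h z = (z - z0) * h' z"
proof (rule that)
  show "(\<lambda>z. if z = z0 then deriv h z0 else (h z - h z0) / (z - z0)) holomorphic_on ball z0 r"
    by (rule pole_lemma) (use assms in auto)
qed (use assms in auto)

context complex_structure
begin

lemma norm_finite_rank_inverse_le:
  assumes R: "norm R \<le> 2" and C: "\<And>i j. i < k \<Longrightarrow> j < k \<Longrightarrow> norm (\<beta> j * cadj k M j i / cdet k M) \<le> C i j"
  shows "norm (finite_rank_inverse R k \<beta> M v \<phi>) \<le>
    2 + (\<Sum>j<k. \<Sum>i<k. C i j * (norm (v j) * 4 * norm (\<phi> i)))"
proof -
  have rank: "norm (cscale c o\<^sub>L (rank1 (R w) \<psi> o\<^sub>L R)) \<le> norm c * (norm w * 4 * norm \<psi>)" for c w \<psi>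
  proof (rule norm_blinfun_bound)
    fix x
    have R2: "norm (R y) \<le> 2 * norm y" for y
      using order_trans[OF norm_blinfun mult_right_mono[OF R]] by auto
    have "norm (\<psi> (R x)) \<le> norm \<psi> * (2 * norm x)"
      by (rule order_trans[OF norm_blinfun mult_left_mono[OF R2]]) simp
    hence "norm (\<psi> (R x)) * norm (R w) \<le> (norm \<psi> * (2 * norm x)) * (2 * norm w)"
      by (intro mult_mono R2) auto
    hence "norm c * (norm (\<psi> (R x)) * norm (R w)) \<le> norm c * ((norm \<psi> * (2 * norm x)) * (2 * norm w))"
      by (rule mult_left_mono) simp
    thus "norm ((cscale c o\<^sub>L (rank1 (R w) \<psi> o\<^sub>L R)) x) \<le> norm c * (norm w * 4 * norm \<psi>) * norm x"
      by (simp add: norm_cscale rank1_apply mult_ac)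
  qed simp
  have "norm (\<Sum>j<k. \<Sum>i<k. cscale (\<beta> j * cadj k M j i / cdet k M) o\<^sub>L (rank1 (R (v j)) (\<phi> i) o\<^sub>L R)) \<le>
      (\<Sum>j<k. \<Sum>i<k. C i j * (norm (v j) * 4 * norm (\<phi> i)))"
    by (intro order_trans[OF norm_sum sum_mono] order_trans[OF rank] mult_right_mono C) auto
  hence "norm R + norm (\<Sum>j<k. \<Sum>i<k. cscale (\<beta> j * cadj k M j i / cdet k M) o\<^sub>L (rank1 (R (v j)) (\<phi> i) o\<^sub>L R)) \<le>
      2 + (\<Sum>j<k. \<Sum>i<k. C i j * (norm (v j) * 4 * norm (\<phi> i)))" using R by (rule add_mono[rotated])
  thus ?thesis unfolding finite_rank_inverse_def by (rule order_trans[OF norm_triangle_ineq4])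
qed

text \<open>The determinant D of the matrix in the finite rank formula is holomorphic. If it
  vanishes identically, no inverse exists nearby. Otherwise D has a zero of order m at most at the
  centre, and (z - z0)^m removes the singularity of every \<psi>(B z f). Let n be the least exponent
  that does this for all f and \<psi>. For n = 0 the maximum principle bounds B by its values on a
  circle; for n > 0 some matrix element of B has a genuine pole, which bounds the norm of B from
  below.\<close>

theorem local_trichotomy:
  fixes k :: nat
  assumes "\<rho> > 0"
    and A: "\<And>z. z \<in> ball z0 \<rho> \<Longrightarrow> op_differentiable A z" "\<And>z. z \<in> ball z0 \<rho> \<Longrightarrow> clinear_op (A z)"
      "\<And>z. z \<in> ball z0 \<rho> \<Longrightarrow> norm (A z) \<le> 1/2"
    and b: "\<And>j. j < k \<Longrightarrow> b j holomorphic_on ball z0 \<rho>"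
    and \<phi>: "\<And>j. j < k \<Longrightarrow> cfunctional (\<phi> j)"
    and K: "\<And>z. z \<in> ball z0 \<rho> - {z0} \<Longrightarrow>
       K z = A z + (\<Sum>j<k. cscale (b j z / (z - z0)) o\<^sub>L rank1 (v j) (\<phi> j))"
  shows "(\<forall>\<^sub>F z in at z0. \<nexists>B. is_inverse (id_blinfun + K z) B) \<or>
    (\<exists>C. \<forall>\<^sub>F z in at z0. \<exists>B. is_inverse (id_blinfun + K z) B \<and> norm B \<le> C) \<or>
    (\<exists>c>0. \<forall>\<^sub>F z in at z0. \<exists>B. is_inverse (id_blinfun + K z) B \<and> norm B \<ge> c / norm (z - z0))"
proof -
  have "\<forall>z. \<exists>R. z \<in> ball z0 \<rho> \<longrightarrow> is_inverse (id_blinfun + A z) R \<and> norm R \<le> 2"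
    using inverse_id_plus_small A(3) by metis
  then obtain R where R: "\<And>z. z \<in> ball z0 \<rho> \<Longrightarrow> is_inverse (id_blinfun + A z) (R z)"
    "\<And>z. z \<in> ball z0 \<rho> \<Longrightarrow> norm (R z) \<le> 2" by metis
  have hR: "(\<lambda>z. \<psi> (R z f)) holomorphic_on ball z0 \<rho>" if "cfunctional \<psi>" for \<psi> f
    by (rule holomorphic_inverse_family[OF A(1,2) R(1,2) open_ball that])
  \<comment> \<open>The matrix of the finite rank formula with \<zeta> = z - z0; it is holomorphic
    at z0 as well.\<close>
  define M where "M z = (\<lambda>i j. (if i = j then z - z0 else 0) + b j z * \<phi> i (R z (v j)))" for z
  have hM: "(\<lambda>z. M z i j) holomorphic_on ball z0 \<rho>" if "i < k" "j < k" for i j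
    unfolding M_def using that by (cases "i = j") (auto intro!: holomorphic_intros hR \<phi> b)
  define D where "D z = cdet k (M z)" for z
  have hD: "D holomorphic_on ball z0 \<rho>" unfolding D_def by (rule holomorphic_cdet) (rule hM)
  define B where "B z = finite_rank_inverse (R z) k (\<lambda>j. b j z) (M z) v \<phi>" for z
  have inv: "is_inverse (id_blinfun + K z) (B z)" if z: "z \<in> ball z0 \<rho>" "z \<noteq> z0" "D z \<noteq> 0" for z
    unfolding B_def
    by (rule finite_rank_inverse[OF A(2)[OF z(1)] R(1)[OF z(1)] _ \<phi> M_def])
       (use z in \<open>auto simp: K add.assoc D_def\<close>)
  have noinv: "\<nexists>B. is_inverse (id_blinfun + K z) B" if z: "z \<in> ball z0 \<rho>" "z \<noteq> z0" "D z = 0" for z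
  proof -
    have "\<not> is_inverse (id_blinfun + K z) B" for B
      by (rule no_inverse_if_cdet_0[OF A(2)[OF z(1)] R(1)[OF z(1)] _ \<phi> M_def])
         (use z in \<open>auto simp: K add.assoc D_def\<close>)
    thus ?thesis by blast
  qed
  show ?thesis
  proof (cases "\<forall>z\<in>ball z0 \<rho>. D z = 0")
    case True
    have "\<forall>\<^sub>F z in at z0. z \<in> ball z0 \<rho> - {z0}"
      using \<open>\<rho> > 0\<close> by (intro eventually_at_in_open) auto
    hence "\<forall>\<^sub>F z in at z0. \<nexists>B. is_inverse (id_blinfun + K z) B"
      by (rule eventually_mono) (use True noinv in auto)
    thus ?thesis by blast
  next
    case False
    then obtain z1 where "z1 \<in> ball z0 \<rho>" "D z1 \<noteq> 0" by blast
    from holomorphic_nonzero_factor[OF hD \<open>\<rho> > 0\<close> this] obtain g r m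
      where r: "0 < r" "ball z0 r \<subseteq> ball z0 \<rho>" and g: "g holomorphic_on ball z0 r"
        "\<And>z. z \<in> ball z0 r \<Longrightarrow> D z = (z - z0) ^ m * g z" "\<And>z. z \<in> ball z0 r \<Longrightarrow> g z \<noteq> 0" by metis
    have D0: "D z \<noteq> 0" if "z \<in> ball z0 r - {z0}" for z using g(2,3)[of z] that by simp
    have inv': "is_inverse (id_blinfun + K z) (B z)" if "z \<in> ball z0 r - {z0}" for z
      using that r D0[OF that] by (intro inv) auto
    \<comment> \<open>\<open>P n\<close>: the factor (z - z0)^n removes the singularity at z0 of all
      matrix elements of B.\<close>
    define P where "P n \<longleftrightarrow> (\<forall>f \<psi>. cfunctional \<psi> \<longrightarrow> (\<exists>h. h holomorphic_on ball z0 r \<and>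
      (\<forall>z\<in>ball z0 r - {z0}. h z = (z - z0) ^ n * \<psi> (B z f))))" for n
    have "P m" unfolding P_def
    proof (intro allI impI)
      fix f \<psi> assume \<psi>: "cfunctional \<psi>"
      \<comment> \<open>The matrix element \<psi>(B z f) times D, in which all denominators have
        cancelled.\<close>
      define H where "H z = D z * \<psi> (R z f) -
        (\<Sum>j<k. b j z * (\<Sum>i<k. cadj k (M z) j i * \<phi> i (R z f)) * \<psi> (R z (v j)))" for z
      have "H holomorphic_on ball z0 \<rho>" unfolding H_def
        by (intro holomorphic_intros hR hD b \<phi> \<psi> holomorphic_cadj hM) auto
      hence "(\<lambda>z. H z / g z) holomorphic_on ball z0 r"
        by (intro holomorphic_on_divide g(1)) (use r g(3) in \<open>auto elim: holomorphic_on_subset\<close>)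
      moreover have "H z / g z = (z - z0) ^ m * \<psi> (B z f)" if z: "z \<in> ball z0 r - {z0}" for z
      proof -
        have "\<psi> (B z f) = \<psi> (R z f) - (\<Sum>j<k. b j z * (\<Sum>i<k. cadj k (M z) j i / D z * \<phi> i (R z f)) * \<psi> (R z (v j)))"
          unfolding B_def finite_rank_inverse_apply D_def blinfun.diff_right blinfun.sum_right
            cfunctional_cscale[OF \<psi>] ..
        also have "\<dots> = H z / D z"
          using D0[OF z] unfolding H_def diff_divide_distrib sum_divide_distrib
          by (simp add: sum_divide_distrib[symmetric] mult_ac)
        finally show ?thesis using g(2,3)[of z] z by simp
      qed
      ultimately show "\<exists>h. h holomorphic_on ball z0 r \<and>
        (\<forall>z\<in>ball z0 r - {z0}. h z = (z - z0) ^ m * \<psi> (B z f))" by blast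
    qed
    define n where "n = (LEAST n. P n)"
    have Pn: "P n" unfolding n_def by (rule LeastI) fact
    show ?thesis
    proof (cases n)
      case 0
      \<comment> \<open>D has no zeros on the circle, so the finite rank formula bounds the operator
        norm of B there, uniformly in f and \<psi>.\<close>
      have "\<exists>C. \<forall>z\<in>sphere z0 (r/2). norm (b j z * cadj k (M z) j i / D z) \<le> C" if "i < k" "j < k" for i j
      proof -
        have sub: "sphere z0 (r/2) \<subseteq> ball z0 r - {z0}" "ball z0 r - {z0} \<subseteq> ball z0 \<rho>" using r by auto
        have "(\<lambda>z. b j z * cadj k (M z) j i / D z) holomorphic_on (ball z0 r - {z0})"
          using that sub(2) D0
          by (intro holomorphic_on_divide holomorphic_on_mult holomorphic_on_subset[OF b]
              holomorphic_on_subset[OF holomorphic_cadj[OF hM]] holomorphic_on_subset[OF hD]) auto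
        hence "continuous_on (sphere z0 (r/2)) (\<lambda>z. b j z * cadj k (M z) j i / D z)"
          by (intro continuous_on_subset[OF _ sub(1)] holomorphic_on_imp_continuous_on)
        hence "bounded ((\<lambda>z. b j z * cadj k (M z) j i / D z) ` sphere z0 (r/2))"
          by (intro compact_imp_bounded compact_continuous_image) auto
        thus ?thesis unfolding bounded_iff by blast
      qed
      then obtain C where C: "\<And>i j z. i < k \<Longrightarrow> j < k \<Longrightarrow> z \<in> sphere z0 (r/2) \<Longrightarrow>
          norm (b j z * cadj k (M z) j i / D z) \<le> C i j" by metis
      define C' where "C' = 2 + (\<Sum>j<k. \<Sum>i<k. C i j * (norm (v j) * 4 * norm (\<phi> i)))"
      have sphere: "norm (B z) \<le> C'" if "z \<in> sphere z0 (r/2)" for z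
      proof -
        have "z \<in> ball z0 \<rho>" using that r(1) by (intro subsetD[OF r(2)]) auto
        from R(2)[OF this] show ?thesis unfolding B_def C'_def
          by (rule norm_finite_rank_inverse_le) (use C that in \<open>auto simp: D_def[symmetric]\<close>)
      qed
      have bound: "norm (B z f) \<le> 2 * C' * norm f" if z: "z \<in> ball z0 (r/2) - {z0}" for z f
      proof -
        obtain \<psi> where \<psi>: "cfunctional \<psi>" "norm \<psi> \<le> 2" "norm (B z f) \<le> norm (\<psi> (B z f))"
          by (rule norming_functional)
        from Pn \<psi>(1) obtain h where h: "h holomorphic_on ball z0 r"
          "\<And>w. w \<in> ball z0 r - {z0} \<Longrightarrow> h w = \<psi> (B w f)" unfolding P_def 0 by fastforce
        \<comment> \<open>The maximum principle for the extension h of \<psi>(B z f); as \<psi>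
          norms B z f up to the factor 2, a bound for B z f itself follows.\<close>
        have "norm (h z) \<le> 2 * (C' * norm f)"
        proof (rule maximum_modulus_frontier[of h "ball z0 (r/2)"])
          show "h holomorphic_on interior (ball z0 (r/2))"
            by (rule holomorphic_on_subset[OF h(1)]) (use r in auto)
          show "continuous_on (closure (ball z0 (r/2))) h"
            by (rule continuous_on_subset[OF holomorphic_on_imp_continuous_on[OF h(1)]]) (use r in auto)
          fix w assume "w \<in> frontier (ball z0 (r/2))"
          hence w: "w \<in> sphere z0 (r/2)" using r by (simp add: frontier_ball)
          hence "h w = \<psi> (B w f)" using r by (intro h(2)) auto
          moreover have "norm (\<psi> (B w f)) \<le> 2 * norm (B w f)"
            by (rule order_trans[OF norm_blinfun mult_right_mono[OF \<psi>(2)]]) simp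
          moreover have "norm (B w f) \<le> C' * norm f"
            by (rule order_trans[OF norm_blinfun mult_right_mono[OF sphere[OF w]]]) simp
          ultimately show "norm (h w) \<le> 2 * (C' * norm f)" by simp
        qed (use z in auto)
        moreover have "h z = \<psi> (B z f)" using z r by (intro h(2)) auto
        ultimately show ?thesis using \<psi>(3) by simp
      qed
      have "0 \<le> C'"
      proof -
        have "z0 + of_real (r/2) \<in> sphere z0 (r/2)" using r(1) by (simp add: dist_norm)
        from order_trans[OF norm_ge_zero sphere[OF this]] show ?thesis .
      qed
      have "\<forall>\<^sub>F z in at z0. z \<in> ball z0 (r/2) - {z0}"
        using r(1) by (intro eventually_at_in_open) auto
      hence "\<forall>\<^sub>F z in at z0. \<exists>B. is_inverse (id_blinfun + K z) B \<and> norm B \<le> 2 * C'"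
      proof (rule eventually_mono)
        fix z assume z: "z \<in> ball z0 (r/2) - {z0}"
        have "norm (B z) \<le> 2 * C'"
          by (rule norm_blinfun_bound) (use bound[OF z] \<open>0 \<le> C'\<close> in auto)
        moreover have "is_inverse (id_blinfun + K z) (B z)" using z r by (intro inv') auto
        ultimately show "\<exists>B. is_inverse (id_blinfun + K z) B \<and> norm B \<le> 2 * C'" by blast
      qed
      thus ?thesis by blast
    next
      case (Suc l)
      \<comment> \<open>Minimality of n supplies f and \<psi> for which the exponent l does not
        suffice; the extension with exponent l + 1 is then nonzero at z0, as otherwise a factor z -
        z0 could be split off.\<close>
      have "\<not> P l" using not_less_Least[of l P] Suc by (simp add: n_def)
      then obtain f \<psi> where \<psi>: "cfunctional \<psi>" and no: "\<nexists>h. h holomorphic_on ball z0 r \<and>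
          (\<forall>z\<in>ball z0 r - {z0}. h z = (z - z0) ^ l * \<psi> (B z f))" unfolding P_def by blast
      from Pn \<psi> obtain h where h: "h holomorphic_on ball z0 r"
        "\<And>z. z \<in> ball z0 r - {z0} \<Longrightarrow> h z = (z - z0) ^ Suc l * \<psi> (B z f)" unfolding P_def Suc by blast
      have "h z0 \<noteq> 0"
      proof
        assume "h z0 = 0"
        from holomorphic_divide_linear[OF h(1) r(1) this] obtain h' where h': "h' holomorphic_on ball z0 r"
          "\<And>z. z \<in> ball z0 r \<Longrightarrow> h z = (z - z0) * h' z" by metis
        have "h' z = (z - z0) ^ l * \<psi> (B z f)" if "z \<in> ball z0 r - {z0}" for z
          using h(2)[OF that] h'(2)[of z] that by (simp add: mult.assoc)
        with no h'(1) show False by blast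
      qed
      define e where "e = norm (h z0) / 2"
      \<comment> \<open>The summand 1 keeps the denominator positive without a case distinction on f
        and \<psi>.\<close>
      define c where "c = e / (norm \<psi> * norm f + 1)"
      have "e > 0" using \<open>h z0 \<noteq> 0\<close> by (simp add: e_def)
      have "(h \<longlongrightarrow> h z0) (at z0)"
        using holomorphic_on_imp_continuous_on[OF h(1)] r(1) by (simp add: continuous_on_eq_continuous_at isContD)
      hence "((\<lambda>z. norm (h z)) \<longlongrightarrow> norm (h z0)) (at z0)" by (rule tendsto_norm)
      hence "\<forall>\<^sub>F z in at z0. e < norm (h z)"
        by (rule order_tendstoD) (use \<open>h z0 \<noteq> 0\<close> in \<open>simp add: e_def\<close>)
      moreover have "\<forall>\<^sub>F z in at z0. z \<in> ball z0 (min r 1) - {z0}"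
        using r(1) by (intro eventually_at_in_open) auto
      ultimately have "\<forall>\<^sub>F z in at z0. \<exists>B. is_inverse (id_blinfun + K z) B \<and> norm B \<ge> c / norm (z - z0)"
      proof eventually_elim
        case (elim z)
        hence z: "z \<in> ball z0 r - {z0}" "norm (z - z0) \<le> 1" "z \<noteq> z0"
          by (auto simp: dist_norm norm_minus_commute)
        have p: "norm (z - z0) > 0" using z by simp
        have "norm (\<psi> (B z f)) \<le> norm \<psi> * (norm (B z) * norm f)"
          by (rule order_trans[OF norm_blinfun mult_left_mono[OF norm_blinfun]]) simp
        also have "\<dots> \<le> (norm \<psi> * norm f + 1) * norm (B z)" by (simp add: algebra_simps)
        finally have "norm (\<psi> (B z f)) \<le> (norm \<psi> * norm f + 1) * norm (B z)" .
        hence "norm (z - z0) ^ Suc l * norm (\<psi> (B z f)) \<le> norm (z - z0) * ((norm \<psi> * norm f + 1) * norm (B z))"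
          using z(2) by (intro mult_mono) (auto simp: power_le_one mult_left_le)
        with elim(1) h(2)[OF z(1)] have "e < norm (z - z0) * ((norm \<psi> * norm f + 1) * norm (B z))"
          by (simp add: norm_mult norm_power)
        moreover have "(norm \<psi> * norm f + 1) * norm (z - z0) > 0"
          using p by (intro mult_pos_pos) (simp_all add: add_nonneg_pos)
        ultimately have "c / norm (z - z0) \<le> norm (B z)"
          unfolding c_def divide_divide_eq_left by (subst pos_divide_le_eq) (simp_all only: mult_ac)
        with inv'[OF z(1)] show ?case by blast
      qed
      moreover have "c > 0" using \<open>e > 0\<close> by (simp add: c_def add_nonneg_pos)
      ultimately show ?thesis by blast
    qed
  qed
qed

end

section \<open>The space \<open>L\<^sup>2\<close> and integral operators\<close>

lemma rep_L2: "square_integrable (rep_L2 f)"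
  using Quotient_rep_reflp[OF Quotient_L2, of f] by (simp add: L2_eq_def)

lemma abs_rep_L2: "abs_L2 (rep_L2 f) = f"
  by (rule Quotient_abs_rep[OF Quotient_L2])

lemma L2_eq_refl: "L2_eq f f \<longleftrightarrow> square_integrable f"
  by (auto simp: L2_eq_def)

lemma abs_L2_eqI:
  assumes "square_integrable f" "square_integrable g" "AE x in lborel. f x = g x"
  shows "abs_L2 f = abs_L2 g"
  using assms Quotient_rel[OF Quotient_L2, of f g] by (auto simp: L2_eq_def)

lemma abs_L2_eq_iff:
  assumes "square_integrable f" "square_integrable g"
  shows "abs_L2 f = abs_L2 g \<longleftrightarrow> (AE x in lborel. f x = g x)"
  using assms Quotient_rel[OF Quotient_L2, of f g] by (auto simp: L2_eq_def)

lemma rep_abs_L2: "square_integrable f \<Longrightarrow> AE x in lborel. rep_L2 (abs_L2 f) x = f x"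
  by (subst abs_L2_eq_iff[symmetric]) (auto simp: rep_L2 abs_rep_L2)

lemma norm_abs_L2:
  assumes "square_integrable f"
  shows "(norm (abs_L2 f))\<^sup>2 = (LINT x|lborel. (norm (f x))\<^sup>2)"
  using assms by (simp add: power2_norm_eq_inner inner_L2.abs_eq L2_eq_refl)

lemma nn_integral_square:
  assumes "square_integrable f"
  shows "(\<integral>\<^sup>+x. ennreal ((norm (f x))\<^sup>2) \<partial>lborel) = ennreal ((norm (abs_L2 f))\<^sup>2)"
  using assms unfolding norm_abs_L2[OF assms] square_integrable_def
  by (intro nn_integral_eq_integral) auto

lemma square_integrable_nn_integral:
  assumes "f \<in> borel_measurable lborel" "(\<integral>\<^sup>+x. ennreal ((norm (f x))\<^sup>2) \<partial>lborel) \<le> ennreal c" "0 \<le> c"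
  shows "square_integrable f" "(norm (abs_L2 f))\<^sup>2 \<le> c"
proof -
  show f: "square_integrable f"
    unfolding square_integrable_def
  proof (intro conjI integrableI_bounded)
    have "(\<integral>\<^sup>+x. ennreal (norm ((norm (f x))\<^sup>2)) \<partial>lborel) \<le> ennreal c" using assms(2) by simp
    also have "\<dots> < \<infinity>" by simp
    finally show "(\<integral>\<^sup>+x. ennreal (norm ((norm (f x))\<^sup>2)) \<partial>lborel) < \<infinity>" .
  qed (use assms in auto)
  show "(norm (abs_L2 f))\<^sup>2 \<le> c"
    using assms(2,3) unfolding nn_integral_square[OF f] by simp
qed

lemma abs_L2_diff:
  "square_integrable f \<Longrightarrow> square_integrable g \<Longrightarrow> abs_L2 f - abs_L2 g = abs_L2 (\<lambda>x. f x - g x)"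
  by (simp add: minus_L2.abs_eq L2_eq_refl)

lemma abs_L2_add:
  "square_integrable f \<Longrightarrow> square_integrable g \<Longrightarrow> abs_L2 f + abs_L2 g = abs_L2 (\<lambda>x. f x + g x)"
  by (simp add: plus_L2.abs_eq L2_eq_refl)

lemma abs_L2_scaleR: "square_integrable f \<Longrightarrow> r *\<^sub>R abs_L2 f = abs_L2 (\<lambda>x. r *\<^sub>R f x)"
  by (simp add: scaleR_L2.abs_eq L2_eq_refl)

lemma abs_L2_0: "abs_L2 (\<lambda>_. 0) = 0"
  by (simp add: zero_L2.abs_eq)

text \<open>The terms 2^k |d k|^2 tend to 0, so |d k| is eventually below the geometric sequence
  2^(-k/2).\<close>

lemma summable_if_weighted_squares:
  fixes d :: "nat \<Rightarrow> complex"
  assumes "summable (\<lambda>k. 2 ^ k * (norm (d k))\<^sup>2)"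
  shows "summable d"
proof (rule summable_comparison_test)
  define q where "q = 1 / sqrt 2"
  have q: "0 < q" "q < 1" "q\<^sup>2 = 1/2" by (auto simp: q_def power_divide)
  have "(\<lambda>k. 2 ^ k * (norm (d k))\<^sup>2) \<longlonglongrightarrow> 0" using assms by (rule summable_LIMSEQ_zero)
  hence "\<forall>\<^sub>F k in sequentially. 2 ^ k * (norm (d k))\<^sup>2 < 1" by (rule order_tendstoD) simp
  then obtain N where N: "\<And>k. k \<ge> N \<Longrightarrow> 2 ^ k * (norm (d k))\<^sup>2 < 1"
    by (auto simp: eventually_sequentially)
  have "norm (d k) \<le> q ^ k" if "k \<ge> N" for k
  proof (rule power2_le_imp_le)
    have "(q ^ k)\<^sup>2 = 1 / 2 ^ k"
      by (metis q(3) power_mult mult.commute power_one_over)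
    hence "2 ^ k * (norm (d k))\<^sup>2 \<le> 2 ^ k * (q ^ k)\<^sup>2" using N[OF that] by simp
    thus "(norm (d k))\<^sup>2 \<le> (q ^ k)\<^sup>2" by (rule mult_left_le_imp_le) simp
  qed (use q in auto)
  thus "\<exists>N. \<forall>k\<ge>N. norm (d k) \<le> q ^ k" by blast
  show "summable (\<lambda>k. q ^ k)" using q by (simp add: summable_geometric)
qed

text \<open>The argument of Riesz and Fischer. Increments of norm 2^-k keep a finite sum of squares
  even with weights 2^k, hence the sequence converges almost everywhere; Fatou's lemma carries the
  estimates over to the limit.\<close>

lemma L2_limit_of_fast_Cauchy:
  fixes f :: "nat \<Rightarrow> real ^ 'n::finite \<Rightarrow> complex"
  assumes f: "\<And>k. square_integrable (f k)"
    and fast: "\<And>k j. k \<le> j \<Longrightarrow> norm (abs_L2 (f j) - abs_L2 (f k)) \<le> (1/2) ^ k"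
  shows "\<exists>g. square_integrable g \<and> (\<forall>k. norm (abs_L2 g - abs_L2 (f k)) \<le> (1/2) ^ k)"
proof -
  have [measurable]: "f k \<in> borel_measurable lborel" for k using f by (simp add: square_integrable_def)
  have le: "(\<integral>\<^sup>+x. ennreal ((norm (f j x - f k x))\<^sup>2) \<partial>lborel) \<le> ennreal (((1/2) ^ k)\<^sup>2)" if "k \<le> j" for j k
    using fast[OF that] f unfolding nn_integral_square[OF square_integrable_diff[OF f f]]
    by (intro ennreal_leI power_mono) (simp_all add: abs_L2_diff)
  define d where "d k x = f (Suc k) x - f k x" for k x
  have [measurable]: "d k \<in> borel_measurable lborel" for k unfolding d_def by measurable
  have "(\<integral>\<^sup>+x. (\<Sum>k. ennreal (2 ^ k * (norm (d k x))\<^sup>2)) \<partial>lborel) =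
      (\<Sum>k. \<integral>\<^sup>+x. ennreal (2 ^ k * (norm (d k x))\<^sup>2) \<partial>lborel)" by (rule nn_integral_suminf) measurable
  also have "\<dots> \<le> (\<Sum>k. ennreal ((1/2) ^ k))"
  proof (rule suminf_le)
    fix k
    have "(\<integral>\<^sup>+x. ennreal (2 ^ k * (norm (d k x))\<^sup>2) \<partial>lborel) = ennreal (2 ^ k) * (\<integral>\<^sup>+x. ennreal ((norm (d k x))\<^sup>2) \<partial>lborel)"
      by (subst nn_integral_cmult[symmetric]) (auto simp: ennreal_mult)
    also have "\<dots> \<le> ennreal (2 ^ k) * ennreal (((1/2) ^ k)\<^sup>2)"
      using le[of k "Suc k"] by (intro mult_left_mono) (simp_all add: d_def)
    also have "\<dots> = ennreal ((1/2) ^ k)"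
      by (simp add: ennreal_mult[symmetric] power2_eq_square power_mult_distrib[symmetric])
    finally show "(\<integral>\<^sup>+x. ennreal (2 ^ k * (norm (d k x))\<^sup>2) \<partial>lborel) \<le> ennreal ((1/2) ^ k)" .
  qed auto
  also have "\<dots> < \<infinity>"
    by (simp add: suminf_ennreal_eq[OF _ geometric_sums[of "1/2 :: real", simplified]] less_top)
  finally have "AE x in lborel. (\<Sum>k. ennreal (2 ^ k * (norm (d k x))\<^sup>2)) \<noteq> \<infinity>"
    by (intro nn_integral_noteq_infinite) auto
  hence conv: "AE x in lborel. convergent (\<lambda>k. f k x)"
  proof eventually_elim
    case (elim x)
    hence "summable (\<lambda>k. 2 ^ k * (norm (d k x))\<^sup>2)"
      by (intro summable_suminf_not_top) auto
    hence "summable (\<lambda>k. d k x)" by (rule summable_if_weighted_squares)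
    hence "convergent (\<lambda>n. \<Sum>k<n. d k x)" by (simp add: summable_iff_convergent)
    hence "convergent (\<lambda>n. f n x - f 0 x)" by (simp add: d_def sum_lessThan_telescope[of "\<lambda>k. f k x"])
    hence "convergent (\<lambda>n. (f n x - f 0 x) + f 0 x)" by (intro convergent_add convergent_const)
    thus ?case by simp
  qed
  define g where "g x = lim (\<lambda>k. f k x)" for x
  have g[measurable]: "g \<in> borel_measurable lborel"
    unfolding g_def by (rule borel_measurable_lim_metric) measurable
  have bound: "(\<integral>\<^sup>+x. ennreal ((norm (g x - f k x))\<^sup>2) \<partial>lborel) \<le> ennreal (((1/2) ^ k)\<^sup>2)" for k
  proof -
    have "(\<integral>\<^sup>+x. ennreal ((norm (g x - f k x))\<^sup>2) \<partial>lborel) =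
        (\<integral>\<^sup>+x. liminf (\<lambda>j. ennreal ((norm (f j x - f k x))\<^sup>2)) \<partial>lborel)"
    proof (rule nn_integral_cong_AE)
      from conv show "AE x in lborel. ennreal ((norm (g x - f k x))\<^sup>2) =
          liminf (\<lambda>j. ennreal ((norm (f j x - f k x))\<^sup>2))"
      proof eventually_elim
        case (elim x)
        hence "(\<lambda>j. f j x) \<longlonglongrightarrow> g x" by (simp add: g_def convergent_LIMSEQ_iff)
        hence "(\<lambda>j. ennreal ((norm (f j x - f k x))\<^sup>2)) \<longlonglongrightarrow> ennreal ((norm (g x - f k x))\<^sup>2)"
          by (intro tendsto_intros)
        thus ?case by (rule lim_imp_Liminf[OF sequentially_bot, symmetric])
      qed
    qed
    also have "\<dots> \<le> liminf (\<lambda>j. \<integral>\<^sup>+x. ennreal ((norm (f j x - f k x))\<^sup>2) \<partial>lborel)"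
      by (rule nn_integral_liminf) measurable
    also have "\<dots> \<le> ennreal (((1/2) ^ k)\<^sup>2)"
      by (intro Liminf_le eventually_mono[OF eventually_ge_at_top[of k]] le) simp_all
    finally show ?thesis .
  qed
  have diff: "square_integrable (\<lambda>x. g x - f k x)" "(norm (abs_L2 (\<lambda>x. g x - f k x)))\<^sup>2 \<le> ((1/2) ^ k)\<^sup>2" for k
    by (rule square_integrable_nn_integral[OF _ bound]; simp)+
  have "square_integrable (\<lambda>x. (g x - f 0 x) + f 0 x)" by (rule square_integrable_add[OF diff(1) f])
  hence "square_integrable g" by simp
  moreover have "norm (abs_L2 g - abs_L2 (f k)) \<le> (1/2) ^ k" for k
    using power2_le_imp_le[OF diff(2)] by (simp add: abs_L2_diff[OF \<open>square_integrable g\<close> f])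
  ultimately show ?thesis by blast
qed

instance L2 :: (finite) banach
proof
  fix X :: "nat \<Rightarrow> 'a L2" assume X: "Cauchy X"
  have "\<exists>N. \<forall>m\<ge>N. \<forall>n\<ge>N. norm (X m - X n) < (1/2) ^ k" for k
    using X unfolding Cauchy_iff by simp
  then obtain N where N: "\<And>k m n. m \<ge> N k \<Longrightarrow> n \<ge> N k \<Longrightarrow> norm (X m - X n) < (1/2) ^ k" by metis
  \<comment> \<open>Partial sums plus k: strictly increasing and at least N k.\<close>
  define r where "r k = (\<Sum>i\<le>k. N i) + k" for k
  have r: "strict_mono r" by (auto simp: r_def strict_mono_Suc_iff)
  have rN: "r k \<ge> N k" for k
    using member_le_sum[of k "{..k}" N] by (simp add: r_def trans_le_add1)
  have "\<exists>g. square_integrable g \<and> (\<forall>k. norm (abs_L2 g - abs_L2 (rep_L2 (X (r k)))) \<le> (1/2) ^ k)"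
  proof (rule L2_limit_of_fast_Cauchy)
    fix k j :: nat assume "k \<le> j"
    hence "r j \<ge> N k" using rN[of k] r by (meson order_trans strict_mono_less_eq)
    from N[OF this rN] show "norm (abs_L2 (rep_L2 (X (r j))) - abs_L2 (rep_L2 (X (r k)))) \<le> (1/2) ^ k"
      by (simp add: abs_rep_L2 less_imp_le)
  qed (rule rep_L2)
  then obtain l where l: "\<And>k. norm (l - X (r k)) \<le> (1/2) ^ k" by (auto simp: abs_rep_L2)
  have "(\<lambda>k. X (r k)) \<longlonglongrightarrow> l"
  proof (rule LIM_zero_cancel, rule Lim_null_comparison)
    show "\<forall>\<^sub>F k in sequentially. norm (X (r k) - l) \<le> (1/2) ^ k"
      using l by (simp add: norm_minus_commute)
    show "(\<lambda>k. (1/2 :: real) ^ k) \<longlonglongrightarrow> 0" by (rule LIMSEQ_power_zero) simp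
  qed
  hence "X \<longlonglongrightarrow> l" using X r Cauchy_converges_subseq by (fastforce simp: o_def)
  thus "convergent X" by (rule convergentI)
qed

lemma square_integrable_mult_const: "square_integrable f \<Longrightarrow> square_integrable (\<lambda>x. c * f x)"
  by (auto simp: square_integrable_def norm_mult power_mult_distrib)

lift_definition imult_L2 :: "'n::finite L2 \<Rightarrow> 'n L2" is "\<lambda>f x. \<i> * f x"
  by (auto simp: L2_eq_def square_integrable_mult_const)

lemma inner_imult_L2: "inner (imult_L2 f) (imult_L2 g) = inner f g"
proof transfer
  have "inner (\<i> * a) (\<i> * b) = inner a b" for a b :: complex by (simp add: inner_complex_def)
  thus "(LINT x|lborel. inner (\<i> * f x) (\<i> * g x)) = (LINT x|lborel. inner (f x) (g x))"
    for f g :: "real ^ 'b \<Rightarrow> complex" by simp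
qed

definition L2_J :: "'n::finite L2 \<Rightarrow>\<^sub>L 'n L2" where "L2_J = Blinfun imult_L2"

lemma L2_J_apply: "blinfun_apply (L2_J :: 'n::finite L2 \<Rightarrow>\<^sub>L 'n L2) = imult_L2"
  unfolding L2_J_def
proof (rule bounded_linear_Blinfun_apply, rule bounded_linear_intro[where K = 1])
  show "imult_L2 (f + g) = imult_L2 f + imult_L2 g" for f g :: "'n L2"
    by transfer (auto simp: L2_eq_def distrib_left square_integrable_mult_const square_integrable_add)
  show "imult_L2 (r *\<^sub>R f) = r *\<^sub>R imult_L2 f" for f :: "'n L2" and r
    by transfer (auto simp: L2_eq_def square_integrable_mult_const square_integrable_scaleR)
  show "norm (imult_L2 f) \<le> norm f * 1" for f :: "'n L2"
    by (simp add: norm_eq_sqrt_inner inner_imult_L2)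
qed

interpretation L2: complex_structure "L2_J :: 'n::finite L2 \<Rightarrow>\<^sub>L 'n L2"
proof
  show "L2_J (L2_J f) = - f" for f :: "'n L2"
    unfolding L2_J_apply
    by transfer (auto simp: L2_eq_def mult.assoc[symmetric] square_integrable_mult_const square_integrable_minus)
  show "inner (L2_J f) (L2_J g) = inner f g" for f g :: "'n L2"
    unfolding L2_J_apply by (rule inner_imult_L2)
qed

lemma L2_J_abs: "square_integrable f \<Longrightarrow> L2_J (abs_L2 f) = abs_L2 (\<lambda>x. \<i> * f x)"
  by (simp add: L2_J_apply imult_L2.abs_eq L2_eq_refl)

lemma cscale_abs_L2:
  assumes "square_integrable f"
  shows "L2.cscale c (abs_L2 f) = abs_L2 (\<lambda>x. c * f x)"
proof -
  have "L2.cscale c (abs_L2 f) = abs_L2 (\<lambda>x. Re c *\<^sub>R f x + Im c *\<^sub>R (\<i> * f x))"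
    using assms
    by (simp add: L2.cscale_apply L2_J_abs abs_L2_scaleR abs_L2_add square_integrable_mult_const square_integrable_scaleR)
  also have "(\<lambda>x. Re c *\<^sub>R f x + Im c *\<^sub>R (\<i> * f x)) = (\<lambda>x. c * f x)"
    by (auto simp: complex_eq_iff algebra_simps)
  finally show ?thesis .
qed

section \<open>Integral operators and the Schur test\<close>

definition schur_kernel :: "(real ^ 'n::finite \<Rightarrow> real ^ 'n \<Rightarrow> complex) \<Rightarrow> real \<Rightarrow> bool" where
  "schur_kernel k B \<longleftrightarrow> case_prod k \<in> borel_measurable (lborel \<Otimes>\<^sub>M lborel) \<and> 0 \<le> B \<and>
     (\<forall>x. (\<integral>\<^sup>+y. ennreal (norm (k x y)) \<partial>lborel) \<le> ennreal B) \<and>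
     (\<forall>y. (\<integral>\<^sup>+x. ennreal (norm (k x y)) \<partial>lborel) \<le> ennreal B)"

text \<open>Cauchy-Schwarz with |k| split as sqrt |k| * sqrt |k| uses the bound on the integrals
  over y; exchanging the integrals uses the one over x. Each contributes a factor B.\<close>

lemma schur_test_nn_integral:
  assumes k: "schur_kernel k B" and f[measurable]: "f \<in> borel_measurable lborel"
  shows "(\<integral>\<^sup>+x. (\<integral>\<^sup>+y. ennreal (norm (k x y * f y)) \<partial>lborel)\<^sup>2 \<partial>lborel) \<le>
    ennreal (B\<^sup>2) * (\<integral>\<^sup>+y. ennreal ((norm (f y))\<^sup>2) \<partial>lborel)"
proof -
  have [measurable]: "case_prod k \<in> borel_measurable (lborel \<Otimes>\<^sub>M lborel)"
    using k by (simp add: schur_kernel_def)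
  have B: "0 \<le> B" using k by (simp add: schur_kernel_def)
  have CS: "(\<integral>\<^sup>+y. ennreal (norm (k x y * f y)) \<partial>lborel)\<^sup>2 \<le>
      ennreal B * (\<integral>\<^sup>+y. ennreal (norm (k x y) * (norm (f y))\<^sup>2) \<partial>lborel)" for x
  proof -
    have "(\<integral>\<^sup>+y. ennreal (norm (k x y * f y)) \<partial>lborel) =
        (\<integral>\<^sup>+y. ennreal (sqrt (norm (k x y))) * ennreal (sqrt (norm (k x y)) * norm (f y)) \<partial>lborel)"
      by (intro nn_integral_cong) (simp add: ennreal_mult[symmetric] norm_mult mult.assoc[symmetric])
    also have "\<dots>\<^sup>2 \<le> (\<integral>\<^sup>+y. (ennreal (sqrt (norm (k x y))))\<^sup>2 \<partial>lborel) *
        (\<integral>\<^sup>+y. (ennreal (sqrt (norm (k x y)) * norm (f y)))\<^sup>2 \<partial>lborel)"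
      by (rule Cauchy_Schwarz_nn_integral) measurable
    also have "\<dots> = (\<integral>\<^sup>+y. ennreal (norm (k x y)) \<partial>lborel) * (\<integral>\<^sup>+y. ennreal (norm (k x y) * (norm (f y))\<^sup>2) \<partial>lborel)"
      by (simp add: ennreal_power power_mult_distrib)
    also have "\<dots> \<le> ennreal B * (\<integral>\<^sup>+y. ennreal (norm (k x y) * (norm (f y))\<^sup>2) \<partial>lborel)"
      using k by (intro mult_right_mono) (auto simp: schur_kernel_def)
    finally show ?thesis .
  qed
  have "(\<integral>\<^sup>+x. (\<integral>\<^sup>+y. ennreal (norm (k x y * f y)) \<partial>lborel)\<^sup>2 \<partial>lborel) \<le>
      (\<integral>\<^sup>+x. ennreal B * (\<integral>\<^sup>+y. ennreal (norm (k x y) * (norm (f y))\<^sup>2) \<partial>lborel) \<partial>lborel)"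
    by (intro nn_integral_mono CS)
  also have "\<dots> = ennreal B * (\<integral>\<^sup>+x. \<integral>\<^sup>+y. ennreal (norm (k x y) * (norm (f y))\<^sup>2) \<partial>lborel \<partial>lborel)"
    by (rule nn_integral_cmult) measurable
  also have "(\<integral>\<^sup>+x. \<integral>\<^sup>+y. ennreal (norm (k x y) * (norm (f y))\<^sup>2) \<partial>lborel \<partial>lborel) =
      (\<integral>\<^sup>+y. \<integral>\<^sup>+x. ennreal (norm (k x y) * (norm (f y))\<^sup>2) \<partial>lborel \<partial>lborel)"
    by (rule lborel_pair.Fubini'[symmetric]) measurable
  also have "\<dots> = (\<integral>\<^sup>+y. (\<integral>\<^sup>+x. ennreal (norm (k x y)) \<partial>lborel) * ennreal ((norm (f y))\<^sup>2) \<partial>lborel)"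
    by (intro nn_integral_cong) (simp add: ennreal_mult nn_integral_multc)
  also have "\<dots> \<le> (\<integral>\<^sup>+y. ennreal B * ennreal ((norm (f y))\<^sup>2) \<partial>lborel)"
    using k by (intro nn_integral_mono mult_right_mono) (auto simp: schur_kernel_def)
  also have "\<dots> = ennreal B * (\<integral>\<^sup>+y. ennreal ((norm (f y))\<^sup>2) \<partial>lborel)"
    by (rule nn_integral_cmult) measurable
  finally show ?thesis
    using B by (simp add: power2_eq_square ennreal_mult mult.assoc mult_left_mono)
qed

lemma schur_test:
  assumes k: "schur_kernel k B" and f: "square_integrable f"
  shows "AE x in lborel. integrable lborel (\<lambda>y. k x y * f y)"
    and "square_integrable (\<lambda>x. LINT y|lborel. k x y * f y)"
    and "norm (abs_L2 (\<lambda>x. LINT y|lborel. k x y * f y)) \<le> B * norm (abs_L2 f)"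
proof -
  have [measurable]: "case_prod k \<in> borel_measurable (lborel \<Otimes>\<^sub>M lborel)"
    using k by (simp add: schur_kernel_def)
  have [measurable]: "f \<in> borel_measurable lborel" using f by (simp add: square_integrable_def)
  have B: "0 \<le> B" using k by (simp add: schur_kernel_def)
  define h where "h x = (\<integral>\<^sup>+y. ennreal (norm (k x y * f y)) \<partial>lborel)" for x
  have [measurable]: "h \<in> borel_measurable lborel" unfolding h_def by measurable
  have le: "(\<integral>\<^sup>+x. (h x)\<^sup>2 \<partial>lborel) \<le> ennreal ((B * norm (abs_L2 f))\<^sup>2)"
    using schur_test_nn_integral[OF k, of f] B unfolding h_def nn_integral_square[OF f]
    by (simp add: ennreal_mult power_mult_distrib)
  have "(\<integral>\<^sup>+x. (h x)\<^sup>2 \<partial>lborel) \<noteq> \<infinity>" using le neq_top_trans by (auto simp: top_unique)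
  hence "AE x in lborel. (h x)\<^sup>2 \<noteq> \<infinity>" by (intro nn_integral_noteq_infinite) auto
  thus "AE x in lborel. integrable lborel (\<lambda>y. k x y * f y)"
  proof eventually_elim
    case (elim x)
    hence "h x < \<infinity>" by (auto simp: less_top power2_eq_square ennreal_mult_eq_top_iff)
    thus ?case unfolding h_def by (intro integrableI_bounded) auto
  qed
  define g where "g x = (LINT y|lborel. k x y * f y)" for x
  have [measurable]: "g \<in> borel_measurable lborel" unfolding g_def by measurable
  \<comment> \<open>Where the integrand is not integrable, the integral is 0 by convention and the
    estimate is trivial.\<close>
  have "ennreal (norm (g x)) \<le> h x" for x
  proof (cases "integrable lborel (\<lambda>y. k x y * f y)")
    case True
    thus ?thesis unfolding g_def h_def by (rule integral_norm_bound_ennreal)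
  qed (simp add: g_def not_integrable_integral_eq)
  hence "(\<integral>\<^sup>+x. ennreal ((norm (g x))\<^sup>2) \<partial>lborel) \<le> (\<integral>\<^sup>+x. (h x)\<^sup>2 \<partial>lborel)"
    by (intro nn_integral_mono) (simp add: ennreal_power[symmetric] power_mono)
  also note le
  finally have g: "(\<integral>\<^sup>+x. ennreal ((norm (g x))\<^sup>2) \<partial>lborel) \<le> ennreal ((B * norm (abs_L2 f))\<^sup>2)" .
  from square_integrable_nn_integral[OF _ this] have "square_integrable g"
    "(norm (abs_L2 g))\<^sup>2 \<le> (B * norm (abs_L2 f))\<^sup>2" by simp_all
  thus "square_integrable (\<lambda>x. LINT y|lborel. k x y * f y)"
    "norm (abs_L2 (\<lambda>x. LINT y|lborel. k x y * f y)) \<le> B * norm (abs_L2 f)"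
    using B by (auto simp: g_def[abs_def] intro: power2_le_imp_le)
qed

definition kernel_op :: "(real ^ 'n::finite \<Rightarrow> real ^ 'n \<Rightarrow> complex) \<Rightarrow> 'n L2 \<Rightarrow>\<^sub>L 'n L2" where
  "kernel_op k = Blinfun (\<lambda>f. abs_L2 (\<lambda>x. LINT y|lborel. k x y * rep_L2 f y))"

context
  fixes k :: "real ^ 'n::finite \<Rightarrow> real ^ 'n \<Rightarrow> complex" and B
  assumes k: "schur_kernel k B"
begin

text \<open>\<open>Blinfun\<close> means something only for bounded linear maps, and
  \<open>rep_L2\<close> respects sums and multiples only almost everywhere. The Schur test gives the
  bound and the integrability that additivity of the integrals needs.\<close>

lemma kernel_op_apply: "kernel_op k f = abs_L2 (\<lambda>x. LINT y|lborel. k x y * rep_L2 f y)"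
proof -
  note schur = schur_test[OF k]
  have cong: "(LINT y|lborel. k x y * g y) = (LINT y|lborel. k x y * h y)"
    if "AE y in lborel. g y = h y" "square_integrable g" "square_integrable h" for g h x
  proof (rule integral_cong_AE)
    have km: "case_prod k \<in> borel_measurable (lborel \<Otimes>\<^sub>M lborel)" using k by (simp add: schur_kernel_def)
    have [measurable]: "k x \<in> borel_measurable lborel" using measurable_compose[OF measurable_Pair1' km, of x] by simp
    show "(\<lambda>y. k x y * g y) \<in> borel_measurable lborel" "(\<lambda>y. k x y * h y) \<in> borel_measurable lborel"
      using that(2,3) by (auto simp: square_integrable_def)
    show "AE y in lborel. k x y * g y = k x y * h y" using that(1) by eventually_elim simp
  qed
  have "bounded_linear (\<lambda>f. abs_L2 (\<lambda>x. LINT y|lborel. k x y * rep_L2 f y))"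
  proof (rule bounded_linear_intro)
    fix f g :: "'n L2" and r :: real
    have "AE y in lborel. rep_L2 (f + g) y = rep_L2 f y + rep_L2 g y"
      using rep_abs_L2[OF square_integrable_add[OF rep_L2 rep_L2], of f g]
      by (simp add: abs_L2_add[symmetric] rep_L2 abs_rep_L2)
    hence "(LINT y|lborel. k x y * rep_L2 (f + g) y) = (LINT y|lborel. k x y * (rep_L2 f y + rep_L2 g y))" for x
      by (rule cong) (auto intro: rep_L2 square_integrable_add)
    moreover have "abs_L2 (\<lambda>x. LINT y|lborel. k x y * (rep_L2 f y + rep_L2 g y)) =
        abs_L2 (\<lambda>x. (LINT y|lborel. k x y * rep_L2 f y) + (LINT y|lborel. k x y * rep_L2 g y))"
    proof (rule abs_L2_eqI)
      show "AE x in lborel. (LINT y|lborel. k x y * (rep_L2 f y + rep_L2 g y)) =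
          (LINT y|lborel. k x y * rep_L2 f y) + (LINT y|lborel. k x y * rep_L2 g y)"
        using schur(1)[OF rep_L2[of f]] schur(1)[OF rep_L2[of g]]
        by eventually_elim (simp add: distrib_left)
    qed (intro schur(2) square_integrable_add rep_L2)+
    ultimately show "abs_L2 (\<lambda>x. LINT y|lborel. k x y * rep_L2 (f + g) y) =
        abs_L2 (\<lambda>x. LINT y|lborel. k x y * rep_L2 f y) + abs_L2 (\<lambda>x. LINT y|lborel. k x y * rep_L2 g y)"
      by (simp add: abs_L2_add schur(2) rep_L2)
    have "AE y in lborel. rep_L2 (r *\<^sub>R f) y = r *\<^sub>R rep_L2 f y"
      using rep_abs_L2[OF square_integrable_scaleR[OF rep_L2], of r f]
      by (simp add: abs_L2_scaleR[symmetric] rep_L2 abs_rep_L2)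
    hence "(LINT y|lborel. k x y * rep_L2 (r *\<^sub>R f) y) = (LINT y|lborel. k x y * r *\<^sub>R rep_L2 f y)" for x
      by (rule cong) (auto intro: rep_L2 square_integrable_scaleR)
    thus "abs_L2 (\<lambda>x. LINT y|lborel. k x y * rep_L2 (r *\<^sub>R f) y) =
        r *\<^sub>R abs_L2 (\<lambda>x. LINT y|lborel. k x y * rep_L2 f y)"
      by (simp add: abs_L2_scaleR schur(2) rep_L2)
    show "norm (abs_L2 (\<lambda>x. LINT y|lborel. k x y * rep_L2 f y)) \<le> norm f * B"
      using schur(3)[OF rep_L2[of f]] by (simp add: abs_rep_L2 mult.commute)
  qed
  thus ?thesis unfolding kernel_op_def by (simp add: bounded_linear_Blinfun_apply)
qed

lemma norm_kernel_op: "norm (kernel_op k) \<le> B"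
proof (rule norm_blinfun_bound)
  show "0 \<le> B" using k by (simp add: schur_kernel_def)
  show "norm (kernel_op k f) \<le> B * norm f" for f
    using schur_test(3)[OF k rep_L2[of f]] by (simp add: kernel_op_apply abs_rep_L2)
qed

lemma kernel_op_abs:
  assumes f: "square_integrable f"
  shows "kernel_op k (abs_L2 f) = abs_L2 (\<lambda>x. LINT y|lborel. k x y * f y)"
proof -
  have km: "case_prod k \<in> borel_measurable (lborel \<Otimes>\<^sub>M lborel)" using k by (simp add: schur_kernel_def)
  have "(LINT y|lborel. k x y * rep_L2 (abs_L2 f) y) = (LINT y|lborel. k x y * f y)" for x
  proof (rule integral_cong_AE)
    have [measurable]: "k x \<in> borel_measurable lborel" using measurable_compose[OF measurable_Pair1' km, of x] by simp
    show "(\<lambda>y. k x y * rep_L2 (abs_L2 f) y) \<in> borel_measurable lborel" "(\<lambda>y. k x y * f y) \<in> borel_measurable lborel"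
      using f rep_L2[of "abs_L2 f"] by (auto simp: square_integrable_def)
    show "AE y in lborel. k x y * rep_L2 (abs_L2 f) y = k x y * f y"
      using rep_abs_L2[OF f] by eventually_elim simp
  qed
  thus ?thesis by (simp add: kernel_op_apply)
qed

end

lemma schur_kernel_cmult:
  assumes "schur_kernel k B"
  shows "schur_kernel (\<lambda>x y. c * k x y) (norm c * B)"
proof -
  have [measurable]: "case_prod k \<in> borel_measurable (lborel \<Otimes>\<^sub>M lborel)"
    using assms by (simp add: schur_kernel_def)
  show ?thesis
    using assms by (auto simp: schur_kernel_def norm_mult ennreal_mult nn_integral_cmult intro!: mult_left_mono)
qed

lemma kernel_op_cmult:
  assumes "schur_kernel k B"
  shows "kernel_op (\<lambda>x y. c * k x y) = L2.cscale c o\<^sub>L kernel_op k"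
proof (rule blinfun_eqI)
  fix f
  show "kernel_op (\<lambda>x y. c * k x y) f = (L2.cscale c o\<^sub>L kernel_op k) f"
    using schur_test(2)[OF assms rep_L2[of f]]
    by (simp add: kernel_op_apply[OF assms] kernel_op_apply[OF schur_kernel_cmult[OF assms]]
        cscale_abs_L2 mult.assoc)
qed

lemma schur_kernel_add:
  assumes "schur_kernel k B" "schur_kernel k' B'"
  shows "schur_kernel (\<lambda>x y. k x y + k' x y) (B + B')"
proof -
  have m[measurable]: "case_prod k \<in> borel_measurable (lborel \<Otimes>\<^sub>M lborel)"
    "case_prod k' \<in> borel_measurable (lborel \<Otimes>\<^sub>M lborel)"
    using assms by (simp_all add: schur_kernel_def)
  have le: "ennreal (norm (a + b)) \<le> ennreal (norm a) + ennreal (norm b)" for a b :: complex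
    by (simp add: ennreal_plus[symmetric] norm_triangle_ineq del: ennreal_plus)
  have "(\<integral>\<^sup>+y. ennreal (norm (k x y + k' x y)) \<partial>lborel) \<le> ennreal (B + B')" for x
  proof -
    have "(\<integral>\<^sup>+y. ennreal (norm (k x y + k' x y)) \<partial>lborel) \<le>
        (\<integral>\<^sup>+y. ennreal (norm (k x y)) + ennreal (norm (k' x y)) \<partial>lborel)" by (intro nn_integral_mono le)
    also have "\<dots> = (\<integral>\<^sup>+y. ennreal (norm (k x y)) \<partial>lborel) + (\<integral>\<^sup>+y. ennreal (norm (k' x y)) \<partial>lborel)"
      by (rule nn_integral_add) measurable
    finally show ?thesis using assms by (auto simp: schur_kernel_def elim!: order_trans intro!: add_mono)
  qed
  moreover have "(\<integral>\<^sup>+x. ennreal (norm (k x y + k' x y)) \<partial>lborel) \<le> ennreal (B + B')" for y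
  proof -
    have "(\<integral>\<^sup>+x. ennreal (norm (k x y + k' x y)) \<partial>lborel) \<le>
        (\<integral>\<^sup>+x. ennreal (norm (k x y)) + ennreal (norm (k' x y)) \<partial>lborel)" by (intro nn_integral_mono le)
    also have "\<dots> = (\<integral>\<^sup>+x. ennreal (norm (k x y)) \<partial>lborel) + (\<integral>\<^sup>+x. ennreal (norm (k' x y)) \<partial>lborel)"
      by (rule nn_integral_add) measurable
    finally show ?thesis using assms by (auto simp: schur_kernel_def elim!: order_trans intro!: add_mono)
  qed
  ultimately show ?thesis using assms by (simp add: schur_kernel_def)
qed

lemma kernel_op_add:
  assumes "schur_kernel k B" "schur_kernel k' B'"
  shows "kernel_op (\<lambda>x y. k x y + k' x y) = kernel_op k + kernel_op k'"
proof (rule blinfun_eqI)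
  fix f
  note app = kernel_op_apply[OF assms(1)] kernel_op_apply[OF assms(2)] kernel_op_apply[OF schur_kernel_add[OF assms]]
  note sq = schur_test(2)[OF assms(1) rep_L2[of f]] schur_test(2)[OF assms(2) rep_L2[of f]]
    schur_test(2)[OF schur_kernel_add[OF assms] rep_L2[of f]]
  have "abs_L2 (\<lambda>x. LINT y|lborel. (k x y + k' x y) * rep_L2 f y) =
      abs_L2 (\<lambda>x. (LINT y|lborel. k x y * rep_L2 f y) + (LINT y|lborel. k' x y * rep_L2 f y))"
  proof (rule abs_L2_eqI)
    show "AE x in lborel. (LINT y|lborel. (k x y + k' x y) * rep_L2 f y) =
        (LINT y|lborel. k x y * rep_L2 f y) + (LINT y|lborel. k' x y * rep_L2 f y)"
      using schur_test(1)[OF assms(1) rep_L2[of f]] schur_test(1)[OF assms(2) rep_L2[of f]]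
      by eventually_elim (simp add: distrib_right)
  qed (use sq in \<open>auto intro: square_integrable_add\<close>)
  thus "kernel_op (\<lambda>x y. k x y + k' x y) f = (kernel_op k + kernel_op k') f"
    using sq by (simp add: app blinfun.add_left abs_L2_add)
qed

lemma kernel_op_minus:
  assumes "schur_kernel k B"
  shows "kernel_op (\<lambda>x y. - k x y) = - kernel_op k"
  using kernel_op_cmult[OF assms, of "- 1"]
  by (auto intro!: blinfun_eqI simp: L2.cscale_minus L2.cscale_1 blinfun.minus_left)

lemma schur_kernel_minus: "schur_kernel k B \<Longrightarrow> schur_kernel (\<lambda>x y. - k x y) B"
  using schur_kernel_cmult[of k B "- 1"] by simp

lemma kernel_op_diff:
  assumes "schur_kernel k B" "schur_kernel k' B'"
  shows "kernel_op (\<lambda>x y. k x y - k' x y) = kernel_op k - kernel_op k'"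
  using kernel_op_add[OF assms(1) schur_kernel_minus[OF assms(2)]]
  by (simp add: kernel_op_minus[OF assms(2)])

lemma schur_kernel_0: "schur_kernel (\<lambda>_ _. 0) 0"
  by (simp add: schur_kernel_def case_prod_unfold)

lemma kernel_op_0: "kernel_op (\<lambda>_ _. 0) = 0"
  using norm_kernel_op[OF schur_kernel_0] by simp

lemma schur_kernel_sum:
  assumes "finite I" "\<And>i. i \<in> I \<Longrightarrow> schur_kernel (k i) (B i)"
  shows "schur_kernel (\<lambda>x y. \<Sum>i\<in>I. k i x y) (\<Sum>i\<in>I. B i)"
  using assms by (induction I rule: finite_induct) (auto intro: schur_kernel_0 schur_kernel_add)

lemma kernel_op_sum:
  assumes "finite I" "\<And>i. i \<in> I \<Longrightarrow> schur_kernel (k i) (B i)"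
  shows "kernel_op (\<lambda>x y. \<Sum>i\<in>I. k i x y) = (\<Sum>i\<in>I. kernel_op (k i))"
  using assms
proof (induction I rule: finite_induct)
  case (insert i I)
  have "kernel_op (\<lambda>x y. k i x y + (\<Sum>i\<in>I. k i x y)) = kernel_op (k i) + kernel_op (\<lambda>x y. \<Sum>i\<in>I. k i x y)"
    by (rule kernel_op_add[OF _ schur_kernel_sum]) (use insert in auto)
  thus ?case using insert by simp
qed (simp add: kernel_op_0)

lemma clinear_kernel_op:
  fixes k :: "real ^ 'n::finite \<Rightarrow> real ^ 'n \<Rightarrow> complex"
  assumes "schur_kernel k B"
  shows "L2.clinear_op (kernel_op k)"
  unfolding L2.clinear_op_def
proof
  fix f :: "'n L2"
  have f: "abs_L2 (rep_L2 f) = f" by (rule abs_rep_L2)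
  have "kernel_op k (L2_J (abs_L2 (rep_L2 f))) = L2_J (kernel_op k (abs_L2 (rep_L2 f)))"
    unfolding L2_J_abs[OF rep_L2] kernel_op_abs[OF assms rep_L2] L2_J_abs[OF schur_test(2)[OF assms rep_L2]]
      kernel_op_abs[OF assms square_integrable_mult_const[OF rep_L2]]
    by (simp add: mult.left_commute)
  thus "kernel_op k (L2_J f) = L2_J (kernel_op k f)" by (simp only: f)
qed

section \<open>Kernels dominated by an integrable weight\<close>

text \<open>
  The exponent is larger than \<open>- d\<close>, which makes the weight locally integrable, and smaller than
  the exponent \<open>2 - d\<close> of the singularity of the fundamental solution.
\<close>

definition weight :: "real ^ 'n::finite \<Rightarrow> real" where
  "weight u = norm u powr (1/2 - real CARD('n))"

lemma weight_nonneg: "0 \<le> weight u"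
  by (simp add: weight_def)

lemma weight_minus_commute: "weight (x - y) = weight (y - x)"
  by (simp add: weight_def norm_minus_commute)

lemma borel_measurable_weight[measurable]: "weight \<in> borel_measurable borel"
  unfolding weight_def[abs_def] by measurable

lemma dyadic_shell:
  assumes "0 < t" "t \<le> (R::real)"
  obtains j where "R / 2 ^ Suc j < t" "t \<le> R / 2 ^ j"
proof -
  have "\<exists>j. R / 2 ^ Suc j < t"
  proof -
    obtain j where "R / t < 2 ^ j" using real_arch_pow[of 2 "R / t"] by auto
    hence "R / 2 ^ j < t" using assms(1) by (simp add: field_simps)
    moreover have "R / 2 ^ Suc j \<le> R / 2 ^ j" using assms by (simp add: field_simps)
    ultimately show ?thesis by (meson order_le_less_trans)
  qed
  define j where "j = (LEAST j. R / 2 ^ Suc j < t)"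
  have "R / 2 ^ Suc j < t" unfolding j_def by (rule LeastI_ex) fact
  moreover have "t \<le> R / 2 ^ j"
  proof (cases j)
    case (Suc i)
    hence "\<not> R / 2 ^ Suc i < t" using not_less_Least[of i "\<lambda>j. R / 2 ^ Suc j < t"] j_def by auto
    thus ?thesis using Suc by simp
  qed (use assms in simp)
  ultimately show ?thesis by (rule that)
qed

text \<open>Summation over dyadic shells: where R / 2^(j+1) < |u| \<le> R / 2^j, the weight is at
  most (R / 2^(j+1))^(1/2 - d) and the volume at most a constant times (R / 2^j)^d. The product is
  geometric in j with ratio sqrt (1/2).\<close>

lemma nn_integral_weight_finite:
  assumes R: "R > 0"
  shows "(\<integral>\<^sup>+u. ennreal (weight u) * indicator (cball (0 :: real ^ 'n::finite) R) u \<partial>lborel) < \<infinity>"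
proof -
  let ?d = "CARD('n)"
  let ?s = "1/2 - real ?d"
  have "real ?d \<ge> 1" by (simp add: Suc_leI)
  hence s: "?s \<le> 0" by linarith
  define c where "c j = (R / 2 ^ Suc j) powr ?s" for j
  have pw: "ennreal (weight u) * indicator (cball 0 R) u \<le> (\<Sum>j. ennreal (c j) * indicator (cball 0 (R / 2 ^ j)) u)"
    for u :: "real ^ 'n"
  \<comment> \<open>At u = 0 the weight is 0, since \<open>0 powr x = 0\<close>.\<close>
  proof (cases "u = 0 \<or> norm u > R")
    case True
    thus ?thesis by (auto simp: weight_def)
  next
    case False
    then obtain j where j: "R / 2 ^ Suc j < norm u" "norm u \<le> R / 2 ^ j"
      using dyadic_shell[of "norm u" R] by auto
    have "weight u \<le> c j"
      unfolding weight_def c_def by (rule powr_mono2'[OF s]) (use j(1) R in auto)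
    hence "ennreal (weight u) * indicator (cball 0 R) u \<le> ennreal (c j) * indicator (cball 0 (R / 2 ^ j)) u"
      using j(2) False by (auto intro: ennreal_leI)
    also have "\<dots> = (\<Sum>i\<in>{j}. ennreal (c i) * indicator (cball 0 (R / 2 ^ i)) u)"
      by (subst sum.insert) (simp_all del: sum.insert)
    also have "\<dots> \<le> (\<Sum>j. ennreal (c j) * indicator (cball 0 (R / 2 ^ j)) u)"
      by (rule sum_le_suminf) auto
    finally show ?thesis .
  qed
  define V where "V = unit_ball_vol (real ?d)"
  define q where "q = sqrt (1/2)"
  have V: "V \<ge> 0" by (simp add: V_def)
  have q: "0 \<le> q" "q < 1" by (auto simp: q_def)
  have shell: "c j * (V * (R / 2 ^ j) ^ ?d) = V * 2 powr (- ?s) * sqrt R * q ^ j" for j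
  proof -
    define x where "x = R / 2 ^ j"
    have x: "x > 0" using R by (simp add: x_def)
    have "c j = x powr ?s * 2 powr (- ?s)"
    proof -
      have "R / 2 ^ Suc j = x / 2" by (simp add: x_def)
      hence "c j = x powr ?s / 2 powr ?s" using x by (simp only: c_def powr_divide)
      thus ?thesis by (simp only: powr_minus_divide) simp
    qed
    moreover have "x powr ?s * x ^ ?d = sqrt x"
      using x by (simp add: powr_realpow[symmetric] powr_add[symmetric] powr_half_sqrt)
    moreover have "sqrt x = sqrt R * q ^ j"
      by (simp add: x_def q_def real_sqrt_divide real_sqrt_power power_divide power_one_over)
    ultimately show ?thesis by (simp add: x_def mult_ac)
  qed
  have [measurable]: "cball (0 :: real ^ 'n) (R / 2 ^ j) \<in> sets borel" for j by simp
  have "(\<integral>\<^sup>+u. ennreal (weight u) * indicator (cball (0 :: real ^ 'n) R) u \<partial>lborel) \<le>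
      (\<integral>\<^sup>+u. (\<Sum>j. ennreal (c j) * indicator (cball 0 (R / 2 ^ j)) (u :: real ^ 'n)) \<partial>lborel)"
    by (intro nn_integral_mono pw)
  also have "\<dots> = (\<Sum>j. \<integral>\<^sup>+u. ennreal (c j) * indicator (cball 0 (R / 2 ^ j)) (u :: real ^ 'n) \<partial>lborel)"
    by (rule nn_integral_suminf) measurable
  also have "\<dots> = (\<Sum>j. ennreal (V * 2 powr (- ?s) * sqrt R * q ^ j))"
  proof (intro suminf_cong)
    fix j
    have "(\<integral>\<^sup>+u. ennreal (c j) * indicator (cball 0 (R / 2 ^ j)) (u :: real ^ 'n) \<partial>lborel) =
        ennreal (c j) * emeasure lborel (cball (0 :: real ^ 'n) (R / 2 ^ j))"
      by (rule nn_integral_cmult_indicator) simp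
    also have "\<dots> = ennreal (c j * (V * (R / 2 ^ j) ^ ?d))"
      using R by (subst emeasure_cball) (auto simp: ennreal_mult V_def c_def)
    finally show "(\<integral>\<^sup>+u. ennreal (c j) * indicator (cball 0 (R / 2 ^ j)) (u :: real ^ 'n) \<partial>lborel) =
        ennreal (V * 2 powr (- ?s) * sqrt R * q ^ j)" by (simp only: shell)
  qed
  also have "\<dots> < \<infinity>"
  proof -
    have "summable (\<lambda>j. V * 2 powr (- ?s) * sqrt R * q ^ j)"
      using q by (intro summable_mult summable_geometric) auto
    hence "(\<Sum>j. ennreal (V * 2 powr (- ?s) * sqrt R * q ^ j)) \<noteq> top_class.top"
      using V q R by (intro ennreal_suminf_neq_top) auto
    thus ?thesis by (simp add: less_top)
  qed
  finally show ?thesis .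
qed

definition weight_mass :: "real \<Rightarrow> 'n::finite itself \<Rightarrow> real" where
  "weight_mass R _ = enn2real (\<integral>\<^sup>+u. ennreal (weight u) * indicator (cball (0 :: real ^ 'n) R) u \<partial>lborel)"

lemma nn_integral_weight_translate:
  fixes x :: "real ^ 'n::finite"
  assumes "R > 0"
  shows "(\<integral>\<^sup>+y. ennreal (weight (x - y)) * indicator (cball 0 R) (x - y) \<partial>lborel) =
    ennreal (weight_mass R TYPE('n))" (is "?l = _")
    and "(\<integral>\<^sup>+y. ennreal (weight (y - x)) * indicator (cball 0 R) (y - x) \<partial>lborel) =
    ennreal (weight_mass R TYPE('n))"
proof -
  have [measurable]: "cball (0 :: real ^ 'n) R \<in> sets borel" by simp
  have sym: "indicator (cball 0 R) (x - y) = (indicator (cball 0 R) (y - x) :: ennreal)" for y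
    by (auto simp: indicator_def norm_minus_commute)
  have "(\<integral>\<^sup>+y. ennreal (weight (y - x)) * indicator (cball 0 R) (y - x) \<partial>lborel) =
      (\<integral>\<^sup>+y. ennreal (weight (- x + y)) * indicator (cball 0 R) (- x + y) \<partial>lborel)"
    by (simp only: uminus_add_conv_diff)
  also have "\<dots> = (\<integral>\<^sup>+u. ennreal (weight u) * indicator (cball 0 R) u \<partial>distr lborel borel ((+) (- x)))"
    by (rule nn_integral_distr[symmetric]) (simp, measurable)
  also have "\<dots> = (\<integral>\<^sup>+u. ennreal (weight u) * indicator (cball (0 :: real ^ 'n) R) u \<partial>lborel)"
    by (simp add: lborel_distr_plus)
  also have "\<dots> = ennreal (weight_mass R TYPE('n))"
    using nn_integral_weight_finite[OF assms, where 'n = 'n] by (simp add: weight_mass_def less_top)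
  finally show *: "(\<integral>\<^sup>+y. ennreal (weight (y - x)) * indicator (cball 0 R) (y - x) \<partial>lborel) =
    ennreal (weight_mass R TYPE('n))" .
  show "?l = ennreal (weight_mass R TYPE('n))"
    using * by (simp add: sym weight_minus_commute[of x])
qed

text \<open>No estimate is asked for on the diagonal, where G is singular for d > 1 and which is a
  null set for each fixed x or y.\<close>

definition dominated :: "real \<Rightarrow> real \<Rightarrow> (real ^ 'n::finite \<Rightarrow> real ^ 'n \<Rightarrow> complex) \<Rightarrow> bool" where
  "dominated M \<eta> k \<longleftrightarrow> case_prod k \<in> borel_measurable (lborel \<Otimes>\<^sub>M lborel) \<and> 0 \<le> \<eta> \<and>
     (\<forall>x y. x \<notin> cube M \<or> y \<notin> cube M \<longrightarrow> k x y = 0) \<and>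
     (\<forall>x\<in>cube M. \<forall>y\<in>cube M. x \<noteq> y \<longrightarrow> norm (k x y) \<le> \<eta> * weight (x - y))"

definition kernel_bound :: "real \<Rightarrow> 'n::finite itself \<Rightarrow> real" where
  "kernel_bound M _ = weight_mass (2 * cube_radius M TYPE('n)) TYPE('n)"

lemma kernel_bound_nonneg: "0 \<le> kernel_bound M TYPE('n::finite)"
  by (simp add: kernel_bound_def weight_mass_def)

lemma cube_diff:
  fixes x y :: "real ^ 'n::finite"
  assumes "x \<in> cube M" "y \<in> cube M"
  shows "norm (x - y) \<le> 2 * cube_radius M TYPE('n)"
  using norm_triangle_ineq4[of x y] norm_le_cube_radius[OF assms(1)] norm_le_cube_radius[OF assms(2)] by linarith

lemma dominated_schur:
  fixes k :: "real ^ 'n::finite \<Rightarrow> real ^ 'n \<Rightarrow> complex"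
  assumes M: "M > 0" and k: "dominated M \<eta> k"
  shows "schur_kernel k (\<eta> * kernel_bound M TYPE('n))"
proof -
  define R where "R = 2 * cube_radius M TYPE('n)"
  have R: "R > 0" using M by (simp add: R_def cube_radius_def)
  have [measurable]: "case_prod k \<in> borel_measurable (lborel \<Otimes>\<^sub>M lborel)" and \<eta>: "0 \<le> \<eta>"
    using k by (auto simp: dominated_def)
  have [measurable]: "cball (0 :: real ^ 'n) R \<in> sets borel" by simp
  have pw: "ennreal (norm (k x y)) \<le> ennreal \<eta> * (ennreal (weight (x - y)) * indicator (cball 0 R) (x - y))"
    if "x \<noteq> y" for x y
  proof (cases "x \<in> cube M \<and> y \<in> cube M")
    case True
    hence "norm (k x y) \<le> \<eta> * weight (x - y)" "x - y \<in> cball 0 R"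
      using k that cube_diff[of x M y] by (auto simp: dominated_def R_def)
    thus ?thesis using \<eta> by (simp add: ennreal_mult[symmetric] weight_nonneg ennreal_leI)
  next
    case False
    hence "k x y = 0" using k by (auto simp: dominated_def)
    thus ?thesis by simp
  qed
  have AE_neq: "AE y in lborel. y \<noteq> (x :: real ^ 'n)" for x by (rule AE_lborel_singleton)
  have "(\<integral>\<^sup>+y. ennreal (norm (k x y)) \<partial>lborel) \<le> ennreal (\<eta> * kernel_bound M TYPE('n))" for x
  proof -
    have "(\<integral>\<^sup>+y. ennreal (norm (k x y)) \<partial>lborel) \<le>
        (\<integral>\<^sup>+y. ennreal \<eta> * (ennreal (weight (x - y)) * indicator (cball 0 R) (x - y)) \<partial>lborel)"
      by (rule nn_integral_mono_AE) (use AE_neq[of x] pw in \<open>auto elim!: eventually_mono\<close>)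
    also have "\<dots> = ennreal \<eta> * (\<integral>\<^sup>+y. ennreal (weight (x - y)) * indicator (cball 0 R) (x - y) \<partial>lborel)"
      by (rule nn_integral_cmult) measurable
    also have "\<dots> = ennreal (\<eta> * kernel_bound M TYPE('n))"
      using \<eta> kernel_bound_nonneg[of M, where 'n = 'n] unfolding nn_integral_weight_translate[OF R]
      by (simp add: ennreal_mult kernel_bound_def R_def)
    finally show ?thesis .
  qed
  moreover have "(\<integral>\<^sup>+x. ennreal (norm (k x y)) \<partial>lborel) \<le> ennreal (\<eta> * kernel_bound M TYPE('n))" for y
  proof -
    have "(\<integral>\<^sup>+x. ennreal (norm (k x y)) \<partial>lborel) \<le>
        (\<integral>\<^sup>+x. ennreal \<eta> * (ennreal (weight (x - y)) * indicator (cball 0 R) (x - y)) \<partial>lborel)"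
      by (rule nn_integral_mono_AE) (use AE_neq[of y] pw in \<open>auto elim!: eventually_mono\<close>)
    also have "\<dots> = ennreal \<eta> * (\<integral>\<^sup>+x. ennreal (weight (x - y)) * indicator (cball 0 R) (x - y) \<partial>lborel)"
      by (rule nn_integral_cmult) measurable
    also have "\<dots> = ennreal (\<eta> * kernel_bound M TYPE('n))"
      using \<eta> kernel_bound_nonneg[of M, where 'n = 'n] unfolding nn_integral_weight_translate[OF R]
      by (simp add: ennreal_mult kernel_bound_def R_def)
    finally show ?thesis .
  qed
  ultimately show ?thesis
    using \<eta> kernel_bound_nonneg[of M, where 'n = 'n] by (simp add: schur_kernel_def)
qed

context complex_structure
begin

lemma bounded_linear_cinner: "bounded_linear (\<lambda>y. Complex (inner y e) (inner y (J e)))"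
proof (rule bounded_linear_intro)
  fix y z :: 'a and r :: real
  let ?f = "\<lambda>y. Complex (inner y e) (inner y (J e))"
  have "norm (?f y) \<le> \<bar>inner y e\<bar> + \<bar>inner y (J e)\<bar>" using cmod_le[of "?f y"] by simp
  moreover have "\<bar>inner y e\<bar> \<le> norm y * norm e" by (rule Cauchy_Schwarz_ineq2)
  moreover have "\<bar>inner y (J e)\<bar> \<le> norm y * norm e"
    using Cauchy_Schwarz_ineq2[of y "J e"] by (simp only: norm_J)
  ultimately show "norm (?f y) \<le> norm y * (2 * norm e)" by (simp only: mult.left_commute)
  show "?f (y + z) = ?f y + ?f z" by (simp only: inner_add_left complex_eq_iff) simp
  show "?f (r *\<^sub>R y) = r *\<^sub>R ?f y" by (simp only: inner_scaleR_left complex_eq_iff) simp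
qed

text \<open>The complex inner product with e, recovered from its real part by means of
  \<open>J\<close>.\<close>

lift_definition cinner_right :: "'a \<Rightarrow> 'a \<Rightarrow>\<^sub>L complex" is
  "\<lambda>e y. Complex (inner y e) (inner y (J e))" by (rule bounded_linear_cinner)

lemma cfunctional_cinner_right: "cfunctional (cinner_right e)"
proof -
  have "inner (J y) e = - inner y (J e)" for y using inner_J_J[of y "J e"] by (simp add: J_J)
  thus ?thesis by (simp add: cfunctional_def cinner_right.rep_eq complex_eq_iff inner_J_J)
qed

end

lemma inner_abs_L2:
  "square_integrable f \<Longrightarrow> square_integrable g \<Longrightarrow>
   inner (abs_L2 f) (abs_L2 g) = (LINT x|lborel. inner (f x) (g x))"
  by (rule inner_L2.abs_eq) (simp_all only: L2_eq_refl)

lemma open_cube: "open (cube M :: (real ^ 'n::finite) set)"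
proof -
  have "cube M = (\<Inter>i. {x :: real ^ 'n. \<bar>x $ i\<bar> < M / 2})" by (auto simp: cube_def)
  moreover have "open {x :: real ^ 'n. \<bar>x $ i\<bar> < M / 2}" for i
    by (intro open_Collect_less continuous_intros)
  ultimately show ?thesis by (auto intro: open_INT)
qed

lemma cube_borel[measurable]: "(cube M :: (real ^ 'n::finite) set) \<in> sets borel"
  by (rule borel_open[OF open_cube])

lemma emeasure_cube_finite: "emeasure lborel (cube M :: (real ^ 'n::finite) set) < \<infinity>"
proof -
  have "emeasure lborel (cube M :: (real ^ 'n) set) \<le> emeasure lborel (cball (0 :: real ^ 'n) (cube_radius M TYPE('n)))"
    by (rule emeasure_mono) (auto simp: norm_le_cube_radius)
  also have "\<dots> < \<infinity>" by (rule emeasure_bounded_finite) simp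
  finally show ?thesis .
qed

lemma square_integrable_bounded:
  fixes v :: "real ^ 'n::finite \<Rightarrow> complex"
  assumes [measurable]: "v \<in> borel_measurable lborel" and "\<And>x. x \<notin> cube M \<Longrightarrow> v x = 0" "\<And>x. norm (v x) \<le> B"
  shows "square_integrable v"
  unfolding square_integrable_def
proof (rule conjI[OF assms(1)], rule Bochner_Integration.integrable_bound)
  have "integrable lborel (indicator (cube M) :: real ^ 'n \<Rightarrow> real)"
    by (rule integrable_real_indicator) (simp, rule emeasure_cube_finite)
  thus "integrable lborel (\<lambda>x :: real ^ 'n. B\<^sup>2 * indicator (cube M) x :: real)"
    by (rule integrable_mult_right)
  have "(norm (v x))\<^sup>2 \<le> B\<^sup>2 * indicator (cube M) x" for x
  proof (cases "x \<in> cube M")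
    case True
    thus ?thesis using power_mono[OF assms(3)[of x] norm_ge_zero, of 2] by simp
  qed (simp add: assms(2))
  thus "AE x in lborel. norm ((norm (v x))\<^sup>2) \<le> norm (B\<^sup>2 * indicator (cube M) x :: real)" by simp
  show "(\<lambda>x. (norm (v x))\<^sup>2) \<in> borel_measurable lborel" by measurable
qed

section \<open>Convolution operators on the cube and their approximation by operators of finite
  rank\<close>

definition conv_kernel ::
  "real \<Rightarrow> (real ^ 'n::finite \<Rightarrow> complex) \<Rightarrow> (real ^ 'n \<Rightarrow> complex) \<Rightarrow> real ^ 'n \<Rightarrow> real ^ 'n \<Rightarrow> complex" where
  "conv_kernel M p h x y = indicator (cube M) x * p x * h (x - y) * indicator (cube M) y"

definition conv_op ::
  "real \<Rightarrow> (real ^ 'n::finite \<Rightarrow> complex) \<Rightarrow> (real ^ 'n \<Rightarrow> complex) \<Rightarrow> 'n L2 \<Rightarrow>\<^sub>L 'n L2" where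
  "conv_op M p h = kernel_op (conv_kernel M p h)"

definition weight_bounded :: "real \<Rightarrow> real \<Rightarrow> (real ^ 'n::finite \<Rightarrow> complex) \<Rightarrow> bool" where
  "weight_bounded M H h \<longleftrightarrow> h \<in> borel_measurable borel \<and> 0 \<le> H \<and>
     (\<forall>u. u \<noteq> 0 \<and> norm u \<le> 2 * cube_radius M TYPE('n) \<longrightarrow> norm (h u) \<le> H * weight u)"

definition cube_bounded :: "real \<Rightarrow> real \<Rightarrow> (real ^ 'n::finite \<Rightarrow> complex) \<Rightarrow> bool" where
  "cube_bounded M P p \<longleftrightarrow> p \<in> borel_measurable borel \<and> 0 \<le> P \<and> (\<forall>x\<in>cube M. norm (p x) \<le> P)"

lemma dominated_conv_kernel:
  fixes p h :: "real ^ 'n::finite \<Rightarrow> complex"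
  assumes "cube_bounded M P p" "weight_bounded M H h"
  shows "dominated M (P * H) (conv_kernel M p h)"
  unfolding dominated_def
proof (intro conjI allI impI ballI)
  have [measurable]: "p \<in> borel_measurable borel" "h \<in> borel_measurable borel"
    using assms by (auto simp: cube_bounded_def weight_bounded_def)
  show "case_prod (conv_kernel M p h) \<in> borel_measurable (lborel \<Otimes>\<^sub>M lborel)"
    unfolding conv_kernel_def[abs_def] case_prod_beta' by measurable
  fix x y :: "real ^ 'n" assume xy: "x \<in> cube M" "y \<in> cube M" "x \<noteq> y"
  have "norm (p x) * norm (h (x - y)) \<le> P * (H * weight (x - y))"
    using assms xy cube_diff[OF xy(1,2)]
    by (intro mult_mono) (auto simp: cube_bounded_def weight_bounded_def)
  thus "norm (conv_kernel M p h x y) \<le> P * H * weight (x - y)"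
    using xy by (simp add: conv_kernel_def norm_mult mult.assoc)
qed (use assms in \<open>auto simp: conv_kernel_def cube_bounded_def weight_bounded_def\<close>)

lemmas schur_conv_kernel = dominated_schur[OF _ dominated_conv_kernel]

lemma norm_conv_op_le:
  fixes p :: "real ^ 'n::finite \<Rightarrow> complex"
  assumes "M > 0" "cube_bounded M P p" "weight_bounded M H h"
  shows "norm (conv_op M p h) \<le> P * H * kernel_bound M TYPE('n)"
  unfolding conv_op_def by (rule norm_kernel_op[OF schur_conv_kernel[OF assms]])

lemma weight_bounded_diff:
  assumes "weight_bounded M H h" "weight_bounded M H' h'"
  shows "weight_bounded M (H + H') (\<lambda>x. h x - h' x)"
  unfolding weight_bounded_def
proof (intro conjI allI impI)
  fix u :: "real ^ 'a" assume u: "u \<noteq> 0 \<and> norm u \<le> 2 * cube_radius M TYPE('a)"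
  have "norm (h u - h' u) \<le> H * weight u + H' * weight u"
    using assms u by (intro order_trans[OF norm_triangle_ineq4] add_mono) (auto simp: weight_bounded_def)
  thus "norm (h u - h' u) \<le> (H + H') * weight u" by (simp add: distrib_right)
qed (use assms in \<open>auto simp: weight_bounded_def\<close>)

lemma weight_bounded_cmult:
  assumes "weight_bounded M H h"
  shows "weight_bounded M (norm c * H) (\<lambda>x. c * h x)"
  unfolding weight_bounded_def norm_mult mult.assoc
  using assms by (intro conjI allI impI mult_left_mono) (auto simp: weight_bounded_def)

lemma conv_op_diff_left:
  assumes "M > 0" "cube_bounded M P p" "cube_bounded M P' p'" "weight_bounded M H h"
  shows "conv_op M p h - conv_op M p' h = conv_op M (\<lambda>x. p x - p' x) h"
  unfolding conv_op_def kernel_op_diff[OF schur_conv_kernel[OF assms(1,2,4)] schur_conv_kernel[OF assms(1,3,4)], symmetric]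
  by (intro arg_cong[of _ _ kernel_op] ext) (simp only: conv_kernel_def left_diff_distrib right_diff_distrib)

lemma conv_op_diff_right:
  assumes "M > 0" "cube_bounded M P p" "weight_bounded M H h" "weight_bounded M H' h'"
  shows "conv_op M p h - conv_op M p h' = conv_op M p (\<lambda>x. h x - h' x)"
  unfolding conv_op_def kernel_op_diff[OF schur_conv_kernel[OF assms(1,2,3)] schur_conv_kernel[OF assms(1,2,4)], symmetric]
  by (intro arg_cong[of _ _ kernel_op] ext) (simp only: conv_kernel_def left_diff_distrib right_diff_distrib)

lemma conv_op_cmult_right:
  assumes "M > 0" "cube_bounded M P p" "weight_bounded M H h"
  shows "L2.cscale c o\<^sub>L conv_op M p h = conv_op M p (\<lambda>x. c * h x)"
  unfolding conv_op_def kernel_op_cmult[OF schur_conv_kernel[OF assms], symmetric]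
  by (intro arg_cong[of _ _ kernel_op] ext) (simp only: conv_kernel_def mult_ac)

lemma clinear_conv_op:
  assumes "M > 0" "cube_bounded M P p" "weight_bounded M H h"
  shows "L2.clinear_op (conv_op M p h)"
  unfolding conv_op_def by (rule clinear_kernel_op[OF schur_conv_kernel[OF assms]])

text \<open>Integration over S, written as the inner product with an indicator function so that it
  is a bounded functional.\<close>

definition integral_functional :: "(real ^ 'n::finite) set \<Rightarrow> 'n L2 \<Rightarrow>\<^sub>L complex" where
  "integral_functional S = L2.cinner_right (abs_L2 (indicator S))"

lemma square_integrable_indicator:
  assumes "S \<in> sets borel" "S \<subseteq> cube M"
  shows "square_integrable (indicator S :: real ^ 'n::finite \<Rightarrow> complex)"
  by (rule square_integrable_bounded[of _ M 1]) (use assms in \<open>auto simp: indicator_def\<close>)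

lemma integral_functional_abs:
  fixes S :: "(real ^ 'n::finite) set"
  assumes S: "S \<in> sets borel" "S \<subseteq> cube M" and f: "square_integrable f"
  shows "integrable lborel (\<lambda>y. indicator S y * f y)"
    "integral_functional S (abs_L2 f) = (LINT y|lborel. indicator S y * f y)"
proof -
  note S' = square_integrable_indicator[OF S]
  have re: "inner (f y) (indicator S y) = Re (indicator S y * f y)"
    "inner (f y) (\<i> * indicator S y) = Im (indicator S y * f y)" for y
    by (auto simp: indicator_def inner_complex_def)
  show int: "integrable lborel (\<lambda>y. indicator S y * f y)"
  proof (rule integrableI_bounded)
    have [measurable]: "f \<in> borel_measurable lborel" "S \<in> sets borel" using f S by (auto simp: square_integrable_def)
    show "(\<lambda>y. indicator S y * f y) \<in> borel_measurable lborel" by measurable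
    have "(\<integral>\<^sup>+y. ennreal (norm (indicator S y * f y)) \<partial>lborel) \<le>
        (\<integral>\<^sup>+y. ennreal ((norm (indicator S y :: complex))\<^sup>2) + ennreal ((norm (f y))\<^sup>2) \<partial>lborel)"
    proof (rule nn_integral_mono)
      fix y
      have "norm (f y) \<le> 1 + (norm (f y))\<^sup>2"
        using sum_squares_bound[of 1 "norm (f y)"] by (simp add: power2_eq_square) (use norm_ge_zero[of "f y"] in linarith)
      thus "ennreal (norm (indicator S y * f y)) \<le> ennreal ((norm (indicator S y :: complex))\<^sup>2) + ennreal ((norm (f y))\<^sup>2)"
        by (auto simp: indicator_def ennreal_plus[symmetric] ennreal_leI simp del: ennreal_plus)
    qed
    also have "\<dots> = (\<integral>\<^sup>+y. ennreal ((norm (indicator S y :: complex))\<^sup>2) \<partial>lborel) +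
        (\<integral>\<^sup>+y. ennreal ((norm (f y))\<^sup>2) \<partial>lborel)"
      by (rule nn_integral_add) measurable
    also have "\<dots> < \<infinity>"
      unfolding nn_integral_square[OF f] nn_integral_square[OF S'] by simp
    finally show "(\<integral>\<^sup>+y. ennreal (norm (indicator S y * f y)) \<partial>lborel) < \<infinity>" .
  qed
  show "integral_functional S (abs_L2 f) = (LINT y|lborel. indicator S y * f y)"
    unfolding integral_functional_def L2.cinner_right.rep_eq L2_J_abs[OF S']
      inner_abs_L2[OF f S'] inner_abs_L2[OF f square_integrable_mult_const[OF S']] re
      integral_Re[OF int] integral_Im[OF int] by simp
qed

lemma kernel_op_rank1:
  fixes S :: "(real ^ 'n::finite) set"
  assumes S: "S \<in> sets borel" "S \<subseteq> cube M" and v: "square_integrable v"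
    and schur: "schur_kernel (\<lambda>x y. v x * indicator S y) B"
  shows "kernel_op (\<lambda>x y. v x * indicator S y) = L2.rank1 (abs_L2 v) (integral_functional S)"
proof (rule blinfun_eqI)
  fix f :: "'n L2"
  have "kernel_op (\<lambda>x y. v x * indicator S y) (abs_L2 (rep_L2 f)) =
      L2.rank1 (abs_L2 v) (integral_functional S) (abs_L2 (rep_L2 f))"
    unfolding kernel_op_abs[OF schur rep_L2] L2.rank1_apply integral_functional_abs(2)[OF S rep_L2] cscale_abs_L2[OF v]
    by (intro arg_cong[of _ _ abs_L2] ext) (simp add: mult.assoc mult.commute[of _ "v _"])
  thus "kernel_op (\<lambda>x y. v x * indicator S y) f = L2.rank1 (abs_L2 v) (integral_functional S) f"
    by (simp only: abs_rep_L2)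
qed

text \<open>Unit discs around points of \<open>cball w 1\<close> stay within
  \<open>cball w 2\<close>, so Cauchy's inequality bounds the second derivative by 2 B on
  \<open>cball w 1\<close>; the rest is Taylor's formula.\<close>

lemma holomorphic_second_order:
  fixes f :: "complex \<Rightarrow> complex"
  assumes hol: "f holomorphic_on UNIV" and B: "\<And>z. z \<in> cball w 2 \<Longrightarrow> norm (f z) \<le> B" and z: "z \<in> ball w 1"
  shows "norm (f z - f w - (z - w) * deriv f w) \<le> 2 * B * (norm (z - w))\<^sup>2"
proof -
  have "norm ((deriv ^^ 0) f z - (\<Sum>i\<le>1. (deriv ^^ i) f w * (z - w) ^ i / fact i)) \<le>
      2 * B * norm (z - w) ^ Suc 1 / fact 1"
  proof (rule complex_Taylor[where S = "cball w 1"])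
    fix i x
    have "(deriv ^^ i) f holomorphic_on UNIV" by (rule holomorphic_higher_deriv[OF hol]) auto
    hence "(deriv ^^ i) f field_differentiable at x" by (simp add: holomorphic_on_def)
    thus "((deriv ^^ i) f has_field_derivative (deriv ^^ Suc i) f x) (at x within cball w 1)"
      by (simp add: field_differentiable_derivI has_field_derivative_at_within)
  next
    fix x assume x: "x \<in> cball w 1"
    have "norm ((deriv ^^ 2) f x) \<le> fact 2 * B / 1 ^ 2"
    proof (rule Cauchy_inequality)
      show "f holomorphic_on ball x 1" by (rule holomorphic_on_subset[OF hol]) auto
      show "continuous_on (cball x 1) f"
        using hol by (auto intro: continuous_on_subset holomorphic_on_imp_continuous_on)
      fix y assume "norm (x - y) = 1"
      hence "dist w y \<le> 2" using x dist_triangle[of w y x] by (simp add: dist_norm)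
      thus "norm (f y) \<le> B" using B by simp
    qed simp
    thus "norm ((deriv ^^ Suc 1) f x) \<le> 2 * B" by (simp add: numeral_2_eq_2)
  qed (use z in auto)
  thus ?thesis by (simp add: mult.commute power2_eq_square diff_diff_eq)
qed

lemma borel_measurable_potential:
  fixes q :: "real ^ 'n::finite \<Rightarrow> complex"
  assumes "q \<in> potentials M"
  shows "q \<in> borel_measurable borel"
proof -
  from assms obtain D where "\<And>x. (q has_derivative blinfun_apply (D x)) (at x)"
    unfolding potentials_def by blast
  hence "isCont q x" for x by (rule has_derivative_continuous)
  thus ?thesis by (intro borel_measurable_continuous_onI continuous_at_imp_continuous_on) blast
qed

lemma potential_cube_bounded:
  fixes q :: "real ^ 'n::finite \<Rightarrow> complex"
  assumes "q \<in> potentials M"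
  obtains P where "cube_bounded M P q"
proof -
  from potential_lipschitz_bound[OF assms, of "cube_radius M TYPE('n)"] obtain L
    where "lipschitz_bound (cube_radius M TYPE('n)) q L" by blast
  hence "cube_bounded M (real L) q"
    using borel_measurable_potential[OF assms] norm_le_cube_radius
    unfolding cube_bounded_def lipschitz_bound_def by (metis mem_cball_0 of_nat_0_le_iff)
  thus ?thesis by (rule that)
qed

lemma weight_bounded_const:
  assumes "M > 0"
  obtains c where "c > 0" "\<And>u :: real ^ 'n::finite. u \<noteq> 0 \<Longrightarrow> norm u \<le> 2 * cube_radius M TYPE('n) \<Longrightarrow> 1 \<le> c * weight u"
proof (rule that)
  let ?R = "2 * cube_radius M TYPE('n)" and ?s = "1/2 - real CARD('n)"
  have R: "?R > 0" using assms by (simp add: cube_radius_def)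
  have "real CARD('n) \<ge> 1" by (simp add: Suc_leI)
  hence s: "?s \<le> 0" by linarith
  show "?R powr (- ?s) > 0" using R by simp
  fix u :: "real ^ 'n" assume u: "u \<noteq> 0" "norm u \<le> ?R"
  have "?R powr (- ?s) * ?R powr ?s = 1" using R by (simp add: powr_add[symmetric])
  moreover have "?R powr ?s \<le> weight u"
    unfolding weight_def by (rule powr_mono2'[OF s]) (use u in auto)
  ultimately show "1 \<le> ?R powr (- ?s) * weight u"
    using R by (metis mult_left_mono powr_ge_zero)
qed

lemma conv_op_eq_off_0:
  fixes p :: "real ^ 'n::finite \<Rightarrow> complex"
  assumes "M > 0" "cube_bounded M P p" "weight_bounded M H h" "weight_bounded M H' h'"
    and eq: "\<And>u. u \<noteq> 0 \<Longrightarrow> h u = h' u"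
  shows "conv_op M p h = conv_op M p h'"
proof -
  have "weight_bounded M 0 (\<lambda>u. h u - h' u)"
    using assms(3,4) eq by (auto simp: weight_bounded_def)
  from norm_conv_op_le[OF assms(1,2) this] show ?thesis
    using conv_op_diff_right[OF assms(1-4)] by simp
qed

text \<open>The cube is cut into small pieces S j near net points y j, and h (x - y) is replaced by
  h (x - y j) for y in S j. The new kernel is a finite sum of products of a function of x and an
  indicator function of y, and uniform continuity of h makes the difference small.\<close>

lemma conv_op_finite_rank:
  fixes p h :: "real ^ 'n::finite \<Rightarrow> complex"
  assumes M: "M > 0" and p: "cube_bounded M P p" and h: "continuous_on UNIV h" and "\<epsilon> > 0"
  shows "\<exists>N v \<phi>. (\<forall>j<N. L2.cfunctional (\<phi> j)) \<and>
    norm (conv_op M p h - (\<Sum>j<N::nat. L2.rank1 (v j) (\<phi> j))) \<le> \<epsilon>"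
proof -
  let ?r = "cube_radius M TYPE('n)"
  obtain c where c: "c > 0" "\<And>u :: real ^ 'n. u \<noteq> 0 \<Longrightarrow> norm u \<le> 2 * ?r \<Longrightarrow> 1 \<le> c * weight u"
    by (rule weight_bounded_const[OF M]) blast
  have P: "0 \<le> P" and pm[measurable]: "p \<in> borel_measurable borel" using p by (auto simp: cube_bounded_def)
  have hm[measurable]: "h \<in> borel_measurable borel" using h by (rule borel_measurable_continuous_onI)
  have "compact (h ` cball 0 (2 * ?r))"
    by (intro compact_continuous_image continuous_on_subset[OF h]) auto
  from compact_imp_bounded[OF this] obtain B0 where "\<forall>u\<in>cball 0 (2 * ?r). norm (h u) \<le> B0"
    unfolding bounded_iff by blast
  hence B0: "norm (h u) \<le> B0" if "norm u \<le> 2 * ?r" for u using that by simp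
  define B where "B = max B0 0"
  have B: "0 \<le> B" "\<And>u. norm u \<le> 2 * ?r \<Longrightarrow> norm (h u) \<le> B" using B0 by (auto simp: B_def le_max_iff_disj)
  define kb where "kb = kernel_bound M TYPE('n)"
  have kb: "0 \<le> kb" by (simp add: kb_def kernel_bound_nonneg)
  \<comment> \<open>The final error is P * c * kb * e; the summand 1 keeps the denominator
    positive.\<close>
  define e where "e = \<epsilon> / (P * c * kb + 1)"
  have pos: "P * c * kb + 1 > 0" using P c(1) kb by (simp add: add_nonneg_pos)
  have e: "e > 0" using \<open>\<epsilon> > 0\<close> pos by (simp add: e_def)
  have "uniformly_continuous_on (cball 0 (2 * ?r)) h"
    by (intro compact_uniformly_continuous continuous_on_subset[OF h]) auto
  then obtain \<tau> where \<tau>: "\<tau> > 0"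
    "\<And>u u'. norm u \<le> 2 * ?r \<Longrightarrow> norm u' \<le> 2 * ?r \<Longrightarrow> dist u' u < \<tau> \<Longrightarrow> dist (h u') (h u) < e"
    unfolding uniformly_continuous_on_def using e by (metis mem_cball_0)
  obtain F :: "(real ^ 'n) set" where F: "finite F" "F \<subseteq> cball 0 ?r" "cball 0 ?r \<subseteq> (\<Union>y\<in>F. ball y \<tau>)"
    by (rule finite_net[OF \<tau>(1)])
  then obtain ys where ys: "set ys = F" using finite_list by blast
  define N where "N = length ys"
  \<comment> \<open>Removing the earlier balls makes the pieces disjoint, so that each point of the
    cube lies in exactly one of them.\<close>
  define S where "S j = (cube M \<inter> ball (ys ! j) \<tau>) - (\<Union>i<j. ball (ys ! i) \<tau>)" for j
  define v where "v j x = indicator (cube M) x * p x * h (x - ys ! j)" for j x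
  have S: "S j \<in> sets borel" "S j \<subseteq> cube M" for j by (auto simp: S_def)
  have ys_norm: "norm (ys ! j) \<le> ?r" if "j < N" for j
    using F(2) ys that nth_mem[of j ys] by (auto simp: N_def)
  have diff_norm: "norm (x - y) \<le> 2 * ?r" if "norm x \<le> ?r" "norm y \<le> ?r" for x y :: "real ^ 'n"
    using norm_triangle_ineq4[of x y] that by linarith
  have one: "\<exists>j<N. \<forall>i<N. indicator (S i) y = (if i = j then 1 else (0 :: complex))" if y: "y \<in> cube M" for y
  proof -
    have "y \<in> cball 0 ?r" using norm_le_cube_radius[OF y] by simp
    then obtain y' where "y' \<in> F" "y \<in> ball y' \<tau>" using F(3) by blast
    then obtain j0 where "j0 < N" "y \<in> ball (ys ! j0) \<tau>"
      unfolding ys[symmetric] N_def in_set_conv_nth by blast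
    define j where "j = (LEAST j. y \<in> ball (ys ! j) \<tau>)"
    have j: "y \<in> ball (ys ! j) \<tau>" "j \<le> j0"
      unfolding j_def by (rule LeastI, fact) (rule Least_le, fact)
    have less: "y \<notin> ball (ys ! i) \<tau>" if "i < j" for i
      using not_less_Least[of i "\<lambda>j. y \<in> ball (ys ! j) \<tau>"] that by (simp add: j_def)
    have "y \<in> S i \<longleftrightarrow> i = j" for i
    proof
      assume "y \<in> S i"
      hence "y \<in> ball (ys ! i) \<tau>" "\<not> j < i" using j(1) by (auto simp: S_def)
      with less[of i] show "i = j" by (cases "i < j") auto
    qed (use y j less in \<open>auto simp: S_def\<close>)
    thus ?thesis using j(2) \<open>j0 < N\<close> by (intro exI[of _ j]) (auto simp: indicator_def)
  qed
  define k where "k j x y = v j x * indicator (S j) y" for j x y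
  have v_bound: "norm (v j x) \<le> P * B" if "j < N" for j x
  proof (cases "x \<in> cube M")
    case True
    hence "norm (p x) * norm (h (x - ys ! j)) \<le> P * B"
      using p ys_norm[OF that] norm_le_cube_radius[OF True] P
      by (intro mult_mono B diff_norm) (auto simp: cube_bounded_def)
    thus ?thesis using True by (simp add: v_def norm_mult)
  qed (use P B(1) in \<open>simp add: v_def\<close>)
  have v_meas[measurable]: "v j \<in> borel_measurable borel" for j unfolding v_def[abs_def] by measurable
  have k_meas: "case_prod (k j) \<in> borel_measurable (lborel \<Otimes>\<^sub>M lborel)" for j
  proof -
    have [measurable]: "S j \<in> sets borel" by (rule S)
    show ?thesis unfolding k_def[abs_def] case_prod_beta' by measurable
  qed
  have weight1: "1 \<le> c * weight (x - y)" if "x \<in> cube M" "y \<in> cube M" "x \<noteq> y" for x y :: "real ^ 'n"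
    using that cube_diff[OF that(1,2)] by (intro c(2)) auto
  have "dominated M (P * B * c) (k j)" if "j < N" for j
    unfolding dominated_def
  proof (intro conjI allI impI ballI)
    fix x y :: "real ^ 'n" assume xy: "x \<in> cube M" "y \<in> cube M" "x \<noteq> y"
    have "norm (k j x y) \<le> P * B" using v_bound[OF that, of x] P B(1) by (auto simp: k_def indicator_def)
    also have "\<dots> \<le> P * B * (c * weight (x - y))" using weight1[OF xy] P B(1) mult_left_mono[of 1 _ "P * B"] by simp
    finally show "norm (k j x y) \<le> P * B * c * weight (x - y)" by (simp add: mult.assoc)
  qed (use k_meas P B(1) c(1) S in \<open>auto simp: k_def v_def indicator_def\<close>)
  hence k_schur: "schur_kernel (k j) (P * B * c * kb)" if "j < N" for j
    using that unfolding kb_def by (intro dominated_schur[OF M])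
  have v_sq: "square_integrable (v j)" if "j < N" for j
    by (rule square_integrable_bounded[of _ M "P * B"]) (use v_bound[OF that] in \<open>auto simp: v_def\<close>)
  have k_op: "kernel_op (k j) = L2.rank1 (abs_L2 (v j)) (integral_functional (S j))" if "j < N" for j
    using kernel_op_rank1[OF S v_sq[OF that]] k_schur[OF that] unfolding k_def by blast
  have h_wb: "weight_bounded M (B * c) h"
    unfolding weight_bounded_def
  proof (intro conjI allI impI)
    fix u :: "real ^ 'n" assume u: "u \<noteq> 0 \<and> norm u \<le> 2 * ?r"
    have "norm (h u) \<le> B" using B(2) u by simp
    also have "\<dots> \<le> B * (c * weight u)" using c(2)[of u] u B(1) mult_left_mono[of 1 _ B] by simp
    finally show "norm (h u) \<le> B * c * weight u" by (simp add: mult.assoc)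
  qed (use B(1) c(1) in auto)
  note h_schur = schur_conv_kernel[OF M p h_wb]
  have sum_schur: "schur_kernel (\<lambda>x y. \<Sum>j\<in>{..<N}. k j x y) (\<Sum>j\<in>{..<N}. P * B * c * kb)"
    by (rule schur_kernel_sum) (use k_schur in auto)
  let ?D = "\<lambda>x y. conv_kernel M p h x y - (\<Sum>j<N. k j x y)"
  have op_eq: "conv_op M p h - (\<Sum>j<N. L2.rank1 (abs_L2 (v j)) (integral_functional (S j))) = kernel_op ?D"
  proof -
    have "(\<Sum>j<N. L2.rank1 (abs_L2 (v j)) (integral_functional (S j))) = (\<Sum>j<N. kernel_op (k j))"
      by (intro sum.cong) (auto simp: k_op)
    also have "\<dots> = kernel_op (\<lambda>x y. \<Sum>j<N. k j x y)"
      by (rule kernel_op_sum[symmetric]) (use k_schur in auto)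
    finally show ?thesis unfolding conv_op_def by (simp only: kernel_op_diff[OF h_schur sum_schur])
  qed
  have "dominated M (P * e * c) ?D"
    unfolding dominated_def
  proof (intro conjI allI impI ballI)
    show "case_prod ?D \<in> borel_measurable (lborel \<Otimes>\<^sub>M lborel)"
      using h_schur sum_schur unfolding schur_kernel_def case_prod_beta' by (intro borel_measurable_diff) auto
    fix x y :: "real ^ 'n" assume xy: "x \<in> cube M" "y \<in> cube M" "x \<noteq> y"
    from one[OF xy(2)] obtain j where j: "j < N" "\<And>i. i < N \<Longrightarrow> indicator (S i) y = (if i = j then 1 else (0 :: complex))"
      by blast
    have "(\<Sum>i<N. k i x y) = (\<Sum>i<N. if i = j then v i x else 0)"
      by (intro sum.cong) (auto simp: k_def j(2))
    also have "\<dots> = v j x" using j(1) by simp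
    finally have D: "?D x y = p x * (h (x - y) - h (x - ys ! j))"
      using xy by (simp add: conv_kernel_def v_def algebra_simps)
    have "y \<in> S j" using j(2)[OF j(1)] by (auto simp: indicator_def split: if_splits)
    hence "dist (x - y) (x - ys ! j) < \<tau>" by (auto simp: S_def dist_norm)
    hence "norm (h (x - y) - h (x - ys ! j)) \<le> e"
      using \<tau>(2)[of "x - ys ! j" "x - y"] diff_norm[of x "ys ! j"] diff_norm[of x y] ys_norm[OF j(1)]
        norm_le_cube_radius[OF xy(1)] norm_le_cube_radius[OF xy(2)] by (simp add: dist_norm)
    hence "norm (?D x y) \<le> P * e"
      unfolding D norm_mult using p xy(1) P by (intro mult_mono) (auto simp: cube_bounded_def)
    also have "\<dots> \<le> P * e * (c * weight (x - y))"
      using weight1[OF xy] P e mult_left_mono[of 1 _ "P * e"] by simp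
    finally show "norm (?D x y) \<le> P * e * c * weight (x - y)" by (simp add: mult.assoc)
  next
    fix x y :: "real ^ 'n" assume "x \<notin> cube M \<or> y \<notin> cube M"
    moreover have "k j x y = 0" if "x \<notin> cube M \<or> y \<notin> cube M" for j
      using that S(2)[of j] by (auto simp: k_def v_def indicator_def)
    ultimately show "?D x y = 0" by (auto simp: conv_kernel_def)
  qed (use P e c(1) in auto)
  from norm_kernel_op[OF dominated_schur[OF M this]] have "norm (kernel_op ?D) \<le> P * e * c * kb"
    by (simp add: kb_def)
  also have "\<dots> = (P * c * kb) * e" by simp
  also have "\<dots> \<le> (P * c * kb + 1) * e" using e by (intro mult_right_mono) auto
  also have "\<dots> = \<epsilon>" using pos by (simp add: e_def)
  finally have "norm (conv_op M p h - (\<Sum>j<N. L2.rank1 (abs_L2 (v j)) (integral_functional (S j)))) \<le> \<epsilon>"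
    unfolding op_eq .
  moreover have "L2.cfunctional (integral_functional (S j))" for j
    unfolding integral_functional_def by (rule L2.cfunctional_cinner_right)
  ultimately show ?thesis
    by (intro exI[of _ N] exI[of _ "\<lambda>j. abs_L2 (v j)"] exI[of _ "\<lambda>j. integral_functional (S j)"]) simp
qed

section \<open>Potentials times the fundamental solution\<close>

text \<open>The term \<open>s / z\<close> is the pole at 0 in dimension 1; otherwise \<open>s = 0\<close>.\<close>

locale helmholtz_kernel =
  fixes M :: real and g :: "real \<Rightarrow> complex \<Rightarrow> complex" and s :: complex
    and G :: "real ^ 'n::finite \<Rightarrow> complex \<Rightarrow> complex"
  assumes M: "M > 0"
    and G_eq: "\<And>x z. x \<noteq> 0 \<Longrightarrow> z \<noteq> 0 \<Longrightarrow> G x z = s / z + g (norm x) z"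
    and g_hol: "\<And>r. r > 0 \<Longrightarrow> g r holomorphic_on UNIV"
    and g_cont: "\<And>z. continuous_on {0<..} (\<lambda>r. g r z)"
    and g_bound: "\<And>R Z. \<exists>C. \<forall>r z. 0 < r \<longrightarrow> r \<le> R \<longrightarrow> norm z \<le> Z \<longrightarrow>
      norm (g r z) \<le> C * r powr (3/4 - real CARD('n))"
begin

abbreviation "K q z \<equiv> conv_op M q (\<lambda>u. G u z)"

lemma radius_pos: "cube_radius M TYPE('n) > 0"
  using M by (simp add: cube_radius_def)

lemma borel_measurable_radial:
  assumes "continuous_on {0<..} f"
  shows "(\<lambda>u :: real ^ 'n. f (norm u) :: complex) \<in> borel_measurable borel"
proof (rule borel_measurable_continuous_countable_exceptions[of "{0}"])
  show "continuous_on (- {0}) (\<lambda>u :: real ^ 'n. f (norm u))"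
    by (rule continuous_on_compose2[OF assms continuous_on_norm_id]) auto
qed simp

lemma borel_measurable_g[measurable]: "(\<lambda>u :: real ^ 'n. g (norm u) z) \<in> borel_measurable borel"
  by (rule borel_measurable_radial[OF g_cont])

lemma g_bound_nonneg:
  obtains C where "C \<ge> 0" "\<And>r z. 0 < r \<Longrightarrow> r \<le> R \<Longrightarrow> norm z \<le> Z \<Longrightarrow>
    norm (g r z) \<le> C * r powr (3/4 - real CARD('n))"
proof -
  from g_bound[of R Z] obtain C where C: "\<And>r z. 0 < r \<Longrightarrow> r \<le> R \<Longrightarrow> norm z \<le> Z \<Longrightarrow>
    norm (g r z) \<le> C * r powr (3/4 - real CARD('n))" by blast
  show ?thesis
  proof (rule that[of "max C 0"])
    fix r :: real and z :: complex assume *: "0 < r" "r \<le> R" "norm z \<le> Z"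
    have "C * r powr (3/4 - real CARD('n)) \<le> max C 0 * r powr (3/4 - real CARD('n))"
      by (rule mult_right_mono) auto
    with C[OF *] show "norm (g r z) \<le> max C 0 * r powr (3/4 - real CARD('n))" by linarith
  qed simp
qed

text \<open>The bound on g beats the weight by a power 1/4 of the distance. This surplus makes the
  part of the kernel close to the diagonal small as an operator.\<close>

lemma powr_weight: "u \<noteq> 0 \<Longrightarrow> norm u powr (3/4 - real CARD('n)) = norm u powr (1/4) * weight (u :: real ^ 'n)"
  by (simp add: weight_def powr_add[symmetric])

lemma weight_bounded_g:
  obtains C where "C \<ge> 0" "\<And>z. norm z \<le> Z \<Longrightarrow> weight_bounded M C (\<lambda>u :: real ^ 'n. g (norm u) z)"
proof -
  obtain C where C: "C \<ge> 0" "\<And>r z. 0 < r \<Longrightarrow> r \<le> 2 * cube_radius M TYPE('n) \<Longrightarrow> norm z \<le> Z \<Longrightarrow>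
    norm (g r z) \<le> C * r powr (3/4 - real CARD('n))" by (rule g_bound_nonneg) blast
  show ?thesis
  proof (rule that[of "C * (2 * cube_radius M TYPE('n)) powr (1/4)"])
    fix z :: complex assume z: "norm z \<le> Z"
    show "weight_bounded M (C * (2 * cube_radius M TYPE('n)) powr (1/4)) (\<lambda>u :: real ^ 'n. g (norm u) z)"
      unfolding weight_bounded_def
    proof (intro conjI allI impI)
      fix u :: "real ^ 'n" assume u: "u \<noteq> 0 \<and> norm u \<le> 2 * cube_radius M TYPE('n)"
      have "norm (g (norm u) z) \<le> C * (norm u powr (1/4) * weight u)"
        using C(2)[of "norm u" z] u z powr_weight[of u] by simp
      also have "\<dots> \<le> C * ((2 * cube_radius M TYPE('n)) powr (1/4) * weight u)"
        using u C(1) by (intro mult_left_mono mult_right_mono powr_mono2) (auto simp: weight_nonneg)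
      finally show "norm (g (norm u) z) \<le> C * (2 * cube_radius M TYPE('n)) powr (1/4) * weight u" by (simp add: mult.assoc)
    qed (use C(1) in auto)
  qed (use C(1) in auto)
qed

lemma weight_bounded_1:
  obtains c where "c \<ge> 0" "weight_bounded M c (\<lambda>_ :: real ^ 'n. 1)"
proof -
  obtain c where "c > 0" "\<And>u :: real ^ 'n. u \<noteq> 0 \<Longrightarrow> norm u \<le> 2 * cube_radius M TYPE('n) \<Longrightarrow> 1 \<le> c * weight u"
    by (rule weight_bounded_const[OF M]) blast
  thus ?thesis by (intro that[of c]) (auto simp: weight_bounded_def)
qed

lemma borel_measurable_G:
  assumes "z \<noteq> 0"
  shows "(\<lambda>u. G u z) \<in> borel_measurable borel"
proof (rule borel_measurable_continuous_countable_exceptions[of "{0}"])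
  have "continuous_on (- {0}) (\<lambda>u :: real ^ 'n. s / z + g (norm u) z)"
    by (intro continuous_intros continuous_on_compose2[OF g_cont[of z]]) auto
  thus "continuous_on (- {0}) (\<lambda>u. G u z)"
    by (rule continuous_on_eq) (use assms G_eq in auto)
qed simp

text \<open>The factor 1 / |z| comes from the term s / z; the regular part is fitted to the same
  form by means of |z| \<le> Z.\<close>

lemma weight_bounded_G:
  obtains C where "C \<ge> 0" "\<And>z. z \<noteq> 0 \<Longrightarrow> norm z \<le> Z \<Longrightarrow> weight_bounded M (C / norm z) (\<lambda>u. G u z)"
proof -
  obtain C where C: "C \<ge> 0" "\<And>z. norm z \<le> Z \<Longrightarrow> weight_bounded M C (\<lambda>u :: real ^ 'n. g (norm u) z)"
    by (rule weight_bounded_g) blast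
  obtain c where c: "c \<ge> 0" "weight_bounded M c (\<lambda>_ :: real ^ 'n. 1)" by (rule weight_bounded_1)
  show ?thesis
  proof (rule that[of "norm s * c + C * \<bar>Z\<bar>"])
    fix z :: complex assume z: "z \<noteq> 0" "norm z \<le> Z"
    show "weight_bounded M ((norm s * c + C * \<bar>Z\<bar>) / norm z) (\<lambda>u. G u z)"
      unfolding weight_bounded_def
    proof (intro conjI allI impI)
      fix u :: "real ^ 'n" assume u: "u \<noteq> 0 \<and> norm u \<le> 2 * cube_radius M TYPE('n)"
      have "norm (G u z) \<le> norm s / norm z * 1 + norm (g (norm u) z)"
        using G_eq[of u z] u z norm_triangle_ineq[of "s / z" "g (norm u) z"] by (simp add: norm_divide)
      also have "\<dots> \<le> norm s / norm z * (c * weight u) + C * weight u"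
        using c C(2)[OF z(2)] u by (intro add_mono mult_left_mono) (auto simp: weight_bounded_def)
      also have "C * weight u \<le> C * \<bar>Z\<bar> / norm z * weight u"
        using C(1) z by (intro mult_right_mono weight_nonneg) (simp add: le_divide_eq mult_left_mono)
      also have "norm s / norm z * (c * weight u) + C * \<bar>Z\<bar> / norm z * weight u =
          (norm s * c + C * \<bar>Z\<bar>) / norm z * weight u" by (simp add: add_divide_distrib distrib_right)
      finally show "norm (G u z) \<le> (norm s * c + C * \<bar>Z\<bar>) / norm z * weight u" by simp
    qed (use C(1) c(1) borel_measurable_G[OF z(1)] in auto)
  qed (use C(1) c(1) in auto)
qed

lemma K_eq:
  assumes q: "cube_bounded M P q" and z: "z \<noteq> 0"
  shows "K q z = (L2.cscale (s / z) o\<^sub>L conv_op M q (\<lambda>_. 1)) + conv_op M q (\<lambda>u. g (norm u) z)"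
proof -
  obtain C where C: "\<And>z'. norm z' \<le> norm z \<Longrightarrow> weight_bounded M C (\<lambda>u :: real ^ 'n. g (norm u) z')"
    by (rule weight_bounded_g) blast
  obtain C' where C': "\<And>z'. z' \<noteq> 0 \<Longrightarrow> norm z' \<le> norm z \<Longrightarrow> weight_bounded M (C' / norm z') (\<lambda>u. G u z')"
    by (rule weight_bounded_G) blast
  obtain c where c: "weight_bounded M c (\<lambda>_ :: real ^ 'n. 1)" by (rule weight_bounded_1)
  note wb = weight_bounded_diff[OF C'[OF z order_refl] C[OF order_refl]] weight_bounded_cmult[OF c, of "s / z"]
  have "K q z - conv_op M q (\<lambda>u. g (norm u) z) = conv_op M q (\<lambda>u. G u z - g (norm u) z)"
    by (rule conv_op_diff_right[OF M q C'[OF z order_refl] C[OF order_refl]])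
  also have "\<dots> = conv_op M q (\<lambda>u. s / z * 1)"
    by (rule conv_op_eq_off_0[OF M q wb]) (use G_eq z in auto)
  also have "\<dots> = L2.cscale (s / z) o\<^sub>L conv_op M q (\<lambda>_. 1)"
    by (rule conv_op_cmult_right[OF M q c, symmetric])
  finally show ?thesis by (simp add: algebra_simps)
qed

text \<open>The derivative is the convolution operator with the z-derivative of the kernel. Since g
  is dominated by the weight on a whole disc, Cauchy's estimates give the same domination for the
  derivative and for the Taylor remainder, and the Schur test turns this into an estimate of
  operator norms.\<close>

lemma op_differentiable_g:
  fixes q :: "real ^ 'n \<Rightarrow> complex"
  assumes q: "cube_bounded M P q"
  shows "L2.op_differentiable (\<lambda>z. conv_op M q (\<lambda>u. g (norm u) z)) w"
proof -
  obtain C where C: "C \<ge> 0" "\<And>z. norm z \<le> norm w + 2 \<Longrightarrow> weight_bounded M C (\<lambda>u :: real ^ 'n. g (norm u) z)"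
    by (rule weight_bounded_g) blast
  have Cw: "weight_bounded M C (\<lambda>u :: real ^ 'n. g (norm u) z)" if "z \<in> cball w 2" for z
  proof (rule C(2))
    show "norm z \<le> norm w + 2"
      using that norm_triangle_ineq2[of z w] by (simp add: dist_norm norm_minus_commute)
  qed
  define g' where "g' u = deriv (g (norm u)) w" for u :: "real ^ 'n"
  have quad: "norm (g (norm u) z - g (norm u) w - (z - w) * g' u) \<le> 2 * (C * weight u) * (norm (z - w))\<^sup>2"
    if "z \<in> ball w 1" "u \<noteq> 0" "norm u \<le> 2 * cube_radius M TYPE('n)" for z u
    unfolding g'_def using that Cw by (intro holomorphic_second_order g_hol) (auto simp: weight_bounded_def)
  \<comment> \<open>Measurability in u is inherited from the difference quotients with increments 1
    / (n + 1).\<close>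
  have g'_meas: "g' \<in> borel_measurable borel"
  proof (rule measurable_discrete_difference[where X = "{0}"])
    show "(\<lambda>u. if u = 0 then 0 else g' u) \<in> borel_measurable borel"
    proof (rule borel_measurable_LIMSEQ_metric)
      show "(\<lambda>u :: real ^ 'n. if u = 0 then 0 else (g (norm u) (w + 1 / of_nat (Suc n)) - g (norm u) w) / (1 / of_nat (Suc n)))
          \<in> borel_measurable borel" for n by measurable
      fix u :: "real ^ 'n"
      show "(\<lambda>n. if u = 0 then 0 else (g (norm u) (w + 1 / of_nat (Suc n)) - g (norm u) w) / (1 / of_nat (Suc n)))
          \<longlonglongrightarrow> (if u = 0 then 0 else g' u)"
      proof (cases "u = 0")
        case False
        hence "(g (norm u) has_field_derivative g' u) (at w)"
          unfolding g'_def using g_hol[of "norm u"] by (intro holomorphic_derivI[of _ UNIV]) auto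
        hence "((\<lambda>h. (g (norm u) (w + h) - g (norm u) w) / h) \<longlongrightarrow> g' u) (at 0)"
          by (simp add: DERIV_def)
        moreover have "filterlim (\<lambda>n. 1 / of_nat (Suc n) :: complex) (at 0) sequentially"
          using LIMSEQ_Suc[OF lim_1_over_n] by (auto simp: filterlim_at simp del: of_nat_Suc)
        ultimately show ?thesis using False filterlim_compose by fastforce
      qed simp
    qed
  qed auto
  have g'_wb: "weight_bounded M (4 * C) g'"
    unfolding weight_bounded_def
  proof (intro conjI allI impI g'_meas)
    fix u :: "real ^ 'n" assume u: "u \<noteq> 0 \<and> norm u \<le> 2 * cube_radius M TYPE('n)"
    have "norm ((deriv ^^ 1) (g (norm u)) w) \<le> fact 1 * (C * weight u) / 1 ^ 1"
    proof (rule Cauchy_inequality)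
      show "g (norm u) holomorphic_on ball w 1" using g_hol[of "norm u"] u by (auto intro: holomorphic_on_subset)
      show "continuous_on (cball w 1) (g (norm u))"
        using g_hol[of "norm u"] u by (auto intro: continuous_on_subset holomorphic_on_imp_continuous_on)
      show "norm (g (norm u) x) \<le> C * weight u" if "norm (w - x) = 1" for x
        using Cw[of x] that u by (auto simp: weight_bounded_def dist_norm)
    qed simp
    moreover have "C * weight u \<le> 4 * C * weight u" using C(1) weight_nonneg[of u] by simp
    ultimately show "norm (g' u) \<le> 4 * C * weight u" by (simp add: g'_def)
  qed (use C(1) in auto)
  define c where "c = P * (2 * C) * kernel_bound M TYPE('n)"
  have "norm (conv_op M q (\<lambda>u. g (norm u) z) - conv_op M q (\<lambda>u. g (norm u) w) -
      (L2.cscale (z - w) o\<^sub>L conv_op M q g')) \<le> c * (norm (z - w))\<^sup>2" if z: "z \<in> ball w 1" for z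
  proof -
    have wz: "weight_bounded M C (\<lambda>u :: real ^ 'n. g (norm u) z)" "weight_bounded M C (\<lambda>u :: real ^ 'n. g (norm u) w)"
      using z by (auto intro!: Cw)
    have "conv_op M q (\<lambda>u. g (norm u) z) - conv_op M q (\<lambda>u. g (norm u) w) - (L2.cscale (z - w) o\<^sub>L conv_op M q g') =
        conv_op M q (\<lambda>u. g (norm u) z - g (norm u) w - (z - w) * g' u)"
      unfolding conv_op_cmult_right[OF M q g'_wb] conv_op_diff_right[OF M q wz]
      by (rule conv_op_diff_right[OF M q weight_bounded_diff[OF wz] weight_bounded_cmult[OF g'_wb]])
    also have "norm \<dots> \<le> P * (2 * C * (norm (z - w))\<^sup>2) * kernel_bound M TYPE('n)"
    proof (rule norm_conv_op_le[OF M q])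
      have [measurable]: "g' \<in> borel_measurable borel" by (rule g'_meas)
      show "weight_bounded M (2 * C * (norm (z - w))\<^sup>2) (\<lambda>u. g (norm u) z - g (norm u) w - (z - w) * g' u)"
        unfolding weight_bounded_def
      proof (intro conjI allI impI)
        show "(\<lambda>u. g (norm u) z - g (norm u) w - (z - w) * g' u) \<in> borel_measurable borel" by measurable
        fix u :: "real ^ 'n" assume "u \<noteq> 0 \<and> norm u \<le> 2 * cube_radius M TYPE('n)"
        thus "norm (g (norm u) z - g (norm u) w - (z - w) * g' u) \<le> 2 * C * (norm (z - w))\<^sup>2 * weight u"
          using quad[OF z, of u] by (simp add: mult_ac)
      qed (use C(1) in auto)
    qed
    finally show ?thesis by (simp add: c_def mult_ac)
  qed
  thus ?thesis unfolding L2.op_differentiable_def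
    by (intro exI[of _ "conv_op M q g'"] exI[of _ c] exI[of _ 1]) auto
qed

text \<open>Freezing the kernel at distance \<delta> makes it continuous, so
  \<open>conv_op_finite_rank\<close> applies. The change only concerns |u| < \<delta>, where it is
  at most 2 C \<delta>^(1/4) times the weight.\<close>

lemma finite_rank_g:
  fixes q :: "real ^ 'n \<Rightarrow> complex"
  assumes q: "cube_bounded M P q" and "\<epsilon> > 0"
  shows "\<exists>N v \<phi>. (\<forall>j<N. L2.cfunctional (\<phi> j)) \<and>
    norm (conv_op M q (\<lambda>u. g (norm u) z) - (\<Sum>j<N::nat. L2.rank1 (v j) (\<phi> j))) \<le> \<epsilon>"
proof -
  obtain C where C: "C \<ge> 0" "\<And>r z'. 0 < r \<Longrightarrow> r \<le> 2 * cube_radius M TYPE('n) \<Longrightarrow> norm z' \<le> norm z \<Longrightarrow>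
    norm (g r z') \<le> C * r powr (3/4 - real CARD('n))" by (rule g_bound_nonneg) blast
  have P: "P \<ge> 0" using q by (simp add: cube_bounded_def)
  define c where "c = P * (2 * C) * kernel_bound M TYPE('n) + 1"
  have c: "c > 0" using P C(1) kernel_bound_nonneg[of M, where 'n = 'n] by (simp add: c_def add_nonneg_pos)
  \<comment> \<open>The fourth power undoes the exponent 1/4 of the truncation error.\<close>
  define \<delta> where "\<delta> = min ((\<epsilon> / (2 * c)) ^ 4) (2 * cube_radius M TYPE('n))"
  have \<delta>: "\<delta> > 0" "\<delta> \<le> 2 * cube_radius M TYPE('n)" using c \<open>\<epsilon> > 0\<close> radius_pos by (auto simp: \<delta>_def)
  have "\<delta> powr (1/4) \<le> ((\<epsilon> / (2 * c)) ^ 4) powr (1/4)" using \<delta>(1) by (intro powr_mono2) (auto simp: \<delta>_def)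
  also have "\<dots> = \<epsilon> / (2 * c)"
  proof -
    have "y ^ 4 = y powr 4" if "y > 0" for y :: real using that by simp
    moreover have y: "\<epsilon> / (2 * c) > 0" using c \<open>\<epsilon> > 0\<close> by simp
    ultimately have "((\<epsilon> / (2 * c)) ^ 4) powr (1/4) = (\<epsilon> / (2 * c)) powr (4 * (1/4))"
      by (simp only: powr_powr)
    thus ?thesis using c \<open>\<epsilon> > 0\<close> by simp
  qed
  finally have \<delta>4: "\<delta> powr (1/4) \<le> \<epsilon> / (2 * c)" .
  define h where "h u = g (max \<delta> (norm u)) z" for u :: "real ^ 'n"
  have h_cont: "continuous_on UNIV h"
    unfolding h_def using \<delta>(1) by (intro continuous_on_compose2[OF g_cont[of z]] continuous_intros) auto
  hence h_meas[measurable]: "h \<in> borel_measurable borel" by (rule borel_measurable_continuous_onI)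
  have d: "3/4 - real CARD('n) \<le> 0"
  proof -
    have "real CARD('n) \<ge> 1" by (simp add: Suc_leI)
    thus ?thesis by linarith
  qed
  have bd: "weight_bounded M (2 * C * \<delta> powr (1/4)) (\<lambda>u. g (norm u) z - h u)"
    unfolding weight_bounded_def
  proof (intro conjI allI impI)
    fix u :: "real ^ 'n" assume u: "u \<noteq> 0 \<and> norm u \<le> 2 * cube_radius M TYPE('n)"
    show "norm (g (norm u) z - h u) \<le> 2 * C * \<delta> powr (1/4) * weight u"
    proof (cases "norm u < \<delta>")
      case True
      have "norm (g \<delta> z) \<le> C * \<delta> powr (3/4 - real CARD('n))" using C(2) \<delta> by auto
      also have "\<dots> \<le> C * norm u powr (3/4 - real CARD('n))"
        using True u C(1) by (intro mult_left_mono powr_mono2'[OF d]) auto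
      finally have "norm (g \<delta> z) \<le> C * norm u powr (3/4 - real CARD('n))" .
      moreover have "norm (g (norm u) z) \<le> C * norm u powr (3/4 - real CARD('n))" using C(2) u by auto
      moreover have "norm (g (norm u) z - h u) \<le> norm (g (norm u) z) + norm (g \<delta> z)"
        using True by (simp add: h_def norm_triangle_ineq4)
      ultimately have "norm (g (norm u) z - h u) \<le> 2 * C * (norm u powr (1/4) * weight u)"
        using u powr_weight[of u] by simp
      also have "\<dots> \<le> 2 * C * (\<delta> powr (1/4) * weight u)"
        using C(1) True by (intro mult_left_mono mult_right_mono powr_mono2) (auto simp: weight_nonneg)
      finally show ?thesis by (simp add: mult.assoc)
    next
      case False
      thus ?thesis using C(1) weight_nonneg[of u] by (simp add: h_def)
    qed
  qed (use C(1) in auto)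
  obtain N :: nat and v \<phi> where N: "\<And>j. j < N \<Longrightarrow> L2.cfunctional (\<phi> j)"
    "norm (conv_op M q h - (\<Sum>j<N. L2.rank1 (v j) (\<phi> j))) \<le> \<epsilon> / 2"
    using conv_op_finite_rank[OF M q h_cont, of "\<epsilon> / 2"] \<open>\<epsilon> > 0\<close> by auto
  obtain Cg where Cg: "\<And>z'. norm z' \<le> norm z \<Longrightarrow> weight_bounded M Cg (\<lambda>u :: real ^ 'n. g (norm u) z')"
    by (rule weight_bounded_g) blast
  have h_wb: "weight_bounded M (Cg + 2 * C * \<delta> powr (1/4)) h"
    using weight_bounded_diff[OF Cg[OF order_refl] bd] by simp
  have "conv_op M q (\<lambda>u. g (norm u) z) - conv_op M q h = conv_op M q (\<lambda>u. g (norm u) z - h u)"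
    by (rule conv_op_diff_right[OF M q Cg[OF order_refl] h_wb])
  also have "norm \<dots> \<le> P * (2 * C * \<delta> powr (1/4)) * kernel_bound M TYPE('n)" by (rule norm_conv_op_le[OF M q bd])
  also have "\<dots> = P * (2 * C) * kernel_bound M TYPE('n) * \<delta> powr (1/4)" by simp
  also have "\<dots> \<le> c * (\<epsilon> / (2 * c))" using P C(1) kernel_bound_nonneg[of M, where 'n = 'n] \<delta>4
    by (intro mult_mono) (auto simp: c_def)
  also have "\<dots> = \<epsilon> / 2" using c by simp
  finally have "norm (conv_op M q (\<lambda>u. g (norm u) z) - conv_op M q h) \<le> \<epsilon> / 2" .
  hence "norm (conv_op M q (\<lambda>u. g (norm u) z) - (\<Sum>j<N. L2.rank1 (v j) (\<phi> j))) \<le> \<epsilon>"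
    using N(2) norm_triangle_ineq[of "conv_op M q (\<lambda>u. g (norm u) z) - conv_op M q h"
        "conv_op M q h - (\<Sum>j<N. L2.rank1 (v j) (\<phi> j))"] by simp
  thus ?thesis using N(1) by (intro exI[of _ N] exI[of _ v] exI[of _ \<phi>]) simp
qed

end

context complex_structure
begin

lemma op_differentiable_small:
  assumes "op_differentiable A w" "\<epsilon> > 0"
  obtains \<delta> where "\<delta> > 0" "\<And>z. z \<in> ball w \<delta> \<Longrightarrow> norm (A z - A w) \<le> \<epsilon>"
proof -
  from assms(1) obtain D C r where r: "r > 0" and D: "\<And>z. z \<in> ball w r \<Longrightarrow>
      norm (A z - A w - (cscale (z - w) o\<^sub>L D)) \<le> C * (norm (z - w))\<^sup>2"
    unfolding op_differentiable_def by blast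
  have "((\<lambda>z. C * (norm (z - w))\<^sup>2 + norm (z - w) * norm D) \<longlongrightarrow> 0) (at w)"
    by (auto intro!: tendsto_eq_intros)
  hence "\<forall>\<^sub>F z in at w. C * (norm (z - w))\<^sup>2 + norm (z - w) * norm D < \<epsilon>"
    using assms(2) by (rule order_tendstoD)
  then obtain d where d: "d > 0" "\<And>z. z \<noteq> w \<Longrightarrow> dist z w < d \<Longrightarrow>
      C * (norm (z - w))\<^sup>2 + norm (z - w) * norm D < \<epsilon>" by (auto simp: eventually_at)
  show ?thesis
  proof (rule that[of "min r d"])
    fix z assume z: "z \<in> ball w (min r d)"
    show "norm (A z - A w) \<le> \<epsilon>"
    proof (cases "z = w")
      case False
      have cD: "norm (cscale (z - w) o\<^sub>L D) \<le> norm (z - w) * norm D"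
      proof (rule norm_blinfun_bound)
        show "norm ((cscale (z - w) o\<^sub>L D) x) \<le> norm (z - w) * norm D * norm x" for x
          using mult_left_mono[OF norm_blinfun[of D x], of "norm (z - w)"] by (simp add: norm_cscale mult.assoc)
      qed simp
      have "norm (A z - A w) \<le> norm (cscale (z - w) o\<^sub>L D) + norm (A z - A w - (cscale (z - w) o\<^sub>L D))"
        by (rule norm_triangle_sub)
      moreover have "norm (A z - A w - (cscale (z - w) o\<^sub>L D)) \<le> C * (norm (z - w))\<^sup>2"
        using z by (intro D) auto
      moreover have "C * (norm (z - w))\<^sup>2 + norm (z - w) * norm D < \<epsilon>"
        using z False by (intro d(2)) (auto simp: dist_commute)
      ultimately show ?thesis using cD by linarith
    qed (use assms(2) in simp)
  qed (use r d(1) in auto)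
qed

lemma op_differentiable_diff_const: "op_differentiable A w \<Longrightarrow> op_differentiable (\<lambda>z. A z - F) w"
  by (simp add: op_differentiable_def)

lemma clinear_op_diff: "clinear_op A \<Longrightarrow> clinear_op B \<Longrightarrow> clinear_op (A - B)"
  by (simp add: clinear_op_def blinfun.diff_left blinfun.diff_right)

lemma cscale_i: "cscale \<i> x = J x"
  by (simp add: cscale_apply)

lemma clinear_op_rank1: "cfunctional \<phi> \<Longrightarrow> clinear_op (rank1 v \<phi>)"
  by (simp add: clinear_op_def cfunctional_def rank1_apply cscale_mult cscale_i)

lemma clinear_op_sum: "(\<And>i. i \<in> I \<Longrightarrow> clinear_op (A i)) \<Longrightarrow> clinear_op (\<Sum>i\<in>I. A i)"
  by (simp add: clinear_op_def blinfun.sum_left blinfun.sum_right)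

end

context helmholtz_kernel
begin

lemma clinear_g:
  fixes q :: "real ^ 'n \<Rightarrow> complex"
  assumes "cube_bounded M P q"
  shows "L2.clinear_op (conv_op M q (\<lambda>u. g (norm u) z))"
proof -
  obtain C where C: "\<And>z'. norm z' \<le> norm z \<Longrightarrow> weight_bounded M C (\<lambda>u :: real ^ 'n. g (norm u) z')"
    by (rule weight_bounded_g) blast
  show ?thesis by (rule clinear_conv_op[OF M assms C[OF order_refl]])
qed

text \<open>The kernel separates into a function of x and one of y, so the coefficient of the pole s
  / z has rank one and fits into the finite rank formula.\<close>

lemma conv_op_1:
  fixes q :: "real ^ 'n \<Rightarrow> complex"
  assumes q: "cube_bounded M P q"
  shows "conv_op M q (\<lambda>_. 1) = L2.rank1 (abs_L2 (\<lambda>x. indicator (cube M) x * q x)) (integral_functional (cube M))"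
proof -
  obtain c where c: "weight_bounded M c (\<lambda>_ :: real ^ 'n. 1)" by (rule weight_bounded_1)
  have [measurable]: "q \<in> borel_measurable borel" using q by (simp add: cube_bounded_def)
  have sq: "square_integrable (\<lambda>x. indicator (cube M) x * q x)"
    by (rule square_integrable_bounded[of _ M P]) (use q in \<open>auto simp: cube_bounded_def indicator_def\<close>)
  have eq: "conv_kernel M q (\<lambda>_. 1) = (\<lambda>x y. (indicator (cube M) x * q x) * indicator (cube M) y)"
    by (intro ext) (simp add: conv_kernel_def)
  have "schur_kernel (\<lambda>x y. (indicator (cube M) x * q x) * indicator (cube M) y) (P * c * kernel_bound M TYPE('n))"
    using schur_conv_kernel[OF M q c] by (simp only: eq)
  from kernel_op_rank1[OF cube_borel subset_refl sq this] show ?thesis unfolding conv_op_def eq .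
qed

text \<open>Subtracting from the regular part a finite rank operator that is close to it at z0
  leaves an analytic family that is small near z0. The subtracted operator and the rank one term s /
  z together form the finite rank part in \<open>local_trichotomy\<close>.\<close>

theorem K_trichotomy:
  fixes q :: "real ^ 'n \<Rightarrow> complex"
  assumes q: "cube_bounded M P q"
  shows "(\<forall>\<^sub>F z in at z0. \<nexists>B. is_inverse (id_blinfun + K q z) B) \<or>
    (\<exists>C. \<forall>\<^sub>F z in at z0. \<exists>B. is_inverse (id_blinfun + K q z) B \<and> norm B \<le> C) \<or>
    (\<exists>c>0. \<forall>\<^sub>F z in at z0. \<exists>B. is_inverse (id_blinfun + K q z) B \<and> norm B \<ge> c / norm (z - z0))"
proof -
  let ?g = "\<lambda>z. conv_op M q (\<lambda>u. g (norm u) z)"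
  obtain N :: nat and v \<phi> where \<phi>: "\<And>j. j < N \<Longrightarrow> L2.cfunctional (\<phi> j)"
    and F: "norm (?g z0 - (\<Sum>j<N. L2.rank1 (v j) (\<phi> j))) \<le> 1/4"
    using finite_rank_g[OF q, of "1/4" z0] by auto
  define A where "A z = ?g z - (\<Sum>j<N. L2.rank1 (v j) (\<phi> j))" for z
  have A_diff: "L2.op_differentiable A w" for w
    unfolding A_def by (rule L2.op_differentiable_diff_const[OF op_differentiable_g[OF q]])
  obtain \<delta> where \<delta>: "\<delta> > 0" "\<And>z. z \<in> ball z0 \<delta> \<Longrightarrow> norm (A z - A z0) \<le> 1/4"
    by (rule L2.op_differentiable_small[OF A_diff, of "1/4" z0]) auto
  \<comment> \<open>Unless z0 = 0, the disc has to avoid the pole of s / z at 0.\<close>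
  define \<rho> where "\<rho> = (if z0 = 0 then \<delta> else min \<delta> (norm z0))"
  have \<rho>: "\<rho> > 0" "\<rho> \<le> \<delta>" using \<delta>(1) by (auto simp: \<rho>_def)
  have nz: "z \<noteq> 0" if "z \<in> ball z0 \<rho>" "z0 \<noteq> 0" for z
    using that by (auto simp: \<rho>_def dist_norm)
  \<comment> \<open>The coefficients multiplied by z - z0: it cancels in the regular terms, and in
    the last one it turns s / z into s when z0 = 0.\<close>
  define b where "b j z = (if j < N then z - z0 else if z0 = 0 then s else s * (z - z0) / z)" for j :: nat and z
  define v' where "v' j = (if j < N then v j else abs_L2 (\<lambda>x. indicator (cube M) x * q x))" for j
  define \<phi>' where "\<phi>' j = (if j < N then \<phi> j else integral_functional (cube M))" for j
  show ?thesis
  proof (rule L2.local_trichotomy[OF \<rho>(1) A_diff, of z0 "Suc N" b \<phi>' "K q" v'])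
    fix z assume z: "z \<in> ball z0 \<rho>"
    show "L2.clinear_op (A z)"
      unfolding A_def by (intro L2.clinear_op_diff clinear_g[OF q] L2.clinear_op_sum L2.clinear_op_rank1 \<phi>) auto
    have "norm (A z) \<le> norm (A z - A z0) + norm (A z0)"
      using norm_triangle_ineq[of "A z - A z0" "A z0"] by simp
    thus "norm (A z) \<le> 1/2" using \<delta>(2)[of z] z \<rho>(2) F by (auto simp: A_def)
  next
    fix j show "b j holomorphic_on ball z0 \<rho>"
      unfolding b_def using nz[of 0] by (cases "j < N"; cases "z0 = 0") (auto intro!: holomorphic_intros)
  next
    fix j show "L2.cfunctional (\<phi>' j)"
      using \<phi> by (auto simp: \<phi>'_def integral_functional_def L2.cfunctional_cinner_right)
  next
    fix z assume z: "z \<in> ball z0 \<rho> - {z0}"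
    hence z0: "z \<noteq> 0" "z - z0 \<noteq> 0" using nz by (cases "z0 = 0"; auto)+
    have "(\<Sum>j<Suc N. L2.cscale (b j z / (z - z0)) o\<^sub>L L2.rank1 (v' j) (\<phi>' j)) =
        (\<Sum>j<N. L2.rank1 (v j) (\<phi> j)) + (L2.cscale (s / z) o\<^sub>L conv_op M q (\<lambda>_. 1))"
    proof -
      have "L2.cscale (b j z / (z - z0)) o\<^sub>L L2.rank1 (v' j) (\<phi>' j) = L2.rank1 (v j) (\<phi> j)" if "j < N" for j
        using that z0 by (intro blinfun_eqI) (simp add: b_def v'_def \<phi>'_def L2.cscale_1)
      moreover have "b N z / (z - z0) = s / z" using z0 by (auto simp: b_def)
      ultimately show ?thesis by (simp add: conv_op_1[OF q] v'_def \<phi>'_def)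
    qed
    thus "K q z = A z + (\<Sum>j<Suc N. L2.cscale (b j z / (z - z0)) o\<^sub>L L2.rank1 (v' j) (\<phi>' j))"
      unfolding K_eq[OF q z0(1)] by (simp add: A_def)
  qed
qed

lemma K_continuous:
  fixes q :: "real ^ 'n \<Rightarrow> complex"
  assumes q: "cube_bounded M P q" and w: "w \<noteq> 0" and "\<epsilon> > 0"
  shows "\<forall>\<^sub>F z in nhds w. norm (K q z - K q w) \<le> \<epsilon>"
proof -
  let ?g = "\<lambda>z. conv_op M q (\<lambda>u. g (norm u) z)" and ?T = "conv_op M q (\<lambda>_. 1)"
  obtain \<delta> where \<delta>: "\<delta> > 0" "\<And>z. z \<in> ball w \<delta> \<Longrightarrow> norm (?g z - ?g w) \<le> \<epsilon> / 2"
    by (rule L2.op_differentiable_small[OF op_differentiable_g[OF q], of "\<epsilon> / 2" w]) (use \<open>\<epsilon> > 0\<close> in auto)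
  have "((\<lambda>z. norm (s / z - s / w) * norm ?T) \<longlongrightarrow> norm (s / w - s / w) * norm ?T) (nhds w)"
    using w by (intro tendsto_intros filterlim_ident)
  hence "((\<lambda>z. norm (s / z - s / w) * norm ?T) \<longlongrightarrow> 0) (nhds w)" by simp
  hence "\<forall>\<^sub>F z in nhds w. norm (s / z - s / w) * norm ?T < \<epsilon> / 2"
    by (rule order_tendstoD) (use \<open>\<epsilon> > 0\<close> in simp)
  moreover have "\<forall>\<^sub>F z in nhds w. z \<in> ball w \<delta>" using \<delta>(1) by (intro eventually_nhds_in_open) auto
  moreover have "\<forall>\<^sub>F z in nhds w. z \<in> - {0}" using w by (intro eventually_nhds_in_open) auto
  ultimately show ?thesis
  proof eventually_elim
    case (elim z)
    have "K q z - K q w = (L2.cscale (s / z - s / w) o\<^sub>L ?T) + (?g z - ?g w)"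
    proof (rule blinfun_eqI)
      fix x
      have "z \<noteq> 0" using elim(3) by simp
      show "(K q z - K q w) x = ((L2.cscale (s / z - s / w) o\<^sub>L ?T) + (?g z - ?g w)) x"
        unfolding K_eq[OF q \<open>z \<noteq> 0\<close>] K_eq[OF q w]
        by (simp only: blinfun.add_left blinfun.diff_left L2.cscale_diff blinfun_apply_blinfun_compose) simp
    qed
    hence "norm (K q z - K q w) \<le> norm (L2.cscale (s / z - s / w) o\<^sub>L ?T) + norm (?g z - ?g w)"
      by (simp only: norm_triangle_ineq)
    moreover have "norm (L2.cscale (s / z - s / w) o\<^sub>L ?T) \<le> norm (s / z - s / w) * norm ?T"
    proof (rule norm_blinfun_bound)
      show "norm ((L2.cscale (s / z - s / w) o\<^sub>L ?T) x) \<le> norm (s / z - s / w) * norm ?T * norm x" for x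
        using mult_left_mono[OF norm_blinfun[of ?T x], of "norm (s / z - s / w)"]
        by (simp add: L2.norm_cscale mult.assoc)
    qed simp
    ultimately show ?case using elim(1) \<delta>(2)[OF elim(2)] by linarith
  qed
qed

lemma K_lipschitz:
  obtains C where "C \<ge> 0" "\<And>p q :: real ^ 'n \<Rightarrow> complex. \<And>P Q \<eta> z. cube_bounded M P p \<Longrightarrow> cube_bounded M Q q \<Longrightarrow>
    (\<And>x. norm (p x - q x) \<le> \<eta>) \<Longrightarrow> z \<noteq> 0 \<Longrightarrow> norm z \<le> Z \<Longrightarrow> norm (K p z - K q z) \<le> \<eta> * C / norm z"
proof -
  obtain C where C: "C \<ge> 0" "\<And>z. z \<noteq> 0 \<Longrightarrow> norm z \<le> Z \<Longrightarrow> weight_bounded M (C / norm z) (\<lambda>u. G u z)"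
    by (rule weight_bounded_G) blast
  show ?thesis
  proof (rule that[of "C * kernel_bound M TYPE('n)"])
    show "C * kernel_bound M TYPE('n) \<ge> 0" using C(1) kernel_bound_nonneg[of M, where 'n = 'n] by simp
    fix p q :: "real ^ 'n \<Rightarrow> complex" and P Q \<eta> :: real and z :: complex
    assume p: "cube_bounded M P p" and q: "cube_bounded M Q q" and \<eta>: "\<And>x. norm (p x - q x) \<le> \<eta>"
      and z: "z \<noteq> 0" "norm z \<le> Z"
    have "cube_bounded M \<eta> (\<lambda>x. p x - q x)"
      using p q \<eta> order_trans[OF norm_ge_zero \<eta>] by (auto simp: cube_bounded_def)
    from norm_conv_op_le[OF M this C(2)[OF z]]
    show "norm (K p z - K q z) \<le> \<eta> * (C * kernel_bound M TYPE('n)) / norm z"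
      unfolding conv_op_diff_left[OF M p q C(2)[OF z]] by simp
  qed
qed

end

section \<open>Bessel functions and the fundamental solution\<close>

text \<open>\<open>J\<^sub>\<nu>(z) = (z/2)\<^sup>\<nu> S\<^sub>\<nu>(z\<^sup>2/4)\<close>, where \<open>S\<^sub>\<nu>(s)\<close> is entire in both variables.\<close>

definition bessel_S :: "complex \<Rightarrow> complex \<Rightarrow> complex" where
  "bessel_S \<nu> s = (\<Sum>k. (- s) ^ k / fact k * rGamma (\<nu> + of_nat k + 1))"

text \<open>For small k this is compactness. Beyond k0 \<ge> R + 1, each step divides 1 /
  \<Gamma>(z) by a z of modulus at least 1, so the values do not grow.\<close>

lemma rGamma_uniform_bound:
  obtains C where "C \<ge> 0" "\<And>\<nu> k. norm \<nu> \<le> R \<Longrightarrow> norm (rGamma (\<nu> + of_nat k + 1 :: complex)) \<le> C"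
proof -
  obtain k0 :: nat where k0: "R + 1 \<le> real k0" using real_arch_simple by blast
  have "compact (rGamma ` cball (0 :: complex) (R + real k0 + 1))"
    by (intro compact_continuous_image continuous_on_rGamma) auto
  from compact_imp_bounded[OF this] obtain C where
    C: "C > 0" "\<And>z :: complex. norm z \<le> R + real k0 + 1 \<Longrightarrow> norm (rGamma z) \<le> C"
    unfolding bounded_pos by auto
  have "norm (rGamma (\<nu> + of_nat k + 1)) \<le> C" if \<nu>: "norm \<nu> \<le> R" for \<nu> :: complex and k
  proof (cases "k \<le> k0")
    case True
    have "norm (\<nu> + of_nat k + 1) \<le> norm \<nu> + real k + 1"
      by (rule order_trans[OF norm_triangle_ineq]) (use norm_triangle_ineq[of \<nu> "of_nat k"] in simp)
    thus ?thesis using True \<nu> by (intro C(2)) linarith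
  next
    case False
    hence "k0 \<le> k" by simp
    thus ?thesis
    proof (induction k rule: dec_induct)
      case base
      have "norm (\<nu> + of_nat k0 + 1) \<le> norm \<nu> + real k0 + 1"
        by (rule order_trans[OF norm_triangle_ineq]) (use norm_triangle_ineq[of \<nu> "of_nat k0"] in simp)
      thus ?case using \<nu> by (intro C(2)) linarith
    next
      case (step k)
      let ?z = "\<nu> + of_nat k + 1"
      have "real k + 1 = norm (of_nat k + 1 :: complex)"
        using norm_of_nat[of "Suc k", where 'a = complex] by (simp add: add.commute)
      also have "\<dots> \<le> norm ?z + norm \<nu>" using norm_triangle_ineq4[of ?z \<nu>] by (simp add: algebra_simps)
      finally have "1 \<le> norm ?z" using k0 step(1) \<nu> by linarith
      hence "norm (rGamma (?z + 1)) \<le> norm ?z * norm (rGamma (?z + 1))"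
        using mult_right_mono[of 1 "norm ?z" "norm (rGamma (?z + 1))"] by simp
      also have "\<dots> = norm (rGamma ?z)" by (simp only: norm_mult[symmetric] rGamma_plus1)
      finally show ?case using step(3) by (simp add: algebra_simps)
    qed
  qed
  thus ?thesis using C(1) by (intro that[of C]) auto
qed

lemma summable_bessel_S: "summable (\<lambda>k. (- s :: complex) ^ k / fact k * rGamma (\<nu> + of_nat k + 1))"
proof -
  obtain C where C: "C \<ge> 0" "\<And>(\<mu> :: complex) k. norm \<mu> \<le> norm \<nu> \<Longrightarrow> norm (rGamma (\<mu> + of_nat k + 1)) \<le> C"
    by (rule rGamma_uniform_bound) blast
  show ?thesis
  proof (rule summable_comparison_test'[of _ 0])
    show "summable (\<lambda>k. C * (norm s ^ k / fact k))"
      using summable_mult[OF summable_exp[of "norm s"], of C] by (simp add: field_simps)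
    show "norm ((- s) ^ k / fact k * rGamma (\<nu> + of_nat k + 1)) \<le> C * (norm s ^ k / fact k)" for k
      using mult_right_mono[OF C(2)[of \<nu> k], of "norm s ^ k / fact k"]
      by (simp add: norm_mult norm_divide norm_power mult.commute)
  qed
qed

lemma bessel_S_sums: "(\<lambda>k. (- s) ^ k / fact k * rGamma (\<nu> + of_nat k + 1)) sums bessel_S \<nu> s"
  unfolding bessel_S_def by (rule summable_sums[OF summable_bessel_S])

lemma bessel_J_eq: "bessel_J \<nu> w = exp (\<nu> * (w - of_real (ln 2))) * bessel_S \<nu> (exp (2 * (w - of_real (ln 2))))"
proof -
  let ?\<omega> = "w - of_real (ln 2)"
  have "(-1) ^ k / fact k * rGamma (\<nu> + of_nat k + 1) * exp ((\<nu> + 2 * of_nat k) * ?\<omega>) =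
      exp (\<nu> * ?\<omega>) * ((- exp (2 * ?\<omega>)) ^ k / fact k * rGamma (\<nu> + of_nat k + 1))" for k
  proof -
    have "exp ((\<nu> + 2 * of_nat k) * ?\<omega>) = exp (\<nu> * ?\<omega>) * exp (of_nat k * (2 * ?\<omega>))"
      by (simp only: exp_add[symmetric]) (simp add: algebra_simps)
    also have "exp (of_nat k * (2 * ?\<omega>)) = exp (2 * ?\<omega>) ^ k" by (rule exp_of_nat_mult)
    finally show ?thesis by (simp only: power_minus[of "exp (2 * ?\<omega>)"]) (simp only: mult_ac times_divide_eq_left times_divide_eq_right)
  qed
  hence "bessel_J \<nu> w = (\<Sum>k. exp (\<nu> * ?\<omega>) * ((- exp (2 * ?\<omega>)) ^ k / fact k * rGamma (\<nu> + of_nat k + 1)))"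
    by (simp only: bessel_J_def)
  also have "\<dots> = exp (\<nu> * ?\<omega>) * bessel_S \<nu> (exp (2 * ?\<omega>))"
    unfolding bessel_S_def by (rule suminf_mult[OF summable_bessel_S])
  finally show ?thesis .
qed

text \<open>Comparison of coefficients: 1 / \<Gamma>(\<nu> + k) = (\<nu> + k) / \<Gamma>(\<nu> + k +
  1), and the part with the factor k is the series of order \<nu> + 1, shifted by one index.\<close>

lemma bessel_S_recurrence: "bessel_S (\<nu> - 1) s + s * bessel_S (\<nu> + 1) s = \<nu> * bessel_S \<nu> s"
proof -
  define c where "c k = (- s) ^ k / fact k * (of_nat k * rGamma (\<nu> + of_nat k + 1))" for k
  have "(\<lambda>k. c (Suc k)) sums (- s * bessel_S (\<nu> + 1) s)"
  proof -
    have "c (Suc k) = - s * ((- s) ^ k / fact k * rGamma (\<nu> + 1 + of_nat k + 1))" for k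
    proof -
      have "(fact (Suc k) :: complex) = of_nat (Suc k) * fact k" by (rule fact_Suc)
      moreover have "1 + of_nat k \<noteq> (0 :: complex)" using of_nat_neq_0[of k, where 'a = complex] by simp
      moreover have "\<nu> + of_nat (Suc k) + 1 = \<nu> + 1 + of_nat k + 1" by simp
      moreover have "- s * p / (a * F) * (a * r) = - s * (p / F * r)" if "a \<noteq> 0" for a p F r :: complex
        using that by simp
      ultimately show ?thesis unfolding c_def power_Suc by (simp only: of_nat_Suc not_False_eq_True)
    qed
    thus ?thesis using sums_mult[OF bessel_S_sums[of s "\<nu> + 1"], of "- s"] by simp
  qed
  hence c: "c sums (- s * bessel_S (\<nu> + 1) s)" using sums_Suc[of c] by (simp add: c_def)
  have "(- s) ^ k / fact k * rGamma (\<nu> - 1 + of_nat k + 1) =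
      \<nu> * ((- s) ^ k / fact k * rGamma (\<nu> + of_nat k + 1)) + c k" for k
  proof -
    have "x * ((\<nu> + of_nat k) * r) = \<nu> * (x * r) + x * (of_nat k * r)" for x r :: complex
      by (simp add: algebra_simps)
    moreover have "rGamma (\<nu> - 1 + of_nat k + 1) = (\<nu> + of_nat k) * rGamma (\<nu> + of_nat k + 1)"
      by (simp add: rGamma_plus1)
    ultimately show ?thesis unfolding c_def by (simp only:)
  qed
  hence "bessel_S (\<nu> - 1) s = \<nu> * bessel_S \<nu> s + - s * bessel_S (\<nu> + 1) s"
    using sums_unique[OF sums_add[OF sums_mult[OF bessel_S_sums[of s \<nu>], of \<nu>] c]] unfolding bessel_S_def
    by simp
  thus ?thesis by (simp add: algebra_simps)
qed

lemma exp_of_real_ln_2 [simp]: "exp (complex_of_real (ln 2)) = 2"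
  by (simp add: exp_of_real)

lemma bessel_J_recurrence: "bessel_J (\<nu> - 1) w + bessel_J (\<nu> + 1) w = 2 * \<nu> * exp (- w) * bessel_J \<nu> w"
proof -
  let ?\<omega> = "w - of_real (ln 2)" and ?s = "exp (2 * (w - of_real (ln 2)))"
  have e1: "exp ((\<nu> - 1) * ?\<omega>) = exp (\<nu> * ?\<omega>) * exp (- ?\<omega>)"
    by (simp only: exp_add[symmetric]) (simp add: algebra_simps)
  have e2: "exp ((\<nu> + 1) * ?\<omega>) = exp (\<nu> * ?\<omega>) * exp (- ?\<omega>) * ?s"
    by (simp only: exp_add[symmetric]) (simp add: algebra_simps)
  have e3: "exp (- ?\<omega>) = 2 * exp (- w)"
    by (simp add: exp_diff exp_minus field_simps)
  have "bessel_J (\<nu> - 1) w + bessel_J (\<nu> + 1) w =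
      exp (\<nu> * ?\<omega>) * exp (- ?\<omega>) * (bessel_S (\<nu> - 1) ?s + ?s * bessel_S (\<nu> + 1) ?s)"
    unfolding bessel_J_eq e1 e2 by (simp add: algebra_simps)
  also have "\<dots> = 2 * \<nu> * exp (- w) * bessel_J \<nu> w"
    unfolding bessel_S_recurrence e3 bessel_J_eq by simp
  finally show ?thesis .
qed

text \<open>Instances of the duplication formula. They turn the series of orders - 1/2 and 1/2 into
  those of cosine and sine.\<close>

lemma rGamma_half_fact:
  "rGamma (of_nat k + 1/2 :: complex) / fact k = rGamma (1/2) * 4 ^ k / fact (2 * k)"
  "rGamma (of_nat k + 3/2 :: complex) / fact k = 2 * rGamma (1/2) * 4 ^ k / fact (2 * k + 1)"
proof -
  show 1: "rGamma (of_nat k + 1/2 :: complex) / fact k = rGamma (1/2) * 4 ^ k / fact (2 * k)" for k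
  proof (induction k)
    case (Suc k)
    have nz: "(2 * of_nat k + 1 :: complex) \<noteq> 0" "(1 + of_nat k :: complex) \<noteq> 0"
      using of_nat_neq_0[of "2 * k", where 'a = complex] of_nat_neq_0[of k, where 'a = complex]
      by (simp_all add: add.commute)
    have "(of_nat k + 1/2 :: complex) * rGamma (of_nat (Suc k) + 1/2) = rGamma (of_nat k + 1/2)"
      using rGamma_plus1[of "of_nat k + 1/2 :: complex"] by (simp add: algebra_simps)
    moreover have "(of_nat k + 1/2 :: complex) = (2 * of_nat k + 1) / 2" by (simp add: field_simps)
    ultimately have "rGamma (of_nat (Suc k) + 1/2 :: complex) = 2 * rGamma (of_nat k + 1/2) / (2 * of_nat k + 1)"
      using nz(1) by (simp add: field_simps)
    hence "rGamma (of_nat (Suc k) + 1/2 :: complex) / fact (Suc k) =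
        2 / ((2 * of_nat k + 1) * (1 + of_nat k)) * (rGamma (of_nat k + 1/2) / fact k)"
      by (simp add: mult_ac)
    also have "\<dots> = rGamma (1/2) * 4 ^ Suc k / fact (2 * Suc k)"
    proof -
      have "2 / (a * b) * (r * p / F) = r * (4 * p) / (2 * b * a * F)"
        if "a \<noteq> 0" "b \<noteq> 0" "F \<noteq> 0" for a b r p F :: complex
        using that by (simp add: field_simps)
      moreover have "(fact (2 * Suc k) :: complex) = 2 * (1 + of_nat k) * (2 * of_nat k + 1) * fact (2 * k)"
        by (simp add: algebra_simps)
      ultimately show ?thesis unfolding Suc power_Suc using nz by (simp only: not_False_eq_True fact_nonzero)
    qed
    finally show ?case .
  qed simp
  have nz: "(2 * of_nat k + 1 :: complex) \<noteq> 0"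
    using of_nat_neq_0[of "2 * k", where 'a = complex] by (simp add: add.commute)
  have "(of_nat k + 1/2 :: complex) * rGamma (of_nat k + 3/2) = rGamma (of_nat k + 1/2)"
    using rGamma_plus1[of "of_nat k + 1/2 :: complex"] by (simp add: algebra_simps)
  moreover have "(of_nat k + 1/2 :: complex) = (2 * of_nat k + 1) / 2" by (simp add: field_simps)
  ultimately have "rGamma (of_nat k + 3/2 :: complex) = 2 * rGamma (of_nat k + 1/2) / (2 * of_nat k + 1)"
    using nz by (simp add: field_simps)
  hence "rGamma (of_nat k + 3/2 :: complex) / fact k = 2 / (2 * of_nat k + 1) * (rGamma (of_nat k + 1/2) / fact k)"
    by simp
  also have "\<dots> = 2 * rGamma (1/2) * 4 ^ k / fact (2 * k + 1)" unfolding 1 by (simp add: mult_ac)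
  finally show "rGamma (of_nat k + 3/2 :: complex) / fact k = 2 * rGamma (1/2) * 4 ^ k / fact (2 * k + 1)" .
qed

lemma cos_sums_complex: "(\<lambda>n. (- 1) ^ n / fact (2 * n) * x ^ (2 * n)) sums cos (x :: complex)"
proof -
  have "(\<lambda>n. \<Sum>k = n * 2..<n * 2 + 2. cos_coeff k *\<^sub>R x ^ k) sums cos x"
    by (rule sums_group[OF cos_converges]) simp
  thus ?thesis by (simp add: cos_coeff_def scaleR_conv_of_real mult.commute)
qed

lemma sin_sums_complex: "(\<lambda>n. (- 1) ^ n / fact (2 * n + 1) * x ^ (2 * n + 1)) sums sin (x :: complex)"
proof -
  have "(\<lambda>n. \<Sum>k = n * 2..<n * 2 + 2. sin_coeff k *\<^sub>R x ^ k) sums sin x"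
    by (rule sums_group[OF sin_converges]) simp
  thus ?thesis by (simp add: sin_coeff_def scaleR_conv_of_real mult.commute)
qed

lemma bessel_S_minus_half: "bessel_S (- 1/2) (x\<^sup>2 / 4) = rGamma (1/2) * cos x"
proof -
  have "(- (x\<^sup>2 / 4)) ^ k / fact k * rGamma (- 1/2 + of_nat k + 1) =
      rGamma (1/2) * ((- 1) ^ k / fact (2 * k) * x ^ (2 * k))" for k
  proof -
    have "(- (x\<^sup>2 / 4)) ^ k / fact k * rGamma (- 1/2 + of_nat k + 1) =
        (- (x\<^sup>2 / 4)) ^ k * (rGamma (of_nat k + 1/2) / fact k)" by (simp add: algebra_simps)
    also have "\<dots> = rGamma (1/2) * ((- 1) ^ k / fact (2 * k) * x ^ (2 * k))"
      unfolding rGamma_half_fact by (simp add: power_minus[of "x\<^sup>2 / 4"] power_divide power_mult)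
    finally show ?thesis .
  qed
  thus ?thesis
    unfolding bessel_S_def using sums_unique[OF sums_mult[OF cos_sums_complex[of x], of "rGamma (1/2)"]] by simp
qed

lemma bessel_S_half: "x * bessel_S (1/2) (x\<^sup>2 / 4) = 2 * rGamma (1/2) * sin x"
proof -
  have "x * ((- (x\<^sup>2 / 4)) ^ k / fact k * rGamma (1/2 + of_nat k + 1)) =
      2 * rGamma (1/2) * ((- 1) ^ k / fact (2 * k + 1) * x ^ (2 * k + 1))" for k
  proof -
    have "x * ((- (x\<^sup>2 / 4)) ^ k / fact k * rGamma (1/2 + of_nat k + 1)) =
        x * (- (x\<^sup>2 / 4)) ^ k * (rGamma (of_nat k + 3/2) / fact k)" by (simp add: algebra_simps)
    also have "\<dots> = 2 * rGamma (1/2) * ((- 1) ^ k / fact (2 * k + 1) * x ^ (2 * k + 1))"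
      unfolding rGamma_half_fact
      by (simp add: power_minus[of "x\<^sup>2 / 4"] power_divide power_mult del: fact_Suc)
    finally show ?thesis .
  qed
  moreover have "x * bessel_S (1/2) (x\<^sup>2 / 4) = (\<Sum>k. x * ((- (x\<^sup>2 / 4)) ^ k / fact k * rGamma (1/2 + of_nat k + 1)))"
    unfolding bessel_S_def by (rule suminf_mult[symmetric, OF summable_bessel_S])
  ultimately show ?thesis
    using sums_unique[OF sums_mult[OF sin_sums_complex[of x], of "2 * rGamma (1/2)"]] by simp
qed

section \<open>Hankel functions of half-integer order\<close>

text \<open>At order \<nu> = m + 1/2 the cosine in the definition of Y vanishes and the sine is
  (-1)^m, so Y is - (-1)^m times the function J of order - \<nu>.\<close>

definition hankel_half :: "nat \<Rightarrow> complex \<Rightarrow> complex" where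
  "hankel_half m w = bessel_J (of_nat m + 1/2) w - \<i> * (- 1) ^ m * bessel_J (- (of_nat m + 1/2)) w"

lemma half_not_int: "(of_nat m + 1/2 :: complex) \<notin> \<int>"
proof
  assume "(of_nat m + 1/2 :: complex) \<in> \<int>"
  then obtain k where "(of_nat m + 1/2 :: complex) = of_int k" by (auto elim: Ints_cases)
  hence "Re (of_nat m + 1/2 :: complex) = Re (of_int k :: complex)" by (rule arg_cong)
  hence "real m + 1/2 = real_of_int k" by simp
  hence "2 * int m + 1 = 2 * k" by linarith
  thus False by presburger
qed

lemma hankel_H1_half: "hankel_H1 (of_nat m + 1/2) w = hankel_half m w"
proof -
  have "of_real pi * (of_nat m + 1/2 :: complex) = of_real (pi * (real m + 1/2))" by simp
  moreover have "cos (pi * (real m + 1/2)) = 0"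
    by (simp add: distrib_left cos_add mult.commute[of pi])
  moreover have "sin (pi * (real m + 1/2)) = (- 1) ^ m"
    by (simp add: distrib_left sin_add mult.commute[of pi])
  ultimately have "cos (of_real pi * (of_nat m + 1/2 :: complex)) = 0"
    "sin (of_real pi * (of_nat m + 1/2 :: complex)) = (- 1) ^ m"
    by (simp_all only: cos_of_real sin_of_real of_real_0 of_real_power of_real_minus of_real_1)
  moreover have "(- 1 :: complex) ^ m * (- 1) ^ m = 1" by (simp flip: power_mult_distrib)
  ultimately show ?thesis
    using half_not_int[of m] by (simp add: hankel_H1_def bessel_Y_def hankel_half_def Let_def field_simps)
qed

lemma hankel_half_recurrence:
  "hankel_half (Suc (Suc m)) w = (2 * of_nat m + 3) * exp (- w) * hankel_half (Suc m) w - hankel_half m w"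
proof -
  let ?\<nu> = "of_nat m + 3/2 :: complex"
  have eqs: "of_nat (Suc (Suc m)) + 1/2 = ?\<nu> + 1" "of_nat (Suc m) + 1/2 = ?\<nu>" "of_nat m + 1/2 = ?\<nu> - 1"
    "- (?\<nu> + 1) = - ?\<nu> - 1" "- (?\<nu> - 1) = - ?\<nu> + 1" by (simp_all add: field_simps)
  have r1: "bessel_J (?\<nu> + 1) w = 2 * ?\<nu> * exp (- w) * bessel_J ?\<nu> w - bessel_J (?\<nu> - 1) w"
    using bessel_J_recurrence[of ?\<nu> w] by (simp only: eq_diff_eq add.commute)
  have r2: "bessel_J (- ?\<nu> - 1) w = 2 * (- ?\<nu>) * exp (- w) * bessel_J (- ?\<nu>) w - bessel_J (- ?\<nu> + 1) w"
    using bessel_J_recurrence[of "- ?\<nu>" w] by (simp only: eq_diff_eq add.commute)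
  have "2 * ?\<nu> = 2 * of_nat m + 3" by simp
  thus ?thesis
    unfolding hankel_half_def eqs r1 r2 by (simp add: algebra_simps)
qed

lemma hankel_half_0: "hankel_half 0 w = - \<i> * rGamma (1/2) * exp (of_real (ln 2) / 2) * exp (- w / 2) * exp (\<i> * exp w)"
proof -
  let ?\<omega> = "w - of_real (ln 2)"
  have s: "exp (2 * ?\<omega>) = (exp w)\<^sup>2 / 4"
  proof -
    have "exp (2 * ?\<omega>) = (exp ?\<omega>)\<^sup>2" by (rule exp_double)
    also have "exp ?\<omega> = exp w / 2" by (simp add: exp_diff)
    finally show ?thesis by (simp add: power_divide)
  qed
  have e: "exp (1/2 * ?\<omega>) = exp (- 1/2 * ?\<omega>) * (exp w / 2)"
  proof -
    have "exp w / 2 = exp ?\<omega>" by (simp add: exp_diff)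
    thus ?thesis by (simp only: exp_add[symmetric]) (simp add: algebra_simps)
  qed
  have "bessel_J (1/2) w = exp (- 1/2 * ?\<omega>) / 2 * (exp w * bessel_S (1/2) ((exp w)\<^sup>2 / 4))"
    unfolding bessel_J_eq s e by simp
  also have "\<dots> = exp (- 1/2 * ?\<omega>) * (rGamma (1/2) * sin (exp w))"
    unfolding bessel_S_half by simp
  finally have 1: "bessel_J (1/2) w = exp (- 1/2 * ?\<omega>) * (rGamma (1/2) * sin (exp w))" .
  have 2: "bessel_J (- 1/2) w = exp (- 1/2 * ?\<omega>) * (rGamma (1/2) * cos (exp w))"
    unfolding bessel_J_eq s bessel_S_minus_half ..
  have 3: "exp (- 1/2 * ?\<omega>) = exp (of_real (ln 2) / 2) * exp (- w / 2)"
    by (simp only: exp_add[symmetric]) (simp add: algebra_simps)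
  have "hankel_half 0 w = exp (- 1/2 * ?\<omega>) * rGamma (1/2) * (- \<i>) * (cos (exp w) + \<i> * sin (exp w))"
    using 1 2 by (simp add: hankel_half_def algebra_simps)
  also have "cos (exp w) + \<i> * sin (exp w) = exp (\<i> * exp w)" by (simp add: exp_Euler)
  finally show ?thesis unfolding 3 by (simp add: mult_ac)
qed

lemma hankel_half_1: "hankel_half 1 w = (exp (- w) - \<i>) * hankel_half 0 w"
proof -
  have r1: "bessel_J (1/2 + 1) w = 2 * (1/2) * exp (- w) * bessel_J (1/2) w - bessel_J (1/2 - 1) w"
    using bessel_J_recurrence[of "1/2" w] by (simp only: eq_diff_eq add.commute)
  have r2: "bessel_J (- (1/2) - 1) w = 2 * (- (1/2)) * exp (- w) * bessel_J (- (1/2)) w - bessel_J (- (1/2) + 1) w"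
    using bessel_J_recurrence[of "- (1/2)" w] by (simp only: eq_diff_eq add.commute)
  have eqs: "of_nat 1 + 1/2 = (1/2 + 1 :: complex)" "- (1/2 + 1) = (- (1/2) - 1 :: complex)" by simp_all
  have eqs2: "(1/2 - 1 :: complex) = - (1/2)" "(- (1/2) + 1 :: complex) = 1/2" by simp_all
  show ?thesis
    unfolding hankel_half_def eqs r1 r2 eqs2 by (simp add: algebra_simps)
qed

text \<open>H(z) is - \<i> z^(- m - 1/2) exp (\<i> z) Q(z), where the polynomials satisfy Q_(m+2) =
  (2 m + 3) Q_(m+1) - z^2 Q_m. On the positive imaginary axis - z^2 is nonnegative, so positivity
  there is inherited; it provides the lower bound on the fundamental solution in odd
  dimensions.\<close>

lemma hankel_half_eq:
  "\<exists>Q. (\<forall>w. hankel_half m w = - \<i> * exp (- (of_nat m + 1/2) * w) * exp (\<i> * exp w) * poly Q (exp w)) \<and>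
    (\<forall>x\<ge>0. \<exists>y>0. poly Q (\<i> * of_real x) = of_real y)"
proof -
  define c :: real where "c = rGamma (1/2) * exp (ln 2 / 2)"
  have c: "c > 0" by (simp add: c_def rGamma_inverse_Gamma)
  have "rGamma (1/2 :: complex) = of_real (rGamma (1/2))" by (simp add: rGamma_complex_of_real[symmetric])
  moreover have "exp (of_real (ln 2) / 2 :: complex) = of_real (exp (ln 2 / 2))" by (simp add: exp_of_real[symmetric])
  ultimately have h0: "hankel_half 0 w = - \<i> * exp (- w / 2) * exp (\<i> * exp w) * of_real c" for w
    by (simp add: hankel_half_0 c_def mult_ac)
  show ?thesis
  proof (induction m rule: induct_nat_012)
    case 0
    show ?case
      using c by (intro exI[of _ "[:of_real c:]"]) (auto simp: h0)
  next
    case 1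
    show ?case
    proof (intro exI[of _ "Polynomial.smult (of_real c) [:1, - \<i>:]"] conjI allI impI)
      fix w :: complex
      have e: "exp (- (of_nat (Suc 0) + 1/2) * w) = exp (- w / 2) * exp (- w)"
        by (simp only: exp_add[symmetric]) (simp add: algebra_simps)
      show "hankel_half (Suc 0) w = - \<i> * exp (- (of_nat (Suc 0) + 1/2) * w) * exp (\<i> * exp w) *
          poly (Polynomial.smult (of_real c) [:1, - \<i>:]) (exp w)"
      proof -
        have "- \<i> * (exp (- w / 2) * exp (- w)) * exp (\<i> * exp w) * (of_real c * (1 - \<i> * exp w)) =
            - \<i> * exp (- w / 2) * exp (\<i> * exp w) * of_real c * (exp (- w) - \<i> * (exp (- w) * exp w))"
          by (simp only: algebra_simps mult_1_left)
        also have "exp (- w) * exp w = 1" by (simp add: exp_minus)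
        finally show ?thesis
          using hankel_half_1[of w] c unfolding e h0 by (simp add: mult_ac right_diff_distrib)
      qed
    next
      fix x :: real assume "x \<ge> 0"
      thus "\<exists>y>0. poly (Polynomial.smult (of_real c) [:1, - \<i>:]) (\<i> * of_real x) = of_real y"
        using c by (intro exI[of _ "c * (1 + x)"]) (auto simp: algebra_simps intro!: add_pos_nonneg)
    qed
  next
    case (ge2 m)
    obtain P where P: "\<And>w. hankel_half m w = - \<i> * exp (- (of_nat m + 1/2) * w) * exp (\<i> * exp w) * poly P (exp w)"
      "\<And>x. x \<ge> 0 \<Longrightarrow> \<exists>y>0. poly P (\<i> * of_real x) = of_real y" using ge2(1) by blast
    obtain Q where Q: "\<And>w. hankel_half (Suc m) w = - \<i> * exp (- (of_nat (Suc m) + 1/2) * w) * exp (\<i> * exp w) * poly Q (exp w)"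
      "\<And>x. x \<ge> 0 \<Longrightarrow> \<exists>y>0. poly Q (\<i> * of_real x) = of_real y" using ge2(2) by blast
    show ?case
    proof (intro exI[of _ "Polynomial.smult (2 * of_nat m + 3) Q - [:0, 0, 1:] * P"] conjI allI impI)
      fix w :: complex
      have e: "exp (- (of_nat (Suc m) + 1/2) * w) = exp (- (of_nat (Suc (Suc m)) + 1/2) * w) * exp w"
        "exp (- (of_nat m + 1/2) * w) = exp (- (of_nat (Suc (Suc m)) + 1/2) * w) * (exp w * exp w)"
        by (simp_all only: exp_add[symmetric]) (simp_all add: algebra_simps)
      show "hankel_half (Suc (Suc m)) w = - \<i> * exp (- (of_nat (Suc (Suc m)) + 1/2) * w) * exp (\<i> * exp w) *
          poly (Polynomial.smult (2 * of_nat m + 3) Q - [:0, 0, 1:] * P) (exp w)"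
      proof -
        have "a * x * (- \<i> * (H * y) * E * q) - - \<i> * (H * (y * y)) * E * p = - \<i> * H * E * (a * q - y * y * p)"
          if "x * y = 1" for a x y H E p q
        proof -
          have "a * x * (- \<i> * (H * y) * E * q) = - \<i> * H * E * (a * q) * (x * y)" by (simp add: mult_ac)
          thus ?thesis unfolding that by (simp add: algebra_simps)
        qed
        moreover have "exp (- w) * exp w = 1" by (simp add: exp_minus)
        moreover have "poly (Polynomial.smult (2 * of_nat m + 3) Q - [:0, 0, 1:] * P) (exp w) =
            (2 * of_nat m + 3) * poly Q (exp w) - exp w * exp w * poly P (exp w)" by simp
        ultimately show ?thesis unfolding hankel_half_recurrence P(1) Q(1) e by (simp only:)
      qed
    next
      fix x :: real assume "x \<ge> 0"
      with P(2) Q(2) obtain y y' where y: "y > 0" "y' > 0" "poly P (\<i> * of_real x) = of_real y" "poly Q (\<i> * of_real x) = of_real y'"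
        by blast
      show "\<exists>y>0. poly (Polynomial.smult (2 * of_nat m + 3) Q - [:0, 0, 1:] * P) (\<i> * of_real x) = of_real y"
      proof (intro exI conjI)
        show "0 < (2 * real m + 3) * y' + x\<^sup>2 * y" using y by (intro add_pos_nonneg) auto
        show "poly (Polynomial.smult (2 * of_nat m + 3) Q - [:0, 0, 1:] * P) (\<i> * of_real x) = of_real ((2 * real m + 3) * y' + x\<^sup>2 * y)"
          using y by (simp add: algebra_simps power2_eq_square)
      qed
    qed
  qed
qed

section \<open>Hankel functions of integer order\<close>

lemma holomorphic_exponential_series:
  fixes c :: "nat \<Rightarrow> complex"
  assumes "\<And>k. norm (c k) \<le> C"
  shows "(\<lambda>s. \<Sum>k. (- s) ^ k / fact k * c k) holomorphic_on UNIV"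
proof -
  have "(\<lambda>s. \<Sum>k. (- s) ^ k / fact k * c k) field_differentiable (at z)" for z
  proof -
    define h where "h k = C * (inverse (fact k) * (norm z + 1) ^ k)" for k
    have hs: "summable h" unfolding h_def by (intro summable_mult summable_exp)
    have "norm ((- s) ^ k / fact k * c k) \<le> h k" if "s \<in> ball 0 (norm z + 1)" for s k
    proof -
      have "norm ((- s) ^ k / fact k * c k) = inverse (fact k) * norm s ^ k * norm (c k)"
        by (simp add: norm_mult norm_divide norm_power field_simps)
      also have "\<dots> \<le> inverse (fact k) * (norm z + 1) ^ k * C"
        using that assms[of k] by (intro mult_mono power_mono) auto
      finally show ?thesis by (simp add: h_def mult_ac)
    qed
    hence hb: "\<forall>\<^sub>F k in sequentially. \<forall>s\<in>ball 0 (norm z + 1). norm ((- s) ^ k / fact k * c k) \<le> h k" by simp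
    have hd: "((\<lambda>s. (- s) ^ k / fact k * c k) has_field_derivative
        - (of_nat k * (- s) ^ (k - 1)) / fact k * c k) (at s)" for k s
      by (auto intro!: derivative_eq_intros)
    obtain g g' where g: "\<forall>s\<in>ball 0 (norm z + 1). (\<lambda>k. (- s) ^ k / fact k * c k) sums g s \<and>
        (\<lambda>k. - (of_nat k * (- s) ^ (k - 1)) / fact k * c k) sums g' s \<and> (g has_field_derivative g' s) (at s)"
      by (rule series_and_derivative_comparison[OF open_ball hs hd hb])
    have "((\<lambda>s. \<Sum>k. (- s) ^ k / fact k * c k) has_field_derivative g' z) (at z)"
    proof (rule DERIV_cong_ev[THEN iffD2])
      have "\<forall>\<^sub>F s in nhds z. s \<in> ball 0 (norm z + 1)" by (intro eventually_nhds_in_open) auto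
      thus "\<forall>\<^sub>F s in nhds z. (\<Sum>k. (- s) ^ k / fact k * c k) = g s"
      proof eventually_elim
        case (elim s)
        with g have "(\<lambda>k. (- s) ^ k / fact k * c k) sums g s" by blast
        thus ?case by (rule sums_unique[symmetric])
      qed
      show "(g has_field_derivative g' z) (at z)" using g by simp
    qed auto
    thus ?thesis by (auto simp: field_differentiable_def)
  qed
  thus ?thesis by (simp add: holomorphic_on_def field_differentiable_at_within)
qed

text \<open>The derivative of \<open>bessel_S\<close> with respect to the order, not the argument;
  it arises because Y of integer order is a limit in the order.\<close>

definition bessel_S' :: "complex \<Rightarrow> complex \<Rightarrow> complex" where
  "bessel_S' \<nu> s = (\<Sum>k. (- s) ^ k / fact k * deriv rGamma (\<nu> + of_nat k + 1))"

lemma deriv_rGamma_uniform_bound: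
  obtains C where "\<And>k. norm (deriv rGamma (\<nu> + of_nat k + 1 :: complex)) \<le> C"
proof -
  obtain C where C: "C \<ge> 0" "\<And>(\<mu> :: complex) k. norm \<mu> \<le> norm \<nu> + 1 \<Longrightarrow> norm (rGamma (\<mu> + of_nat k + 1)) \<le> C"
    by (rule rGamma_uniform_bound) blast
  have "norm ((deriv ^^ 1) rGamma (\<nu> + of_nat k + 1)) \<le> fact 1 * C / 1 ^ 1" for k
  proof (rule Cauchy_inequality)
    show "rGamma holomorphic_on ball (\<nu> + of_nat k + 1) 1" by (rule holomorphic_rGamma)
    show "continuous_on (cball (\<nu> + of_nat k + 1) 1) rGamma" by (intro holomorphic_on_imp_continuous_on holomorphic_rGamma)
    fix x assume "norm (\<nu> + of_nat k + 1 - x) = 1"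
    hence "norm (x - (of_nat k + 1)) \<le> norm \<nu> + 1"
      using norm_triangle_ineq4[of \<nu> "\<nu> + of_nat k + 1 - x"] by (simp add: algebra_simps)
    from C(2)[OF this, of k] show "norm (rGamma x) \<le> C" by (simp add: algebra_simps)
  qed simp
  thus ?thesis by (intro that[of C]) simp
qed

lemma holomorphic_bessel_S: "bessel_S \<nu> holomorphic_on UNIV"
proof -
  obtain C where "\<And>(\<mu> :: complex) k. norm \<mu> \<le> norm \<nu> \<Longrightarrow> norm (rGamma (\<mu> + of_nat k + 1)) \<le> C"
    by (rule rGamma_uniform_bound) blast
  from this[OF order_refl] have "norm (rGamma (\<nu> + of_nat k + 1)) \<le> C" for k .
  from holomorphic_exponential_series[OF this] show ?thesis by (simp add: bessel_S_def[abs_def])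
qed

lemma holomorphic_bessel_S': "bessel_S' \<nu> holomorphic_on UNIV"
proof -
  obtain C where "\<And>k. norm (deriv rGamma (\<nu> + of_nat k + 1)) \<le> C" by (rule deriv_rGamma_uniform_bound) blast
  from holomorphic_exponential_series[OF this] show ?thesis by (simp add: bessel_S'_def[abs_def])
qed

lemma bessel_S_has_derivative_order: "((\<lambda>\<nu>. bessel_S \<nu> s) has_field_derivative bessel_S' \<nu> s) (at \<nu>)"
proof -
  obtain C where C: "C \<ge> 0" "\<And>(\<mu> :: complex) k. norm \<mu> \<le> norm \<nu> + 1 \<Longrightarrow> norm (rGamma (\<mu> + of_nat k + 1)) \<le> C"
    by (rule rGamma_uniform_bound) blast
  define h where "h k = C * (inverse (fact k) * norm s ^ k)" for k
  have hs: "summable h" unfolding h_def by (intro summable_mult summable_exp)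
  have "norm ((- s) ^ k / fact k * rGamma (\<mu> + of_nat k + 1)) \<le> h k" if "\<mu> \<in> ball 0 (norm \<nu> + 1)" for \<mu> k
    using mult_left_mono[OF C(2)[of \<mu> k], of "inverse (fact k) * norm s ^ k"] that
    by (simp add: h_def norm_mult norm_divide norm_power field_simps)
  hence hb: "\<forall>\<^sub>F k in sequentially. \<forall>\<mu>\<in>ball 0 (norm \<nu> + 1). norm ((- s) ^ k / fact k * rGamma (\<mu> + of_nat k + 1)) \<le> h k"
    by simp
  have hd: "((\<lambda>\<mu>. (- s) ^ k / fact k * rGamma (\<mu> + of_nat k + 1)) has_field_derivative
      (- s) ^ k / fact k * deriv rGamma (\<mu> + of_nat k + 1)) (at \<mu>)" for k and \<mu> :: complex
  proof -
    have "(rGamma has_field_derivative deriv rGamma (\<mu> + of_nat k + 1)) (at (\<mu> + of_nat k + 1))"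
      by (rule holomorphic_derivI[OF holomorphic_rGamma open_UNIV]) simp
    moreover have "((\<lambda>\<mu>. \<mu> + of_nat k + 1) has_field_derivative 1) (at \<mu>)" by (auto intro!: derivative_eq_intros)
    ultimately have "((\<lambda>\<mu>. rGamma (\<mu> + of_nat k + 1)) has_field_derivative deriv rGamma (\<mu> + of_nat k + 1) * 1) (at \<mu>)"
      by (rule DERIV_chain2[where f = rGamma and g = "\<lambda>\<mu>. \<mu> + of_nat k + 1"])
    hence "((\<lambda>\<mu>. rGamma (\<mu> + of_nat k + 1)) has_field_derivative deriv rGamma (\<mu> + of_nat k + 1)) (at \<mu>)" by simp
    thus ?thesis by (rule DERIV_cmult)
  qed
  obtain g g' where g: "\<forall>\<mu>\<in>ball 0 (norm \<nu> + 1).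
      (\<lambda>k. (- s) ^ k / fact k * rGamma (\<mu> + of_nat k + 1)) sums g \<mu> \<and>
      (\<lambda>k. (- s) ^ k / fact k * deriv rGamma (\<mu> + of_nat k + 1)) sums g' \<mu> \<and> (g has_field_derivative g' \<mu>) (at \<mu>)"
    by (rule series_and_derivative_comparison[OF open_ball hs hd hb])
  have "((\<lambda>\<nu>. bessel_S \<nu> s) has_field_derivative g' \<nu>) (at \<nu>)"
  proof (rule DERIV_cong_ev[THEN iffD2])
    have "\<forall>\<^sub>F \<mu> in nhds \<nu>. \<mu> \<in> ball 0 (norm \<nu> + 1)" by (intro eventually_nhds_in_open) auto
    thus "\<forall>\<^sub>F \<mu> in nhds \<nu>. bessel_S \<mu> s = g \<mu>"
    proof eventually_elim
      case (elim \<mu>)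
      with g have "(\<lambda>k. (- s) ^ k / fact k * rGamma (\<mu> + of_nat k + 1)) sums g \<mu>" by blast
      thus ?case unfolding bessel_S_def by (rule sums_unique[symmetric])
    qed
    show "(g has_field_derivative g' \<nu>) (at \<nu>)" using g by simp
  qed auto
  moreover have "g' \<nu> = bessel_S' \<nu> s"
    using g sums_unique[of _ "g' \<nu>"] by (simp add: bessel_S'_def)
  ultimately show ?thesis by simp
qed

lemma bessel_S_minus_nat: "bessel_S (- of_nat n) s = (- s) ^ n * bessel_S (of_nat n) s"
proof (induction n rule: induct_nat_012)
  case 1
  show ?case using bessel_S_recurrence[of 0 s] by (simp add: eq_neg_iff_add_eq_0)
next
  case (ge2 n)
  define b where "b = bessel_S (of_nat n) s"
  have r1: "b + s * bessel_S (of_nat (Suc (Suc n))) s = of_nat (Suc n) * bessel_S (of_nat (Suc n)) s"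
    using bessel_S_recurrence[of "of_nat (Suc n)" s] by (simp add: b_def add_ac)
  have "bessel_S (- of_nat (Suc (Suc n))) s + s * bessel_S (- of_nat n) s = - of_nat (Suc n) * bessel_S (- of_nat (Suc n)) s"
    using bessel_S_recurrence[of "- of_nat (Suc n)" s] by (simp add: add_ac algebra_simps)
  hence "bessel_S (- of_nat (Suc (Suc n))) s =
      (- s) ^ Suc n * (b - of_nat (Suc n) * bessel_S (of_nat (Suc n)) s)"
    unfolding ge2 by (simp only: b_def[symmetric] power_Suc) (simp add: algebra_simps eq_diff_eq)
  also have "\<dots> = (- s) ^ Suc n * (- s * bessel_S (of_nat (Suc (Suc n))) s)"
    unfolding r1[symmetric] by simp
  finally show ?case by (simp only: power_Suc mult_ac)
qed simp

lemma bessel_J_minus_nat: "bessel_J (- of_nat n) w = (- 1) ^ n * bessel_J (of_nat n) w"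
proof -
  let ?\<omega> = "w - of_real (ln 2)"
  have "exp (- of_nat n * ?\<omega>) * (- exp (2 * ?\<omega>)) ^ n = (- 1) ^ n * (exp (- of_nat n * ?\<omega>) * exp (of_nat n * (2 * ?\<omega>)))"
    unfolding exp_of_nat_mult power_minus[of "exp (2 * ?\<omega>)"] by (simp only: mult_ac)
  also have "exp (- of_nat n * ?\<omega>) * exp (of_nat n * (2 * ?\<omega>)) = exp (of_nat n * ?\<omega>)"
    by (simp only: exp_add[symmetric]) (simp add: algebra_simps)
  finally show ?thesis
    unfolding bessel_J_eq bessel_S_minus_nat by (simp only: mult.assoc[symmetric])
qed

text \<open>The derivative of \<open>bessel_J\<close> with respect to the order. The factor
  \<omega>, the logarithm of half the argument, is the source of the logarithmic term in even
  dimensions.\<close>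

definition bessel_J' :: "complex \<Rightarrow> complex \<Rightarrow> complex" where
  "bessel_J' \<nu> w = (let \<omega> = w - of_real (ln 2) in
     exp (\<nu> * \<omega>) * (\<omega> * bessel_S \<nu> (exp (2 * \<omega>)) + bessel_S' \<nu> (exp (2 * \<omega>))))"

lemma bessel_J_has_derivative_order: "((\<lambda>\<nu>. bessel_J \<nu> w) has_field_derivative bessel_J' \<nu> w) (at \<nu>)"
  unfolding bessel_J_eq bessel_J'_def Let_def
  by (auto intro!: derivative_eq_intros bessel_S_has_derivative_order simp: algebra_simps)

text \<open>Numerator and denominator both vanish at \<nu> = n, so the limit in the definition of Y
  follows from l'Hopital's rule in the order.\<close>

lemma bessel_Y_nat: "bessel_Y (of_nat n) w = (bessel_J' (of_nat n) w + (- 1) ^ n * bessel_J' (- of_nat n) w) / of_real pi"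
proof -
  have cs: "cos (of_real pi * of_nat n :: complex) = (- 1) ^ n" "sin (of_real pi * of_nat n :: complex) = 0"
  proof -
    have "(of_real pi * of_nat n :: complex) = of_real (pi * real n)" by simp
    thus "cos (of_real pi * of_nat n :: complex) = (- 1) ^ n" "sin (of_real pi * of_nat n :: complex) = 0"
      by (simp_all only: cos_of_real sin_of_real cos_npi2 sin_npi2) simp_all
  qed
  have "((\<lambda>\<mu>. bessel_J (- \<mu>) w) has_field_derivative bessel_J' (- of_nat n) w * (- 1)) (at (of_nat n))"
    by (rule DERIV_chain2[where f = "\<lambda>\<mu>. bessel_J \<mu> w" and g = uminus])
       (auto intro!: derivative_eq_intros bessel_J_has_derivative_order)
  hence d1: "((\<lambda>\<mu>. bessel_J \<mu> w * cos (of_real pi * \<mu>) - bessel_J (- \<mu>) w) has_field_derivative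
      (- 1) ^ n * bessel_J' (of_nat n) w + bessel_J' (- of_nat n) w) (at (of_nat n))"
    by (auto intro!: derivative_eq_intros bessel_J_has_derivative_order simp: cs)
  have d2: "((\<lambda>\<mu>. sin (of_real pi * \<mu>)) has_field_derivative (- 1) ^ n * of_real pi) (at (of_nat n :: complex))"
    by (auto intro!: derivative_eq_intros simp: cs)
  have e: "((- 1) ^ n * bessel_J' (of_nat n) w + bessel_J' (- of_nat n) w) / ((- 1) ^ n * of_real pi) =
      (bessel_J' (of_nat n) w + (- 1) ^ n * bessel_J' (- of_nat n) w) / of_real pi"
    by (cases "even n") (simp_all add: field_simps)
  have "((\<lambda>\<mu>. (bessel_J \<mu> w * cos (of_real pi * \<mu>) - bessel_J (- \<mu>) w) / sin (of_real pi * \<mu>)) \<longlongrightarrow>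
      (bessel_J' (of_nat n) w + (- 1) ^ n * bessel_J' (- of_nat n) w) / of_real pi) (at (of_nat n))"
    by (rule lhopital_complex_simple[OF d1 d2 _ _ _ e]) (auto simp: cs bessel_J_minus_nat)
  hence "Lim (at (of_nat n)) (\<lambda>\<mu>. (bessel_J \<mu> w * cos (of_real pi * \<mu>) - bessel_J (- \<mu>) w) / sin (of_real pi * \<mu>)) =
      (bessel_J' (of_nat n) w + (- 1) ^ n * bessel_J' (- of_nat n) w) / of_real pi"
    by (intro tendsto_Lim) auto
  thus ?thesis by (simp add: bessel_Y_def Let_def)
qed

text \<open>With s = z^2 r^2 / 4, everything is single-valued and entire in s except for the factor
  w + ln r, the logarithm of z r. That E 0 is nonzero says that the logarithm really occurs, so that
  G changes from sheet to sheet even at the diagonal.\<close>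

lemma green_log_even:
  "\<exists>A E. A holomorphic_on UNIV \<and> E holomorphic_on UNIV \<and> (\<exists>e>0. E 0 = - of_real e) \<and>
    (\<forall>r>0. \<forall>w. green_log (2 * n + 2) r w =
      of_real ((1 / r) ^ (2 * n)) * (A (exp (2 * w) * of_real (r\<^sup>2 / 4)) +
        (w + of_real (ln r)) * (exp (2 * w) * of_real (r\<^sup>2 / 4)) ^ n * E (exp (2 * w) * of_real (r\<^sup>2 / 4))))"
proof -
  define \<kappa> :: real where "\<kappa> = 1 / pi ^ n"
  \<comment> \<open>The coefficient of the logarithm: \<i> / 4 times \<i> / \<pi> times 2 is - 1 /
    (2 \<pi>).\<close>
  define E where "E s = - of_real (\<kappa> / (2 * pi)) * bessel_S (of_nat n) s" for s
  \<comment> \<open>The last summand accounts for ln 2 in \<omega> = w + ln r - ln 2.\<close>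
  define A where "A s = \<i> / 4 * of_real \<kappa> * (s ^ n * bessel_S (of_nat n) s +
      \<i> / of_real pi * (s ^ n * bessel_S' (of_nat n) s + (- 1) ^ n * bessel_S' (- of_nat n) s)) -
      of_real (ln 2) * s ^ n * E s" for s
  have "A holomorphic_on UNIV" "E holomorphic_on UNIV"
    unfolding A_def E_def by (intro holomorphic_intros holomorphic_bessel_S holomorphic_bessel_S'; fail)+
  moreover have "\<exists>e>0. E 0 = - of_real e"
  proof (intro exI conjI)
    have "bessel_S (of_nat n) 0 = (\<Sum>k\<in>{0}. (- 0) ^ k / fact k * rGamma (of_nat n + of_nat k + 1))"
      unfolding bessel_S_def by (rule suminf_finite) (auto simp: power_0_left)
    also have "\<dots> = 1 / fact n"
      using Gamma_fact[of n, where 'a = complex] by (simp add: rGamma_inverse_Gamma add.commute inverse_eq_divide)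
    finally have S0: "bessel_S (of_nat n) 0 = 1 / fact n" .
    show "0 < \<kappa> / (2 * pi * fact n)" by (simp add: \<kappa>_def)
    show "E 0 = - of_real (\<kappa> / (2 * pi * fact n))" by (simp add: E_def S0)
  qed
  moreover have "green_log (2 * n + 2) r w = of_real ((1 / r) ^ (2 * n)) * (A (exp (2 * w) * of_real (r\<^sup>2 / 4)) +
        (w + of_real (ln r)) * (exp (2 * w) * of_real (r\<^sup>2 / 4)) ^ n * E (exp (2 * w) * of_real (r\<^sup>2 / 4)))"
    if r: "r > 0" for r w
  proof -
    define \<omega> where "\<omega> = w + of_real (ln r) - of_real (ln 2)"
    define s where "s = exp (2 * w) * of_real (r\<^sup>2 / 4)"
    have er: "exp (of_real (ln r)) = complex_of_real r" using r by (simp add: exp_of_real)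
    have "exp (2 * \<omega>) = (exp w * of_real r / 2)\<^sup>2"
      unfolding exp_double by (simp add: \<omega>_def exp_diff exp_add er)
    hence s: "exp (2 * \<omega>) = s" by (simp add: s_def exp_double power_mult_distrib power_divide)
    define p where "p = exp (- of_nat n * \<omega>)"
    have sn: "exp (of_nat n * \<omega>) = p * s ^ n"
      unfolding s[symmetric] p_def exp_of_nat_mult[symmetric] exp_add[symmetric] by (simp add: algebra_simps)
    \<comment> \<open>The powers of z cancel: (z / (2 \<pi> r))^n times (z r / 2)^-n is \<pi>^-n
      r^(-2n).\<close>
    have pre: "exp (of_nat n * (w - of_real (ln (2 * pi * r)))) * p = of_real (\<kappa> * (1 / r) ^ (2 * n))"
    proof -
      have "exp (of_nat n * (w - of_real (ln (2 * pi * r)))) * p =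
          exp (of_nat n * of_real (ln 2 - ln r - ln (2 * pi * r)))"
        unfolding p_def exp_add[symmetric] \<omega>_def by (simp add: algebra_simps)
      also have "\<dots> = of_real (exp (ln 2 - ln r - ln (2 * pi * r)) ^ n)"
        unfolding exp_of_nat_mult exp_of_real of_real_power ..
      also have "exp (ln 2 - ln r - ln (2 * pi * r)) = 1 / pi * (1 / r)\<^sup>2"
        unfolding exp_diff using r exp_ln[of "2 * pi * r"] by (simp del: ln_mult add: power2_eq_square)
      finally show ?thesis by (simp add: \<kappa>_def power_mult_distrib power_one_over power_mult)
    qed
    have S: "bessel_S (- of_nat n) s = (- 1) ^ n * s ^ n * bessel_S (of_nat n) s"
      unfolding bessel_S_minus_nat by (simp only: power_minus[of s])
    have m1: "(- 1) ^ n * ((- 1) ^ n * x) = x" for x :: complex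
      by (simp add: mult.assoc[symmetric] power_mult_distrib[symmetric])
    have Y: "bessel_Y (of_nat n) (w + of_real (ln r)) = p / of_real pi * (2 * \<omega> * s ^ n * bessel_S (of_nat n) s +
        (s ^ n * bessel_S' (of_nat n) s + (- 1) ^ n * bessel_S' (- of_nat n) s))"
    proof -
      have "bessel_J' (of_nat n) (w + of_real (ln r)) = p * s ^ n * (\<omega> * bessel_S (of_nat n) s + bessel_S' (of_nat n) s)"
        unfolding bessel_J'_def Let_def \<omega>_def[symmetric] s sn ..
      moreover have "bessel_J' (- of_nat n) (w + of_real (ln r)) = p * (\<omega> * bessel_S (- of_nat n) s + bessel_S' (- of_nat n) s)"
        unfolding bessel_J'_def Let_def \<omega>_def[symmetric] s p_def ..
      moreover have "(- 1) ^ n * (p * (\<omega> * bessel_S (- of_nat n) s + bessel_S' (- of_nat n) s)) =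
          p * (\<omega> * ((- 1) ^ n * ((- 1) ^ n * (s ^ n * bessel_S (of_nat n) s))) + (- 1) ^ n * bessel_S' (- of_nat n) s)"
        unfolding S by (simp add: algebra_simps)
      ultimately have "bessel_J' (of_nat n) (w + of_real (ln r)) + (- 1) ^ n * bessel_J' (- of_nat n) (w + of_real (ln r)) =
          p * s ^ n * (\<omega> * bessel_S (of_nat n) s + bessel_S' (of_nat n) s) +
          p * (\<omega> * (s ^ n * bessel_S (of_nat n) s) + (- 1) ^ n * bessel_S' (- of_nat n) s)"
        by (simp only: m1)
      also have "\<dots> = p * (2 * \<omega> * s ^ n * bessel_S (of_nat n) s +
          (s ^ n * bessel_S' (of_nat n) s + (- 1) ^ n * bessel_S' (- of_nat n) s))" by (simp add: algebra_simps)
      finally show ?thesis unfolding bessel_Y_nat by simp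
    qed
    have J: "bessel_J (of_nat n) (w + of_real (ln r)) = p * s ^ n * bessel_S (of_nat n) s"
      unfolding bessel_J_eq \<omega>_def[symmetric] s sn ..
    have "hankel_H1 (of_nat n) (w + of_real (ln r)) = p * (s ^ n * bessel_S (of_nat n) s +
        \<i> / of_real pi * (2 * \<omega> * s ^ n * bessel_S (of_nat n) s +
        (s ^ n * bessel_S' (of_nat n) s + (- 1) ^ n * bessel_S' (- of_nat n) s)))"
      unfolding hankel_H1_def Y J by (simp add: algebra_simps)
    moreover have "green_log (2 * n + 2) r w = \<i> / 4 * exp (of_nat n * (w - of_real (ln (2 * pi * r)))) * hankel_H1 (of_nat n) (w + of_real (ln r))"
      by (simp add: green_log_def Let_def)
    ultimately have "green_log (2 * n + 2) r w = \<i> / 4 * (exp (of_nat n * (w - of_real (ln (2 * pi * r)))) * p) *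
       (s ^ n * bessel_S (of_nat n) s +
        \<i> / of_real pi * (2 * \<omega> * s ^ n * bessel_S (of_nat n) s +
        (s ^ n * bessel_S' (of_nat n) s + (- 1) ^ n * bessel_S' (- of_nat n) s)))"
      by (simp only: mult.assoc)
    also have "\<dots> = of_real ((1 / r) ^ (2 * n)) * (A s + (w + of_real (ln r)) * s ^ n * E s)"
    proof -
      have "\<i> / 4 * (k * R) * (x * S + \<i> / P * (2 * (w + a - l) * x * S + T)) =
          R * ((\<i> / 4 * k * (x * S + \<i> / P * T) - l * x * (- (k / (2 * P)) * S)) + (w + a) * x * (- (k / (2 * P)) * S))"
        for k R x P a l S T :: complex
        by (simp add: algebra_simps add_divide_distrib diff_divide_distrib)
      thus ?thesis unfolding pre A_def E_def \<omega>_def of_real_mult of_real_divide of_real_numeral .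
    qed
    finally show ?thesis unfolding s_def .
  qed
  ultimately show ?thesis by blast
qed

text \<open>With the elementary form of the Hankel function, the powers of z in front cancel and
  only r^-(2m+1) remains.\<close>

lemma green_log_odd:
  "\<exists>Q. (\<forall>r>0. \<forall>w. green_log (2 * m + 3) r w =
      of_real ((1 / r) ^ (2 * m + 1)) * (exp (\<i> * (exp w * of_real r)) * poly Q (exp w * of_real r))) \<and>
    (\<forall>x\<ge>0. \<exists>y>0. poly Q (\<i> * of_real x) = of_real y)"
proof -
  obtain Q where Q: "\<And>w. hankel_half m w = - \<i> * exp (- (of_nat m + 1/2) * w) * exp (\<i> * exp w) * poly Q (exp w)"
    "\<And>x. x \<ge> 0 \<Longrightarrow> \<exists>y>0. poly Q (\<i> * of_real x) = of_real y" using hankel_half_eq[of m] by blast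
  define \<kappa> :: real where "\<kappa> = exp (- (real m + 1/2) * ln (2 * pi)) / 4"
  have "green_log (2 * m + 3) r w = of_real ((1 / r) ^ (2 * m + 1)) *
      (exp (\<i> * (exp w * of_real r)) * poly (Polynomial.smult (of_real \<kappa>) Q) (exp w * of_real r))" if r: "r > 0" for r w
  proof -
    have e: "exp (w + of_real (ln r)) = exp w * of_real r" using r by (simp add: exp_add exp_of_real)
    have "exp ((of_nat m + 1/2) * (w - of_real (ln (2 * pi * r)))) * exp (- (of_nat m + 1/2) * (w + of_real (ln r))) =
        exp (of_real (- (real m + 1/2) * (ln (2 * pi * r) + ln r)))"
      unfolding exp_add[symmetric] by (simp add: algebra_simps add_divide_distrib)
    also have "- (real m + 1/2) * (ln (2 * pi * r) + ln r) = - (real m + 1/2) * ln (2 * pi) + real (2 * m + 1) * (- ln r)"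
      using r by (simp add: ln_mult algebra_simps)
    also have "exp (complex_of_real (- (real m + 1/2) * ln (2 * pi) + real (2 * m + 1) * (- ln r))) =
        of_real (4 * \<kappa> * (1 / r) ^ (2 * m + 1))"
      unfolding exp_of_real exp_add exp_of_nat_mult using r by (simp add: \<kappa>_def exp_minus inverse_eq_divide)
    finally have pre: "exp ((of_nat m + 1/2) * (w - of_real (ln (2 * pi * r)))) *
      exp (- (of_nat m + 1/2) * (w + of_real (ln r))) = complex_of_real (4 * \<kappa> * (1 / r) ^ (2 * m + 1))" .
    have "(of_nat (2 * m + 3) - 2) / 2 = (of_nat m + 1/2 :: complex)" by (simp add: field_simps)
    moreover have "2 * m + 3 \<noteq> 1" by simp
    ultimately have "green_log (2 * m + 3) r w = \<i> / 4 * exp ((of_nat m + 1/2) * (w - of_real (ln (2 * pi * r)))) *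
        hankel_half m (w + of_real (ln r))"
      unfolding green_log_def Let_def hankel_H1_half[symmetric] by (simp only: if_False)
    also have "\<dots> = 1 / 4 * (exp ((of_nat m + 1/2) * (w - of_real (ln (2 * pi * r)))) * exp (- (of_nat m + 1/2) * (w + of_real (ln r)))) *
        (exp (\<i> * (exp w * of_real r)) * poly Q (exp w * of_real r))"
      unfolding Q(1) e by (simp add: mult_ac)
    finally show ?thesis unfolding pre by simp
  qed
  moreover have "\<exists>y>0. poly (Polynomial.smult (of_real \<kappa>) Q) (\<i> * of_real x) = of_real y" if x: "x \<ge> 0" for x
  proof -
    obtain y where "y > 0" "poly Q (\<i> * of_real x) = of_real y" using Q(2)[OF x] by blast
    thus ?thesis by (intro exI[of _ "\<kappa> * y"]) (auto simp: \<kappa>_def)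
  qed
  ultimately show ?thesis by blast
qed

section \<open>The fundamental solution in each dimension\<close>

lemma entire_bounded:
  fixes f :: "complex \<Rightarrow> complex"
  assumes "f holomorphic_on UNIV"
  obtains C where "C \<ge> 0" "\<And>z. norm z \<le> B \<Longrightarrow> norm (f z) \<le> C"
proof -
  have "compact (f ` cball 0 B)"
    using assms by (intro compact_continuous_image) (auto intro: holomorphic_on_imp_continuous_on holomorphic_on_subset)
  from compact_imp_bounded[OF this] obtain C where "C > 0" "\<forall>z\<in>cball 0 B. norm (f z) \<le> C"
    unfolding bounded_pos by auto
  thus ?thesis by (intro that[of C]) auto
qed

text \<open>Between r^(2 - d) and r^(3/4 - d) there is a factor r^(5/4), which absorbs the logarithm
  because |ln r| \<le> r + 1 / r.\<close>

lemma radial_weight_bound: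
  fixes F :: "real \<Rightarrow> complex \<Rightarrow> complex"
  assumes C: "\<And>r z. 0 < r \<Longrightarrow> r \<le> R \<Longrightarrow> norm z \<le> Z \<Longrightarrow> norm (F r z) \<le> C * (1 + \<bar>ln r\<bar>)"
  shows "\<exists>C. \<forall>r z. 0 < r \<longrightarrow> r \<le> R \<longrightarrow> norm z \<le> Z \<longrightarrow> norm (of_real (r powr (2 - d)) * F r z) \<le> C * r powr (3/4 - d)"
proof -
  define C' where "C' = max C 0 * (R powr (5/4) + R powr (9/4) + R powr (1/4))"
  have "norm (of_real (r powr (2 - d)) * F r z) \<le> C' * r powr (3/4 - d)" if "0 < r" "r \<le> R" "norm z \<le> Z" for r z
  proof -
    have p: "r powr (2 - d) = r powr (5/4) * r powr (3/4 - d)" by (simp flip: powr_add)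
    have "ln r \<le> r" "ln (1 / r) \<le> 1 / r" using that ln_bound[of r] ln_bound[of "1 / r"] by auto
    hence "\<bar>ln r\<bar> \<le> r + 1 / r" using that by (auto simp: ln_div abs_if intro: add_increasing add_increasing2)
    hence "r powr (5/4) * (1 + \<bar>ln r\<bar>) \<le> r powr (5/4) * (1 + r + 1 / r)"
      by (intro mult_left_mono) auto
    also have "\<dots> = r powr (5/4) + r powr (9/4) + r powr (1/4)"
    proof -
      have "r powr (5/4) * r = r powr (9/4)" "r powr (5/4) / r = r powr (1/4)"
        using that powr_add[of r "5/4" 1] powr_diff[of r "5/4" 1] by simp_all
      thus ?thesis by (simp add: distrib_left)
    qed
    also have "\<dots> \<le> R powr (5/4) + R powr (9/4) + R powr (1/4)"
      using that by (intro add_mono powr_mono2) auto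
    finally have b: "r powr (5/4) * (1 + \<bar>ln r\<bar>) \<le> R powr (5/4) + R powr (9/4) + R powr (1/4)" .
    have "norm (of_real (r powr (2 - d)) * F r z) \<le> r powr (2 - d) * (C * (1 + \<bar>ln r\<bar>))"
      using C[OF that] by (simp add: norm_mult mult_left_mono)
    also have "\<dots> \<le> r powr (2 - d) * (max C 0 * (1 + \<bar>ln r\<bar>))"
      by (intro mult_left_mono mult_right_mono) auto
    also have "\<dots> = max C 0 * (r powr (5/4) * (1 + \<bar>ln r\<bar>)) * r powr (3/4 - d)" unfolding p by (simp add: mult_ac)
    also have "\<dots> \<le> C' * r powr (3/4 - d)"
      unfolding C'_def using b by (intro mult_right_mono mult_left_mono) auto
    finally show ?thesis .
  qed
  thus ?thesis by blast
qed

lemma helmholtz_kernel_oddI: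
  fixes \<Phi> :: "complex \<Rightarrow> complex"
  assumes M: "M > 0" and hol: "\<Phi> holomorphic_on UNIV"
    and eq: "\<And>(x :: real ^ 'n::finite) z. x \<noteq> 0 \<Longrightarrow> z \<noteq> 0 \<Longrightarrow>
      G x z = s / z + of_real (norm x powr (2 - real CARD('n))) * \<Phi> (z * of_real (norm x))"
  shows "helmholtz_kernel M (\<lambda>r z. of_real (r powr (2 - real CARD('n))) * \<Phi> (z * of_real r)) s (G :: real ^ 'n \<Rightarrow> _)"
proof
  show "M > 0" by (rule M)
  show "G x z = s / z + of_real (norm x powr (2 - real CARD('n))) * \<Phi> (z * of_real (norm x))"
    if "x \<noteq> 0" "z \<noteq> 0" for x z using that by (rule eq)
  show "(\<lambda>z. of_real (r powr (2 - real CARD('n))) * \<Phi> (z * of_real r)) holomorphic_on UNIV" for r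
    by (intro holomorphic_intros holomorphic_on_compose[of "\<lambda>z. z * of_real r" UNIV \<Phi>, unfolded o_def]
        holomorphic_on_subset[OF hol]) auto
  show "continuous_on {0<..} (\<lambda>r. of_real (r powr (2 - real CARD('n))) * \<Phi> (z * of_real r))" for z
    by (intro continuous_intros continuous_on_compose2[OF holomorphic_on_imp_continuous_on[OF hol]]) auto
  fix R Z :: real
  obtain C where C: "C \<ge> 0" "\<And>z. norm z \<le> \<bar>Z\<bar> * \<bar>R\<bar> \<Longrightarrow> norm (\<Phi> z) \<le> C"
    by (rule entire_bounded[OF hol]) blast
  show "\<exists>C. \<forall>r z. 0 < r \<longrightarrow> r \<le> R \<longrightarrow> norm z \<le> Z \<longrightarrow>
      norm (of_real (r powr (2 - real CARD('n))) * \<Phi> (z * of_real r)) \<le> C * r powr (3/4 - real CARD('n))"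
  proof (rule radial_weight_bound)
    fix r :: real and z :: complex assume *: "0 < r" "r \<le> R" "norm z \<le> Z"
    have "norm (\<Phi> (z * of_real r)) \<le> C" using * by (intro C(2)) (auto simp: norm_mult intro!: mult_mono)
    also have "\<dots> \<le> C * (1 + \<bar>ln r\<bar>)" using C(1) by (simp add: distrib_left)
    finally show "norm (\<Phi> (z * of_real r)) \<le> C * (1 + \<bar>ln r\<bar>)" .
  qed
qed

lemma helmholtz_kernel_evenI:
  fixes A E :: "complex \<Rightarrow> complex"
  assumes M: "M > 0" and hol: "A holomorphic_on UNIV" "E holomorphic_on UNIV"
    and eq: "\<And>(x :: real ^ 'n::finite) z. x \<noteq> 0 \<Longrightarrow> G x z =
      of_real (norm x powr (2 - real CARD('n))) * (A (exp (2 * z) * of_real ((norm x)\<^sup>2 / 4)) +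
        (z + of_real (ln (norm x))) * E (exp (2 * z) * of_real ((norm x)\<^sup>2 / 4)))"
  shows "helmholtz_kernel M (\<lambda>r z. of_real (r powr (2 - real CARD('n))) * (A (exp (2 * z) * of_real (r\<^sup>2 / 4)) +
        (z + of_real (ln r)) * E (exp (2 * z) * of_real (r\<^sup>2 / 4)))) 0 (G :: real ^ 'n \<Rightarrow> _)"
proof
  show "M > 0" by (rule M)
  show "G x z = 0 / z + of_real (norm x powr (2 - real CARD('n))) * (A (exp (2 * z) * of_real ((norm x)\<^sup>2 / 4)) +
        (z + of_real (ln (norm x))) * E (exp (2 * z) * of_real ((norm x)\<^sup>2 / 4)))"
    if "x \<noteq> 0" "z \<noteq> 0" for x z using eq[OF that(1)] by simp
  show "(\<lambda>z. of_real (r powr (2 - real CARD('n))) * (A (exp (2 * z) * of_real (r\<^sup>2 / 4)) +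
        (z + of_real (ln r)) * E (exp (2 * z) * of_real (r\<^sup>2 / 4)))) holomorphic_on UNIV" for r :: real
    by (intro holomorphic_intros holomorphic_on_compose[of "\<lambda>z. exp (2 * z) * of_real (r\<^sup>2 / 4)" UNIV, unfolded o_def]
        holomorphic_on_subset[OF hol(1)] holomorphic_on_subset[OF hol(2)]) auto
  show "continuous_on {0<..} (\<lambda>r. of_real (r powr (2 - real CARD('n))) * (A (exp (2 * z) * of_real (r\<^sup>2 / 4)) +
        (z + of_real (ln r)) * E (exp (2 * z) * of_real (r\<^sup>2 / 4))))" for z
    by (intro continuous_intros continuous_on_compose2[OF holomorphic_on_imp_continuous_on[OF hol(1)]]
        continuous_on_compose2[OF holomorphic_on_imp_continuous_on[OF hol(2)]]) auto
  fix R Z :: real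
  define B where "B = exp (2 * \<bar>Z\<bar>) * (R\<^sup>2 / 4)"
  obtain C where C: "C \<ge> 0" "\<And>z. norm z \<le> B \<Longrightarrow> norm (A z) \<le> C" by (rule entire_bounded[OF hol(1)]) blast
  obtain D where D: "D \<ge> 0" "\<And>z. norm z \<le> B \<Longrightarrow> norm (E z) \<le> D" by (rule entire_bounded[OF hol(2)]) blast
  show "\<exists>C. \<forall>r z. 0 < r \<longrightarrow> r \<le> R \<longrightarrow> norm z \<le> Z \<longrightarrow>
      norm (of_real (r powr (2 - real CARD('n))) * (A (exp (2 * z) * of_real (r\<^sup>2 / 4)) +
        (z + of_real (ln r)) * E (exp (2 * z) * of_real (r\<^sup>2 / 4)))) \<le> C * r powr (3/4 - real CARD('n))"
  proof (rule radial_weight_bound)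
    fix r :: real and z :: complex assume *: "0 < r" "r \<le> R" "norm z \<le> Z"
    let ?s = "exp (2 * z) * of_real (r\<^sup>2 / 4)"
    have "norm ?s = exp (2 * Re z) * (r\<^sup>2 / 4)" by (simp add: norm_mult norm_divide norm_power)
    also have "\<dots> \<le> B"
      unfolding B_def using * abs_Re_le_cmod[of z] by (intro mult_mono divide_right_mono power_mono) auto
    finally have s: "norm ?s \<le> B" .
    have "norm (A ?s + (z + of_real (ln r)) * E ?s) \<le> norm (A ?s) + norm (z + of_real (ln r)) * norm (E ?s)"
      by (rule order_trans[OF norm_triangle_ineq]) (simp add: norm_mult)
    also have "\<dots> \<le> C + (\<bar>Z\<bar> + \<bar>ln r\<bar>) * D"
    proof (intro add_mono mult_mono C(2) D(2) s)
      show "norm (z + of_real (ln r)) \<le> \<bar>Z\<bar> + \<bar>ln r\<bar>"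
        using norm_triangle_ineq[of z "of_real (ln r)"] * by (simp del: norm_of_real add: norm_of_real)
    qed auto
    also have "\<dots> \<le> (C + (\<bar>Z\<bar> + 1) * D) * (1 + \<bar>ln r\<bar>)"
      using C(1) D(1) by (simp add: algebra_simps)
    finally show "norm (A ?s + (z + of_real (ln r)) * E ?s) \<le> (C + (\<bar>Z\<bar> + 1) * D) * (1 + \<bar>ln r\<bar>)" .
  qed
qed

text \<open>
  Close to the diagonal, the kernel at \<open>z\<^sub>1\<close> is larger by a factor \<open>N\<close> than the kernel at \<open>z\<^sub>2\<close>.
  In dimension 1 take \<open>z\<^sub>1 \<rightarrow> 0\<close>, in other odd dimensions \<open>z\<^sub>2 \<rightarrow> \<i>\<infinity>\<close>, and in even
  dimensions let \<open>z\<^sub>1\<close> run through the points of the logarithmic cover above a fixed one.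
\<close>

definition amplifying :: "real \<Rightarrow> (real ^ 'n::finite \<Rightarrow> complex \<Rightarrow> complex) \<Rightarrow> bool" where
  "amplifying M G \<longleftrightarrow> (\<exists>\<rho>>0. \<forall>N::real\<ge>0. \<exists>z1 z2 \<kappa> A H c. z1 \<noteq> 0 \<and> z2 \<noteq> 0 \<and> norm \<kappa> = 1 \<and> A \<ge> 0 \<and> c > 0 \<and>
     weight_bounded M H (\<lambda>u. G u z2) \<and> N * (A + H) \<le> c \<and>
     (\<forall>x. x \<noteq> 0 \<and> norm x \<le> \<rho> \<longrightarrow> Re (\<kappa> * G x z1) \<ge> c - A * weight x))"

text \<open>Splitting off \<i> / (2 z) leaves a multiple of (exp y - 1) / y, which is entire. For
  the amplification, G at z1 = \<i> t is exp (- t |x|) / (2 t), which grows without bound as t tends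
  to 0, while z2 = 1 stays fixed.\<close>

lemma green_dim_1:
  assumes M: "M > 0" and d: "CARD('n::finite) = 1"
  shows "\<exists>g s. helmholtz_kernel M g s (green :: real ^ 'n \<Rightarrow> _)" "amplifying M (green :: real ^ 'n \<Rightarrow> _)"
proof -
  \<comment> \<open>The function (exp y - 1) / y with its removable singularity filled in.\<close>
  define \<phi> where "\<phi> y = (if y = 0 then deriv exp 0 else (exp y - exp 0) / (y - 0))" for y :: complex
  have \<phi>: "\<phi> holomorphic_on UNIV"
    unfolding \<phi>_def by (rule pole_lemma) (auto intro: holomorphic_intros)
  define \<Phi> where "\<Phi> y = - 1/2 * \<phi> (\<i> * y)" for y
  have hol: "\<Phi> holomorphic_on UNIV"
    unfolding \<Phi>_def by (intro holomorphic_intros holomorphic_on_compose[of "\<lambda>z. \<i> * z" UNIV \<phi>, unfolded o_def]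
        holomorphic_on_subset[OF \<phi>]) auto
  have G: "green (x :: real ^ 'n) z = \<i> / (2 * z) * exp (\<i> * z * of_real (norm x))" if "z \<noteq> 0" for x z
    using that d by (simp add: green_def green_log_def Let_def)
  have "helmholtz_kernel M (\<lambda>r z. of_real (r powr (2 - real CARD('n))) * \<Phi> (z * of_real r)) (\<i> / 2) (green :: real ^ 'n \<Rightarrow> _)"
  proof (rule helmholtz_kernel_oddI[OF M hol])
    fix x :: "real ^ 'n" and z :: complex assume *: "x \<noteq> 0" "z \<noteq> 0"
    have "\<i> * (z * of_real (norm x)) \<noteq> 0" using * by simp
    hence "\<phi> (\<i> * (z * of_real (norm x))) = (exp (\<i> * (z * of_real (norm x))) - 1) / (\<i> * (z * of_real (norm x)))"
      by (simp only: \<phi>_def if_False exp_zero diff_0_right)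
    hence "\<Phi> (z * of_real (norm x)) = - 1/2 * ((exp (\<i> * z * of_real (norm x)) - 1) / (\<i> * z * of_real (norm x)))"
      by (simp only: \<Phi>_def mult.assoc)
    also have "\<dots> = \<i> / 2 * ((exp (\<i> * z * of_real (norm x)) - 1) / (z * of_real (norm x)))"
    proof -
      have "- 1/2 * (e / (\<i> * a * b)) = \<i> / 2 * (e / (a * b))" if "a \<noteq> 0" "b \<noteq> 0" for a b e :: complex
        using that by (simp add: field_simps)
      from this[of z "of_real (norm x)"] * show ?thesis by simp
    qed
    finally have "\<Phi> (z * of_real (norm x)) = \<i> / 2 * ((exp (\<i> * z * of_real (norm x)) - 1) / (z * of_real (norm x)))" .
    thus "green x z = \<i> / 2 / z + of_real (norm x powr (2 - real CARD('n))) * \<Phi> (z * of_real (norm x))"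
      using * d by (simp add: G field_simps)
  qed
  thus ex: "\<exists>g s. helmholtz_kernel M g s (green :: real ^ 'n \<Rightarrow> _)" by blast
  then obtain g s where "helmholtz_kernel M g s (green :: real ^ 'n \<Rightarrow> _)" by blast
  then interpret helmholtz_kernel M g s "green :: real ^ 'n \<Rightarrow> _" .
  obtain C where C: "C \<ge> 0" "\<And>z. z \<noteq> 0 \<Longrightarrow> norm z \<le> 1 \<Longrightarrow> weight_bounded M (C / norm z) (\<lambda>u :: real ^ 'n. green u z)"
    by (rule weight_bounded_G) blast
  have wb: "weight_bounded M C (\<lambda>u :: real ^ 'n. green u 1)" using C(2)[of 1] by simp
  show "amplifying M (green :: real ^ 'n \<Rightarrow> _)"
    unfolding amplifying_def
  proof (rule exI[of _ 1], intro conjI allI impI)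
    fix N :: real assume N: "N \<ge> 0"
    \<comment> \<open>Chosen so that the lower bound 1 / (4 t) equals N * C + 1.\<close>
    define t where "t = 1 / (4 * (N * C + 1))"
    have NC: "N * C \<ge> 0" using N C(1) by simp
    hence t: "t > 0" "t \<le> 1/4" "1 / (4 * t) = N * C + 1" by (auto simp: t_def field_simps)
    have lb: "Re (1 * green x (\<i> * of_real t)) \<ge> 1 / (4 * t) - 0 * weight x" if "x \<noteq> 0 \<and> norm x \<le> 1" for x :: "real ^ 'n"
    proof -
      have "green x (\<i> * of_real t) = of_real (exp (- t * norm x) / (2 * t))"
        using t by (simp add: G exp_of_real[symmetric] field_simps)
      hence "Re (1 * green x (\<i> * of_real t)) = exp (- t * norm x) / (2 * t)" by simp
      moreover have "exp (- t * norm x) \<ge> 1/2"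
      proof -
        have "t * norm x \<le> 1/4 * 1" using that t by (intro mult_mono) auto
        thus ?thesis using exp_ge_add_one_self[of "- t * norm x"] by simp
      qed
      hence "1/2 / (2 * t) \<le> exp (- t * norm x) / (2 * t)" using t by (intro divide_right_mono) auto
      ultimately show ?thesis by simp
    qed
    show "\<exists>z1 z2 \<kappa> A H c. z1 \<noteq> 0 \<and> z2 \<noteq> 0 \<and> norm \<kappa> = 1 \<and> A \<ge> 0 \<and> c > 0 \<and>
       weight_bounded M H (\<lambda>u :: real ^ 'n. green u z2) \<and> N * (A + H) \<le> c \<and>
       (\<forall>x :: real ^ 'n. x \<noteq> 0 \<and> norm x \<le> 1 \<longrightarrow> Re (\<kappa> * green x z1) \<ge> c - A * weight x)"
      by (rule exI[of _ "\<i> * of_real t"], rule exI[of _ 1], rule exI[of _ 1], rule exI[of _ 0],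
          rule exI[of _ C], rule exI[of _ "1 / (4 * t)"], use wb t NC lb in simp)
  qed simp
qed

text \<open>Induction on the coefficients: a factor y costs half of the exponential rate, since y
  \<le> 2 / e * exp (e y / 2).\<close>

lemma poly_imaginary_exp_bound:
  assumes "e > 0"
  shows "\<exists>C\<ge>0. \<forall>y\<ge>0. norm (poly Q (\<i> * of_real y)) \<le> C * exp (e * y)"
  using assms
proof (induction Q arbitrary: e)
  case 0
  show ?case by (intro exI[of _ 0]) auto
next
  case (pCons a Q)
  from pCons.IH[of "e / 2"] pCons.prems obtain C where C: "C \<ge> 0" "\<And>y. y \<ge> 0 \<Longrightarrow> norm (poly Q (\<i> * of_real y)) \<le> C * exp (e / 2 * y)"
    by auto
  have "norm (poly (pCons a Q) (\<i> * of_real y)) \<le> (norm a + 2 / e * C) * exp (e * y)" if y: "y \<ge> 0" for y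
  proof -
    have "norm (poly (pCons a Q) (\<i> * of_real y)) \<le> norm a + y * norm (poly Q (\<i> * of_real y))"
      using norm_triangle_ineq[of a "\<i> * of_real y * poly Q (\<i> * of_real y)"] y by (simp add: norm_mult)
    also have "\<dots> \<le> norm a * exp (e * y) + (2 / e * exp (e / 2 * y)) * (C * exp (e / 2 * y))"
    proof (intro add_mono mult_mono C(2) y)
      show "norm a \<le> norm a * exp (e * y)" using y pCons.prems by (simp add: mult_le_cancel_left1)
      show "y \<le> 2 / e * exp (e / 2 * y)"
        using exp_ge_add_one_self[of "e / 2 * y"] pCons.prems by (simp add: field_simps)
    qed (use pCons.prems C(1) in auto)
    also have "\<dots> = norm a * exp (e * y) + 2 / e * C * (exp (e / 2 * y) * exp (e / 2 * y))" by (simp add: mult_ac)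
    also have "exp (e / 2 * y) * exp (e / 2 * y) = exp (e * y)" by (simp flip: exp_add)
    finally show ?thesis by (simp add: distrib_right)
  qed
  thus ?case using C(1) pCons.prems by (intro exI[of _ "norm a + 2 / e * C"]) auto
qed

text \<open>At z1 = \<i> the kernel is |x|^(2 - d) times a function that is positive near 0, so its
  real part is bounded below there. At z2 = \<i> k the exponential decay makes the kernel of order 1
  / k, measured against the weight.\<close>

lemma green_odd:
  assumes M: "M > 0" and d: "CARD('n::finite) = 2 * m + 3"
  shows "\<exists>g s. helmholtz_kernel M g s (green :: real ^ 'n \<Rightarrow> _)" "amplifying M (green :: real ^ 'n \<Rightarrow> _)"
proof -
  obtain Q where Q: "\<And>r w. r > 0 \<Longrightarrow> green_log (2 * m + 3) r w =
      of_real ((1 / r) ^ (2 * m + 1)) * (exp (\<i> * (exp w * of_real r)) * poly Q (exp w * of_real r))"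
    "\<And>x. x \<ge> 0 \<Longrightarrow> \<exists>y>0. poly Q (\<i> * of_real x) = of_real y" using green_log_odd[of m] by blast
  define \<Phi> where "\<Phi> y = exp (\<i> * y) * poly Q y" for y
  have hol: "\<Phi> holomorphic_on UNIV" unfolding \<Phi>_def by (intro holomorphic_intros)
  have G: "green (x :: real ^ 'n) z = of_real (norm x powr (2 - real CARD('n))) * \<Phi> (z * of_real (norm x))"
    if "x \<noteq> 0" "z \<noteq> 0" for x z
  proof -
    have "norm x powr (2 - real CARD('n)) = norm x powr (- real (2 * m + 1))" using d by simp
    also have "\<dots> = (1 / norm x) ^ (2 * m + 1)"
      unfolding powr_minus by (subst powr_realpow) (use that in \<open>auto simp: power_one_over inverse_eq_divide\<close>)
    finally have "norm x powr (2 - real CARD('n)) = (1 / norm x) ^ (2 * m + 1)" .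
    moreover have "odd CARD('n)" using d by simp
    ultimately show ?thesis
      using that Q(1)[of "norm x" "Ln z"] by (simp add: green_def Let_def d[symmetric] \<Phi>_def)
  qed
  have "helmholtz_kernel M (\<lambda>r z. of_real (r powr (2 - real CARD('n))) * \<Phi> (z * of_real r)) 0 (green :: real ^ 'n \<Rightarrow> _)"
    by (rule helmholtz_kernel_oddI[OF M hol]) (use G in simp)
  thus ex: "\<exists>g s. helmholtz_kernel M g s (green :: real ^ 'n \<Rightarrow> _)" by blast
  then obtain g s where "helmholtz_kernel M g s (green :: real ^ 'n \<Rightarrow> _)" by blast
  then interpret helmholtz_kernel M g s "green :: real ^ 'n \<Rightarrow> _" .
  obtain y0 where y0: "y0 > 0" "\<Phi> 0 = of_real y0" using Q(2)[of 0] by (auto simp: \<Phi>_def)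
  have "continuous_on UNIV (\<lambda>r :: real. Re (\<Phi> (\<i> * of_real r)))"
    by (intro continuous_intros continuous_on_compose2[OF holomorphic_on_imp_continuous_on[OF hol]]) auto
  hence "isCont (\<lambda>r :: real. Re (\<Phi> (\<i> * of_real r))) 0" by (simp add: continuous_on_eq_continuous_at)
  from this[unfolded continuous_at_eps_delta, rule_format, of "y0 / 2"] y0
  obtain \<delta> where \<delta>: "\<delta> > 0" "\<And>r. \<bar>r\<bar> < \<delta> \<Longrightarrow> \<bar>Re (\<Phi> (\<i> * of_real r)) - y0\<bar> < y0 / 2"
    by (auto simp: dist_real_def)
  obtain C where C: "C \<ge> 0" "\<And>y. y \<ge> 0 \<Longrightarrow> norm (poly Q (\<i> * of_real y)) \<le> C * exp (1/2 * y)"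
    using poly_imaginary_exp_bound[of "1/2" Q] by auto
  define R where "R = 2 * cube_radius M TYPE('n)"
  have R: "R > 0" using radius_pos by (simp add: R_def)
  \<comment> \<open>The decay is spent as exp (- y / 2) \<le> 2 / y with y = k |x|. This costs one
    power of |x|, and the resulting |x|^(1 - d) is still dominated by the weight.\<close>
  have wb: "weight_bounded M (2 * C * R powr (1/2) / k) (\<lambda>u :: real ^ 'n. green u (\<i> * of_real k))" if k: "k > 0" for k
    unfolding weight_bounded_def
  proof (intro conjI allI impI)
    show "(\<lambda>u :: real ^ 'n. green u (\<i> * of_real k)) \<in> borel_measurable borel" by (rule borel_measurable_G) (use k in simp)
    show "0 \<le> 2 * C * R powr (1/2) / k" using C(1) k by simp
    fix x :: "real ^ 'n" assume x: "x \<noteq> 0 \<and> norm x \<le> 2 * cube_radius M TYPE('n)"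
    let ?y = "k * norm x"
    have y: "?y > 0" using x k by simp
    have "norm (\<Phi> (\<i> * of_real ?y)) = exp (- ?y) * norm (poly Q (\<i> * of_real ?y))"
      by (simp add: \<Phi>_def norm_mult)
    also have "\<dots> \<le> exp (- ?y) * (C * exp (1/2 * ?y))" using y C(2)[of ?y] by (intro mult_left_mono) auto
    also have "\<dots> = C * exp (- (?y / 2))" by (simp flip: exp_add)
    also have "\<dots> \<le> C * (2 / ?y)"
    proof (intro mult_left_mono C(1))
      have "?y / 2 \<le> exp (?y / 2)" using exp_ge_add_one_self[of "?y / 2"] by linarith
      thus "exp (- (?y / 2)) \<le> 2 / ?y" using y by (simp add: exp_minus field_simps)
    qed
    finally have \<Phi>: "norm (\<Phi> (\<i> * of_real ?y)) \<le> C * (2 / ?y)" .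
    have "norm (green x (\<i> * of_real k)) \<le> norm x powr (2 - real CARD('n)) * (C * (2 / ?y))"
    proof -
      have "norm (green x (\<i> * of_real k)) = norm x powr (2 - real CARD('n)) * norm (\<Phi> (\<i> * of_real ?y))"
        using x k by (simp add: G norm_mult mult.assoc)
      also have "\<dots> \<le> norm x powr (2 - real CARD('n)) * (C * (2 / ?y))" by (intro mult_left_mono \<Phi>) simp
      finally show ?thesis .
    qed
    also have "norm x powr (2 - real CARD('n)) * (C * (2 / ?y)) = 2 * C / k * (norm x powr (2 - real CARD('n)) / norm x)"
      using k x by (simp add: field_simps)
    also have "norm x powr (2 - real CARD('n)) / norm x = norm x powr (1/2) * weight x"
      using x powr_diff[of "norm x" "2 - real CARD('n)" 1] by (simp add: weight_def powr_add[symmetric])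
    also have "2 * C / k * (norm x powr (1/2) * weight x) \<le> 2 * C / k * (R powr (1/2) * weight x)"
      using x k C(1) R by (intro mult_left_mono mult_right_mono powr_mono2 weight_nonneg) (auto simp: R_def)
    finally show "norm (green x (\<i> * of_real k)) \<le> 2 * C * R powr (1/2) / k * weight x" by simp
  qed
  show "amplifying M (green :: real ^ 'n \<Rightarrow> _)"
    unfolding amplifying_def
  proof (rule exI[of _ "min 1 (\<delta> / 2)"], intro conjI allI impI)
    fix N :: real assume N: "N \<ge> 0"
    \<comment> \<open>Large enough for N times the bound of order 1 / k to stay below y0 /
      2.\<close>
    define k where "k = 2 / y0 * (N * (2 * C * R powr (1/2))) + 1"
    have k: "k > 0" using y0 N C(1) by (auto simp: k_def intro!: add_nonneg_pos)
    have NC: "N * (2 * C * R powr (1/2) / k) \<le> y0 / 2"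
    proof -
      have "N * (2 * C * R powr (1/2)) \<le> k * (y0 / 2)" using y0 by (simp add: k_def field_simps)
      thus ?thesis using k by (simp add: field_simps)
    qed
    have lb: "Re (1 * green x \<i>) \<ge> y0 / 2 - 0 * weight x" if "x \<noteq> 0 \<and> norm x \<le> min 1 (\<delta> / 2)" for x :: "real ^ 'n"
    proof -
      have "Re (\<Phi> (\<i> * of_real (norm x))) \<ge> y0 / 2" using \<delta>(2)[of "norm x"] that \<delta>(1) by (auto simp: abs_if split: if_splits)
      moreover have "1 \<le> norm x powr (2 - real CARD('n))"
      proof -
        have "norm x powr 0 \<le> norm x powr (2 - real CARD('n))" using that d by (intro powr_mono') auto
        thus ?thesis using that by simp
      qed
      ultimately have "1 * (y0 / 2) \<le> norm x powr (2 - real CARD('n)) * Re (\<Phi> (\<i> * of_real (norm x)))"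
        using y0 by (intro mult_mono) auto
      thus ?thesis using that by (simp add: G)
    qed
    show "\<exists>z1 z2 \<kappa> A H c. z1 \<noteq> 0 \<and> z2 \<noteq> 0 \<and> norm \<kappa> = 1 \<and> A \<ge> 0 \<and> c > 0 \<and>
       weight_bounded M H (\<lambda>u :: real ^ 'n. green u z2) \<and> N * (A + H) \<le> c \<and>
       (\<forall>x :: real ^ 'n. x \<noteq> 0 \<and> norm x \<le> min 1 (\<delta> / 2) \<longrightarrow> Re (\<kappa> * green x z1) \<ge> c - A * weight x)"
      by (rule exI[of _ \<i>], rule exI[of _ "\<i> * of_real k"], rule exI[of _ 1], rule exI[of _ 0],
          rule exI[of _ "2 * C * R powr (1/2) / k"], rule exI[of _ "y0 / 2"], use wb[OF k] k y0 NC lb in simp)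
  qed (use \<delta> in auto)
qed

text \<open>Going round the logarithmic cover m times from z = 1 leaves exp (2 z) unchanged and adds
  2 \<pi> \<i> m times the coefficient of the logarithm. In it the singular factor |x|^(2 - d)
  cancels against s^n, so a nearly constant multiple of m remains: it is what makes z1 dominate. The
  base point serves as z2.\<close>

lemma green_even:
  assumes M: "M > 0" and d: "CARD('n::finite) = 2 * n + 2"
  shows "\<exists>g s. helmholtz_kernel M g s (green :: real ^ 'n \<Rightarrow> _)" "amplifying M (green :: real ^ 'n \<Rightarrow> _)"
proof -
  obtain A E e where AE: "A holomorphic_on UNIV" "E holomorphic_on UNIV" "e > 0" "E 0 = - of_real e"
    "\<And>r w. r > 0 \<Longrightarrow> green_log (2 * n + 2) r w =
      of_real ((1 / r) ^ (2 * n)) * (A (exp (2 * w) * of_real (r\<^sup>2 / 4)) +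
        (w + of_real (ln r)) * (exp (2 * w) * of_real (r\<^sup>2 / 4)) ^ n * E (exp (2 * w) * of_real (r\<^sup>2 / 4)))"
    using green_log_even[of n] by blast
  have E': "(\<lambda>s. s ^ n * E s) holomorphic_on UNIV" by (intro holomorphic_intros AE)
  have p: "norm x powr (2 - real CARD('n)) = (1 / norm x) ^ (2 * n)" if "x \<noteq> 0" for x :: "real ^ 'n"
  proof -
    have "norm x powr (2 - real CARD('n)) = norm x powr (- real (2 * n))" using d by simp
    also have "\<dots> = (1 / norm x) ^ (2 * n)"
      unfolding powr_minus by (subst powr_realpow) (use that in \<open>auto simp: power_one_over inverse_eq_divide\<close>)
    finally show ?thesis .
  qed
  have "even CARD('n)" using d by simp
  hence G: "green (x :: real ^ 'n) z = of_real (norm x powr (2 - real CARD('n))) *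
      (A (exp (2 * z) * of_real ((norm x)\<^sup>2 / 4)) + (z + of_real (ln (norm x))) *
        ((exp (2 * z) * of_real ((norm x)\<^sup>2 / 4)) ^ n * E (exp (2 * z) * of_real ((norm x)\<^sup>2 / 4))))"
    if "x \<noteq> 0" for x z
    unfolding p[OF that] using AE(5)[of "norm x" z] that by (simp only: green_def Let_def d if_True zero_less_norm_iff mult.assoc not_False_eq_True)
  from helmholtz_kernel_evenI[OF M AE(1) E' G]
  show ex: "\<exists>g s. helmholtz_kernel M g s (green :: real ^ 'n \<Rightarrow> _)" by blast
  then obtain g s where "helmholtz_kernel M g s (green :: real ^ 'n \<Rightarrow> _)" by blast
  then interpret helmholtz_kernel M g s "green :: real ^ 'n \<Rightarrow> _" .
  obtain C where C: "C \<ge> 0" "\<And>z. z \<noteq> 0 \<Longrightarrow> norm z \<le> 1 \<Longrightarrow> weight_bounded M (C / norm z) (\<lambda>u :: real ^ 'n. green u z)"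
    by (rule weight_bounded_G) blast
  have wb: "weight_bounded M C (\<lambda>u :: real ^ 'n. green u 1)" using C(2)[of 1] by simp
  have "isCont (\<lambda>s. Re (E s)) 0"
    using holomorphic_on_imp_continuous_on[OF AE(2)] by (auto simp: continuous_on_eq_continuous_at intro: continuous_intros)
  from this[unfolded continuous_at_eps_delta, rule_format, of "e / 2"] AE(3,4)
  obtain \<delta> where \<delta>: "\<delta> > 0" "\<And>s. norm s < \<delta> \<Longrightarrow> \<bar>Re (E s) + e\<bar> < e / 2"
    by (auto simp: dist_real_def)
  \<comment> \<open>On the sheets above the base point, s = a |x|^2.\<close>
  define a where "a = exp 2 / (4 :: real)"
  have a: "a > 0" by (simp add: a_def)
  define \<rho> where "\<rho> = min (2 * cube_radius M TYPE('n)) (sqrt (\<delta> / (2 * a)))"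
  have \<rho>: "\<rho> > 0" using radius_pos \<delta>(1) a by (simp add: \<rho>_def)
  show "amplifying M (green :: real ^ 'n \<Rightarrow> _)"
    unfolding amplifying_def
  proof (rule exI[of _ \<rho>], intro conjI allI impI \<rho>)
    fix N :: real assume N: "N \<ge> 0"
    define b where "b = pi * a ^ n * e"
    have b: "b > 0" using a AE(3) by (simp add: b_def)
    \<comment> \<open>Enough turns for m * b to exceed N times the two bounds at the base point, one
      for A and one for H.\<close>
    obtain m :: nat where "N * (C + C) / b + 1 \<le> real m" using real_arch_simple by blast
    moreover have "N * (C + C) / b \<ge> 0" using N C(1) b by simp
    ultimately have m: "real m \<ge> 1" "N * (C + C) / b \<le> real m" by linarith+
    have mb: "real m * b > 0" "N * (C + C) \<le> real m * b" using m b by (auto simp: field_simps)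
    define z1 where "z1 = 1 + 2 * of_real pi * of_nat m * \<i>"
    have z1: "z1 \<noteq> 0" by (auto simp: z1_def complex_eq_iff)
    have "exp (2 * z1) = exp 2 * exp (of_nat (2 * m) * (2 * of_real pi * \<i>))"
      unfolding z1_def exp_add[symmetric] by (simp add: algebra_simps)
    hence ez: "exp (2 * z1) = exp (2 * 1)" unfolding exp_of_nat_mult by simp
    have lb: "Re (\<i> * green x z1) \<ge> real m * b - C * weight x" if x: "x \<noteq> 0 \<and> norm x \<le> \<rho>" for x :: "real ^ 'n"
    proof -
      define s where "s = exp (2 * 1) * complex_of_real ((norm x)\<^sup>2 / 4)"
      have sa: "s = of_real (a * (norm x)\<^sup>2)" by (simp add: s_def a_def exp_of_real[symmetric])
      have "(norm x)\<^sup>2 \<le> (sqrt (\<delta> / (2 * a)))\<^sup>2" using x by (intro power_mono) (auto simp: \<rho>_def)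
      also have "\<dots> = \<delta> / (2 * a)" using \<delta>(1) a by simp
      finally have "a * (norm x)\<^sup>2 \<le> a * (\<delta> / (2 * a))" using a by (intro mult_left_mono) auto
      also have "\<dots> = \<delta> / 2" using a by simp
      finally have "a * (norm x)\<^sup>2 \<le> \<delta> / 2" .
      hence "norm s < \<delta>" unfolding sa using \<delta>(1) a by (simp only: norm_of_real) simp
      hence Es: "Re (E s) \<le> - e / 2" using \<delta>(2)[of s] by (simp add: abs_if split: if_splits)
      have "green x z1 = green x 1 + of_real (norm x powr (2 - real CARD('n))) * ((z1 - 1) * (s ^ n * E s))"
        using x unfolding G[OF conjunct1[OF x]] ez s_def[symmetric] by (simp add: algebra_simps)
      also have "of_real (norm x powr (2 - real CARD('n))) * ((z1 - 1) * (s ^ n * E s)) =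
          \<i> * of_real (2 * pi * real m * a ^ n) * E s"
      proof -
        have "norm x powr (2 - real CARD('n)) * (a * (norm x)\<^sup>2) ^ n = a ^ n"
          using x by (simp add: p power_mult_distrib power_one_over power_mult)
        hence "of_real (norm x powr (2 - real CARD('n))) * s ^ n = complex_of_real (a ^ n)"
          unfolding sa by (simp only: of_real_mult[symmetric] of_real_power[symmetric])
        hence "of_real (norm x powr (2 - real CARD('n))) * ((z1 - 1) * (s ^ n * E s)) = (z1 - 1) * (of_real (a ^ n) * E s)"
          by (metis mult.assoc mult.left_commute)
        thus ?thesis by (simp add: z1_def mult_ac)
      qed
      finally have "Re (\<i> * green x z1) = Re (\<i> * green x 1) - 2 * pi * real m * a ^ n * Re (E s)"
        by (simp add: algebra_simps)
      moreover have "2 * pi * real m * a ^ n * Re (E s) \<le> 2 * pi * real m * a ^ n * (- e / 2)"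
        using a Es by (intro mult_left_mono) auto
      moreover have "norm (green x 1) \<le> C * weight x" using wb x by (auto simp: weight_bounded_def \<rho>_def)
      moreover have "\<bar>Re (\<i> * green x 1)\<bar> \<le> norm (green x 1)" using abs_Im_le_cmod[of "green x 1"] by simp
      moreover have "2 * pi * real m * a ^ n * (- e / 2) = - (real m * b)" by (simp add: b_def)
      ultimately show ?thesis by linarith
    qed
    show "\<exists>z1 z2 \<kappa> A H c. z1 \<noteq> 0 \<and> z2 \<noteq> 0 \<and> norm \<kappa> = 1 \<and> A \<ge> 0 \<and> c > 0 \<and>
       weight_bounded M H (\<lambda>u :: real ^ 'n. green u z2) \<and> N * (A + H) \<le> c \<and>
       (\<forall>x :: real ^ 'n. x \<noteq> 0 \<and> norm x \<le> \<rho> \<longrightarrow> Re (\<kappa> * green x z1) \<ge> c - A * weight x)"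
      by (rule exI[of _ z1], rule exI[of _ 1], rule exI[of _ \<i>], rule exI[of _ C], rule exI[of _ C],
          rule exI[of _ "real m * b"], use wb z1 C(1) mb lb in \<open>simp del: mult_pos_pos\<close>)
  qed
qed

theorem green_helmholtz_kernel:
  assumes M: "M > 0"
  shows "\<exists>g s. helmholtz_kernel M g s (green :: real ^ 'n::finite \<Rightarrow> _)" "amplifying M (green :: real ^ 'n \<Rightarrow> _)"
proof -
  have "CARD('n) > 0" by simp
  then consider "CARD('n) = 1" | m where "CARD('n) = 2 * m + 3" | n where "CARD('n) = 2 * n + 2"
  proof (atomize_elim, cases "even CARD('n)")
    case True
    then obtain k where k: "CARD('n) = 2 * k" by (auto elim: evenE)
    hence "CARD('n) = 2 * (k - 1) + 2" using \<open>CARD('n) > 0\<close> by linarith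
    thus "CARD('n) = 1 \<or> (\<exists>m. CARD('n) = 2 * m + 3) \<or> (\<exists>n. CARD('n) = 2 * n + 2)" by blast
  next
    case False
    then obtain k where k: "CARD('n) = 2 * k + 1" by (auto elim: oddE)
    hence "CARD('n) = 1 \<or> CARD('n) = 2 * (k - 1) + 3" by linarith
    thus "CARD('n) = 1 \<or> (\<exists>m. CARD('n) = 2 * m + 3) \<or> (\<exists>n. CARD('n) = 2 * n + 2)" by blast
  qed
  hence "(\<exists>g s. helmholtz_kernel M g s (green :: real ^ 'n \<Rightarrow> _)) \<and> amplifying M (green :: real ^ 'n \<Rightarrow> _)"
    by cases (use green_dim_1[OF M] green_odd[OF M] green_even[OF M] in blast)+
  thus "\<exists>g s. helmholtz_kernel M g s (green :: real ^ 'n \<Rightarrow> _)" "amplifying M (green :: real ^ 'n \<Rightarrow> _)" by auto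
qed

section \<open>Resonances and their approximation\<close>

lemma dense_gaussian_rationals:
  assumes "e > 0"
  obtains w where "w \<in> gaussian_rationals" "dist z w < e"
proof -
  have "\<exists>r. \<bar>x - real_of_rat r\<bar> < e / 2" for x
  proof -
    from assms obtain t where t: "t \<in> \<rat>" "x < t" "t < x + e / 2" using Rats_dense_in_real[of x "x + e / 2"] by auto
    then obtain r where "t = real_of_rat r" by (auto elim: Rats_cases)
    with t show ?thesis by (intro exI[of _ r]) auto
  qed
  then obtain a b where ab: "\<bar>Re z - real_of_rat a\<bar> < e / 2" "\<bar>Im z - real_of_rat b\<bar> < e / 2" by metis
  show ?thesis
  proof (rule that)
    show "Complex (of_rat a) (of_rat b) \<in> gaussian_rationals" by (auto simp: gaussian_rationals_def)
    show "dist z (Complex (of_rat a) (of_rat b)) < e"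
      using ab cmod_le[of "z - Complex (of_rat a) (of_rat b)"] by (simp add: dist_norm)
  qed
qed

lemma gaussian_rational_net:
  assumes "e > 0"
  shows "\<exists>A. finite A \<and> A \<subseteq> gaussian_rationals \<and> (\<forall>z. norm z \<le> r \<longrightarrow> (\<exists>w\<in>A. dist z w < e))"
proof -
  have "e / 2 > 0" using assms by simp
  then obtain F :: "complex set" where F: "finite F" "cball 0 r \<subseteq> (\<Union>y\<in>F. ball y (e / 2))"
    using seq_compact_imp_totally_bounded[OF compact_imp_seq_compact[OF compact_cball], of "0 :: complex" r,
        rule_format, OF \<open>e / 2 > 0\<close>] by blast
  have "\<exists>w. w \<in> gaussian_rationals \<and> dist y w < e / 2" for y
    using dense_gaussian_rationals[OF \<open>e / 2 > 0\<close>] by blast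
  then obtain c where c: "\<And>y. c y \<in> gaussian_rationals" "\<And>y. dist y (c y) < e / 2"
    by metis
  show ?thesis
  proof (intro exI[of _ "c ` F"] conjI allI impI)
    fix z :: complex assume "norm z \<le> r"
    hence "z \<in> cball 0 r" by simp
    then obtain y where "y \<in> F" "dist y z < e / 2" using F(2) by auto
    thus "\<exists>w\<in>c ` F. dist z w < e"
      using dist_triangle_half_r[of y z e "c y"] c(2)[of y] by auto
  qed (use F c in auto)
qed

definition grid :: "nat \<Rightarrow> complex set" where
  "grid n = (SOME A. finite A \<and> A \<subseteq> gaussian_rationals \<and>
     (\<forall>z. norm z \<le> real (Suc n) \<longrightarrow> (\<exists>w\<in>A. dist z w < 1 / (real (Suc n))\<^sup>2)))"

lemma grid:
  "finite (grid n)" "grid n \<subseteq> gaussian_rationals"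
  "norm z \<le> real (Suc n) \<Longrightarrow> \<exists>w\<in>grid n. dist z w < 1 / (real (Suc n))\<^sup>2"
proof -
  have "1 / (real (Suc n))\<^sup>2 > 0" by simp
  note * = someI_ex[OF gaussian_rational_net[OF this, of "real (Suc n)"], folded grid_def]
  show "finite (grid n)" by (rule conjunct1[OF *])
  show "grid n \<subseteq> gaussian_rationals" by (rule conjunct1[OF conjunct2[OF *]])
  show "\<exists>w\<in>grid n. dist z w < 1 / (real (Suc n))\<^sup>2" if "norm z \<le> real (Suc n)"
    by (rule mp[OF spec[OF conjunct2[OF conjunct2[OF *]]] that])
qed

lemma eventually_Suc_ge: "\<forall>\<^sub>F n in sequentially. X \<le> real (Suc n)"
proof -
  obtain N :: nat where "X \<le> real N" using real_arch_simple by blast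
  thus ?thesis unfolding eventually_sequentially by (intro exI[of _ N]) auto
qed

text \<open>A property of a punctured neighbourhood also holds near each other point w of it, after
  z0 has been removed from the neighbourhood of w.\<close>

lemma eventually_at_eventually:
  fixes P :: "complex \<Rightarrow> bool"
  assumes "\<forall>\<^sub>F z in at z0. P z"
  obtains S where "open S" "z0 \<in> S" "\<And>w. w \<in> S \<Longrightarrow> \<forall>\<^sub>F z in at w. P z"
proof -
  from assms obtain S where S: "open S" "z0 \<in> S" "\<And>z. z \<in> S \<Longrightarrow> z \<noteq> z0 \<Longrightarrow> P z"
    unfolding eventually_at_topological by blast
  show ?thesis
  proof (rule that[OF S(1,2)])
    fix w assume w: "w \<in> S"
    show "\<forall>\<^sub>F z in at w. P z"
    proof (cases "w = z0")
      case False
      hence "\<forall>\<^sub>F z in at w. z \<in> (S - {z0}) - {w}"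
        using w S(1) by (intro eventually_at_in_open) auto
      thus ?thesis by (rule eventually_mono) (use S in auto)
    qed (use assms in simp)
  qed
qed

lemma open_eventually_at: "open {z0 :: complex. \<forall>\<^sub>F z in at z0. Q z}"
proof (subst open_subopen, intro ballI)
  fix z0 assume "z0 \<in> {z0. \<forall>\<^sub>F z in at z0. Q z}"
  hence "\<forall>\<^sub>F z in at z0. Q z" by simp
  then obtain S where "open S" "z0 \<in> S" "\<And>w. w \<in> S \<Longrightarrow> \<forall>\<^sub>F z in at w. Q z"
    by (rule eventually_at_eventually) blast
  thus "\<exists>T. open T \<and> z0 \<in> T \<and> T \<subseteq> {z0. \<forall>\<^sub>F z in at z0. Q z}"
    by (intro exI[of _ S]) auto
qed

section \<open>The singular set of the inverse\<close>

context helmholtz_kernel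
begin

definition invertible_at :: "(real ^ 'n \<Rightarrow> complex) \<Rightarrow> complex \<Rightarrow> bool" where
  "invertible_at q z \<longleftrightarrow> (\<exists>B. is_inverse (id_blinfun + K q z) B)"

definition inverse_le :: "(real ^ 'n \<Rightarrow> complex) \<Rightarrow> complex \<Rightarrow> real \<Rightarrow> bool" where
  "inverse_le q z b \<longleftrightarrow> (\<exists>B. is_inverse (id_blinfun + K q z) B \<and> norm B \<le> b)"

text \<open>By the trichotomy this rate of growth is automatic at every pole; it is part of the
  definition because the algorithm compares it with its threshold.\<close>

definition singular_set :: "(real ^ 'n \<Rightarrow> complex) \<Rightarrow> complex set" where
  "singular_set q = {z0. \<exists>c>0. \<forall>\<^sub>F z in at z0. \<exists>B. is_inverse (id_blinfun + K q z) B \<and> norm B \<ge> c / norm (z - z0)}"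

lemma inverse_le_perturb:
  assumes "inverse_le q z b" "norm (K p z' - K q z) * b \<le> 1/2"
  shows "inverse_le p z' (2 * b)"
proof -
  from assms(1) obtain B where B: "is_inverse (id_blinfun + K q z) B" "norm B \<le> b"
    by (auto simp: inverse_le_def)
  have "norm ((id_blinfun + K p z') - (id_blinfun + K q z)) * norm B \<le> 1/2"
    using mult_left_mono[OF B(2) norm_ge_zero[of "K p z' - K q z"]] assms(2) by simp
  from inverse_perturbation[OF B(1) this] obtain B'
    where "is_inverse (id_blinfun + K p z') B'" "norm B' \<le> 2 * norm B" .
  thus ?thesis unfolding inverse_le_def using B(2) by (intro exI[of _ B']) simp
qed

lemma invertible_iff_inverse_le: "invertible_at q z \<longleftrightarrow> (\<exists>b\<ge>0. inverse_le q z b)"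
proof
  assume "invertible_at q z"
  then obtain B where "is_inverse (id_blinfun + K q z) B" unfolding invertible_at_def ..
  thus "\<exists>b\<ge>0. inverse_le q z b" unfolding inverse_le_def by (intro exI[of _ "norm B"]) auto
qed (auto simp: invertible_at_def inverse_le_def)

lemma inverse_le_mono: "inverse_le q z b \<Longrightarrow> b \<le> b' \<Longrightarrow> inverse_le q z b'"
  unfolding inverse_le_def by (elim exE conjE) (intro exI conjI, assumption, rule order_trans)

context
  fixes q :: "real ^ 'n \<Rightarrow> complex" and P
  assumes q: "cube_bounded M P q"
begin

lemma inverse_le_nhds:
  assumes "w \<noteq> 0" "inverse_le q w b" "b \<ge> 0"
  shows "\<forall>\<^sub>F z in nhds w. inverse_le q z (2 * b)"
proof -
  have "\<forall>\<^sub>F z in nhds w. norm (K q z - K q w) \<le> 1 / (2 * (b + 1))"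
    by (rule K_continuous[OF q assms(1)]) (use assms(3) in simp)
  thus ?thesis
  proof eventually_elim
    case (elim z)
    have "norm (K q z - K q w) * b \<le> 1 / (2 * (b + 1)) * (b + 1)"
      using elim assms(3) by (intro mult_mono) auto
    also have "\<dots> = 1/2" using assms(3) by (simp add: field_simps)
    finally show ?case by (rule inverse_le_perturb[OF assms(2)])
  qed
qed

text \<open>K is continuous at w \<noteq> 0, so the operator at w is a small perturbation of one at
  a nearby point, where the inverse is bounded.\<close>

lemma inverse_le_at:
  assumes "w \<noteq> 0" and b: "b \<ge> 0" "\<forall>\<^sub>F z in at w. inverse_le q z b"
  shows "inverse_le q w (2 * b)"
proof -
  have "\<forall>\<^sub>F z in at w. norm (K q z - K q w) \<le> 1 / (2 * (b + 1))"
    using K_continuous[OF q assms(1), of "1 / (2 * (b + 1))"] b(1) by (simp add: eventually_at_filter eventually_mono)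
  with b(2) have "\<forall>\<^sub>F z in at w. inverse_le q z b \<and> norm (K q z - K q w) \<le> 1 / (2 * (b + 1))"
    by eventually_elim simp
  then obtain z where z: "inverse_le q z b" "norm (K q z - K q w) \<le> 1 / (2 * (b + 1))"
    using eventually_happens by fastforce
  have "norm (K q w - K q z) * b \<le> 1 / (2 * (b + 1)) * (b + 1)"
    using z(2) b(1) by (intro mult_mono) (auto simp: norm_minus_commute)
  also have "\<dots> = 1/2" using b(1) by (simp add: field_simps)
  finally show ?thesis by (rule inverse_le_perturb[OF z(1)])
qed

lemma trichotomy:
  "(\<forall>\<^sub>F z in at z0. \<not> invertible_at q z) \<or> (\<exists>b\<ge>0. \<forall>\<^sub>F z in at z0. inverse_le q z b) \<or> z0 \<in> singular_set q"
proof -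
  have "\<exists>b\<ge>0. \<forall>\<^sub>F z in at z0. inverse_le q z b"
    if "\<forall>\<^sub>F z in at z0. \<exists>B. is_inverse (id_blinfun + K q z) B \<and> norm B \<le> C" for C
  proof (intro exI[of _ "max C 0"] conjI)
    show "\<forall>\<^sub>F z in at z0. inverse_le q z (max C 0)"
      using that by eventually_elim (auto simp: inverse_le_def le_max_iff_disj)
  qed simp
  with K_trichotomy[OF q, of z0] show ?thesis
    unfolding invertible_at_def singular_set_def by blast
qed

lemma singular_not_bounded:
  assumes "z0 \<in> singular_set q"
  shows "\<not> (\<forall>\<^sub>F z in at z0. inverse_le q z b)"
proof
  assume b: "\<forall>\<^sub>F z in at z0. inverse_le q z b"
  from assms obtain c where c: "c > 0"
    "\<forall>\<^sub>F z in at z0. \<exists>B. is_inverse (id_blinfun + K q z) B \<and> norm B \<ge> c / norm (z - z0)"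
    by (auto simp: singular_set_def)
  have "((\<lambda>z. (\<bar>b\<bar> + 1) * norm (z - z0)) \<longlongrightarrow> 0) (at z0)" by (auto intro!: tendsto_eq_intros)
  hence "\<forall>\<^sub>F z in at z0. (\<bar>b\<bar> + 1) * norm (z - z0) < c" by (rule order_tendstoD) fact
  moreover have "\<forall>\<^sub>F z in at z0. z \<noteq> z0" by (simp add: eventually_neq_at_within)
  ultimately have "\<forall>\<^sub>F z in at z0. False" using b c(2)
  proof eventually_elim
    case (elim z)
    then obtain B B' where "is_inverse (id_blinfun + K q z) B" "norm B \<ge> c / norm (z - z0)"
      "is_inverse (id_blinfun + K q z) B'" "norm B' \<le> b" by (auto simp: inverse_le_def)
    hence "c / norm (z - z0) \<le> b" using is_inverse_unique by fastforce
    hence "c \<le> b * norm (z - z0)" using elim(2) by (simp add: divide_le_eq)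
    also have "\<dots> \<le> (\<bar>b\<bar> + 1) * norm (z - z0)" by (intro mult_right_mono) auto
    finally show False using elim(1) by simp
  qed
  thus False by simp
qed

lemma singular_imp_invertible:
  assumes "z0 \<in> singular_set q"
  shows "\<forall>\<^sub>F z in at z0. invertible_at q z"
  using assms by (auto simp: singular_set_def invertible_at_def elim!: eventually_mono)

text \<open>Both alternatives describe open sets of centres z0, and by the trichotomy these sets are
  complementary; the plane is connected.\<close>

lemma invertible_dichotomy:
  "(\<forall>z0. \<forall>\<^sub>F z in at z0. \<not> invertible_at q z) \<or> (\<forall>z0. \<forall>\<^sub>F z in at z0. invertible_at q z)"
proof -
  define U where "U = {z0. \<forall>\<^sub>F z in at z0. \<not> invertible_at q z}"
  define V where "V = {z0. \<forall>\<^sub>F z in at z0. invertible_at q z}"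
  have UV: "- U = V"
  proof
    show "- U \<subseteq> V"
    proof
      fix z0 assume "z0 \<in> - U"
      with trichotomy[of z0] have "(\<exists>b\<ge>0. \<forall>\<^sub>F z in at z0. inverse_le q z b) \<or> z0 \<in> singular_set q"
        unfolding U_def by blast
      thus "z0 \<in> V"
      proof
        assume "\<exists>b\<ge>0. \<forall>\<^sub>F z in at z0. inverse_le q z b"
        then obtain b where "b \<ge> 0" "\<forall>\<^sub>F z in at z0. inverse_le q z b" by blast
        from this(2) have "\<forall>\<^sub>F z in at z0. invertible_at q z"
          by eventually_elim (use \<open>b \<ge> 0\<close> invertible_iff_inverse_le in blast)
        thus ?thesis by (simp add: V_def)
      qed (simp add: V_def singular_imp_invertible)
    qed
    show "V \<subseteq> - U"
    proof
      fix z0 assume V: "z0 \<in> V"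
      show "z0 \<in> - U"
      proof
        assume "z0 \<in> U"
        with V have "\<forall>\<^sub>F z in at z0. False" unfolding U_def V_def mem_Collect_eq by eventually_elim simp
        thus False by simp
      qed
    qed
  qed
  have "open U" unfolding U_def by (rule open_eventually_at)
  moreover have "open V" unfolding V_def by (rule open_eventually_at)
  hence "closed U" using UV by (simp add: closed_def)
  ultimately have "U = {} \<or> U = UNIV" using clopen by blast
  thus ?thesis
  proof
    assume "U = {}"
    hence "V = UNIV" using UV by auto
    thus ?thesis by (auto simp: V_def)
  qed (auto simp: U_def)
qed

text \<open>Outside the singular set, in the generically invertible case, the inverse is bounded
  near z0 and thus near all points close to z0, none of which can be singular. In the other case the
  set is empty.\<close>

lemma closed_singular_set: "closed (singular_set q)"
proof -
  have "open (- singular_set q)"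
  proof (subst open_subopen, intro ballI)
    fix z0 assume z0: "z0 \<in> - singular_set q"
    from invertible_dichotomy show "\<exists>T. open T \<and> z0 \<in> T \<and> T \<subseteq> - singular_set q"
    proof
      assume *: "\<forall>z0. \<forall>\<^sub>F z in at z0. \<not> invertible_at q z"
      have "singular_set q = {}"
      proof (rule equals0I)
        fix z assume "z \<in> singular_set q"
        from singular_imp_invertible[OF this] *[rule_format, of z] have "\<forall>\<^sub>F z in at z. False"
          by eventually_elim simp
        thus False by simp
      qed
      thus ?thesis by (intro exI[of _ UNIV]) auto
    next
      assume *: "\<forall>z0. \<forall>\<^sub>F z in at z0. invertible_at q z"
      have "\<not> (\<forall>\<^sub>F z in at z0. \<not> invertible_at q z)"
      proof
        assume "\<forall>\<^sub>F z in at z0. \<not> invertible_at q z"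
        with *[rule_format, of z0] have "\<forall>\<^sub>F z in at z0. False" by eventually_elim simp
        thus False by simp
      qed
      with trichotomy[of z0] z0 obtain b where "\<forall>\<^sub>F z in at z0. inverse_le q z b" by auto
      then obtain S where "open S" "z0 \<in> S" "\<And>w. w \<in> S \<Longrightarrow> \<forall>\<^sub>F z in at w. inverse_le q z b"
        by (rule eventually_at_eventually) blast
      thus ?thesis using singular_not_bounded by (intro exI[of _ S]) auto
    qed
  qed
  thus ?thesis by (simp add: closed_def)
qed

text \<open>By the trichotomy a point outside the singular set has a punctured neighbourhood where
  the inverse is bounded or does not exist at all, and in neither case does the norm tend to
  infinity.\<close>

lemma is_pole_iff: "is_pole (\<lambda>z. blinfun_inverse (id_blinfun + K q z)) z0 \<longleftrightarrow> z0 \<in> singular_set q"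
proof
  assume "z0 \<in> singular_set q"
  then obtain c where c: "c > 0"
    "\<forall>\<^sub>F z in at z0. \<exists>B. is_inverse (id_blinfun + K q z) B \<and> norm B \<ge> c / norm (z - z0)"
    by (auto simp: singular_set_def)
  have "filterlim (\<lambda>z. norm (z - z0)) (at_right 0) (at z0)"
    unfolding filterlim_at by (auto intro!: tendsto_eq_intros simp: eventually_at_filter)
  hence "filterlim (\<lambda>z. c * inverse (norm (z - z0))) at_top (at z0)"
    using c(1) by (intro filterlim_tendsto_pos_mult_at_top[OF tendsto_const]
        filterlim_compose[OF filterlim_inverse_at_top_right]) auto
  moreover have "\<forall>\<^sub>F z in at z0. c * inverse (norm (z - z0)) \<le> norm (blinfun_inverse (id_blinfun + K q z))"
    using c(2) by eventually_elim (auto simp: blinfun_inverse_eq divide_inverse)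
  ultimately have "filterlim (\<lambda>z. norm (blinfun_inverse (id_blinfun + K q z))) at_top (at z0)"
    by (rule filterlim_at_top_mono)
  thus "is_pole (\<lambda>z. blinfun_inverse (id_blinfun + K q z)) z0"
    unfolding is_pole_def filterlim_at_infinity_conv_norm_at_top .
next
  assume pole: "is_pole (\<lambda>z. blinfun_inverse (id_blinfun + K q z)) z0"
  have big: "\<forall>\<^sub>F z in at z0. norm (blinfun_inverse (id_blinfun + K q z)) > b" for b
    using pole unfolding is_pole_def filterlim_at_infinity_conv_norm_at_top filterlim_at_top_dense by blast
  show "z0 \<in> singular_set q"
  proof (rule ccontr)
    assume "z0 \<notin> singular_set q"
    with trichotomy[of z0] consider "\<forall>\<^sub>F z in at z0. \<not> invertible_at q z" |
      b where "\<forall>\<^sub>F z in at z0. inverse_le q z b" by blast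
    hence "\<forall>\<^sub>F z in at z0. False"
    proof cases
      case 1
      \<comment> \<open>Without inverses, \<open>blinfun_inverse\<close> takes one fixed value, and
        a pole would force its norm to exceed itself.\<close>
      from 1 big[of "norm (THE B :: 'n L2 \<Rightarrow>\<^sub>L 'n L2. False)"] show ?thesis
        by eventually_elim (simp add: invertible_at_def blinfun_inverse_undefined)
    next
      case 2
      from 2 big[of b] show ?thesis
        by eventually_elim (auto simp: inverse_le_def blinfun_inverse_eq)
    qed
    thus False by simp
  qed
qed

end

definition bad :: "nat \<Rightarrow> (real ^ 'n \<Rightarrow> complex) \<Rightarrow> complex \<Rightarrow> bool" where
  "bad n p z \<longleftrightarrow> \<not> inverse_le p z (real (Suc n))"

text \<open>The unit disc around 2 serves to recognise the degenerate case that \<open>I + K(z)\<close> is never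
  invertible.\<close>

definition approx_set :: "nat \<Rightarrow> (real ^ 'n \<Rightarrow> complex) \<Rightarrow> complex set" where
  "approx_set n p = (if \<forall>w\<in>grid n \<inter> cball 2 1. bad n p w then {}
     else {w\<in>grid n. norm w \<ge> 1 / (real (Suc n))\<^sup>2 \<and> bad n p w})"

end

section \<open>Convergence of the output of the algorithm\<close>

context helmholtz_kernel
begin

context
  fixes q :: "real ^ 'n \<Rightarrow> complex" and p :: "nat \<Rightarrow> real ^ 'n \<Rightarrow> complex" and P and P' and C
  assumes q: "cube_bounded M P q" and p: "\<And>n. cube_bounded M (P' n) (p n)"
    and close: "\<forall>\<^sub>F n in sequentially. \<forall>x. norm (p n x - q x) \<le> C / real (Suc n) ^ 4"
begin

text \<open>An error n^-4 in the potential, divided by |z| \<ge> n^-2, changes K by order n^-2;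
  multiplied by an inverse of norm b n this is of order 1 / n. This is where the exponents 4 and 2
  come from.\<close>

lemma K_close:
  assumes "b \<ge> 0"
  shows "\<forall>\<^sub>F n in sequentially. \<forall>z. norm z \<le> Z \<longrightarrow> norm z \<ge> 1 / (real (Suc n))\<^sup>2 \<longrightarrow>
    norm (K (p n) z - K q z) * (b * real (Suc n)) \<le> 1/2"
proof -
  obtain D where D: "D \<ge> 0" "\<And>p q :: real ^ 'n \<Rightarrow> complex. \<And>P Q \<eta> z. cube_bounded M P p \<Longrightarrow> cube_bounded M Q q \<Longrightarrow>
    (\<And>x. norm (p x - q x) \<le> \<eta>) \<Longrightarrow> z \<noteq> 0 \<Longrightarrow> norm z \<le> Z \<Longrightarrow> norm (K p z - K q z) \<le> \<eta> * D / norm z"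
    by (rule K_lipschitz) blast
  from close eventually_Suc_ge[of "2 * \<bar>C\<bar> * D * b"] show ?thesis
  proof eventually_elim
    case (elim n)
    define k where "k = real (Suc n)"
    have k: "k \<ge> 1" by (simp add: k_def)
    show ?case
    proof (intro allI impI)
      fix z :: complex assume z: "norm z \<le> Z" "norm z \<ge> 1 / (real (Suc n))\<^sup>2"
      have z0: "norm z > 0" using z(2) k by (auto simp: k_def[symmetric] intro: less_le_trans[rotated])
      have "norm (K (p n) z - K q z) \<le> C / k ^ 4 * D / norm z"
        using elim(1) z0 z(1) by (intro D(2)[OF p q]) (auto simp: k_def)
      also have "\<dots> \<le> \<bar>C\<bar> / k ^ 4 * D / norm z"
        using D(1) k by (intro divide_right_mono mult_right_mono) auto
      also have "\<dots> \<le> \<bar>C\<bar> / k ^ 4 * D / (1 / k\<^sup>2)"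
        using k D(1) z0 z(2)[folded k_def] by (intro divide_left_mono) auto
      also have "\<dots> = \<bar>C\<bar> * D / k\<^sup>2" using k by (simp add: field_simps power2_eq_square eval_nat_numeral)
      finally have "norm (K (p n) z - K q z) * (b * k) \<le> \<bar>C\<bar> * D / k\<^sup>2 * (b * k)"
        using assms k by (intro mult_right_mono) auto
      also have "\<dots> = \<bar>C\<bar> * D * b / k" using k by (simp add: field_simps power2_eq_square)
      also have "\<dots> \<le> 1/2" using elim(2)[folded k_def] k by (simp add: divide_le_eq mult_ac)
      finally show "norm (K (p n) z - K q z) * (b * real (Suc n)) \<le> 1/2" by (simp add: k_def)
    qed
  qed
qed

text \<open>A bound b for the inverse becomes 2 b for the approximating potential, which the growing
  threshold n + 1 eventually passes.\<close>

lemma not_bad_near: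
  assumes b: "b \<ge> 0" and inv: "\<And>z. z \<in> A \<Longrightarrow> z \<noteq> 0 \<Longrightarrow> inverse_le q z b" and A: "\<And>z. z \<in> A \<Longrightarrow> norm z \<le> Z"
  shows "\<forall>\<^sub>F n in sequentially. \<forall>z\<in>A. norm z \<ge> 1 / (real (Suc n))\<^sup>2 \<longrightarrow> \<not> bad n (p n) z"
  using K_close[OF b, of Z] eventually_Suc_ge[of "2 * b"]
proof eventually_elim
  case (elim n)
  show ?case
  proof (intro ballI impI)
    fix z assume z: "z \<in> A" "norm z \<ge> 1 / (real (Suc n))\<^sup>2"
    hence "z \<noteq> 0" by auto
    have "norm (K (p n) z - K q z) * b \<le> norm (K (p n) z - K q z) * (b * real (Suc n))"
      using b by (intro mult_left_mono) (auto simp: algebra_simps)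
    also have "\<dots> \<le> 1/2" using elim(1) z A by blast
    finally have "inverse_le (p n) z (2 * b)" by (rule inverse_le_perturb[OF inv[OF z(1) \<open>z \<noteq> 0\<close>]])
    thus "\<not> bad n (p n) z" unfolding bad_def using inverse_le_mono elim(2) by blast
  qed
qed

lemma inverse_le_if_not_bad:
  "\<forall>\<^sub>F n in sequentially. \<forall>z. norm z \<le> Z \<longrightarrow> norm z \<ge> 1 / (real (Suc n))\<^sup>2 \<longrightarrow> \<not> bad n (p n) z \<longrightarrow>
     inverse_le q z (2 * real (Suc n))"
  using K_close[of 1 Z, simplified]
proof eventually_elim
  case (elim n)
  show ?case
  proof (intro allI impI)
    fix z assume z: "norm z \<le> Z" "norm z \<ge> 1 / (real (Suc n))\<^sup>2" "\<not> bad n (p n) z"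
    have "norm (K q z - K (p n) z) * real (Suc n) \<le> 1/2"
      using elim z(1,2) by (simp add: norm_minus_commute)
    moreover have "inverse_le (p n) z (real (Suc n))" using z(3) by (simp add: bad_def)
    ultimately show "inverse_le q z (2 * real (Suc n))" by (intro inverse_le_perturb)
  qed
qed

lemma test_disc_norm: "w \<in> cball 2 1 \<Longrightarrow> 1 \<le> norm w \<and> norm w \<le> (3 :: real)" for w :: complex
  using norm_triangle_ineq2[of 2 "2 - w"] norm_triangle_ineq2[of w 2] by (auto simp: dist_norm norm_minus_commute)

lemma inv_square_le_1: "1 / (real (Suc n))\<^sup>2 \<le> 1"
proof -
  have "1 \<le> (real (Suc n))\<^sup>2" by (rule one_le_power) simp
  thus ?thesis by (simp only: divide_le_eq_1) simp
qed

text \<open>A point of the test disc that is not bad would make I + K(z) for the true potential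
  invertible there and, by continuity, in a neighbourhood.\<close>

lemma approx_set_empty:
  assumes "\<forall>z0. \<forall>\<^sub>F z in at z0. \<not> invertible_at q z"
  shows "\<forall>\<^sub>F n in sequentially. approx_set n (p n) = {}"
  using inverse_le_if_not_bad[of 3]
proof eventually_elim
  case (elim n)
  have "bad n (p n) w" if w: "w \<in> cball 2 1" for w
  proof (rule ccontr)
    assume "\<not> bad n (p n) w"
    moreover have "1 / (real (Suc n))\<^sup>2 \<le> norm w" using test_disc_norm[OF w] inv_square_le_1[of n] by linarith
    ultimately have "inverse_le q w (2 * real (Suc n))" using elim test_disc_norm[OF w] by blast
    moreover have "w \<noteq> 0" using test_disc_norm[OF w] by auto
    ultimately have "\<forall>\<^sub>F z in nhds w. inverse_le q z (2 * (2 * real (Suc n)))"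
      by (intro inverse_le_nhds[OF q]) auto
    hence "\<forall>\<^sub>F z in at w. inverse_le q z (2 * (2 * real (Suc n)))"
      by (simp add: eventually_at_filter eventually_mono)
    with assms[rule_format, of w] have "\<forall>\<^sub>F z in at w. False"
      by eventually_elim (auto simp: invertible_at_def inverse_le_def)
    thus False by simp
  qed
  thus ?case by (auto simp: approx_set_def)
qed

text \<open>The test disc contains a smaller disc on which the inverse is bounded. The grid
  eventually meets it, and its points there are not bad, so the degenerate branch of
  \<open>approx_set\<close> is not taken.\<close>

lemma approx_set_eq:
  assumes "\<forall>z0. \<forall>\<^sub>F z in at z0. invertible_at q z"
  shows "\<forall>\<^sub>F n in sequentially. approx_set n (p n) = {w\<in>grid n. norm w \<ge> 1 / (real (Suc n))\<^sup>2 \<and> bad n (p n) w}"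
proof -
  have "\<forall>\<^sub>F z in at (2 :: complex). z \<in> ball 2 1 - {2}" by (intro eventually_at_in_open) auto
  with assms[rule_format, of 2] have "\<forall>\<^sub>F z in at 2. z \<in> ball 2 1 \<and> invertible_at q z"
    by eventually_elim auto
  then obtain z1 where z1: "z1 \<in> ball 2 1" "invertible_at q z1" using eventually_happens by fastforce
  then obtain b where b: "b \<ge> 0" "inverse_le q z1 b" by (auto simp: invertible_iff_inverse_le)
  have "z1 \<noteq> 0" using z1(1) by auto
  have "\<forall>\<^sub>F z in nhds z1. z \<in> ball 2 1" using z1(1) by (intro eventually_nhds_in_open) auto
  with inverse_le_nhds[OF q \<open>z1 \<noteq> 0\<close> b(2,1)] have "\<forall>\<^sub>F z in nhds z1. z \<in> ball 2 1 \<and> inverse_le q z (2 * b)"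
    by eventually_elim simp
  then obtain r where r: "r > 0" "\<And>z. dist z z1 < r \<Longrightarrow> z \<in> ball 2 1 \<and> inverse_le q z (2 * b)"
    unfolding eventually_nhds_metric by blast
  have A: "norm z \<le> 3" if "z \<in> ball z1 r" for z
    using r(2)[of z] that test_disc_norm[of z] by (auto simp: dist_commute)
  have "\<forall>\<^sub>F n in sequentially. \<forall>z\<in>ball z1 r. norm z \<ge> 1 / (real (Suc n))\<^sup>2 \<longrightarrow> \<not> bad n (p n) z"
    by (rule not_bad_near[of "2 * b" _ 3]) (use b(1) r(2) A in \<open>auto simp: dist_commute\<close>)
  thus ?thesis using eventually_Suc_ge[of "max 3 (1 / r)"]
  proof eventually_elim
    case (elim n)
    have n: "3 \<le> real (Suc n)" "1 / r \<le> real (Suc n)" using elim(2) by (simp_all only: max.bounded_iff)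
    have "norm z1 \<le> real (Suc n)" using A[of z1] r(1) n(1) by simp
    then obtain w where w: "w \<in> grid n" "dist z1 w < 1 / (real (Suc n))\<^sup>2" using grid(3) by blast
    have "1 / (real (Suc n))\<^sup>2 \<le> 1 / real (Suc n)"
      using n(1) by (intro divide_left_mono) (auto simp: power2_eq_square)
    also have "\<dots> \<le> r"
    proof -
      have "1 \<le> real (Suc n) * r" using n(2) r(1) by (simp only: pos_divide_le_eq)
      thus ?thesis by (simp only: divide_le_eq) (simp add: mult.commute)
    qed
    finally have "w \<in> ball z1 r" using w(2) by simp
    moreover from this have w21: "w \<in> cball 2 1" using r(2)[of w] by (auto simp: dist_commute)
    moreover have "1 / (real (Suc n))\<^sup>2 \<le> norm w" using test_disc_norm[OF w21] inv_square_le_1[of n] by linarith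
    ultimately have "\<not> bad n (p n) w" using elim(1) by blast
    with w(1) w21 show ?case by (auto simp: approx_set_def)
  qed
qed

text \<open>Near a point that is not singular the inverse is bounded, so eventually no bad points
  are left there.\<close>

lemma limit_point_singular:
  assumes gen: "\<forall>z0. \<forall>\<^sub>F z in at z0. invertible_at q z"
    and r: "strict_mono r" "\<And>k. x k \<in> approx_set (r k) (p (r k))" "x \<longlonglongrightarrow> l"
  shows "l \<in> singular_set q"
proof (rule ccontr)
  assume "l \<notin> singular_set q"
  moreover have "\<not> (\<forall>\<^sub>F z in at l. \<not> invertible_at q z)"
  proof
    assume "\<forall>\<^sub>F z in at l. \<not> invertible_at q z"
    with gen[rule_format, of l] have "\<forall>\<^sub>F z in at l. False" by eventually_elim simp
    thus False by simp
  qed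
  ultimately obtain b where b: "b \<ge> 0" "\<forall>\<^sub>F z in at l. inverse_le q z b" using trichotomy[OF q, of l] by blast
  \<comment> \<open>Continuity of K is available away from 0 only. For l = 0 the bound on the
    punctured disc suffices, as the points of \<open>approx_set\<close> are nonzero.\<close>
  have l: "inverse_le q l (2 * b)" if "l \<noteq> 0" by (rule inverse_le_at[OF q that b])
  from b(2) obtain \<rho> where \<rho>: "\<rho> > 0" "\<And>z. z \<noteq> l \<Longrightarrow> dist z l < \<rho> \<Longrightarrow> inverse_le q z b"
    by (auto simp: eventually_at)
  have inv: "inverse_le q z (2 * b)" if "z \<in> ball l \<rho>" "z \<noteq> 0" for z
  proof (cases "z = l")
    case False
    hence "inverse_le q z b" using that \<rho>(2)[of z] by (simp add: dist_commute)
    thus ?thesis by (rule inverse_le_mono) (use b(1) in simp)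
  qed (use l that in simp)
  have nl: "norm z \<le> norm l + \<rho>" if "z \<in> ball l \<rho>" for z
    using that norm_triangle_ineq2[of z l] by (simp add: dist_norm norm_minus_commute)
  have "\<forall>\<^sub>F n in sequentially. \<forall>z\<in>ball l \<rho>. norm z \<ge> 1 / (real (Suc n))\<^sup>2 \<longrightarrow> \<not> bad n (p n) z"
    by (rule not_bad_near[OF _ inv nl]) (use b(1) in auto)
  hence "\<forall>\<^sub>F k in sequentially. \<forall>z\<in>ball l \<rho>. norm z \<ge> 1 / (real (Suc (r k)))\<^sup>2 \<longrightarrow> \<not> bad (r k) (p (r k)) z"
    by (rule eventually_compose_filterlim[OF _ filterlim_subseq[OF r(1)]])
  moreover have "\<forall>\<^sub>F k in sequentially. x k \<in> ball l \<rho>"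
    using topological_tendstoD[OF r(3), of "ball l \<rho>"] \<rho>(1) by simp
  ultimately have "\<forall>\<^sub>F k in sequentially. False"
  proof eventually_elim
    case (elim k)
    from r(2)[of k] have "norm (x k) \<ge> 1 / (real (Suc (r k)))\<^sup>2" "bad (r k) (p (r k)) (x k)"
      by (auto simp: approx_set_def split: if_splits)
    with elim show False by blast
  qed
  thus False by simp
qed

text \<open>The approximating grid points must be near l, but neither equal to l nor in the excluded
  disc around 0. With d = 1 / (n + 1)^2 they are taken within d of a point t at distance 2 d from l,
  hence between d and 3 d from l. There the inverse has norm at least c (n + 1)^2 / 3, which
  eventually exceeds 2 (n + 1), the bound that a point which is not bad would give.\<close>

lemma singular_is_limit:
  assumes gen: "\<forall>z0. \<forall>\<^sub>F z in at z0. invertible_at q z" and l: "l \<in> singular_set q"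
  shows "\<exists>x. (\<forall>\<^sub>F n in sequentially. x n \<in> approx_set n (p n)) \<and> x \<longlonglongrightarrow> l"
proof -
  define d where "d n = 1 / (real (Suc n))\<^sup>2" for n
  \<comment> \<open>The direction pointing away from 0, so that moving along it increases the
    modulus.\<close>
  define e where "e = (if l = 0 then 1 else sgn l)"
  define t where "t n = l + of_real (2 * d n) * e" for n
  have e: "norm e = 1" by (simp add: e_def norm_sgn)
  have d: "d n > 0" for n by (simp add: d_def)
  have d0: "d \<longlonglongrightarrow> 0"
    unfolding d_def using tendsto_power[OF LIMSEQ_inverse_real_of_nat, of 2]
    by (simp add: power_divide inverse_eq_divide power_one_over)
  have t_norm: "norm (t n) = norm l + 2 * d n" for n
  proof (cases "l = 0")
    case False
    have "t n = of_real (norm l + 2 * d n) * e"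
      using False by (simp add: t_def e_def sgn_div_norm distrib_right scaleR_conv_of_real field_simps)
    thus ?thesis using e d[of n] by (simp only: norm_mult norm_of_real) simp
  qed (use d[of n] in \<open>simp add: t_def e_def norm_mult\<close>)
  have t_dist: "dist (t n) l = 2 * d n" for n
    using d[of n] e by (simp add: t_def dist_norm norm_mult)
  define x where "x n = (SOME w. w \<in> grid n \<and> dist (t n) w < d n)" for n
  have "\<forall>\<^sub>F n in sequentially. x n \<in> grid n \<and> dist (t n) (x n) < d n"
    using eventually_Suc_ge[of "norm l + 2"]
  proof eventually_elim
    case (elim n)
    have "norm (t n) \<le> real (Suc n)" using t_norm[of n] inv_square_le_1[of n] elim unfolding d_def by linarith
    hence "\<exists>w. w \<in> grid n \<and> dist (t n) w < d n" using grid(3) by (auto simp: d_def)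
    thus ?case unfolding x_def by (rule someI_ex)
  qed
  hence ex: "\<forall>\<^sub>F n in sequentially. x n \<in> grid n \<and> d n \<le> norm (x n) \<and> d n \<le> dist (x n) l \<and> dist (x n) l \<le> 3 * d n"
  proof eventually_elim
    case (elim n)
    have "norm (t n) - norm (x n) \<le> dist (t n) (x n)" unfolding dist_norm by (rule norm_triangle_ineq2)
    moreover have "dist (t n) l \<le> dist (t n) (x n) + dist (x n) l" by (rule dist_triangle)
    moreover have "dist (x n) l \<le> dist (x n) (t n) + dist (t n) l" by (rule dist_triangle)
    moreover have "dist (x n) (t n) = dist (t n) (x n)" by (rule dist_commute)
    ultimately show ?case
      using elim t_norm[of n] t_dist[of n] norm_ge_zero[of l] by (intro conjI) (blast, linarith+)
  qed
  have "(\<lambda>n. 3 * d n) \<longlonglongrightarrow> 0" using tendsto_mult_right_zero[OF d0, of 3] by simp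
  moreover have "\<forall>\<^sub>F n in sequentially. norm (dist (x n) l) \<le> 3 * d n" using ex by eventually_elim simp
  ultimately have "(\<lambda>n. dist (x n) l) \<longlonglongrightarrow> 0" by (rule Lim_null_comparison[rotated])
  hence xl: "x \<longlonglongrightarrow> l" by (rule tendsto_dist_iff[THEN iffD2])
  from l obtain c where c: "c > 0"
    "\<forall>\<^sub>F z in at l. \<exists>B. is_inverse (id_blinfun + K q z) B \<and> norm B \<ge> c / norm (z - l)"
    by (auto simp: singular_set_def)
  have "filterlim x (at l) sequentially"
    unfolding filterlim_at
  proof
    show "\<forall>\<^sub>F n in sequentially. x n \<in> UNIV \<and> x n \<noteq> l"
      using ex
    proof eventually_elim
      case (elim n)
      thus ?case using d[of n] by auto
    qed
  qed (rule xl)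
  with c(2) have "\<forall>\<^sub>F n in sequentially. \<exists>B. is_inverse (id_blinfun + K q (x n)) B \<and> norm B \<ge> c / norm (x n - l)"
    by (rule eventually_compose_filterlim)
  \<comment> \<open>The threshold 6 / c + 1 is where c k^2 / 3 \<le> 2 k fails for k = n +
    1.\<close>
  moreover note ex approx_set_eq[OF gen] eventually_Suc_ge[of "6 / c + 1"] inverse_le_if_not_bad[of "norm l + 3"]
  ultimately have "\<forall>\<^sub>F n in sequentially. x n \<in> approx_set n (p n)"
  proof eventually_elim
    case (elim n)
    define k where "k = real (Suc n)"
    have k: "k \<ge> 1" by (simp add: k_def)
    have "bad n (p n) (x n)"
    proof (rule ccontr)
      assume nb: "\<not> bad n (p n) (x n)"
      have "norm (x n) \<le> norm l + dist (x n) l"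
        using norm_triangle_ineq[of l "x n - l"] by (simp add: dist_norm)
      also have "\<dots> \<le> norm l + 3" using elim(2) inv_square_le_1[of n] unfolding d_def by linarith
      finally have "inverse_le q (x n) (2 * k)" using elim(2,5) nb by (simp add: d_def k_def)
      then obtain B where B: "is_inverse (id_blinfun + K q (x n)) B" "norm B \<le> 2 * k" by (auto simp: inverse_le_def)
      with elim(1) have "c / norm (x n - l) \<le> 2 * k" using is_inverse_unique by fastforce
      moreover have "c / (3 * d n) \<le> c / norm (x n - l)"
      proof (rule divide_left_mono)
        have "0 < norm (x n - l)" using elim(2) d[of n] unfolding dist_norm by linarith
        thus "0 < 3 * d n * norm (x n - l)" using d[of n] by simp
      qed (use elim(2) c(1) in \<open>simp_all add: dist_norm\<close>)
      moreover have "c / (3 * d n) = c * k\<^sup>2 / 3" by (simp add: d_def k_def)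
      ultimately have "c * k\<^sup>2 / 3 \<le> 2 * k" by linarith
      hence "c * k \<le> 6" using k by (simp add: power2_eq_square)
      hence "k \<le> 6 / c" using c(1) by (simp add: field_simps)
      thus False using elim(4) by (simp add: k_def)
    qed
    thus ?case using elim(2,3) by (simp add: d_def)
  qed
  thus ?thesis using xl by blast
qed

theorem approx_set_convergence: "set_convergence (\<lambda>n. approx_set n (p n)) (singular_set q)"
  using invertible_dichotomy[OF q]
proof
  assume gen: "\<forall>z0. \<forall>\<^sub>F z in at z0. invertible_at q z"
  show ?thesis
    unfolding set_convergence_def
  proof (intro conjI allI impI ballI)
    fix r x l assume "strict_mono r \<and> (\<forall>k. x k \<in> approx_set (r k) (p (r k))) \<and> x \<longlonglongrightarrow> l"
    thus "l \<in> singular_set q" using limit_point_singular[OF gen, of r x l] by simp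
  qed (rule singular_is_limit[OF gen])
next
  assume none: "\<forall>z0. \<forall>\<^sub>F z in at z0. \<not> invertible_at q z"
  have empty: "singular_set q = {}"
  proof (rule equals0I)
    fix z assume "z \<in> singular_set q"
    from singular_imp_invertible[OF q this] none[rule_format, of z] have "\<forall>\<^sub>F z in at z. False"
      by eventually_elim simp
    thus False by simp
  qed
  show ?thesis
    unfolding set_convergence_def empty
  proof (intro conjI allI impI)
    fix r :: "nat \<Rightarrow> nat" and x and l :: complex
    assume *: "strict_mono r \<and> (\<forall>k. x k \<in> approx_set (r k) (p (r k))) \<and> x \<longlonglongrightarrow> l"
    have "\<forall>\<^sub>F k in sequentially. approx_set (r k) (p (r k)) = {}"
      by (rule eventually_compose_filterlim[OF approx_set_empty[OF none] filterlim_subseq[OF conjunct1[OF *]]])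
    hence "\<forall>\<^sub>F k in sequentially. False"
    proof eventually_elim
      case (elim k)
      have "x k \<in> approx_set (r k) (p (r k))" using * by blast
      with elim show False by blast
    qed
    thus "l \<in> {}" by simp
  qed simp
qed

end

end

section \<open>Potentials with a prescribed eigenfunction\<close>

lemma has_derivative_quadratic:
  assumes "bounded_linear D" and C: "\<And>v. norm v \<le> 1 \<Longrightarrow> norm (f (x + v) - f x - D v) \<le> C * (norm v)\<^sup>2"
  shows "(f has_derivative D) (at x)"
  unfolding has_derivative_at
proof (rule conjI[OF assms(1)])
  have "\<forall>\<^sub>F v in at 0. v \<in> ball 0 1 - {0 :: 'a}" by (intro eventually_at_in_open) auto
  hence "\<forall>\<^sub>F v in at 0. norm (norm (f (x + v) - f x - D v) / norm v) \<le> C * norm v"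
  proof eventually_elim
    case (elim v)
    thus ?case using C[of v] by (simp add: divide_le_eq power2_eq_square)
  qed
  moreover have "((\<lambda>v. C * norm v) \<longlongrightarrow> 0) (at 0)" by (auto intro!: tendsto_eq_intros)
  ultimately show "((\<lambda>v. norm (f (x + v) - f x - D v) / norm v) \<longlongrightarrow> 0) (at 0)"
    by (rule Lim_null_comparison)
qed

text \<open>Squaring the positive part makes the function continuously differentiable across the
  sphere, which is all the regularity that potentials require.\<close>

definition bump :: "real \<Rightarrow> real ^ 'n::finite \<Rightarrow> real" where
  "bump \<rho> x = (max 0 (\<rho>\<^sup>2 - (norm x)\<^sup>2))\<^sup>2"

definition bump_grad :: "real \<Rightarrow> real ^ 'n::finite \<Rightarrow> real ^ 'n" where
  "bump_grad \<rho> x = (- 4 * max 0 (\<rho>\<^sup>2 - (norm x)\<^sup>2)) *\<^sub>R x"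

lemma continuous_bump: "continuous_on S (bump \<rho>)" "continuous_on S (\<lambda>x. bump_grad \<rho> x $ i)"
  unfolding bump_def bump_grad_def by (intro continuous_intros)+

lemma bump_bounds:
  assumes "\<rho> \<ge> 0"
  shows "0 \<le> bump \<rho> x" "bump \<rho> x \<le> \<rho> ^ 4" "\<bar>bump_grad \<rho> x $ i\<bar> \<le> 4 * \<rho> ^ 3"
proof -
  have m: "0 \<le> max 0 (\<rho>\<^sup>2 - (norm x)\<^sup>2)" "max 0 (\<rho>\<^sup>2 - (norm x)\<^sup>2) \<le> \<rho>\<^sup>2" by auto
  show "0 \<le> bump \<rho> x" by (simp add: bump_def)
  have "bump \<rho> x \<le> (\<rho>\<^sup>2)\<^sup>2" unfolding bump_def using m by (intro power_mono) auto
  thus "bump \<rho> x \<le> \<rho> ^ 4" by simp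
  have "\<bar>bump_grad \<rho> x $ i\<bar> \<le> norm (bump_grad \<rho> x)" by (rule component_le_norm_cart)
  also have "\<dots> = 4 * (max 0 (\<rho>\<^sup>2 - (norm x)\<^sup>2) * norm x)" by (simp add: bump_grad_def)
  also have "\<dots> \<le> 4 * (\<rho>\<^sup>2 * \<rho>)"
  proof (cases "norm x \<le> \<rho>")
    case True
    thus ?thesis using m by (intro mult_left_mono mult_mono) auto
  next
    case False
    hence "\<rho>\<^sup>2 \<le> (norm x)\<^sup>2" using assms by (intro power_mono) auto
    thus ?thesis using assms by simp
  qed
  finally show "\<bar>bump_grad \<rho> x $ i\<bar> \<le> 4 * \<rho> ^ 3" by (simp add: power2_eq_square power3_eq_cube)
qed

lemma bump_eq_0_iff: "\<rho> \<ge> 0 \<Longrightarrow> bump \<rho> x = 0 \<longleftrightarrow> norm x \<ge> \<rho>"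
  by (auto simp: bump_def max_def not_le intro: power_mono dest: power2_le_imp_le)

lemma bump_grad_eq_0: "\<rho> \<ge> 0 \<Longrightarrow> norm x \<ge> \<rho> \<Longrightarrow> bump_grad \<rho> x = 0"
  using power_mono[of \<rho> "norm x" 2] by (simp add: bump_grad_def)

text \<open>The squared positive part has a quadratic remainder with constant 1, to which b - a, the
  change of \<rho>^2 - |x|^2, is inserted. For |x| > \<rho> + 1 everything vanishes, so the constant
  is uniform in x.\<close>

lemma bump_second_order:
  assumes "\<rho> \<ge> 0"
  obtains L where "\<And>x v. norm v \<le> 1 \<Longrightarrow>
    \<bar>bump \<rho> (x + v) - bump \<rho> x - inner (bump_grad \<rho> x) v\<bar> \<le> L * (norm (v :: real ^ 'n::finite))\<^sup>2"
proof (rule that[of "(2 * (\<rho> + 1) + 1)\<^sup>2 + 2 * \<rho>\<^sup>2"])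
  fix x v :: "real ^ 'n" assume v: "norm v \<le> 1"
  show "\<bar>bump \<rho> (x + v) - bump \<rho> x - inner (bump_grad \<rho> x) v\<bar> \<le> ((2 * (\<rho> + 1) + 1)\<^sup>2 + 2 * \<rho>\<^sup>2) * (norm v)\<^sup>2"
  proof (cases "norm x \<le> \<rho> + 1")
    case False
    hence "norm (x + v) \<ge> \<rho>" "norm x \<ge> \<rho>" using v norm_triangle_ineq4[of "x + v" v] by auto
    thus ?thesis using bump_eq_0_iff[OF assms, of x] bump_eq_0_iff[OF assms, of "x + v"] bump_grad_eq_0[OF assms, of x] by simp
  next
    case True
    define a b where "a = \<rho>\<^sup>2 - (norm x)\<^sup>2" and "b = \<rho>\<^sup>2 - (norm (x + v))\<^sup>2"
    have ba: "b - a = - 2 * inner x v - (norm v)\<^sup>2"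
      unfolding a_def b_def power2_norm_eq_inner by (simp add: inner_add_left inner_add_right inner_commute)
    \<comment> \<open>Second-order estimate for the function (max 0 t)^2, whose derivative 2 max 0 t
      has Lipschitz constant 2.\<close>
    have q: "\<bar>(max 0 b)\<^sup>2 - (max 0 a)\<^sup>2 - 2 * max 0 a * (b - a)\<bar> \<le> (b - a)\<^sup>2"
    proof (cases "a \<ge> 0"; cases "b \<ge> 0")
      assume "a \<ge> 0" "b \<ge> 0"
      hence "(max 0 b)\<^sup>2 - (max 0 a)\<^sup>2 - 2 * max 0 a * (b - a) = (b - a)\<^sup>2"
        by (simp add: power2_eq_square algebra_simps)
      thus ?thesis by simp
    next
      assume *: "a \<ge> 0" "\<not> b \<ge> 0"
      hence "a * b \<le> 0" by (simp add: mult_nonneg_nonpos)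
      moreover have "a\<^sup>2 - 2 * (a * b) \<ge> 0" using calculation by (simp add: add_nonneg_nonneg) (use zero_le_power2[of a] in linarith)
      ultimately show ?thesis using * zero_le_power2[of b] by (simp add: power2_eq_square algebra_simps)
    next
      assume *: "\<not> a \<ge> 0" "b \<ge> 0"
      hence "b\<^sup>2 \<le> (b - a)\<^sup>2" by (intro power_mono) auto
      thus ?thesis using * by simp
    qed simp
    have ma: "max 0 a \<le> \<rho>\<^sup>2" "0 \<le> max 0 a" by (auto simp: a_def)
    have "\<bar>b - a\<bar> \<le> (2 * (\<rho> + 1) + 1) * norm v"
    proof -
      have "\<bar>b - a\<bar> \<le> 2 * \<bar>inner x v\<bar> + norm v * norm v" unfolding ba by (simp add: power2_eq_square abs_if)
      moreover have "\<bar>inner x v\<bar> \<le> (\<rho> + 1) * norm v"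
        using Cauchy_Schwarz_ineq2[of x v] mult_right_mono[OF True norm_ge_zero[of v]] by linarith
      moreover have "norm v * norm v \<le> 1 * norm v" using v by (intro mult_right_mono) auto
      ultimately show ?thesis by (simp add: algebra_simps)
    qed
    hence "\<bar>b - a\<bar>\<^sup>2 \<le> ((2 * (\<rho> + 1) + 1) * norm v)\<^sup>2" by (rule power_mono) simp
    hence "(b - a)\<^sup>2 \<le> (2 * (\<rho> + 1) + 1)\<^sup>2 * (norm v)\<^sup>2" unfolding power_mult_distrib power2_abs .
    moreover have "2 * max 0 a * (norm v)\<^sup>2 \<le> 2 * \<rho>\<^sup>2 * (norm v)\<^sup>2" using ma by (intro mult_right_mono) auto
    moreover have "0 \<le> 2 * max 0 a * (norm v)\<^sup>2" using ma by simp
    moreover have "inner (bump_grad \<rho> x) v = 2 * max 0 a * (b - a) + 2 * max 0 a * (norm v)\<^sup>2"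
    proof -
      have "inner (bump_grad \<rho> x) v = - 4 * max 0 a * inner x v" by (simp add: bump_grad_def a_def)
      thus ?thesis unfolding ba by (simp add: algebra_simps)
    qed
    ultimately show ?thesis
      using q unfolding bump_def a_def[symmetric] b_def[symmetric] distrib_right[of "(2 * (\<rho> + 1) + 1)\<^sup>2"] by linarith
  qed
qed

lemma integrable_times_bounded:
  fixes h k :: "real ^ 'n::finite \<Rightarrow> complex"
  assumes h: "integrable lborel h" and [measurable]: "k \<in> borel_measurable borel" and k: "\<And>y. norm (k y) \<le> B"
  shows "integrable lborel (\<lambda>y. h y * k y)"
proof (rule Bochner_Integration.integrable_bound)
  have [measurable]: "h \<in> borel_measurable lborel" using h by simp
  show "integrable lborel (\<lambda>y. norm (h y) * B)" using h by simp
  show "(\<lambda>y. h y * k y) \<in> borel_measurable lborel" by measurable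
  show "AE y in lborel. norm (h y * k y) \<le> norm (norm (h y) * B)"
    using k order_trans[OF norm_ge_zero k] by (auto simp: norm_mult intro!: mult_left_mono)
qed

lemma continuous_convolution:
  fixes h :: "real ^ 'n::finite \<Rightarrow> complex" and k :: "real ^ 'n \<Rightarrow> real"
  assumes h: "integrable lborel h" and k: "continuous_on UNIV k" "\<And>x. \<bar>k x\<bar> \<le> B"
  shows "continuous_on UNIV (\<lambda>x. LINT y|lborel. h y * of_real (k (x + y)))"
  unfolding continuous_on_sequentially
proof (intro allI ballI impI)
  fix X :: "nat \<Rightarrow> real ^ 'n" and x assume "(\<forall>n. X n \<in> UNIV) \<and> X \<longlonglongrightarrow> x"
  hence X: "X \<longlonglongrightarrow> x" by simp
  have [measurable]: "k \<in> borel_measurable borel" by (rule borel_measurable_continuous_onI[OF k(1)])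
  have [measurable]: "h \<in> borel_measurable lborel" using h by simp
  show "((\<lambda>x. LINT y|lborel. h y * of_real (k (x + y))) \<circ> X) \<longlonglongrightarrow> (LINT y|lborel. h y * of_real (k (x + y)))"
    unfolding o_def
  proof (rule integral_dominated_convergence[where w = "\<lambda>y. norm (h y) * B"])
    show "integrable lborel (\<lambda>y. norm (h y) * B)" using h by simp
    show "AE y in lborel. (\<lambda>n. h y * of_real (k (X n + y))) \<longlonglongrightarrow> h y * of_real (k (x + y))"
    proof (intro AE_I2 tendsto_mult tendsto_const tendsto_of_real)
      fix y
      have "isCont k (x + y)" using k(1) by (simp add: continuous_on_eq_continuous_at)
      thus "(\<lambda>n. k (X n + y)) \<longlonglongrightarrow> k (x + y)" by (rule isCont_tendsto_compose) (intro tendsto_intros X)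
    qed
    show "AE y in lborel. norm (h y * of_real (k (X n + y))) \<le> norm (h y) * B" for n
      using k(2) by (auto simp: norm_mult intro!: mult_left_mono)
  qed measurable
qed

text \<open>As h is merely integrable, all derivatives fall on the bump; its remainder estimate is
  uniform in the base point and can be integrated against |h|.\<close>

lemma has_derivative_convolution_bump:
  fixes h :: "real ^ 'n::finite \<Rightarrow> complex"
  assumes h: "integrable lborel h" and \<rho>: "\<rho> \<ge> 0"
  shows "((\<lambda>x. LINT y|lborel. h y * of_real (bump \<rho> (x + y))) has_derivative
    (\<lambda>v. \<Sum>i\<in>UNIV. of_real (v $ i) * (LINT y|lborel. h y * of_real (bump_grad \<rho> (x + y) $ i)))) (at x)"
proof -
  obtain L where L: "\<And>x v :: real ^ 'n. norm v \<le> 1 \<Longrightarrow>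
    \<bar>bump \<rho> (x + v) - bump \<rho> x - inner (bump_grad \<rho> x) v\<bar> \<le> L * (norm v)\<^sup>2" by (rule bump_second_order[OF \<rho>]) blast
  have [measurable]: "bump \<rho> \<in> borel_measurable borel" "(\<lambda>x. bump_grad \<rho> x $ i) \<in> borel_measurable borel" for i :: 'n
    by (rule borel_measurable_continuous_onI[OF continuous_bump(1)])
       (rule borel_measurable_continuous_onI[OF continuous_bump(2)])
  have int: "integrable lborel (\<lambda>y. h y * of_real (bump \<rho> (x + y)))" for x
    by (rule integrable_times_bounded[OF h, of _ "\<rho> ^ 4"]) (use bump_bounds(1,2)[OF \<rho>] in \<open>simp_all add: abs_le_iff order_trans[OF _ bump_bounds(1)[OF \<rho>]]\<close>)
  have int': "integrable lborel (\<lambda>y. h y * of_real (bump_grad \<rho> (x + y) $ i))" for x i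
    by (rule integrable_times_bounded[OF h, of _ "4 * \<rho> ^ 3"]) (use bump_bounds[OF \<rho>] in auto)
  show ?thesis
  proof (rule has_derivative_quadratic[where C = "L * (LINT y|lborel. norm (h y))"])
    show "bounded_linear (\<lambda>v :: real ^ 'n. \<Sum>i\<in>UNIV. of_real (v $ i) * (LINT y|lborel. h y * of_real (bump_grad \<rho> (x + y) $ i)))"
      by (intro bounded_linear_sum bounded_linear_mult_const
          bounded_linear_compose[OF bounded_linear_of_real bounded_linear_vec_nth])
    fix v :: "real ^ 'n" assume v: "norm v \<le> 1"
    have "(\<Sum>i\<in>UNIV. of_real (v $ i) * (LINT y|lborel. h y * of_real (bump_grad \<rho> (x + y) $ i))) =
        (LINT y|lborel. (\<Sum>i\<in>UNIV. of_real (v $ i) * (h y * of_real (bump_grad \<rho> (x + y) $ i))))"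
      using int' by (subst Bochner_Integration.integral_sum) auto
    also have "\<dots> = (LINT y|lborel. h y * of_real (inner (bump_grad \<rho> (x + y)) v))"
      by (intro Bochner_Integration.integral_cong refl) (simp add: inner_vec_def sum_distrib_left mult_ac)
    finally have D: "(\<Sum>i\<in>UNIV. of_real (v $ i) * (LINT y|lborel. h y * of_real (bump_grad \<rho> (x + y) $ i))) =
      (LINT y|lborel. h y * of_real (inner (bump_grad \<rho> (x + y)) v))" .
    have intD: "integrable lborel (\<lambda>y. h y * of_real (inner (bump_grad \<rho> (x + y)) v))"
    proof -
      have "integrable lborel (\<lambda>y. \<Sum>i\<in>UNIV. of_real (v $ i) * (h y * of_real (bump_grad \<rho> (x + y) $ i)))"
        using int' by auto
      thus ?thesis by (rule back_subst[of "integrable lborel"]) (auto simp: inner_vec_def sum_distrib_left mult_ac)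
    qed
    let ?r = "\<lambda>y. bump \<rho> (x + y + v) - bump \<rho> (x + y) - inner (bump_grad \<rho> (x + y)) v"
    have eq: "x + v + y = x + y + v" for y by (simp add: add_ac)
    have "(LINT y|lborel. h y * of_real (bump \<rho> (x + v + y))) - (LINT y|lborel. h y * of_real (bump \<rho> (x + y))) -
        (LINT y|lborel. h y * of_real (inner (bump_grad \<rho> (x + y)) v)) = (LINT y|lborel. h y * of_real (?r y))"
      using int[of x] int[of "x + v"] intD unfolding eq
      by (simp flip: Bochner_Integration.integral_diff add: algebra_simps)
    also have "norm \<dots> \<le> (LINT y|lborel. norm (h y) * (L * (norm v)\<^sup>2))"
    proof (rule order_trans[OF integral_norm_bound integral_mono'])
      show "integrable lborel (\<lambda>y. norm (h y) * (L * (norm v)\<^sup>2))" using h by simp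
      show "norm (h y * of_real (?r y)) \<le> norm (h y) * (L * (norm v)\<^sup>2)" for y
        unfolding norm_mult norm_of_real by (intro mult_left_mono L v) simp
      show "0 \<le> norm (h y) * (L * (norm v)\<^sup>2)" for y
        using order_trans[OF abs_ge_zero L[OF v, of 0]] by simp
    qed
    also have "\<dots> = L * (LINT y|lborel. norm (h y)) * (norm v)\<^sup>2" by simp
    finally show "norm ((LINT y|lborel. h y * of_real (bump \<rho> (x + v + y))) - (LINT y|lborel. h y * of_real (bump \<rho> (x + y))) -
        (\<Sum>i\<in>UNIV. of_real (v $ i) * (LINT y|lborel. h y * of_real (bump_grad \<rho> (x + y) $ i))))
        \<le> L * (LINT y|lborel. norm (h y)) * (norm v)\<^sup>2" unfolding D .
  qed
qed

lemma potentialsI: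
  fixes q :: "real ^ 'n::finite \<Rightarrow> complex"
  assumes "\<And>x. (q has_derivative (\<lambda>v. \<Sum>i\<in>UNIV. of_real (v $ i) * c i x)) (at x)"
    and "\<And>i. continuous_on UNIV (c i)" and "closure {x. q x \<noteq> 0} \<subseteq> cube M"
  shows "q \<in> potentials M"
proof -
  define e :: "'n \<Rightarrow> (real ^ 'n) \<Rightarrow>\<^sub>L complex" where "e i = Blinfun (\<lambda>v. of_real (v $ i))" for i
  have e: "blinfun_apply (e i) = (\<lambda>v. of_real (v $ i))" for i
    unfolding e_def by (rule bounded_linear_Blinfun_apply)
      (rule bounded_linear_compose[OF bounded_linear_of_real bounded_linear_vec_nth])
  define D where "D x = (\<Sum>i\<in>UNIV. blinfun_mult_right (c i x) o\<^sub>L e i)" for x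
  have "blinfun_apply (D x) = (\<lambda>v. \<Sum>i\<in>UNIV. of_real (v $ i) * c i x)" for x
    unfolding D_def by (auto simp: e blinfun.sum_left mult.commute)
  moreover have "continuous_on UNIV D"
    unfolding D_def by (intro continuous_intros assms(2))
  ultimately have "(\<forall>x. (q has_derivative blinfun_apply (D x)) (at x)) \<and> continuous_on UNIV D" using assms(1) by simp
  thus ?thesis unfolding potentials_def using assms(3) by blast
qed

lemma lborel_integral_translate:
  fixes \<phi> :: "real ^ 'n::finite \<Rightarrow> 'b::{banach, second_countable_topology}"
  assumes "\<phi> \<in> borel_measurable borel"
  shows "(LINT y|lborel. \<phi> (x + y)) = (LINT y|lborel. \<phi> y)"
proof -
  have "(LINT y|lborel. \<phi> (x + y)) = (LINT y|distr lborel borel ((+) x). \<phi> y)"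
    by (rule integral_distr[symmetric]) (use assms in auto)
  thus ?thesis by (simp add: lborel_distr_plus)
qed

lemma bump_has_derivative:
  assumes "\<rho> \<ge> 0"
  shows "(bump \<rho> has_derivative (\<lambda>v. inner (bump_grad \<rho> x) v)) (at (x :: real ^ 'n::finite))"
proof -
  obtain L where L: "\<And>x v :: real ^ 'n. norm v \<le> 1 \<Longrightarrow>
    \<bar>bump \<rho> (x + v) - bump \<rho> x - inner (bump_grad \<rho> x) v\<bar> \<le> L * (norm v)\<^sup>2" by (rule bump_second_order[OF assms]) blast
  show ?thesis
    by (rule has_derivative_quadratic[of _ _ _ L]) (use L in \<open>auto intro: bounded_linear_inner_right\<close>)
qed

text \<open>The quotient is a product of differentiable functions where U is nonzero and vanishes
  identically outside the closed ball. These two open sets cover the space because U has no zeros in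
  the ball.\<close>

lemma bump_quotient_potential:
  fixes h :: "real ^ 'n::finite \<Rightarrow> complex" and \<rho> :: real
  defines "U \<equiv> \<lambda>x. LINT y|lborel. h y * of_real (bump \<rho> (x + y))"
  assumes h: "integrable lborel h" and \<rho>: "\<rho> > 0" and nz: "\<And>x. norm x \<le> \<rho> \<Longrightarrow> U x \<noteq> 0"
    and cube: "cball x0 \<rho> \<subseteq> cube M"
  shows "(\<lambda>x. - of_real (bump \<rho> (x - x0)) / U (x - x0)) \<in> potentials M"
proof -
  have \<rho>0: "\<rho> \<ge> 0" using \<rho> by simp
  define c where "c i x = (LINT y|lborel. h y * of_real (bump_grad \<rho> (x + y) $ i))" for i x
  define Q where "Q x = - of_real (bump \<rho> x) * inverse (U x)" for x
  define e where "e i x = of_real (bump \<rho> x) * (inverse (U x) * c i x * inverse (U x)) - of_real (bump_grad \<rho> x $ i) * inverse (U x)" for i x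
  have Uc: "continuous_on UNIV U"
    unfolding U_def by (rule continuous_convolution[OF h continuous_bump(1), of _ "\<rho> ^ 4"])
      (use bump_bounds(1,2)[OF \<rho>0] in \<open>simp add: abs_le_iff order_trans[OF _ bump_bounds(1)[OF \<rho>0]]\<close>)
  have cc: "continuous_on UNIV (c i)" for i
    unfolding c_def by (rule continuous_convolution[OF h continuous_bump(2) bump_bounds(3)[OF \<rho>0]])
  have out: "Q x = 0" "e i x = 0" if "norm x \<ge> \<rho>" for x i
    using bump_eq_0_iff[OF \<rho>0, of x] bump_grad_eq_0[OF \<rho>0 that] that by (simp_all add: Q_def e_def)
  \<comment> \<open>Zeros of U lie strictly outside the ball, so near them the quotient is
    constantly 0.\<close>
  have far: "norm x > \<rho>" if "U x = 0" for x using nz[of x] that by force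
  have oU: "open {x. U x \<noteq> 0}" using Uc by (intro open_Collect_neq continuous_intros) auto
  have oF: "open {x :: real ^ 'n. norm x > \<rho>}" by (intro open_Collect_less continuous_intros)
  have D: "(Q has_derivative (\<lambda>v. \<Sum>i\<in>UNIV. of_real (v $ i) * e i x)) (at x)" for x
  proof (cases "U x = 0")
    case True
    have "(Q has_derivative (\<lambda>v. 0)) (at x)"
      by (rule has_derivative_transform_within_open[OF has_derivative_const oF])
        (use far[OF True] out(1) in auto)
    thus ?thesis using out(2) far[OF True] by simp
  next
    case False
    have "(U has_derivative (\<lambda>v. \<Sum>i\<in>UNIV. of_real (v $ i) * c i x)) (at x)"
      unfolding U_def c_def by (rule has_derivative_convolution_bump[OF h \<rho>0])
    from Deriv.has_derivative_inverse[OF False this]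
    have "(Q has_derivative (\<lambda>v. - of_real (bump \<rho> x) * - (inverse (U x) * (\<Sum>i\<in>UNIV. of_real (v $ i) * c i x) * inverse (U x)) +
        - of_real (inner (bump_grad \<rho> x) v) * inverse (U x))) (at x)"
      unfolding Q_def
      by (intro has_derivative_mult has_derivative_minus has_derivative_of_real bump_has_derivative[OF \<rho>0])
    thus ?thesis
      by (rule has_derivative_eq_rhs)
         (auto simp: e_def fun_eq_iff inner_vec_def sum_distrib_left sum_distrib_right sum_subtractf sum_negf algebra_simps)
  qed
  have "continuous_on {x. U x \<noteq> 0} (e i)" for i
    unfolding e_def using continuous_on_subset[OF Uc subset_UNIV] continuous_on_subset[OF cc subset_UNIV]
    by (intro continuous_intros continuous_bump continuous_on_subset[OF continuous_bump(1)]) auto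
  moreover have "continuous_on {x. norm x > \<rho>} (e i)" for i
    by (rule continuous_on_eq[of _ "\<lambda>_. 0"]) (auto simp: out(2))
  ultimately have "continuous_on ({x. U x \<noteq> 0} \<union> {x. norm x > \<rho>}) (e i)" for i
    by (intro continuous_on_open_Un oU oF)
  moreover have "{x. U x \<noteq> 0} \<union> {x. norm x > \<rho>} = UNIV" using far by auto
  ultimately have ec: "continuous_on UNIV (e i)" for i by simp
  have "(\<lambda>x. Q (x - x0)) \<in> potentials M"
  proof (rule potentialsI)
    show "((\<lambda>x. Q (x - x0)) has_derivative (\<lambda>v. \<Sum>i\<in>UNIV. of_real (v $ i) * e i (x - x0))) (at x)" for x
      by (rule has_derivative_compose[of "\<lambda>x. x - x0" "\<lambda>v. v", OF _ D]) (auto intro!: derivative_eq_intros)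
    show "continuous_on UNIV (\<lambda>x. e i (x - x0))" for i
      by (intro continuous_on_compose2[OF ec] continuous_intros) auto
    have "{x. Q (x - x0) \<noteq> 0} \<subseteq> cball x0 \<rho>"
      using out(1) by (force simp: dist_norm norm_minus_commute)
    hence "closure {x. Q (x - x0) \<noteq> 0} \<subseteq> cball x0 \<rho>" by (rule closure_minimal) simp
    thus "closure {x. Q (x - x0) \<noteq> 0} \<subseteq> cube M" using cube by blast
  qed
  thus ?thesis by (simp add: Q_def divide_inverse)
qed

lemma bump_integral_pos:
  assumes "\<rho> > 0"
  shows "integrable lborel (bump \<rho> :: real ^ 'n::finite \<Rightarrow> real)" "(LINT y|lborel. bump \<rho> (y :: real ^ 'n)) > 0"
proof -
  have \<rho>: "\<rho> \<ge> 0" using assms by simp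
  have [measurable]: "bump \<rho> \<in> borel_measurable (borel :: (real ^ 'n) measure)"
    by (rule borel_measurable_continuous_onI[OF continuous_bump(1)])
  show int: "integrable lborel (bump \<rho> :: real ^ 'n \<Rightarrow> real)"
  proof (rule Bochner_Integration.integrable_bound)
    have "emeasure lborel (cball (0 :: real ^ 'n) \<rho>) < \<infinity>" by (rule emeasure_bounded_finite) simp
    thus "integrable lborel (\<lambda>x :: real ^ 'n. \<rho> ^ 4 * indicator (cball 0 \<rho>) x :: real)"
      by (intro integrable_mult_right integrable_real_indicator) auto
    have "norm (bump \<rho> x) \<le> norm (\<rho> ^ 4 * indicator (cball 0 \<rho>) x :: real)" for x :: "real ^ 'n"
      using bump_bounds(1,2)[OF \<rho>, of x] bump_eq_0_iff[OF \<rho>, of x] by (cases "norm x \<le> \<rho>") auto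
    thus "AE x :: real ^ 'n in lborel. norm (bump \<rho> x) \<le> norm (\<rho> ^ 4 * indicator (cball 0 \<rho>) x :: real)" by simp
  qed simp
  have "(LINT y|lborel. bump \<rho> (y :: real ^ 'n)) \<noteq> 0"
  proof
    assume "(LINT y|lborel. bump \<rho> (y :: real ^ 'n)) = 0"
    hence "AE y :: real ^ 'n in lborel. bump \<rho> y = 0"
      using integral_nonneg_eq_0_iff_AE[OF int AE_I2[OF bump_bounds(1)[OF \<rho>]]] by simp
    hence "AE y :: real ^ 'n in lborel. y \<notin> ball 0 \<rho>"
      by eventually_elim (simp add: bump_eq_0_iff[OF \<rho>])
    hence "emeasure lborel (ball (0 :: real ^ 'n) \<rho>) = 0" by (simp add: AE_iff_measurable[OF _ refl] ball_def)
    moreover have "measure lborel (ball (0 :: real ^ 'n) \<rho>) > 0" by (rule content_ball_pos[OF assms])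
    ultimately show False by (simp add: measure_def)
  qed
  moreover have "(LINT y|lborel. bump \<rho> (y :: real ^ 'n)) \<ge> 0"
    by (rule Bochner_Integration.integral_nonneg) (rule bump_bounds(1)[OF \<rho>])
  ultimately show "(LINT y|lborel. bump \<rho> (y :: real ^ 'n)) > 0" by linarith
qed

section \<open>A potential that vanishes at given points and has a resonance\<close>

text \<open>Invertibility near z2 excludes the degenerate case. If z1 were not singular, the inverse
  would be bounded near z1 and by continuity exist at z1, against f being in the kernel.\<close>

lemma (in helmholtz_kernel) exists_singular_if_not_injective:
  assumes q: "cube_bounded M P q" and "z1 \<noteq> 0" "z2 \<noteq> 0"
    and f: "f \<noteq> 0" "K q z1 f = - f" and small: "norm (K q z2) \<le> 1/2"
  shows "z1 \<in> singular_set q"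
proof (rule ccontr)
  assume n: "z1 \<notin> singular_set q"
  obtain B where "is_inverse (id_blinfun + K q z2) B" "norm B \<le> 2" by (rule inverse_id_plus_small[OF small])
  hence "inverse_le q z2 2" by (auto simp: inverse_le_def)
  from inverse_le_nhds[OF q \<open>z2 \<noteq> 0\<close> this] have "\<forall>\<^sub>F z in at z2. invertible_at q z"
    by (auto simp: eventually_at_filter invertible_at_def inverse_le_def elim!: eventually_mono)
  hence "\<not> (\<forall>\<^sub>F z in at z2. \<not> invertible_at q z)"
    using eventually_happens[OF eventually_conj] by fastforce
  with invertible_dichotomy[OF q] have "\<forall>\<^sub>F z in at z1. invertible_at q z" by blast
  hence "\<not> (\<forall>\<^sub>F z in at z1. \<not> invertible_at q z)"
    using eventually_happens[OF eventually_conj] by fastforce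
  with trichotomy[OF q, of z1] n obtain b where b: "b \<ge> 0" "\<forall>\<^sub>F z in at z1. inverse_le q z b" by blast
  then obtain B where "is_inverse (id_blinfun + K q z1) B"
    using inverse_le_at[OF q \<open>z1 \<noteq> 0\<close>] by (auto simp: inverse_le_def)
  hence "B ((id_blinfun + K q z1) f) = f" by (simp add: is_inverse_iff)
  thus False using f by (simp add: blinfun.add_left blinfun.zero_right)
qed

text \<open>
  With a bump function \<open>f\<close> and \<open>q = - f / (G * f)\<close>, the function \<open>f\<close> is in the kernel of
  \<open>I + K(z\<^sub>1)\<close>.  As \<open>G * f\<close> is large, \<open>q\<close> is so small that \<open>I + K(z\<^sub>2)\<close> is invertible.
\<close>

theorem (in helmholtz_kernel) exists_singular_potential:
  assumes amp: "amplifying M G" and F: "finite F"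
  shows "\<exists>q\<in>potentials M. (\<forall>x\<in>F. q x = 0) \<and> singular_set q \<noteq> {}"
proof -
  obtain \<rho>0 where \<rho>0: "\<rho>0 > 0" and amp':
    "\<And>N :: real. N \<ge> 0 \<Longrightarrow> \<exists>z1 z2 \<kappa> A H c. z1 \<noteq> 0 \<and> z2 \<noteq> 0 \<and> norm \<kappa> = 1 \<and> A \<ge> 0 \<and> c > 0 \<and>
     weight_bounded M H (\<lambda>u. G u z2) \<and> N * (A + H) \<le> c \<and>
     (\<forall>x. x \<noteq> 0 \<and> norm x \<le> \<rho>0 \<longrightarrow> Re (\<kappa> * G x z1) \<ge> c - A * weight x)"
    using amp unfolding amplifying_def by blast
  have "open (cube M :: (real ^ 'n) set)" by (rule open_cube)
  moreover have "(0 :: real ^ 'n) \<in> cube M" using M by (simp add: cube_def)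
  ultimately have "infinite (cube M :: (real ^ 'n) set)" using finite_imp_not_open by blast
  hence "infinite (cube M - F)" using F by simp
  then obtain x0 where "x0 \<in> cube M - F" by (metis finite.emptyI ex_in_conv)
  moreover have "open (cube M - F)" using open_cube F by (intro open_Diff finite_imp_closed)
  ultimately obtain r where r: "r > 0" "cball x0 r \<subseteq> cube M - F" by (meson open_contains_cball)
  define R where "R = 2 * cube_radius M TYPE('n)"
  have R: "R > 0" using radius_pos by (simp add: R_def)
  \<comment> \<open>Differences of points of the ball have norm at most 2 \<rho>: they should lie
    where the lower bound on G holds and within the range of the weight estimates.\<close>
  define \<rho> where "\<rho> = min r (min (\<rho>0 / 2) (R / 2))"
  have \<rho>: "\<rho> > 0" "2 * \<rho> \<le> \<rho>0" "2 * \<rho> \<le> R" "cball x0 \<rho> \<subseteq> cube M - F"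
    using r \<rho>0 R by (auto simp: \<rho>_def)
  hence \<rho>': "\<rho> \<ge> 0" by simp
  define I where "I = (LINT y|lborel. bump \<rho> (y :: real ^ 'n))"
  have I: "I > 0" unfolding I_def by (rule bump_integral_pos(2)[OF \<rho>(1)])
  define W where "W = (LINT y|lborel. weight (y :: real ^ 'n) * indicator (cball 0 (2 * \<rho>)) y)"
  have [measurable]: "cball (0 :: real ^ 'n) (2 * \<rho>) \<in> sets borel" by simp
  have W: "integrable lborel (\<lambda>y :: real ^ 'n. weight y * indicator (cball 0 (2 * \<rho>)) y)" "W \<ge> 0"
  proof -
    show "integrable lborel (\<lambda>y :: real ^ 'n. weight y * indicator (cball 0 (2 * \<rho>)) y)"
    proof (rule integrableI_bounded)
      have "(\<integral>\<^sup>+y. ennreal (norm (weight (y :: real ^ 'n) * indicator (cball 0 (2 * \<rho>)) y)) \<partial>lborel) =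
          (\<integral>\<^sup>+y. ennreal (weight y) * indicator (cball (0 :: real ^ 'n) (2 * \<rho>)) y \<partial>lborel)"
        by (intro nn_integral_cong) (auto simp: indicator_def weight_nonneg)
      also have "\<dots> < \<infinity>" by (rule nn_integral_weight_finite) (use \<rho>(1) in simp)
      finally show "(\<integral>\<^sup>+y. ennreal (norm (weight (y :: real ^ 'n) * indicator (cball 0 (2 * \<rho>)) y)) \<partial>lborel) < \<infinity>" .
    qed measurable
    show "W \<ge> 0" unfolding W_def by (intro Bochner_Integration.integral_nonneg) (auto simp: weight_nonneg)
  qed
  \<comment> \<open>The two summands serve two purposes: the loss A \<rho>^4 W in the lower bound of
    U must not exceed half of c I, and K q z2 must have norm at most 1/2.\<close>
  define N where "N = (2 * \<rho> ^ 4 * W + 4 * \<rho> ^ 4 * kernel_bound M TYPE('n)) / I"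
  have kb: "kernel_bound M TYPE('n) \<ge> 0" by (rule kernel_bound_nonneg)
  have N: "N \<ge> 0" using I W(2) kb \<rho>' by (simp add: N_def)
  from amp'[OF this] obtain z1 z2 \<kappa> A H c where z: "z1 \<noteq> 0" "z2 \<noteq> 0" and \<kappa>: "norm \<kappa> = 1" and A: "A \<ge> 0" and c: "c > 0"
    and H: "weight_bounded M H (\<lambda>u. G u z2)" and Nc: "N * (A + H) \<le> c"
    and low: "\<And>x. x \<noteq> 0 \<Longrightarrow> norm x \<le> \<rho>0 \<Longrightarrow> Re (\<kappa> * G x z1) \<ge> c - A * weight x" by blast
  have H0: "H \<ge> 0" using H by (simp add: weight_bounded_def)
  have Nc': "2 * \<rho> ^ 4 * W * A \<le> c * I" "4 * \<rho> ^ 4 * kernel_bound M TYPE('n) * H \<le> c * I"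
  proof -
    have "(2 * \<rho> ^ 4 * W + 4 * \<rho> ^ 4 * kernel_bound M TYPE('n)) * (A + H) = N * (A + H) * I"
      using I by (simp add: N_def)
    also have "\<dots> \<le> c * I" using Nc I by (intro mult_right_mono) auto
    finally have *: "(2 * \<rho> ^ 4 * W + 4 * \<rho> ^ 4 * kernel_bound M TYPE('n)) * (A + H) \<le> c * I" .
    have "0 \<le> \<rho> ^ 4 * W * H" "0 \<le> \<rho> ^ 4 * kernel_bound M TYPE('n) * A" "0 \<le> \<rho> ^ 4 * W * A" "0 \<le> \<rho> ^ 4 * kernel_bound M TYPE('n) * H"
      using W(2) H0 A kb by simp_all
    with * show "2 * \<rho> ^ 4 * W * A \<le> c * I" "4 * \<rho> ^ 4 * kernel_bound M TYPE('n) * H \<le> c * I"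
      by (simp_all add: distrib_left distrib_right mult_ac)
  qed
  \<comment> \<open>Cutting G off at distance 2 \<rho> makes it integrable without changing its
    values at differences of points of the ball.\<close>
  define h where "h y = (if y \<noteq> 0 \<and> norm y \<le> 2 * \<rho> then G y z1 else 0)" for y :: "real ^ 'n"
  have [measurable]: "(\<lambda>y. G y z1) \<in> borel_measurable borel" by (rule borel_measurable_G[OF z(1)])
  have [measurable]: "h \<in> borel_measurable borel" unfolding h_def by measurable
  have [measurable]: "bump \<rho> \<in> borel_measurable (borel :: (real ^ 'n) measure)"
    by (rule borel_measurable_continuous_onI[OF continuous_bump(1)])
  obtain C where C: "C \<ge> 0" "\<And>z. z \<noteq> 0 \<Longrightarrow> norm z \<le> norm z1 \<Longrightarrow> weight_bounded M (C / norm z) (\<lambda>u. G u z)"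
    by (rule weight_bounded_G) blast
  note wb1 = C(2)[OF z(1) order_refl]
  have h: "integrable lborel h"
  proof (rule Bochner_Integration.integrable_bound)
    show "integrable lborel (\<lambda>y :: real ^ 'n. C / norm z1 * (weight y * indicator (cball 0 (2 * \<rho>)) y))"
      by (intro integrable_mult_right W)
    have "norm (h y) \<le> norm (C / norm z1 * (weight y * indicator (cball 0 (2 * \<rho>)) y))" for y
      using wb1 C(1) \<rho>(3) by (auto simp: h_def weight_bounded_def weight_nonneg R_def abs_mult)
    thus "AE y in lborel. norm (h y) \<le> norm (C / norm z1 * (weight y * indicator (cball 0 (2 * \<rho>)) y))" by simp
  qed simp
  \<comment> \<open>G * f, translated so that the centre x0 becomes 0; the plus sign is justified by
    G being radial.\<close>
  define U where "U x = (LINT y|lborel. h y * of_real (bump \<rho> (x + y)))" for x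
  have U: "norm (U x) \<ge> c * I / 2" if x: "norm x \<le> \<rho>" for x
  proof -
    have bI: "integrable lborel (\<lambda>y. bump \<rho> (x + y))" "(LINT y|lborel. bump \<rho> (x + y)) = I"
    proof -
      show "(LINT y|lborel. bump \<rho> (x + y)) = I" unfolding I_def by (rule lborel_integral_translate) simp
      thus "integrable lborel (\<lambda>y. bump \<rho> (x + y))" using I not_integrable_integral_eq by fastforce
    qed
    have int: "integrable lborel (\<lambda>y. h y * of_real (bump \<rho> (x + y)))"
      by (rule integrable_times_bounded[OF h, of _ "\<rho> ^ 4"])
        (use bump_bounds(1,2)[OF \<rho>'] in \<open>simp_all add: abs_le_iff order_trans[OF _ bump_bounds(1)[OF \<rho>']]\<close>)
    \<comment> \<open>The rotated kernel has real part at least c - A * weight. Integrated against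
      the bump, c yields c I, and the weight costs at most A \<rho>^4 W.\<close>
    have "c * I - A * \<rho> ^ 4 * W = (LINT y|lborel. c * bump \<rho> (x + y) - A * \<rho> ^ 4 * (weight y * indicator (cball 0 (2 * \<rho>)) y))"
      using bI W(1) by (subst Bochner_Integration.integral_diff) (auto simp: W_def)
    also have "\<dots> \<le> (LINT y|lborel. Re (\<kappa> * (h y * of_real (bump \<rho> (x + y)))))"
    proof (rule integral_mono_AE)
      show "integrable lborel (\<lambda>y. c * bump \<rho> (x + y) - A * \<rho> ^ 4 * (weight y * indicator (cball 0 (2 * \<rho>)) y))"
        by (intro Bochner_Integration.integrable_diff integrable_mult_right bI W)
      show "integrable lborel (\<lambda>y. Re (\<kappa> * (h y * of_real (bump \<rho> (x + y)))))"
        by (intro integrable_Re integrable_mult_right int)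
      have "AE y :: real ^ 'n in lborel. y \<noteq> 0" by (rule AE_lborel_singleton)
      thus "AE y in lborel. c * bump \<rho> (x + y) - A * \<rho> ^ 4 * (weight y * indicator (cball 0 (2 * \<rho>)) y) \<le>
          Re (\<kappa> * (h y * of_real (bump \<rho> (x + y))))"
      proof eventually_elim
        case (elim y)
        note b = bump_bounds(1,2)[OF \<rho>', of "x + y"]
        show ?case
        proof (cases "norm y \<le> 2 * \<rho>")
          case False
          hence "norm (x + y) \<ge> \<rho>" using x norm_triangle_ineq4[of "x + y" x] by simp
          thus ?thesis using False by (simp add: bump_eq_0_iff[OF \<rho>', THEN iffD2])
        next
          case True
          have "(c - A * weight y) * bump \<rho> (x + y) \<le> Re (\<kappa> * G y z1) * bump \<rho> (x + y)"
            using low[OF elim] True \<rho>(2) b by (intro mult_right_mono) auto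
          moreover have "A * weight y * bump \<rho> (x + y) \<le> A * weight y * \<rho> ^ 4"
            using b A by (intro mult_left_mono) (auto simp: weight_nonneg)
          ultimately show ?thesis using True elim by (simp add: h_def algebra_simps)
        qed
      qed
    qed
    also have "\<dots> = Re (LINT y|lborel. \<kappa> * (h y * of_real (bump \<rho> (x + y))))"
      by (rule integral_Re) (rule integrable_mult_right[OF int])
    also have "\<dots> = Re (\<kappa> * U x)" unfolding U_def by (simp only: integral_mult_right_zero)
    also have "\<dots> \<le> norm (\<kappa> * U x)" by (rule complex_Re_le_cmod)
    also have "\<dots> = norm (U x)" by (simp add: norm_mult \<kappa>)
    finally show ?thesis using Nc'(1) by (simp add: mult_ac)
  qed
  have cI: "c * I > 0" using c I by simp
  define f where "f x = complex_of_real (bump \<rho> (x - x0))" for x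
  define q where "q x = - f x / U (x - x0)" for x
  have q: "q \<in> potentials M"
    unfolding q_def f_def U_def
    by (rule bump_quotient_potential[OF h \<rho>(1)]) (use U cI \<rho>(4) in \<open>force simp: U_def\<close>)+
  have out: "f x = 0" "q x = 0" if "x \<notin> cball x0 \<rho>" for x
    using that bump_eq_0_iff[OF \<rho>', of "x - x0"] by (auto simp: f_def q_def dist_norm norm_minus_commute)
  define P where "P = 2 * \<rho> ^ 4 / (c * I)"
  have P: "cube_bounded M P q"
    unfolding cube_bounded_def
  proof (intro conjI ballI)
    show "q \<in> borel_measurable borel" by (rule borel_measurable_potential[OF q])
    show "0 \<le> P" using cI by (simp add: P_def)
    fix x
    show "norm (q x) \<le> P"
    proof (cases "x \<in> cball x0 \<rho>")
      case True
      hence "norm (U (x - x0)) \<ge> c * I / 2" by (intro U) (simp add: dist_norm norm_minus_commute)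
      hence "norm (f x) / norm (U (x - x0)) \<le> \<rho> ^ 4 / (c * I / 2)"
        using cI bump_bounds(1,2)[OF \<rho>', of "x - x0"] by (intro frac_le) (auto simp: f_def)
      thus ?thesis by (simp add: q_def norm_divide P_def mult.commute[of 2])
    qed (use out \<open>0 \<le> P\<close> in simp)
  qed
  have fm[measurable]: "f \<in> borel_measurable borel" unfolding f_def by measurable
  have f: "square_integrable f"
  proof (rule square_integrable_bounded[of _ M "\<rho> ^ 4"])
    show "f x = 0" if "x \<notin> cube M" for x by (rule out(1)) (use that \<rho>(4) in blast)
    show "norm (f x) \<le> \<rho> ^ 4" for x using bump_bounds(1,2)[OF \<rho>', of "x - x0"] by (simp add: f_def)
  qed simp
  have "abs_L2 f \<noteq> 0"
  proof
    assume "abs_L2 f = 0"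
    hence "AE x in lborel. f x = 0" using abs_L2_eq_iff[OF f square_integrable_zero] by (simp add: abs_L2_0)
    hence "AE x in lborel. bump \<rho> (- x0 + x) = 0" by (simp add: f_def)
    hence "(LINT x|lborel. bump \<rho> (- x0 + x)) = 0" by (rule integral_eq_zero_AE)
    thus False using I lborel_integral_translate[of "bump \<rho>" "- x0"] by (simp add: I_def)
  qed
  moreover have "K q z1 (abs_L2 f) = - abs_L2 f"
  proof -
    have "(LINT y|lborel. conv_kernel M q (\<lambda>u. G u z1) x y * f y) = - f x" for x
    proof (cases "x \<in> cball x0 \<rho>")
      case False
      thus ?thesis by (simp add: out conv_kernel_def)
    next
      case True
      hence x: "norm (x - x0) \<le> \<rho>" "x \<in> cube M" using \<rho>(4) by (auto simp: dist_norm norm_minus_commute)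
      \<comment> \<open>For y in the ball, G (x - y) = h (y - x): G is radial away from 0, and the
        cut-off is not reached.\<close>
      have "(LINT y|lborel. conv_kernel M q (\<lambda>u. G u z1) x y * f y) = (LINT y|lborel. q x * (h (y - x) * f y))"
      proof (rule integral_cong_AE)
        have "AE y in lborel. y \<noteq> x" by (rule AE_lborel_singleton)
        thus "AE y in lborel. conv_kernel M q (\<lambda>u. G u z1) x y * f y = q x * (h (y - x) * f y)"
        proof eventually_elim
          case (elim y)
          show ?case
          proof (cases "y \<in> cball x0 \<rho>")
            case False
            thus ?thesis by (simp add: out)
          next
            case y: True
            hence "norm (y - x) \<le> 2 * \<rho>"
              using x(1) norm_triangle_ineq4[of "y - x0" "x - x0"] by (simp add: dist_norm norm_minus_commute)
            moreover have "G (x - y) z1 = G (y - x) z1"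
              using G_eq[of "x - y" z1] G_eq[of "y - x" z1] elim z(1) by (simp add: norm_minus_commute)
            moreover have "y \<in> cube M" using y \<rho>(4) by blast
            ultimately show ?thesis using elim x(2) by (simp add: conv_kernel_def h_def)
          qed
        qed
        have [measurable]: "q \<in> borel_measurable borel" by (rule borel_measurable_potential[OF q])
        show "(\<lambda>y. conv_kernel M q (\<lambda>u. G u z1) x y * f y) \<in> borel_measurable lborel"
          unfolding conv_kernel_def by measurable
      qed measurable
      also have "\<dots> = q x * (LINT y|lborel. h (y - x) * f y)" by simp
      also have "(LINT y|lborel. h (y - x) * f y) = (LINT y|lborel. h (x + y - x) * f (x + y))"
        by (rule lborel_integral_translate[symmetric, of "\<lambda>y. h (y - x) * f y"]) measurable
      also have "\<dots> = U (x - x0)" unfolding U_def f_def by (simp add: algebra_simps)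
      also have "q x * U (x - x0) = - f x" using U[OF x(1)] cI by (auto simp: q_def)
      finally show ?thesis .
    qed
    hence "K q z1 (abs_L2 f) = abs_L2 (\<lambda>x. - f x)"
      unfolding conv_op_def by (simp add: kernel_op_abs[OF schur_conv_kernel[OF M P wb1] f])
    also have "\<dots> = - abs_L2 f"
      using abs_L2_scaleR[OF f, of "- 1"] by simp
    finally show ?thesis .
  qed
  moreover have "norm (K q z2) \<le> 1/2"
  proof -
    have "norm (K q z2) \<le> P * H * kernel_bound M TYPE('n)" by (rule norm_conv_op_le[OF M P H])
    also have "\<dots> \<le> 1/2"
      using Nc'(2) cI by (simp add: P_def divide_le_eq mult_ac)
    finally show ?thesis .
  qed
  ultimately have "z1 \<in> singular_set q" by (intro exists_singular_if_not_injective[OF P z])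
  moreover have "\<forall>x\<in>F. q x = 0" using \<rho>(4) out(2) by blast
  ultimately show ?thesis using q by blast
qed

section \<open>The index\<close>

context helmholtz_kernel
begin

lemma singular_set_zero: "singular_set (\<lambda>_. 0) = {}"
proof (rule equals0I)
  fix z0 assume z0: "z0 \<in> singular_set (\<lambda>_. 0)"
  have q: "cube_bounded M 0 (\<lambda>_ :: real ^ 'n. 0)" by (simp add: cube_bounded_def)
  have "\<forall>\<^sub>F z in at z0. z \<noteq> 0"
    by (rule eventually_neq_at_within)
  hence "\<forall>\<^sub>F z in at z0. inverse_le (\<lambda>_. 0) z 2"
  proof eventually_elim
    case (elim z)
    obtain C where C: "C \<ge> 0" "\<And>z'. z' \<noteq> 0 \<Longrightarrow> norm z' \<le> norm z \<Longrightarrow> weight_bounded M (C / norm z') (\<lambda>u. G u z')"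
      by (rule weight_bounded_G) blast
    have "norm (K (\<lambda>_. 0) z) \<le> 1/2" using norm_conv_op_le[OF M q C(2)[OF elim order_refl]] by simp
    then obtain B where "is_inverse (id_blinfun + K (\<lambda>_. 0) z) B" "norm B \<le> 2" by (rule inverse_id_plus_small)
    thus ?case by (auto simp: inverse_le_def)
  qed
  thus False using singular_not_bounded[OF q z0] by blast
qed

end

text \<open>The indicator function in x changes nothing because q vanishes outside the cube; it
  makes the kernel supported in the cube in both variables.\<close>

lemma K_operator_eq_conv_op:
  fixes q :: "real ^ 'n::finite \<Rightarrow> complex"
  assumes q: "q \<in> potentials M"
  shows "K_operator q (indicator (cube M)) z = conv_op M q (\<lambda>u. green u z)"
proof -
  have "q x * (LINT y|lborel. green (x - y) z * of_real (indicator (cube M) y) * rep_L2 f y) =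
      (LINT y|lborel. conv_kernel M q (\<lambda>u. green u z) x y * rep_L2 f y)" for x f
  proof -
    have "indicator (cube M) x * q x = q x" using potential_eq_0[OF q, of x] by (auto simp: indicator_def)
    moreover have "complex_of_real (indicator (cube M) y) = indicator (cube M) y" for y :: "real ^ 'n"
      by (simp add: indicator_def)
    ultimately show ?thesis
      unfolding conv_kernel_def by (simp only: mult.assoc integral_mult_right_zero)
  qed
  thus ?thesis unfolding K_operator_def conv_op_def kernel_op_def by simp
qed

lemma resonances_eq_singular_set:
  fixes q :: "real ^ 'n::finite \<Rightarrow> complex"
  assumes "helmholtz_kernel M g s (green :: real ^ 'n \<Rightarrow> _)" and q: "q \<in> potentials M"
  shows "resonances M q = helmholtz_kernel.singular_set M green q"
proof -
  interpret helmholtz_kernel M g s "green :: real ^ 'n \<Rightarrow> _" by fact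
  obtain P where "cube_bounded M P q" by (rule potential_cube_bounded[OF q])
  thus ?thesis
    unfolding resonances_def K_operator_eq_conv_op[OF q] using is_pole_iff by blast
qed

text \<open>On the potential 0 only finitely many points are evaluated, and the other members of
  \<open>\<Lambda>\<close> are constants. A potential that vanishes at these points is therefore
  given the same output.\<close>

lemma no_tower_of_height_zero:
  fixes \<Xi> :: "(real ^ 'n::finite \<Rightarrow> complex) \<Rightarrow> 'm"
  assumes zero: "(\<lambda>_ :: real ^ 'n. 0) \<in> potentials M"
    and ex: "\<And>F. finite F \<Longrightarrow> \<exists>q\<in>potentials M. (\<forall>x\<in>F. q x = 0) \<and> \<Xi> q \<noteq> \<Xi> (\<lambda>_. 0)"
  shows "\<not> tower_of_algorithms (potentials M) (evaluations M) \<Xi> \<M> rd 0 \<Gamma>"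
proof
  assume T: "tower_of_algorithms (potentials M) (evaluations M) \<Xi> \<M> rd 0 \<Gamma>"
  hence \<Xi>: "\<Gamma> [] q = \<Xi> q" if "q \<in> potentials M" for q using that by (simp add: tower_of_algorithms_def)
  have "arithmetic_algorithm (potentials M) (evaluations M) \<M> rd (\<Gamma> [])"
    using T by (simp add: tower_of_algorithms_def)
  then obtain \<Lambda>' A where \<Lambda>': "\<forall>q\<in>potentials M. finite (\<Lambda>' q) \<and> \<Lambda>' q \<subseteq> evaluations M \<and>
      (\<forall>p\<in>potentials M. (\<forall>f\<in>\<Lambda>' q. f q = f p) \<longrightarrow> \<Gamma> [] p = \<Gamma> [] q \<and> \<Lambda>' p = \<Lambda>' q) \<and>
      (\<exists>U out. run q A U out \<and> U \<subseteq> \<Lambda>' q \<and> \<Gamma> [] q = rd out)"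
    unfolding arithmetic_algorithm_def by (elim conjE exE)
  note \<Lambda> = bspec[OF \<Lambda>' zero]
  \<comment> \<open>Point evaluations at different points are different functions, so a finite set
    of evaluations involves finitely many points.\<close>
  define ev where "ev x q = q x" for x :: "real ^ 'n" and q :: "real ^ 'n \<Rightarrow> complex"
  have "inj ev"
  proof (rule injI)
    fix x y assume "ev x = ev y"
    hence "ev x (indicator {x}) = ev y (indicator {x})" by simp
    thus "x = y" by (auto simp: ev_def indicator_def split: if_splits)
  qed
  hence "finite (ev -` \<Lambda>' (\<lambda>_. 0))" by (rule finite_vimageI[OF conjunct1[OF \<Lambda>]])
  from ex[OF this] obtain q where q: "q \<in> potentials M" "\<forall>x\<in>ev -` \<Lambda>' (\<lambda>_. 0). q x = 0" "\<Xi> q \<noteq> \<Xi> (\<lambda>_. 0)" by blast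
  have "f (\<lambda>_. 0) = f q" if f: "f \<in> \<Lambda>' (\<lambda>_. 0)" for f
  proof -
    have "f \<in> evaluations M" using \<Lambda> f by (elim conjE) (rule subsetD)
    then consider a where "f = (\<lambda>_. a)" | x where "f = ev x"
      unfolding evaluations_def ev_def[abs_def] by blast
    thus ?thesis
    proof cases
      case 2
      hence "q x = 0" using q(2) f by simp
      thus ?thesis by (simp add: 2 ev_def)
    qed simp
  qed
  hence "\<Gamma> [] q = \<Gamma> [] (\<lambda>_. 0)" using \<Lambda> q(1) by simp
  thus False using \<Xi> q zero by simp
qed

theorem theorem1p8:
  fixes M :: real
  assumes "M > 0"
  shows "SCI (potentials M :: (real ^ 'n::finite \<Rightarrow> complex) set) (evaluations M)
           (resonances M) closed_sets set = 1"
proof -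
  obtain g s where hk: "helmholtz_kernel M g s (green :: real ^ 'n \<Rightarrow> _)"
    using green_helmholtz_kernel(1)[OF assms, where 'n = 'n] by blast
  then interpret helmholtz_kernel M g s "green :: real ^ 'n \<Rightarrow> _" .
  note res = resonances_eq_singular_set[OF hk]
  have zero: "(\<lambda>_. 0) \<in> (potentials M :: (real ^ 'n \<Rightarrow> complex) set)"
    unfolding potentials_def by (auto intro!: exI[of _ "\<lambda>_. 0"] simp: zero_blinfun.rep_eq)
  have "\<exists>\<Gamma>. tower_of_algorithms (potentials M :: (real ^ 'n \<Rightarrow> complex) set) (evaluations M) (resonances M) closed_sets set 1 \<Gamma>"
  proof (rule tower_of_height_one[of M approx_set])
    show "finite (approx_set n p)" "approx_set n p \<subseteq> gaussian_rationals" for n p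
      using grid(1,2)[of n] by (auto simp: approx_set_def)
    show "closed (resonances M q)" if "q \<in> potentials M" for q :: "real ^ 'n \<Rightarrow> complex"
      unfolding res[OF that] using closed_singular_set potential_cube_bounded[OF that] by metis
    fix q :: "real ^ 'n \<Rightarrow> complex" and p C
    assume q: "q \<in> potentials M" and p: "\<And>n. p n \<in> potentials M"
      and close: "\<forall>\<^sub>F n in sequentially. \<forall>x. norm (p n x - q x) \<le> C / real (Suc n) ^ 4"
    have "\<exists>P. cube_bounded M P (p n)" for n using potential_cube_bounded[OF p] by metis
    then obtain P' where P': "\<And>n. cube_bounded M (P' n) (p n)" by metis
    obtain P where "cube_bounded M P q" by (rule potential_cube_bounded[OF q])
    from approx_set_convergence[OF this P' close]
    show "set_convergence (\<lambda>n. approx_set n (p n)) (resonances M q)" unfolding res[OF q] .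
  qed
  hence 1: "1 \<in> {enat k | k. \<exists>\<Gamma>. tower_of_algorithms (potentials M :: (real ^ 'n \<Rightarrow> complex) set) (evaluations M)
      (resonances M) closed_sets set k \<Gamma>}" using one_enat_def by auto
  have 0: "\<not> tower_of_algorithms (potentials M :: (real ^ 'n \<Rightarrow> complex) set) (evaluations M) (resonances M) closed_sets set 0 \<Gamma>" for \<Gamma>
  proof (rule no_tower_of_height_zero[OF zero])
    fix F :: "(real ^ 'n) set" assume "finite F"
    from exists_singular_potential[OF green_helmholtz_kernel(2)[OF assms] this] obtain q
      where q: "q \<in> potentials M" "\<forall>x\<in>F. q x = 0" "singular_set q \<noteq> {}" by blast
    moreover have "resonances M (\<lambda>_ :: real ^ 'n. 0) = {}" by (rule trans[OF res[OF zero] singular_set_zero])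
    ultimately have "resonances M q \<noteq> resonances M (\<lambda>_ :: real ^ 'n. 0)" unfolding res[OF q(1)] by simp
    thus "\<exists>q\<in>potentials M. (\<forall>x\<in>F. q x = 0) \<and> resonances M q \<noteq> resonances M (\<lambda>_ :: real ^ 'n. 0)" using q by blast
  qed
  show ?thesis
    unfolding SCI_def
  proof (rule antisym)
    show "1 \<le> Inf {enat k | k. \<exists>\<Gamma>. tower_of_algorithms (potentials M :: (real ^ 'n \<Rightarrow> complex) set) (evaluations M)
      (resonances M) closed_sets set k \<Gamma>}"
    proof (rule Inf_greatest)
      fix k assume "k \<in> {enat k | k. \<exists>\<Gamma>. tower_of_algorithms (potentials M :: (real ^ 'n \<Rightarrow> complex) set) (evaluations M)
      (resonances M) closed_sets set k \<Gamma>}"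
      then obtain m \<Gamma> where m: "k = enat m" "tower_of_algorithms (potentials M :: (real ^ 'n \<Rightarrow> complex) set) (evaluations M)
      (resonances M) closed_sets set m \<Gamma>" by blast
      with 0 have "m \<noteq> 0" by metis
      thus "1 \<le> k" using m(1) by (simp add: one_enat_def)
    qed
  qed (rule Inf_lower[OF 1])
qed

end
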